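(* Let $Q=Q(d,d_0)$ be a compact connected two-point homogeneous space (normalized as in the context), and let $\eta\in W(d,d_0)$, $\eta\ne0$. Suppose that the $N$-point subset $\mathcal D_N\subset Q$ is an optimal $t$-design and satisfies one of the following conditions: (i) $\mathcal D_N$ is well-separated; (ii) $\mathcal D_N$ is subordinated to an equal-measure partition of small diameter. Then, for all sufficiently large $N$, $$\langle\theta^{\Delta}(\eta)\rangle N^2-cN^{1-\frac1d}>\theta^{\Delta}[\eta,\mathcal D_N]>\langle\theta^{\Delta}(\eta)\rangle N^2-CN^{1-\frac1d},$$ $$cN^{1-\frac1d}<\lambda[\eta,\mathcal D_N]<CN^{1-\frac1d}.$$ In particular, for the chordal metric $\tau$ on $Q$, $$\langle\tau\rangle N^2-cN^{1-\frac1d}>\tau[\mathcal D_N]>\langle\tau\rangle N^2-CN^{1-\frac1d}.$$ The positive constants $c,C$ (possibly different in each relation) are independent of $N$.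
   Context: Spaces. $Q=Q(d,d_0)$ is one of the following: the sphere $S^d$, $d\ge 1$, with the convention $d_0=d$; or a projective space $\mathbb{F}P^n$ with $\mathbb F=\mathbb R,\mathbb C,\mathbb H$, $n\ge2$, or the octonionic projective plane $\mathbb{O}P^2$ ($\mathbb F=\mathbb O$, $n=2$), where $d_0=\dim_{\mathbb R}\mathbb F=1,2,4,8$ for $\mathbb F=\mathbb R,\mathbb C,\mathbb H,\mathbb O$ respectively and $d=nd_0$. $Q$ carries the isometry-invariant Riemannian distance $\theta$, rescaled so that $\operatorname{diam}(Q,\theta)=\pi$, and the isometry-invariant Riemannian measure $\mu$ with $\mu(Q)=1$. Concretely, $S^d=\{x\in\mathbb R^{d+1}:\|x\|=1\}$ with $\cos\theta(x_1,x_2)=(x_1,x_2)$; and $\mathbb{F}P^n$ is the set of Hermitian $(n+1)\times(n+1)$ matrices $\Pi$ over $\mathbb F$ with $\Pi^2=\Pi$, $\operatorname{Tr}\Pi=1$, with $\sin\frac12\theta(\Pi_1,\Pi_2)=\frac1{\sqrt2}\|\Pi_1-\Pi_2\|$, $0\le\theta\le\pi$, where $\|A\|^2=\sum_{i,j}|a_{ij}|^2$. Thus $Q$ sits in a Euclidean space $\mathbb R^m$ ($\mathbb R^{d+1}$ for spheres; the real vector space of Hermitian $(n+1)\times(n+1)$ matrices, $m=\frac12(n+1)(d+2)$, for projective spaces). Chordal metric: $\tau(x_1,x_2)=\sin\frac12\theta(x_1,x_2)$. Designs: an $N$-point subset $\mathcal D_N\subset Q$ is a $t$-design if $\sum_{x\in\mathcal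 D_N}F(x)=N\int_QF(y)\,d\mu(y)$ for all polynomials $F$ on $\mathbb R^m$ of total degree at most $t$; it is optimal if moreover $c_+t^d\ge N\ge c_-t^d$ with positive constants $c_+,c_-$ independent of $N$ and $t$. Well-separated: $\delta[\mathcal D_N]\ge c'N^{-1/d}$ with a constant $c'>0$ independent of $N$, where $\delta[\mathcal D_N]=\frac12\min\{\theta(x_i,x_j):i\ne j\}$ for $\mathcal D_N=\{x_i\}_1^N$. Equal-measure partition of small diameter: $\mathcal P_N=\{P_i\}_1^N$ with $Q=\bigcup_{i=1}^NP_i$, $\mu(P_i\cap P_j)=0$ for $i\ne j$, $\mu(P_i)=1/N$, and $\max_i\operatorname{diam}(P_i,\theta)\le c_0N^{-1/d}$ with a constant $c_0>0$ independent of $N$. $\mathcal D_N=\{x_i\}_1^N$ is subordinated to $\mathcal P_N$ if $x_i\in P_i$ for $i=1,\dots,N$. The notions "optimal", "well-separated", "small diameter" concern families of $\mathcal D_N$ as $N\to\infty$: the constants $c_\pm,c',c_0$ are fixed for the whole family, and the constants $c,C$ in the conclusion (and the threshold on $N$) may depend on them, on $Q$ and on $\eta$. Balls: $B_r(y)=\{x\in Q:\theta(x,y)<r\}$; $v_r=\mu(B_r(y))$ (independent of $y$). Discrepancies: $\lambda_r[\mathcal D_N]=\int_Q\big(\#\{B_r(y)\cap\mathcal D_N\}-Nv_r\big)^2\,d\mu(y)$, $\lambda[\eta,\mathcal D_N]=\int_0^\pi\lambda_r[\mathcal D_N]\,\eta(r)\,dr$. Metrics: $\theta^{\Delta}_r(y_1,y_2)=\frac12\mu\big(B_r(y_1)\Delta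 B_r(y_2)\big)$, $\theta^{\Delta}(\eta,y_1,y_2)=\int_0^\pi\theta^{\Delta}_r(y_1,y_2)\,\eta(r)\,dr$, $\theta^{\Delta}[\eta,\mathcal D_N]=\sum_{x_1,x_2\in\mathcal D_N}\theta^{\Delta}(\eta,x_1,x_2)$, $\tau[\mathcal D_N]=\sum_{x_1,x_2\in\mathcal D_N}\tau(x_1,x_2)$; for a metric $\rho$, $\langle\rho\rangle=\iint_{Q\times Q}\rho\,d\mu\,d\mu$. Sums and cardinalities count multiplicity. Weight classes: for $a\ge b\ge1$, $W(a,b)$ is the class of (measurable) functions $\eta\ge0$ on $[0,\pi]$ with $\int_0^\pi(\sin\frac12r)^{a-1}(\cos\frac12r)^{b-1}\eta(r)\,dr<\infty$; $\eta\ne0$ means not almost everywhere zero. *)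

theory Defs
  imports "HOL-Probability.Probability"
begin

section \<open>Hypercomplex entries and Hermitian matrices\<close>

text \<open>
  Cayley--Dickson doubling, twice, starting from the complex numbers. The product-type norm is
  the Euclidean one, hence the usual absolute value of quaternions and octonions.
\<close>

type_synonym quat = "complex \<times> complex"
type_synonym octonion = "quat \<times> quat"

definition quat_cnj :: "quat \<Rightarrow> quat" where
  "quat_cnj x = (cnj (fst x), - snd x)"

definition quat_mult :: "quat \<Rightarrow> quat \<Rightarrow> quat" where
  "quat_mult x y =
     (fst x * fst y - cnj (snd y) * snd x, snd y * fst x + snd x * cnj (fst y))"

definition oct_cnj :: "octonion \<Rightarrow> octonion" where
  "oct_cnj x = (quat_cnj (fst x), - snd x)"

definition oct_mult :: "octonion \<Rightarrow> octonion \<Rightarrow> octonion" where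
  "oct_mult x y =
     (quat_mult (fst x) (fst y) - quat_mult (quat_cnj (snd y)) (snd x),
      quat_mult (snd y) (fst x) + quat_mult (snd x) (quat_cnj (fst y)))"

definition oct_one :: octonion where
  "oct_one = ((1, 0), (0, 0))"

text \<open>
  The real numbers, complex numbers, quaternions and octonions, for real dimension
  \<open>d0 = 1, 2, 4, 8\<close>, as nested subalgebras of the octonions.
\<close>

definition hypercomplex :: "nat \<Rightarrow> octonion set" where
  "hypercomplex d0 =
     (if d0 = 1 then {((of_real r, 0), (0, 0)) | r. True}
      else if d0 = 2 then {((z, 0), (0, 0)) | z. True}
      else if d0 = 4 then {(q, (0, 0)) | q. True}
      else UNIV)"

text \<open>
  Square matrices of size \<open>n + 1\<close> are functions with indices \<open>0, \<dots>, n\<close>, extended by \<open>0\<close>.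
\<close>

type_synonym oct_matrix = "nat \<Rightarrow> nat \<Rightarrow> octonion"

definition hermitian_matrices :: "nat \<Rightarrow> nat \<Rightarrow> oct_matrix set" where
  "hermitian_matrices n d0 =
     {A. (\<forall>i j. A i j \<in> hypercomplex d0) \<and> (\<forall>i j. A j i = oct_cnj (A i j)) \<and>
         (\<forall>i j. n < i \<or> n < j \<longrightarrow> A i j = 0)}"

definition matrix_norm :: "nat \<Rightarrow> oct_matrix \<Rightarrow> real" where
  "matrix_norm n A = sqrt (\<Sum>i\<le>n. \<Sum>j\<le>n. (norm (A i j))\<^sup>2)"

definition projective_matrices :: "nat \<Rightarrow> nat \<Rightarrow> oct_matrix set" where
  "projective_matrices n d0 =
     {A \<in> hermitian_matrices n d0.
        (\<forall>i\<le>n. \<forall>j\<le>n. (\<Sum>k\<le>n. oct_mult (A i k) (A k j)) = A i j) \<and>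
        (\<Sum>i\<le>n. A i i) = oct_one}"


section \<open>The spaces Q(d, d0)\<close>

text \<open>
  The ambient Euclidean space is the type \<open>'a\<close>. For projective spaces it is the space of
  Hermitian matrices itself: \<open>h x\<close> is the matrix with coordinate vector \<open>x\<close> in some linear
  isometric coordinate system (so \<open>DIM('a) = (n + 1) * (d + 2) / 2\<close>).
  The distance \<open>\<theta>\<close> is only constrained on \<open>Q\<close>.
\<close>

definition sphere_space ::
    "'a::euclidean_space set \<Rightarrow> ('a \<Rightarrow> 'a \<Rightarrow> real) \<Rightarrow> nat \<Rightarrow> nat \<Rightarrow> bool" where
  "sphere_space Q \<theta> d d0 \<longleftrightarrow>
     1 \<le> d \<and> d0 = d \<and> DIM('a) = d + 1 \<and> Q = sphere 0 1 \<and>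
     (\<forall>x\<in>Q. \<forall>y\<in>Q. \<theta> x y = arccos (x \<bullet> y))"

definition projective_space ::
    "'a::euclidean_space set \<Rightarrow> ('a \<Rightarrow> 'a \<Rightarrow> real) \<Rightarrow> nat \<Rightarrow> nat \<Rightarrow> bool" where
  "projective_space Q \<theta> d d0 \<longleftrightarrow>
     (\<exists>n (h :: 'a \<Rightarrow> oct_matrix).
        2 \<le> n \<and> d0 \<in> {1, 2, 4, 8} \<and> (d0 = 8 \<longrightarrow> n = 2) \<and> d = n * d0 \<and>
        (\<forall>i j. linear (\<lambda>x. h x i j)) \<and> bij_betw h UNIV (hermitian_matrices n d0) \<and>
        (\<forall>x. norm x = matrix_norm n (h x)) \<and>
        Q = {x. h x \<in> projective_matrices n d0} \<and>
        (\<forall>x\<in>Q. \<forall>y\<in>Q.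
           \<theta> x y = 2 * arcsin (matrix_norm n (\<lambda>i j. h x i j - h y i j) / sqrt 2)))"

definition two_point_homogeneous_space ::
    "'a::euclidean_space set \<Rightarrow> ('a \<Rightarrow> 'a \<Rightarrow> real) \<Rightarrow> nat \<Rightarrow> nat \<Rightarrow> bool" where
  "two_point_homogeneous_space Q \<theta> d d0 \<longleftrightarrow>
     sphere_space Q \<theta> d d0 \<or> projective_space Q \<theta> d d0"

text \<open>
  The normalized Riemannian measure, as the isometry-invariant Borel probability measure on
  \<open>Q\<close> (unique, as the isometry group is compact and transitive). Since its space is \<open>Q\<close>,
  later definitions take \<open>\<mu>\<close> and \<open>\<theta>\<close> and refer to \<open>Q\<close> as \<open>space \<mu>\<close>.
\<close>

definition isometry_of :: "'a set \<Rightarrow> ('a \<Rightarrow> 'a \<Rightarrow> real) \<Rightarrow> ('a \<Rightarrow> 'a) \<Rightarrow> bool" where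
  "isometry_of Q \<theta> g \<longleftrightarrow> bij_betw g Q Q \<and> (\<forall>x\<in>Q. \<forall>y\<in>Q. \<theta> (g x) (g y) = \<theta> x y)"

definition invariant_measure ::
    "'a::euclidean_space set \<Rightarrow> ('a \<Rightarrow> 'a \<Rightarrow> real) \<Rightarrow> 'a measure \<Rightarrow> bool" where
  "invariant_measure Q \<theta> \<mu> \<longleftrightarrow>
     sets \<mu> = sets (restrict_space borel Q) \<and> prob_space \<mu> \<and>
     (\<forall>g. isometry_of Q \<theta> g \<longrightarrow> (\<forall>A\<in>sets \<mu>. measure \<mu> (g ` A) = measure \<mu> A))"


section \<open>Point distributions\<close>

text \<open>
  An \<open>N\<close>-point distribution is a family \<open>x 0, \<dots>, x (N - 1)\<close>; repetitions are counted with
  multiplicity. Polynomials are written in the coordinates of the standard basis of \<open>'a\<close>.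
\<close>

definition polynomial_of_degree_le :: "nat \<Rightarrow> ('a::euclidean_space \<Rightarrow> real) \<Rightarrow> bool" where
  "polynomial_of_degree_le t F \<longleftrightarrow>
     (\<exists>S c. finite S \<and> (\<forall>\<alpha>\<in>S. (\<Sum>b\<in>Basis. \<alpha> b) \<le> t) \<and>
        F = (\<lambda>x. \<Sum>\<alpha>\<in>S. c \<alpha> * (\<Prod>b\<in>Basis. (x \<bullet> b) ^ (\<alpha> b :: nat))))"

definition design ::
    "'a::euclidean_space measure \<Rightarrow> nat \<Rightarrow> nat \<Rightarrow> (nat \<Rightarrow> 'a) \<Rightarrow> bool" where
  "design \<mu> t N x \<longleftrightarrow>
     (\<forall>i<N. x i \<in> space \<mu>) \<and>
     (\<forall>F. polynomial_of_degree_le t F \<longrightarrow> (\<Sum>i<N. F (x i)) = real N * (\<integral>y. F y \<partial>\<mu>))"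

definition optimal_design ::
    "'a::euclidean_space measure \<Rightarrow> nat \<Rightarrow> real \<Rightarrow> real \<Rightarrow> nat \<Rightarrow> (nat \<Rightarrow> 'a) \<Rightarrow> bool" where
  "optimal_design \<mu> d cminus cplus N x \<longleftrightarrow>
     (\<exists>t. design \<mu> t N x \<and> cplus * real t ^ d \<ge> real N \<and> real N \<ge> cminus * real t ^ d)"

definition separation :: "('a \<Rightarrow> 'a \<Rightarrow> real) \<Rightarrow> nat \<Rightarrow> (nat \<Rightarrow> 'a) \<Rightarrow> real" where
  "separation \<theta> N x = 1 / 2 * Min {\<theta> (x i) (x j) | i j. i < N \<and> j < N \<and> i \<noteq> j}"

definition well_separated ::
    "('a \<Rightarrow> 'a \<Rightarrow> real) \<Rightarrow> nat \<Rightarrow> real \<Rightarrow> nat \<Rightarrow> (nat \<Rightarrow> 'a) \<Rightarrow> bool" where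
  "well_separated \<theta> d c' N x \<longleftrightarrow> separation \<theta> N x \<ge> c' * real N powr (- 1 / real d)"

definition theta_diameter :: "('a \<Rightarrow> 'a \<Rightarrow> real) \<Rightarrow> 'a set \<Rightarrow> real" where
  "theta_diameter \<theta> A = Sup {\<theta> x y | x y. x \<in> A \<and> y \<in> A}"

text \<open>The pieces only need to be measurable for the completion of \<open>\<mu>\<close>.\<close>

definition small_equal_measure_partition ::
    "'a measure \<Rightarrow> ('a \<Rightarrow> 'a \<Rightarrow> real) \<Rightarrow> nat \<Rightarrow> real \<Rightarrow> nat \<Rightarrow> (nat \<Rightarrow> 'a set) \<Rightarrow> bool" where
  "small_equal_measure_partition \<mu> \<theta> d c0 N P \<longleftrightarrow>
     (\<forall>i<N. P i \<in> sets (completion \<mu>)) \<and>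
     (\<Union>i<N. P i) = space \<mu> \<and>
     (\<forall>i<N. \<forall>j<N. i \<noteq> j \<longrightarrow> measure (completion \<mu>) (P i \<inter> P j) = 0) \<and>
     (\<forall>i<N. measure (completion \<mu>) (P i) = 1 / real N) \<and>
     (\<forall>i<N. theta_diameter \<theta> (P i) \<le> c0 * real N powr (- 1 / real d))"

definition subordinated_small ::
    "'a measure \<Rightarrow> ('a \<Rightarrow> 'a \<Rightarrow> real) \<Rightarrow> nat \<Rightarrow> real \<Rightarrow> nat \<Rightarrow> (nat \<Rightarrow> 'a) \<Rightarrow> bool" where
  "subordinated_small \<mu> \<theta> d c0 N x \<longleftrightarrow>
     (\<exists>P. small_equal_measure_partition \<mu> \<theta> d c0 N P \<and> (\<forall>i<N. x i \<in> P i))"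

definition admissible ::
    "'a::euclidean_space measure \<Rightarrow> ('a \<Rightarrow> 'a \<Rightarrow> real) \<Rightarrow> nat \<Rightarrow> real \<Rightarrow> real \<Rightarrow> real \<Rightarrow> real
       \<Rightarrow> nat \<Rightarrow> (nat \<Rightarrow> 'a) \<Rightarrow> bool" where
  "admissible \<mu> \<theta> d cminus cplus c' c0 N x \<longleftrightarrow>
     optimal_design \<mu> d cminus cplus N x \<and>
     (well_separated \<theta> d c' N x \<or> subordinated_small \<mu> \<theta> d c0 N x)"


section \<open>Discrepancies and metrics\<close>

definition theta_ball :: "'a measure \<Rightarrow> ('a \<Rightarrow> 'a \<Rightarrow> real) \<Rightarrow> real \<Rightarrow> 'a \<Rightarrow> 'a set" where
  "theta_ball \<mu> \<theta> r y = {x \<in> space \<mu>. \<theta> x y < r}"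

definition ball_discrepancy ::
    "'a measure \<Rightarrow> ('a \<Rightarrow> 'a \<Rightarrow> real) \<Rightarrow> nat \<Rightarrow> (nat \<Rightarrow> 'a) \<Rightarrow> real \<Rightarrow> real" where
  "ball_discrepancy \<mu> \<theta> N x r =
     (\<integral>y. (real (card {i. i < N \<and> x i \<in> theta_ball \<mu> \<theta> r y})
            - real N * measure \<mu> (theta_ball \<mu> \<theta> r y))\<^sup>2 \<partial>\<mu>)"

definition discrepancy ::
    "'a measure \<Rightarrow> ('a \<Rightarrow> 'a \<Rightarrow> real) \<Rightarrow> (real \<Rightarrow> real) \<Rightarrow> nat \<Rightarrow> (nat \<Rightarrow> 'a) \<Rightarrow> real" where
  "discrepancy \<mu> \<theta> \<eta> N x = (LINT r:{0..pi}|lebesgue. ball_discrepancy \<mu> \<theta> N x r * \<eta> r)"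

definition symdiff_metric_at ::
    "'a measure \<Rightarrow> ('a \<Rightarrow> 'a \<Rightarrow> real) \<Rightarrow> real \<Rightarrow> 'a \<Rightarrow> 'a \<Rightarrow> real" where
  "symdiff_metric_at \<mu> \<theta> r y1 y2 =
     1 / 2 * measure \<mu> (sym_diff (theta_ball \<mu> \<theta> r y1) (theta_ball \<mu> \<theta> r y2))"

definition symdiff_metric ::
    "'a measure \<Rightarrow> ('a \<Rightarrow> 'a \<Rightarrow> real) \<Rightarrow> (real \<Rightarrow> real) \<Rightarrow> 'a \<Rightarrow> 'a \<Rightarrow> real" where
  "symdiff_metric \<mu> \<theta> \<eta> y1 y2 =
     (LINT r:{0..pi}|lebesgue. symdiff_metric_at \<mu> \<theta> r y1 y2 * \<eta> r)"

definition chordal_metric :: "('a \<Rightarrow> 'a \<Rightarrow> real) \<Rightarrow> 'a \<Rightarrow> 'a \<Rightarrow> real" where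
  "chordal_metric \<theta> x1 x2 = sin (\<theta> x1 x2 / 2)"

definition average_distance :: "'a measure \<Rightarrow> ('a \<Rightarrow> 'a \<Rightarrow> real) \<Rightarrow> real" where
  "average_distance \<mu> \<rho> = (\<integral>y1. (\<integral>y2. \<rho> y1 y2 \<partial>\<mu>) \<partial>\<mu>)"

definition sum_of_distances :: "('a \<Rightarrow> 'a \<Rightarrow> real) \<Rightarrow> nat \<Rightarrow> (nat \<Rightarrow> 'a) \<Rightarrow> real" where
  "sum_of_distances \<rho> N x = (\<Sum>i<N. \<Sum>j<N. \<rho> (x i) (x j))"

definition weight_class :: "nat \<Rightarrow> nat \<Rightarrow> (real \<Rightarrow> real) set" where
  "weight_class a b =
     {\<eta>. \<eta> \<in> borel_measurable (lebesgue_on {0..pi}) \<and> (\<forall>r\<in>{0..pi}. 0 \<le> \<eta> r) \<and>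
         set_integrable lebesgue {0..pi}
           (\<lambda>r. sin (r / 2) ^ (a - 1) * cos (r / 2) ^ (b - 1) * \<eta> r)}"

end

theory Submission imports Defs begin

text \<open>
  Expanding the indicator function of a ball in the zonal spherical functions
  \<open>\<phi>\<^sub>k (cos \<theta>)\<close>, which are Jacobi polynomials, writes the discrepancy \<open>\<lambda>\<^sub>r\<close> as
  \<open>\<Sum>\<^sub>k f\<^sub>k(r)\<^sup>2 g\<^sub>k\<close> with \<open>g\<^sub>k = \<Sum>\<^sub>i\<^sub>,\<^sub>j \<phi>\<^sub>k (cos \<theta>(x\<^sub>i, x\<^sub>j)) / \<kappa>\<^sub>k \<ge> 0\<close>, where \<open>\<kappa>\<^sub>k\<close> is the mean
  square of \<open>\<phi>\<^sub>k\<close> and \<open>k \<ge> 1\<close>. For a \<open>t\<close>-design the terms with \<open>k \<le> t\<close> vanish. Energy estimates for the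
  Jacobi equation show that \<open>f\<^sub>k(r)\<^sup>2\<close> is at most a multiple of \<open>w(r) / k^(d+1)\<close>, \<open>w\<close> being the density of the
  distance from a point, and that its integral against \<open>\<eta>\<close> is at least a multiple of \<open>1 / k^(d+1)\<close>.

  Upper bound: both conditions on the points bound the number of them in a ball of radius \<open>a / L\<close>
  for \<open>L \<ge> t\<close>. Bessel's inequality for such balls gives \<open>\<Sum>\<^sub>k\<^sub>\<le>\<^sub>L g\<^sub>k \<le> C N L^d\<close>, and summation by parts
  gives \<open>\<lambda>\<^sub>r \<le> C w(r) N / t\<close>. Lower bound: the nonnegative kernel \<open>D\<^sup>2 / D(1)\<close> with
  \<open>D = \<Sum>\<^sub>k\<^sub>\<le>\<^sub>m \<phi>\<^sub>k / \<kappa>\<^sub>k\<close> gives \<open>\<Sum>\<^sub>k\<^sub>\<le>\<^sub>2\<^sub>m g\<^sub>k \<ge> N D(1) - N\<^sup>2\<close>, which is at least \<open>N\<^sup>2\<close> for a suitable \<open>m\<close> of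
  order \<open>N^(1/d)\<close>. Stolarsky's identity carries the bounds over to the sums of distances; the
  chordal metric is a multiple of the symmetric difference metric with weight \<open>sin\<close>.
\<close>

section \<open>The Jacobi differential equation\<close>

text \<open>The octonionic plane is not a space of lines in a vector space, so the harmonic analysis
  is not built on a matrix group and its representations. What enters instead is that isometries
  preserve \<open>\<mu>\<close>, that a pair of points at distance s can be moved to
  \<open>Y 0\<close> and \<open>Y s\<close>, and two moment identities. The mean of a zonal
  polynomial centred at \<open>Y s\<close> does not depend on s; its vanishing second variation at s
  = 0 is where the Jacobi operator comes from, and it determines the distribution of the distance.
  Convolution does not raise degrees, because a zonal polynomial restricted to a geodesic circle is
  a trigonometric polynomial; orthogonality then yields the addition and Funk-Hecke formulas. No
  asymptotic expansion of Jacobi polynomials is used. The functions and their derivatives have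
  zeros, but the energy f^2 + g^2 / l is controlled from both sides. This is also why the
  coefficients have a lower bound only after integration over r, except for balls of radius a / L,
  on which the spherical functions of degree at most L stay at least 1/2.\<close>

definition jw :: "nat \<Rightarrow> nat \<Rightarrow> real \<Rightarrow> real" where
  "jw m n t = sin (t / 2) ^ m * cos (t / 2) ^ n"

text \<open>The logarithmic derivative of \<open>jw m n\<close>, that is, the damping coefficient of
  the equation f'' + \<open>jb\<close> f' + l f = 0.\<close>

definition jb :: "nat \<Rightarrow> nat \<Rightarrow> real \<Rightarrow> real" where
  "jb m n t = real m / 2 * (cos (t / 2) / sin (t / 2)) - real n / 2 * (sin (t / 2) / cos (t / 2))"

text \<open>The equation is kept as a first-order system with \<open>g\<close> = f'. That
  \<open>g\<close> vanishes at both singular endpoints expresses regularity there and keeps the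
  notion symmetric under t -> pi - t.\<close>

definition jacobi_solution :: "nat \<Rightarrow> nat \<Rightarrow> real \<Rightarrow> (real \<Rightarrow> real) \<Rightarrow> (real \<Rightarrow> real) \<Rightarrow> bool" where
  "jacobi_solution m n l f g \<longleftrightarrow>
     l > 0 \<and> g 0 = 0 \<and> g pi = 0 \<and> continuous_on UNIV g \<and>
     (\<forall>t. (f has_real_derivative g t) (at t)) \<and>
     (\<forall>t. 0 < t \<longrightarrow> t < pi \<longrightarrow> (g has_real_derivative - jb m n t * g t - l * f t) (at t))"

text \<open>For constant coefficients this is the squared amplitude of the oscillation. Here it
  changes only through the damping term, which involves g^2 alone.\<close>

definition energy :: "real \<Rightarrow> (real \<Rightarrow> real) \<Rightarrow> (real \<Rightarrow> real) \<Rightarrow> real \<Rightarrow> real" where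
  "energy l f g t = (f t)\<^sup>2 + (g t)\<^sup>2 / l"

lemma half_angle_pos:
  assumes "0 < t" "t < pi" shows "0 < sin (t / 2)" "0 < cos (t / 2)"
  using assms by (auto intro!: sin_gt_zero cos_gt_zero)

lemma jw_pos: "0 < t \<Longrightarrow> t < pi \<Longrightarrow> 0 < jw m n t"
  by (simp add: jw_def half_angle_pos)

lemma jw_nonneg: "0 \<le> t \<Longrightarrow> t \<le> pi \<Longrightarrow> 0 \<le> jw m n t"
  unfolding jw_def by (intro mult_nonneg_nonneg zero_le_power sin_ge_zero cos_ge_zero) auto

lemma continuous_on_jw [continuous_intros]: "continuous_on A (jw m n)"
  unfolding jw_def by (intro continuous_intros) auto

lemma jw_flip: "jw m n (pi - t) = jw n m t"
  by (simp add: jw_def diff_divide_distrib sin_diff cos_diff mult.commute)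

lemma jb_flip: "jb m n (pi - t) = - jb n m t"
  by (simp add: jb_def diff_divide_distrib sin_diff cos_diff)

lemma jw_has_derivative:
  assumes "0 < t" "t < pi"
  shows "(jw m n has_real_derivative jw m n t * jb m n t) (at t)"
proof -
  note pos = half_angle_pos[OF assms]
  have S: "((\<lambda>t. sin (t / 2)) has_real_derivative cos (t/2) / 2) (at t)"
    and C: "((\<lambda>t. cos (t / 2)) has_real_derivative - sin (t/2) / 2) (at t)"
    by (auto intro!: derivative_eq_intros)
  have 1: "((\<lambda>t. sin (t / 2) ^ m) has_real_derivative sin (t/2) ^ m * (real m / 2 * (cos (t/2) / sin (t/2)))) (at t)"
    by (rule DERIV_cong[OF DERIV_power[OF S]]) (use pos in \<open>cases m; simp add: field_simps\<close>)
  have 2: "((\<lambda>t. cos (t / 2) ^ n) has_real_derivative cos (t/2) ^ n * - (real n / 2 * (sin (t/2) / cos (t/2)))) (at t)"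
    by (rule DERIV_cong[OF DERIV_power[OF C]]) (use pos in \<open>cases n; simp add: field_simps\<close>)
  show ?thesis unfolding jw_def[abs_def] jb_def
    by (rule DERIV_cong[OF DERIV_mult[OF 1 2]]) (simp add: algebra_simps)
qed

lemma jb_has_derivative:
  assumes "0 < t" "t < pi"
  shows "(jb m n has_real_derivative - (real m / 4 / sin (t/2) ^ 2 + real n / 4 / cos (t/2) ^ 2)) (at t)"
proof -
  note pos = half_angle_pos[OF assms]
  have S: "((\<lambda>t. sin (t / 2)) has_real_derivative cos (t/2) * (1/2)) (at t)"
    and C: "((\<lambda>t. cos (t / 2)) has_real_derivative - sin (t/2) * (1/2)) (at t)"
    by (auto intro!: derivative_eq_intros)
  have sq: "cos (t/2) * cos (t/2) = 1 - sin (t/2) * sin (t/2)"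
    using sin_cos_squared_add3[of "t/2"] by linarith
  have "((\<lambda>t. cos (t/2) / sin (t / 2)) has_real_derivative
      ((- sin (t/2) * (1/2)) * sin (t/2) - cos (t/2) * (cos (t/2) * (1/2))) / (sin (t/2) * sin (t/2))) (at t)"
    using pos by (intro derivative_intros S C) auto
  also have "((- sin (t/2) * (1/2)) * sin (t/2) - cos (t/2) * (cos (t/2) * (1/2))) = - (1/2)"
    using sq by (simp add: algebra_simps)
  finally have 1: "((\<lambda>t. cos (t/2) / sin (t / 2)) has_real_derivative - (1 / 2 / sin (t/2) ^ 2)) (at t)"
    by (simp add: power2_eq_square)
  have "((\<lambda>t. sin (t/2) / cos (t / 2)) has_real_derivative
      ((cos (t/2) * (1/2)) * cos (t/2) - sin (t/2) * (- sin (t/2) * (1/2))) / (cos (t/2) * cos (t/2))) (at t)"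
    using pos by (intro derivative_intros S C) auto
  also have "((cos (t/2) * (1/2)) * cos (t/2) - sin (t/2) * (- sin (t/2) * (1/2))) = 1/2"
    using sq by (simp add: algebra_simps)
  finally have 2: "((\<lambda>t. sin (t/2) / cos (t / 2)) has_real_derivative 1 / 2 / cos (t/2) ^ 2) (at t)"
    by (simp add: power2_eq_square)
  show ?thesis unfolding jb_def[abs_def]
    by (rule DERIV_cong[OF DERIV_diff[OF DERIV_cmult[OF 1] DERIV_cmult[OF 2]]])
       (use pos in \<open>simp add: field_simps\<close>)
qed

lemma sin_half_ge:
  assumes "0 \<le> t" "t \<le> pi" shows "t / pi \<le> sin (t / 2)"
proof -
  have "concave_on {0..pi} (\<lambda>x. sin (x/2))"
  proof (rule f''_le0_imp_concave)
    show "convex {0..pi}" by simp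
    fix x :: real assume "x \<in> {0..pi}"
    show "((\<lambda>x. sin (x/2)) has_real_derivative cos (x/2) / 2) (at x)"
      by (auto intro!: derivative_eq_intros)
    show "((\<lambda>x. cos (x/2) / 2) has_real_derivative - sin (x/2) / 4) (at x)"
      by (auto intro!: derivative_eq_intros)
    show "- sin (x/2) / 4 \<le> 0" using \<open>x \<in> {0..pi}\<close> by (auto intro!: sin_ge_zero)
  qed
  then have "(\<lambda>x. sin (x/2)) ((1 - t/pi) *\<^sub>R 0 + (t/pi) *\<^sub>R pi) \<ge> (1 - t/pi) * sin (0/2) + (t/pi) * sin (pi/2)"
    by (rule concave_onD) (use assms in auto)
  then show ?thesis by simp
qed

lemma sin_half_le: "0 \<le> (t::real) \<Longrightarrow> sin (t / 2) \<le> t / 2"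
  by (rule sin_x_le_x) simp

lemma cos_half_ge:
  assumes "0 \<le> t" "t \<le> pi / 2" shows "1 / 2 \<le> cos (t / 2)"
proof -
  have "cos (pi/3) \<le> cos (t/2)"
    by (rule cos_monotone_0_pi_le) (use assms in auto)
  then show ?thesis by (simp add: cos_60)
qed

lemma cot_half_le:
  assumes "0 < t" "t < pi" shows "cos (t/2) / sin (t/2) \<le> 2 / t"
proof -
  note pos = half_angle_pos[OF assms]
  have "sin 0 - 0 * cos 0 \<le> sin (t/2) - t/2 * cos (t/2)"
  proof (rule DERIV_nonneg_imp_nondecreasing[of 0 "t/2" "\<lambda>x. sin x - x * cos x"])
    fix x :: real assume x: "0 \<le> x" "x \<le> t / 2"
    have "((\<lambda>x. sin x - x * cos x) has_real_derivative x * sin x) (at x)"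
      by (auto intro!: derivative_eq_intros)
    moreover have "0 \<le> x * sin x" using x assms by (intro mult_nonneg_nonneg sin_ge_zero) auto
    ultimately show "\<exists>y. ((\<lambda>x. sin x - x * cos x) has_real_derivative y) (at x) \<and> 0 \<le> y"
      by blast
  qed (use assms in simp)
  then show ?thesis using assms pos by (simp add: field_simps)
qed

lemma jb_upper:
  assumes "0 < t" "t < pi" shows "jb m n t \<le> real m / t"
proof -
  have "real m / 2 * (cos (t/2) / sin (t/2)) \<le> real m / 2 * (2 / t)"
    using cot_half_le[OF assms] by (intro mult_left_mono) auto
  moreover have "real n / 2 * (sin (t/2) / cos (t/2)) \<ge> 0" using half_angle_pos[OF assms] by simp
  ultimately show ?thesis by (simp add: jb_def)
qed

lemma jb_lower:
  assumes "0 < t" "t < pi" shows "- (real n / (pi - t)) \<le> jb m n t"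
  using jb_upper[of "pi - t" n m] assms by (simp add: jb_flip)

text \<open>On the left half only the tangent term is negative, and there it is at most n/2; the
  singular cotangent term has the favourable sign. Hence the monotonicity arguments below work right
  up to t = 0.\<close>

lemma jb_ge:
  assumes "0 < t" "t \<le> pi / 2" shows "- (real n / 2) \<le> jb m n t"
proof -
  have lt: "t < pi" using assms pi_gt_zero by linarith
  note pos = half_angle_pos[OF assms(1) lt]
  have "sin (t/2) \<le> cos (t/2)"
  proof -
    have "sin (t/2) \<le> sin (pi/2 - t/2)" by (rule sin_monotone_2pi_le) (use assms in auto)
    then show ?thesis by (simp add: sin_diff)
  qed
  then have "sin (t/2) / cos (t/2) \<le> 1" using pos by simp
  then have "real n / 2 * (sin (t/2) / cos (t/2)) \<le> real n / 2 * 1" by (intro mult_left_mono) auto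
  moreover have "real m / 2 * (cos (t/2) / sin (t/2)) \<ge> 0" using pos by simp
  ultimately show ?thesis unfolding jb_def by linarith
qed

lemma jw_le_sin: "0 \<le> t \<Longrightarrow> t \<le> pi / 2 \<Longrightarrow> jw m n t \<le> sin (t / 2) ^ m"
  unfolding jw_def using cos_half_ge[of t] sin_ge_zero[of "t/2"]
  by (intro mult_left_le power_le_one zero_le_power) auto

lemma jw_ge_sin: "0 \<le> t \<Longrightarrow> t \<le> pi / 2 \<Longrightarrow> sin (t / 2) ^ m * (1 / 2) ^ n \<le> jw m n t"
  unfolding jw_def using cos_half_ge[of t] sin_ge_zero[of "t/2"]
  by (intro mult_left_mono power_mono zero_le_power) auto

section \<open>Energy estimates for a single solution\<close>

context
  fixes m n :: nat and l :: real and f g :: "real \<Rightarrow> real"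
  assumes sol: "jacobi_solution m n l f g"
begin

lemma l_pos: "0 < l" and g_0: "g 0 = 0" and g_pi: "g pi = 0"
  and g_cont: "continuous_on UNIV g"
  and f_deriv: "(f has_real_derivative g t) (at t)"
  and g_deriv: "0 < t \<Longrightarrow> t < pi \<Longrightarrow> (g has_real_derivative - jb m n t * g t - l * f t) (at t)"
  using sol by (auto simp: jacobi_solution_def)

lemma f_cont: "continuous_on A f"
  by (meson DERIV_isCont continuous_at_imp_continuous_on f_deriv)

lemma g_cont': "continuous_on A g"
  using g_cont continuous_on_subset by blast

lemma energy_nonneg: "0 \<le> energy l f g t"
  using l_pos by (simp add: energy_def)

lemma f_sq_le_energy: "(f t)\<^sup>2 \<le> energy l f g t"
  using l_pos by (simp add: energy_def)

lemma g_sq_le_energy: "(g t)\<^sup>2 / l \<le> energy l f g t"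
  by (simp add: energy_def)

lemma fg_le_energy: "\<bar>f t * g t\<bar> \<le> sqrt l * energy l f g t / 2"
proof -
  have "2 * (\<bar>f t\<bar> * (\<bar>g t\<bar> / sqrt l)) \<le> \<bar>f t\<bar>\<^sup>2 + (\<bar>g t\<bar> / sqrt l)\<^sup>2"
    using sum_squares_bound[of "\<bar>f t\<bar>" "\<bar>g t\<bar> / sqrt l"] by simp
  also have "\<dots> = energy l f g t" using l_pos by (simp add: energy_def power_divide)
  finally show ?thesis using l_pos by (simp add: abs_mult field_simps)
qed

lemma energy_deriv:
  assumes "0 < t" "t < pi"
  shows "(energy l f g has_real_derivative - 2 * jb m n t * (g t)\<^sup>2 / l) (at t)"
  unfolding energy_def[abs_def]
  by (rule DERIV_cong, (rule derivative_intros f_deriv g_deriv assms)+)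
     (use l_pos in \<open>simp_all add: field_simps power2_eq_square\<close>)

lemma energy_cont: "continuous_on A (energy l f g)"
  unfolding energy_def[abs_def] using l_pos f_cont g_cont'
  by (intro continuous_intros) auto

lemma wg_deriv:
  assumes "0 < t" "t < pi"
  shows "((\<lambda>t. jw m n t * g t) has_real_derivative - l * (jw m n t * f t)) (at t)"
  by (rule DERIV_cong, (rule derivative_intros jw_has_derivative g_deriv assms)+)
     (simp add: algebra_simps)

lemma wfg_deriv:
  assumes "0 < t" "t < pi"
  shows "((\<lambda>t. jw m n t * f t * g t) has_real_derivative jw m n t * (g t)\<^sup>2 - l * (jw m n t * (f t)\<^sup>2)) (at t)"
  by (rule DERIV_cong, (rule derivative_intros jw_has_derivative f_deriv g_deriv assms)+)
     (simp add: algebra_simps power2_eq_square)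

text \<open>The derivative of the energy E is -2 \<open>jb\<close> g^2 / l, which by
  \<open>jb_ge\<close> is at most n E; the exponential is the integrating factor of this
  inequality.\<close>

lemma energy_exp_decreasing:
  assumes "0 \<le> s" "s \<le> t" "t \<le> pi / 2"
  shows "energy l f g t * exp (- real n * t) \<le> energy l f g s * exp (- real n * s)"
proof -
  have "- (energy l f g s * exp (- real n * s)) \<le> - (energy l f g t * exp (- real n * t))"
  proof (rule DERIV_nonneg_imp_increasing_open[OF \<open>s \<le> t\<close>])
    fix x assume x: "s < x" "x < t"
    then have x': "0 < x" "x < pi" "x \<le> pi/2" using assms pi_gt_zero by linarith+
    have D: "((\<lambda>t. - (energy l f g t * exp (- real n * t))) has_real_derivative
        (2 * jb m n x * (g x)\<^sup>2 / l + real n * energy l f g x) * exp (- real n * x)) (at x)"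
      by (rule DERIV_cong, (rule derivative_intros energy_deriv x')+) (simp add: algebra_simps)
    have "- real n * ((g x)\<^sup>2 / l) \<le> 2 * jb m n x * ((g x)\<^sup>2 / l)"
      using jb_ge[OF x'(1,3), of n m] l_pos by (intro mult_right_mono) auto
    moreover have "real n * ((g x)\<^sup>2 / l) \<le> real n * energy l f g x"
      by (intro mult_left_mono g_sq_le_energy) auto
    ultimately have "0 \<le> 2 * jb m n x * (g x)\<^sup>2 / l + real n * energy l f g x" by simp
    with D show "\<exists>y. ((\<lambda>t. - (energy l f g t * exp (- real n * t))) has_real_derivative y) (at x) \<and> 0 \<le> y"
      by (meson exp_ge_zero mult_nonneg_nonneg)
  qed (intro continuous_intros energy_cont)
  then show ?thesis by simp
qed

text \<open>Multiplication by the square of the weight exchanges the roles of f and g: the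
  derivative of w^2 E is 2 \<open>jb\<close> w^2 f^2, so that the singular part of \<open>jb\<close>
  now makes it grow. This is the lower counterpart of \<open>energy_exp_decreasing\<close> where
  \<open>jb\<close> is large.\<close>

lemma w2_energy_exp_increasing:
  assumes "0 \<le> s" "s \<le> t" "t \<le> pi / 2"
  shows "(jw m n s)\<^sup>2 * energy l f g s * exp (real n * s) \<le> (jw m n t)\<^sup>2 * energy l f g t * exp (real n * t)"
proof (rule DERIV_nonneg_imp_increasing_open[OF \<open>s \<le> t\<close>])
  fix x assume x: "s < x" "x < t"
  then have x': "0 < x" "x < pi" "x \<le> pi/2" using assms pi_gt_zero by linarith+
  have D: "((\<lambda>t. (jw m n t)\<^sup>2 * energy l f g t * exp (real n * t)) has_real_derivative
      (jw m n x)\<^sup>2 * (2 * jb m n x * (f x)\<^sup>2 + real n * energy l f g x) * exp (real n * x)) (at x)"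
    by (rule DERIV_cong, (rule derivative_intros energy_deriv jw_has_derivative x')+)
       (use l_pos in \<open>simp add: energy_def field_simps power2_eq_square\<close>)
  have "- real n * (f x)\<^sup>2 \<le> 2 * jb m n x * (f x)\<^sup>2"
    using jb_ge[OF x'(1,3), of n m] by (intro mult_right_mono) auto
  moreover have "real n * (f x)\<^sup>2 \<le> real n * energy l f g x"
    by (intro mult_left_mono f_sq_le_energy) auto
  ultimately have "0 \<le> 2 * jb m n x * (f x)\<^sup>2 + real n * energy l f g x" by simp
  with D show "\<exists>y. ((\<lambda>t. (jw m n t)\<^sup>2 * energy l f g t * exp (real n * t)) has_real_derivative y) (at x) \<and> 0 \<le> y"
    by (meson exp_ge_zero mult_nonneg_nonneg zero_le_power2)
qed (intro continuous_intros energy_cont)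

lemma energy_le_initial:
  assumes "0 \<le> t" "t \<le> pi / 2"
  shows "energy l f g t \<le> exp (real n * pi / 2) * (f 0)\<^sup>2"
proof -
  have "energy l f g t * exp (- real n * t) \<le> (f 0)\<^sup>2"
    using energy_exp_decreasing[of 0 t] assms g_0 by (simp add: energy_def)
  then have "energy l f g t * exp (- real n * t) * exp (real n * t) \<le> (f 0)\<^sup>2 * exp (real n * t)"
    by (intro mult_right_mono) auto
  also have "\<dots> \<le> (f 0)\<^sup>2 * exp (real n * pi / 2)"
    using assms mult_left_mono[of t "pi/2" "real n"] by (intro mult_left_mono) auto
  finally show ?thesis by (simp add: mult.assoc flip: exp_add) (simp add: mult.commute)
qed

text \<open>Two integrations of the equation from 0: the identity (w g)' = - l w f together with the
  bound on f from \<open>energy_le_initial\<close> makes g at most linear in t, and hence f - f 0 at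
  most quadratic. The factor 2^n comes from cos (t/2) being at least 1/2.\<close>

lemma f_near_zero:
  assumes "0 \<le> t" "t \<le> pi / 2"
  shows "\<bar>f t - f 0\<bar> \<le> l * (2 ^ n * (exp (real n * pi / 4) * \<bar>f 0\<bar>)) * t\<^sup>2 / 2"
proof -
  define M where "M = exp (real n * pi / 4) * \<bar>f 0\<bar>"
  have f_le: "\<bar>f x\<bar> \<le> M" if "0 \<le> x" "x \<le> pi / 2" for x
  proof (rule power2_le_imp_le)
    have "\<bar>f x\<bar>\<^sup>2 \<le> exp (real n * pi / 2) * (f 0)\<^sup>2"
      using energy_le_initial[OF that] f_sq_le_energy[of x] by simp
    also have "\<dots> = M\<^sup>2" by (simp add: M_def power_mult_distrib flip: exp_double)
    finally show "\<bar>f x\<bar>\<^sup>2 \<le> M\<^sup>2" .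
  qed (simp add: M_def)
  have "M \<ge> 0" by (simp add: M_def)
  have g_le: "\<bar>g x\<bar> \<le> l * (2 ^ n * M) * x" if x: "0 < x" "x \<le> pi / 2" for x
  proof -
    \<comment> \<open>The signs \<open>e\<close> = 1 and -1 give the two halves of the bound on |w
      g|. The derivative of the comparison function contains l M sin^m, which dominates l w
      f.\<close>
    have mono: "0 \<le> l * M * x * sin (x/2) ^ m + e * (jw m n x * g x)" if e: "\<bar>e\<bar> = 1" for e :: real
    proof -
      let ?h = "\<lambda>y. l * M * y * sin (y/2) ^ m + e * (jw m n y * g y)"
      have "?h 0 \<le> ?h x"
      proof (rule DERIV_nonneg_imp_increasing_open[of 0 x ?h])
        fix y assume "0 < y" "y < x"
        then have y: "0 < y" "y < pi" "y \<le> pi/2" using x pi_gt_zero by linarith+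
        note pos = half_angle_pos[OF y(1,2)]
        have S: "((\<lambda>t. sin (t / 2)) has_real_derivative cos (y/2) / 2) (at y)"
          by (auto intro!: derivative_eq_intros)
        have D: "(?h has_real_derivative l * (M * sin (y/2) ^ m - e * (jw m n y * f y))
            + l * M * y * (real m * (cos (y/2) / 2 * sin (y/2) ^ (m - Suc 0)))) (at y)"
          by (rule DERIV_cong, (rule derivative_intros wg_deriv DERIV_power S y)+)
             (simp add: algebra_simps)
        have "\<bar>e * (jw m n y * f y)\<bar> \<le> sin (y/2) ^ m * M"
          unfolding abs_mult using e f_le[of y] jw_le_sin[of y m n] jw_pos[OF y(1,2), of m n] y
          by simp (intro mult_mono; simp)
        then have "0 \<le> l * (M * sin (y/2) ^ m - e * (jw m n y * f y))"
          using l_pos by (intro mult_nonneg_nonneg) (auto simp: mult.commute abs_le_iff)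
        moreover have "0 \<le> l * M * y * (real m * (cos (y/2) / 2 * sin (y/2) ^ (m - Suc 0)))"
          using l_pos \<open>M \<ge> 0\<close> y pos by simp
        ultimately show "\<exists>z. (?h has_real_derivative z) (at y) \<and> 0 \<le> z"
          using D by (meson add_nonneg_nonneg)
      next
        show "continuous_on {0..x} ?h" by (intro continuous_intros g_cont') auto
      qed (use x in simp)
      then show ?thesis by (simp add: g_0)
    qed
    have xp: "x < pi" using x pi_gt_zero by linarith
    have "jw m n x * \<bar>g x\<bar> = \<bar>jw m n x * g x\<bar>" using jw_pos[OF x(1) xp, of m n] by (simp add: abs_mult)
    also have "\<dots> \<le> l * M * x * sin (x/2) ^ m" using mono[of 1] mono[of "-1"] by simp
    also have "\<dots> \<le> l * M * x * (2 ^ n * jw m n x)"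
      using jw_ge_sin[of x m n] x l_pos \<open>M \<ge> 0\<close>
      by (intro mult_left_mono) (auto simp: field_simps)
    finally have "jw m n x * \<bar>g x\<bar> \<le> jw m n x * (l * (2 ^ n * M) * x)" by (simp add: mult_ac)
    then show ?thesis using jw_pos[OF x(1) xp, of m n] by simp
  qed
  have "0 \<le> l * (2 ^ n * M) * t\<^sup>2 / 2 + e * (f t - f 0)" if e: "\<bar>e\<bar> = 1" for e :: real
  proof -
    let ?h = "\<lambda>y. l * (2 ^ n * M) * y\<^sup>2 / 2 + e * (f y - f 0)"
    have "?h 0 \<le> ?h t"
    proof (rule DERIV_nonneg_imp_increasing_open[of 0 t ?h])
      fix y assume "0 < y" "y < t"
      then have y: "0 < y" "y \<le> pi/2" using assms by auto
      have D: "(?h has_real_derivative l * (2 ^ n * M) * y + e * g y) (at y)"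
        by (auto intro!: derivative_eq_intros f_deriv)
      have "\<bar>e * g y\<bar> \<le> l * (2 ^ n * M) * y" using g_le[OF y] e by (simp add: abs_mult)
      then have "0 \<le> l * (2 ^ n * M) * y + e * g y" by linarith
      with D show "\<exists>z. (?h has_real_derivative z) (at y) \<and> 0 \<le> z" by blast
    next
      show "continuous_on {0..t} ?h" by (intro continuous_intros f_cont) auto
    qed (use assms in simp)
    then show ?thesis by simp
  qed
  from this[of 1] this[of "-1"]
  have "- (l * (2 ^ n * M) * t\<^sup>2 / 2) \<le> f t - f 0" "f t - f 0 \<le> l * (2 ^ n * M) * t\<^sup>2 / 2"
    by auto
  then show ?thesis unfolding M_def[symmetric] by (intro abs_leI) auto
qed

text \<open>The derivative of w E is w \<open>jb\<close> (f^2 - g^2 / l), and that of w f g / l is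
  the negative of w (f^2 - g^2 / l). Adding \<open>jb\<close> f g / l to the energy therefore
  cancels the main term and leaves one containing only the derivative of \<open>jb\<close>.\<close>

lemma wJ_deriv:
  assumes "0 < t" "t < pi"
  shows "((\<lambda>t. jw m n t * (energy l f g t + jb m n t * f t * g t / l)) has_real_derivative
     jw m n t * (- (real m / 4 / sin (t/2) ^ 2 + real n / 4 / cos (t/2) ^ 2)) * f t * g t / l) (at t)"
proof -
  have D: "((\<lambda>t. jw m n t * energy l f g t + jb m n t * (jw m n t * f t * g t) / l) has_real_derivative
     jw m n t * (- (real m / 4 / sin (t/2) ^ 2 + real n / 4 / cos (t/2) ^ 2)) * f t * g t / l) (at t)"
    by (rule DERIV_cong, (rule derivative_intros energy_deriv jw_has_derivative wfg_deriv jb_has_derivative assms)+)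
       (use l_pos in \<open>simp_all add: energy_def divide_simps\<close>, simp add: algebra_simps power2_eq_square)
  show ?thesis by (rule DERIV_cong_ev[THEN iffD1, OF refl _ refl D]) (auto simp: algebra_simps)
qed

text \<open>At distance A / sqrt l from the endpoints \<open>jb\<close> is at most sqrt l in
  absolute value. The corrected quantity J of \<open>wJ_deriv\<close> then lies between 1/2 and 3/2
  of w E, and its logarithmic derivative is at most |jb'| / sqrt l. As \<open>jb\<close> is monotone
  with total variation at most 2 sqrt l, J changes by a factor of at most exp 2.\<close>

lemma energy_middle:
  assumes A: "real m \<le> A" "real n \<le> A" "0 < A"
    and s: "A / sqrt l \<le> s" "s \<le> pi - A / sqrt l" and t: "A / sqrt l \<le> t" "t \<le> pi - A / sqrt l"
  shows "jw m n s * energy l f g s \<le> 3 * exp 2 * (jw m n t * energy l f g t)"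
proof -
  define L where "L = sqrt l"
  have L: "L > 0" "l = L * L" using l_pos by (simp_all add: L_def)
  have AL: "A / L > 0" using A L by simp
  define J where "J = (\<lambda>t. jw m n t * (energy l f g t + jb m n t * f t * g t / l))"
  let ?I = "{A / L .. pi - A / L}"
  have I: "0 < x" "x < pi" if "x \<in> ?I" for x using that AL by auto
  have b: "\<bar>jb m n x\<bar> \<le> L" if "x \<in> ?I" for x
  proof -
    have "real m / x \<le> A / (A / L)" using that A AL by (intro frac_le) auto
    moreover have "real n / (pi - x) \<le> A / (A / L)" using that A AL by (intro frac_le) auto
    ultimately show ?thesis using jb_upper[OF I[OF that], of m n] jb_lower[OF I[OF that], of n m] A by auto
  qed
  have fg: "\<bar>f x * g x / l\<bar> \<le> energy l f g x / (2 * L)" for x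
    using fg_le_energy[of x] L by (simp add: L_def[symmetric] abs_mult field_simps)
  have bfg: "\<bar>jb m n x * f x * g x / l\<bar> \<le> energy l f g x / 2" if "x \<in> ?I" for x
  proof -
    have "\<bar>jb m n x * f x * g x / l\<bar> = \<bar>jb m n x\<bar> * \<bar>f x * g x / l\<bar>" by (simp add: abs_mult)
    also have "\<dots> \<le> L * (energy l f g x / (2 * L))" by (intro mult_mono b fg that) (use L in auto)
    finally show ?thesis using L by simp
  qed
  have J_lo: "jw m n x * energy l f g x / 2 \<le> J x" if "x \<in> ?I" for x
  proof -
    have "jw m n x * (energy l f g x / 2) \<le> J x" unfolding J_def
      using bfg[OF that, unfolded abs_le_iff] jw_pos[OF I[OF that], of m n]
      by (intro mult_left_mono) linarith+
    then show ?thesis by simp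
  qed
  have J_hi: "J x \<le> 3 / 2 * (jw m n x * energy l f g x)" if "x \<in> ?I" for x
  proof -
    have "J x \<le> jw m n x * (3 / 2 * energy l f g x)" unfolding J_def
      using bfg[OF that, unfolded abs_le_iff] jw_pos[OF I[OF that], of m n]
      by (intro mult_left_mono) linarith+
    then show ?thesis by simp
  qed
  define b' where "b' = (\<lambda>x. - (real m / 4 / sin (x/2) ^ 2 + real n / 4 / cos (x/2) ^ 2))"
  have J': "(J has_real_derivative jw m n x * b' x * f x * g x / l) (at x)" if "x \<in> ?I" for x
    unfolding J_def b'_def by (rule wJ_deriv[OF I[OF that]])
  have J'_le: "\<bar>jw m n x * b' x * f x * g x / l\<bar> \<le> - b' x / L * J x" if "x \<in> ?I" for x
  proof -
    have b'0: "b' x \<le> 0" unfolding b'_def by (simp only: neg_le_0_iff_le) (intro add_nonneg_nonneg divide_nonneg_nonneg; simp)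
    have "\<bar>jw m n x * b' x * f x * g x / l\<bar> = (jw m n x * - b' x) * \<bar>f x * g x / l\<bar>"
      using jw_pos[OF I[OF that], of m n] b'0 by (simp add: abs_mult abs_of_nonpos)
    also have "\<dots> \<le> (jw m n x * - b' x) * (energy l f g x / (2 * L))"
      using jw_pos[OF I[OF that], of m n] b'0 by (intro mult_left_mono fg mult_nonneg_nonneg) auto
    also have "\<dots> = - b' x / L * (jw m n x * energy l f g x / 2)" by (simp add: mult_ac)
    also have "\<dots> \<le> - b' x / L * J x"
      using b'0 L by (intro mult_left_mono J_lo that) (auto simp: divide_nonpos_pos)
    finally show ?thesis .
  qed
  have bD: "(jb m n has_real_derivative b' x) (at x)" if "x \<in> ?I" for x
    unfolding b'_def by (rule jb_has_derivative[OF I[OF that]])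
  \<comment> \<open>Because \<open>jb\<close> decreases, |jb'| is the derivative of -
    \<open>jb\<close>; thus exp (- \<open>jb\<close> / L) is an integrating factor that absorbs the
    bound on the derivative of J.\<close>
  have inc: "J u * exp (- jb m n u / L) \<le> J v * exp (- jb m n v / L)"
    if uv: "u \<in> ?I" "v \<in> ?I" "u \<le> v" for u v
  proof (rule DERIV_nonneg_imp_nondecreasing[OF \<open>u \<le> v\<close>])
    fix x assume "u \<le> x" "x \<le> v"
    then have x: "x \<in> ?I" using uv by auto
    have "((\<lambda>x. J x * exp (- jb m n x / L)) has_real_derivative
      (jw m n x * b' x * f x * g x / l + - b' x / L * J x) * exp (- jb m n x / L)) (at x)"
      by (rule DERIV_cong, (rule derivative_intros J' bD x)+) (use L in \<open>simp_all add: algebra_simps\<close>)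
    moreover have "0 \<le> (jw m n x * b' x * f x * g x / l + - b' x / L * J x) * exp (- jb m n x / L)"
      using J'_le[OF x, unfolded abs_le_iff] by (intro mult_nonneg_nonneg) (linarith, simp)
    ultimately show "\<exists>y. ((\<lambda>x. J x * exp (- jb m n x / L)) has_real_derivative y) (at x) \<and> 0 \<le> y" by blast
  qed
  have dec: "J v * exp (jb m n v / L) \<le> J u * exp (jb m n u / L)"
    if uv: "u \<in> ?I" "v \<in> ?I" "u \<le> v" for u v
  proof (rule DERIV_nonpos_imp_nonincreasing[OF \<open>u \<le> v\<close>])
    fix x assume "u \<le> x" "x \<le> v"
    then have x: "x \<in> ?I" using uv by auto
    have "((\<lambda>x. J x * exp (jb m n x / L)) has_real_derivative
      (jw m n x * b' x * f x * g x / l - - b' x / L * J x) * exp (jb m n x / L)) (at x)"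
      by (rule DERIV_cong, (rule derivative_intros J' bD x)+) (use L in \<open>simp_all add: algebra_simps\<close>)
    moreover have "(jw m n x * b' x * f x * g x / l - - b' x / L * J x) * exp (jb m n x / L) \<le> 0"
      using J'_le[OF x, unfolded abs_le_iff] by (intro mult_nonpos_nonneg) (linarith, simp)
    ultimately show "\<exists>y. ((\<lambda>x. J x * exp (jb m n x / L)) has_real_derivative y) (at x) \<and> y \<le> 0" by blast
  qed
  have e1: "\<bar>jb m n x / L\<bar> \<le> 1" if "x \<in> ?I" for x using b[OF that] L by simp
  have J0: "0 \<le> J x" if "x \<in> ?I" for x
    using J_lo[OF that] energy_nonneg[of x] jw_pos[OF I[OF that], of m n]
    by (meson divide_nonneg_pos mult_nonneg_nonneg order.trans less_imp_le zero_less_numeral)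
  have sI: "s \<in> ?I" and tI: "t \<in> ?I" using s t by (auto simp: L_def)
  have key: "J s \<le> exp 2 * J t"
  proof -
    have aux: "x \<le> exp 2 * y" if "x * exp a \<le> y * exp c" "\<bar>a\<bar> \<le> 1" "\<bar>c\<bar> \<le> 1" "0 \<le> y" for x y a c :: real
    proof -
      have "x = x * exp a * exp (- a)" by (simp add: mult.assoc flip: exp_add)
      also have "\<dots> \<le> y * exp c * exp (- a)" using that by (intro mult_right_mono) auto
      also have "\<dots> = y * exp (c - a)" by (simp add: exp_diff exp_minus field_simps)
      also have "\<dots> \<le> y * exp 2" using that by (intro mult_left_mono) auto
      finally show ?thesis by (simp add: mult.commute)
    qed
    show ?thesis
    proof (cases "s \<le> t")
      case True
      from inc[OF sI tI this] show ?thesis by (rule aux) (use e1[OF sI] e1[OF tI] J0[OF tI] in auto)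
    next
      case False
      then have "t \<le> s" by simp
      from dec[OF tI sI this] show ?thesis by (rule aux) (use e1[OF sI] e1[OF tI] J0[OF tI] in auto)
    qed
  qed
  have "jw m n s * energy l f g s \<le> 2 * J s" using J_lo[OF sI] by simp
  also have "\<dots> \<le> 2 * (exp 2 * J t)" using key by simp
  also have "\<dots> \<le> 2 * (exp 2 * (3 / 2 * (jw m n t * energy l f g t)))" using J_hi[OF tI] by simp
  finally show ?thesis by (simp add: mult_ac)
qed

end

text \<open>In the layer of width A / sqrt l the energy is comparable with f(0)^2. It is at most a
  multiple of it by \<open>energy_le_initial\<close>. Conversely, at b = a / sqrt l with small a the
  function is still at least half its initial value, and \<open>w2_energy_exp_increasing\<close>
  carries this to the edge B of the layer at the price of the square of w(B) / w(b), which is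
  bounded since both points are multiples of 1 / sqrt l.\<close>

lemma endpoint_bounds:
  fixes A :: real
  assumes A: "A \<ge> 1"
  shows "\<exists>C>0. \<forall>l f g. jacobi_solution m n l f g \<longrightarrow> A / sqrt l \<le> pi / 2 \<longrightarrow>
     (f 0)\<^sup>2 \<le> C * energy l f g (A / sqrt l) \<and>
     (\<forall>t\<in>{0..A / sqrt l}. energy l f g t \<le> C * (f 0)\<^sup>2 \<and>
        jw m n t * energy l f g t \<le> C * (jw m n (A / sqrt l) * energy l f g (A / sqrt l)))"
proof -
  define K where "K = exp (real n * pi / 2)"
  define K' where "K' = 2 ^ n * exp (real n * pi / 4)"
  \<comment> \<open>Chosen so that K' a^2 = 1, which makes the error in \<open>f_near_zero\<close>
    at a / sqrt l at most half of |f 0|. The constant R below bounds the ratio of the weights at A /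
    sqrt l and a / sqrt l.\<close>
  define a where "a = 1 / sqrt K'"
  define R where "R = (pi * A / (2 * a)) ^ m * 2 ^ n"
  define C1 where "C1 = 4 * R\<^sup>2 * K"
  define C where "C = 2 ^ n * K * C1 + C1 + K"
  have K: "K > 0" by (simp add: K_def)
  have "1 * 1 \<le> K'" unfolding K'_def by (intro mult_mono) auto
  then have a: "0 < a" "a \<le> 1" "K' * a\<^sup>2 = 1" by (auto simp: a_def power_divide)
  have R: "R > 0" using A a by (simp add: R_def)
  have C1: "C1 > 0" using R K by (simp add: C1_def)
  have "C > 0" using K C1 by (simp add: C_def add_pos_pos)
  moreover have "(f 0)\<^sup>2 \<le> C * energy l f g (A / sqrt l) \<and>
     (\<forall>t\<in>{0..A / sqrt l}. energy l f g t \<le> C * (f 0)\<^sup>2 \<and>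
        jw m n t * energy l f g t \<le> C * (jw m n (A / sqrt l) * energy l f g (A / sqrt l)))"
    if sol: "jacobi_solution m n l f g" and le: "A / sqrt l \<le> pi / 2" for l f g
  proof -
    define L where "L = sqrt l"
    have L: "L > 0" "l = L\<^sup>2" using l_pos[OF sol] by (simp_all add: L_def)
    let ?E = "energy l f g"
    define B where "B = A / L"
    define b where "b = a / L"
    have aA: "0 < b" "b \<le> B" "B \<le> pi / 2"
      using a A L(1) le[folded L_def] unfolding b_def B_def by (auto simp: divide_right_mono)
    have lt: "b < pi" "B < pi" using aA pi_gt_zero by linarith+
    have E0: "0 \<le> ?E t" for t by (rule energy_nonneg[OF sol])
    have wa: "(a / (pi * L)) ^ m / 2 ^ n \<le> jw m n (b)"
    proof -
      have "(b / pi) ^ m \<le> sin (b / 2) ^ m"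
        using aA lt a L(1) by (intro power_mono sin_half_ge) auto
      then have "(b / pi) ^ m * (1/2) ^ n \<le> sin (b / 2) ^ m * (1/2) ^ n"
        by (intro mult_right_mono) auto
      also have "\<dots> \<le> jw m n (b)" using aA by (intro jw_ge_sin) linarith+
      finally show ?thesis by (simp add: power_divide mult.commute b_def)
    qed
    have wA: "jw m n (B) \<le> (A / (2 * L)) ^ m"
    proof -
      have "jw m n (B) \<le> sin (B / 2) ^ m" using aA by (intro jw_le_sin) auto
      also have "\<dots> \<le> (B / 2) ^ m" using aA lt
        by (intro power_mono sin_half_le sin_ge_zero) auto
      finally show ?thesis by (simp add: mult.commute B_def)
    qed
    have wAR: "jw m n (B) \<le> R * jw m n (b)"
    proof -
      have "R * ((a / (pi * L)) ^ m / 2 ^ n) = ((pi * A / (2 * a)) * (a / (pi * L))) ^ m"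
        unfolding R_def power_mult_distrib by simp
      also have "(pi * A / (2 * a)) * (a / (pi * L)) = A / (2 * L)" using a by simp
      finally have "(A / (2 * L)) ^ m = R * ((a / (pi * L)) ^ m / 2 ^ n)" by simp
      also have "\<dots> \<le> R * jw m n (b)" using R wa by (intro mult_left_mono) auto
      finally show ?thesis using wA by linarith
    qed
    have fa: "(f 0)\<^sup>2 / 4 \<le> ?E (b)"
    proof -
      have "\<bar>f (b) - f 0\<bar> \<le> l * (2 ^ n * (exp (real n * pi / 4) * \<bar>f 0\<bar>)) * (b)\<^sup>2 / 2"
        using aA by (intro f_near_zero[OF sol]) linarith+
      also have "\<dots> = (K' * a\<^sup>2) * \<bar>f 0\<bar> / 2" using L by (simp add: K'_def b_def power_divide)
      finally have "\<bar>f 0\<bar> / 2 \<le> \<bar>f (b)\<bar>" unfolding a(3) by linarith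
      then have "(\<bar>f 0\<bar> / 2)\<^sup>2 \<le> \<bar>f (b)\<bar>\<^sup>2" by (rule power_mono) simp
      also have "\<dots> \<le> ?E (b)" using f_sq_le_energy[OF sol] by simp
      finally show ?thesis by (simp add: power_divide)
    qed
    have EaA: "?E (b) \<le> R\<^sup>2 * K * ?E (B)"
    proof -
      have wpos: "0 < jw m n (b)" using aA lt by (intro jw_pos) auto
      have "(jw m n (b))\<^sup>2 * ?E (b) * 1 \<le> (jw m n (b))\<^sup>2 * ?E (b) * exp (real n * (b))"
        using E0 aA by (intro mult_left_mono) auto
      also have "\<dots> \<le> (jw m n (B))\<^sup>2 * ?E (B) * exp (real n * (B))"
        using aA by (intro w2_energy_exp_increasing[OF sol]) linarith+
      also have "\<dots> \<le> (jw m n (B))\<^sup>2 * ?E (B) * K"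
        unfolding K_def using E0 aA mult_left_mono[of "B" "pi / 2" "real n"] by (intro mult_left_mono) auto
      also have "\<dots> \<le> (R * jw m n (b))\<^sup>2 * ?E (B) * K"
        using wAR K E0 jw_nonneg[of "B" m n] aA lt by (intro mult_right_mono power_mono) (auto simp: less_imp_le)
      finally have "(jw m n (b))\<^sup>2 * ?E (b) \<le> (jw m n (b))\<^sup>2 * (R\<^sup>2 * K * ?E (B))"
        by (simp add: power_mult_distrib mult_ac)
      then show ?thesis using wpos by simp
    qed
    have f0: "(f 0)\<^sup>2 \<le> C1 * ?E (B)" using fa EaA by (simp add: C1_def)
    have t_le: "0 \<le> t" "t \<le> B" "t \<le> pi / 2" "t \<le> pi" if "t \<in> {0..B}" for t
      using that aA(3) lt(2) unfolding atLeastAtMost_iff by linarith+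
    have EC: "?E t \<le> K * (f 0)\<^sup>2" if "t \<in> {0..B}" for t
      unfolding K_def using t_le[OF that] by (intro energy_le_initial[OF sol])
    have wC: "jw m n t \<le> 2 ^ n * jw m n (B)" if t: "t \<in> {0..B}" for t
    proof -
      have "jw m n t \<le> sin (t / 2) ^ m" using t_le[OF t] by (intro jw_le_sin)
      also have "\<dots> \<le> sin (B / 2) ^ m"
        using t_le[OF t] aA(3) lt by (intro power_mono sin_monotone_2pi_le sin_ge_zero) linarith+
      also have "\<dots> \<le> 2 ^ n * jw m n (B)"
        using jw_ge_sin[of "B" m n] aA by (auto simp: field_simps)
      finally show ?thesis .
    qed
    have C_ge: "C1 \<le> C" "K \<le> C" "2 ^ n * K * C1 \<le> C" using K C1 by (auto simp: C_def)
    have "(f 0)\<^sup>2 \<le> C * ?E (B)"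
      using f0 mult_right_mono[OF C_ge(1) E0] by (rule order.trans)
    moreover have "?E t \<le> C * (f 0)\<^sup>2" if "t \<in> {0..B}" for t
      using EC[OF that] mult_right_mono[OF C_ge(2) zero_le_power2] by (rule order.trans)
    moreover have "jw m n t * ?E t \<le> C * (jw m n (B) * ?E (B))" if t: "t \<in> {0..B}" for t
    proof -
      have "?E t \<le> K * (C1 * ?E (B))"
        using EC[OF t] mult_left_mono[OF f0, of K] K by linarith
      then have "jw m n t * ?E t \<le> (2 ^ n * jw m n (B)) * (K * (C1 * ?E (B)))"
        using wC[OF t] E0 t_le[OF t] lt aA jw_nonneg[of "B" m n] by (intro mult_mono) auto
      also have "\<dots> = 2 ^ n * K * C1 * (jw m n (B) * ?E (B))" by simp
      also have "\<dots> \<le> C * (jw m n (B) * ?E (B))"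
        using E0 jw_nonneg[of "B" m n] aA lt by (intro mult_right_mono C_ge mult_nonneg_nonneg) auto
      finally show ?thesis .
    qed
    ultimately show ?thesis by (simp add: L_def B_def)
  qed
  ultimately show ?thesis by blast
qed

text \<open>Makes \<open>endpoint_bounds\<close> available at pi, with the two exponents
  exchanged.\<close>

lemma jacobi_solution_flip:
  assumes "jacobi_solution m n l f g"
  shows "jacobi_solution n m l (\<lambda>t. f (pi - t)) (\<lambda>t. - g (pi - t))"
  unfolding jacobi_solution_def
proof (intro conjI allI impI)
  show "l > 0" by (rule l_pos[OF assms])
  show "- g (pi - 0) = 0" "- g (pi - pi) = 0" using g_0[OF assms] g_pi[OF assms] by auto
  show "continuous_on UNIV (\<lambda>t. - g (pi - t))"
    by (intro continuous_intros continuous_on_compose2[OF g_cont[OF assms]]) auto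
  show "((\<lambda>t. f (pi - t)) has_real_derivative - g (pi - t)) (at t)" for t
  proof -
    have "((\<lambda>t. f (pi - t)) has_real_derivative g (pi - t) * (0 - 1)) (at t)"
      by (intro DERIV_chain2[OF f_deriv[OF assms]] derivative_intros)
    then show ?thesis by simp
  qed
  show "((\<lambda>t. - g (pi - t)) has_real_derivative - jb n m t * - g (pi - t) - l * f (pi - t)) (at t)"
    if "0 < t" "t < pi" for t
  proof -
    have "((\<lambda>t. - g (pi - t)) has_real_derivative
        - ((- jb m n (pi - t) * g (pi - t) - l * f (pi - t)) * (0 - 1))) (at t)"
      using that by (intro derivative_intros DERIV_chain2[OF g_deriv[OF assms]]) auto
    then show ?thesis by (simp add: jb_flip)
  qed
qed

lemma energy_flip: "energy l (\<lambda>t. f (pi - t)) (\<lambda>t. - g (pi - t)) t = energy l f g (pi - t)"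
  by (simp add: energy_def)

text \<open>
  Away from the endpoints the weighted energy is constant up to a factor; its size is the one
  forced by the normalization at the endpoint \<open>0\<close>.
\<close>

theorem jacobi_energy_bounds:
  fixes m n :: nat
  shows "\<exists>C>0. \<exists>A>0. \<exists>l0>0. \<forall>l f g. jacobi_solution m n l f g \<longrightarrow> f 0 = 1 \<longrightarrow> l \<ge> l0 \<longrightarrow>
    (\<forall>t\<in>{0..pi}. jw m n t * energy l f g t \<le> C / sqrt l ^ m) \<and>
    (\<forall>t\<in>{A / sqrt l..pi - A / sqrt l}. 1 / (C * sqrt l ^ m) \<le> jw m n t * energy l f g t)"
proof -
  define A where "A = real m + real n + 1"
  have A: "A \<ge> 1" "real m \<le> A" "real n \<le> A" by (auto simp: A_def)
  obtain C1 where C1: "C1 > 0" and end1: "\<And>l f g. jacobi_solution m n l f g \<Longrightarrow> A / sqrt l \<le> pi / 2 \<Longrightarrow>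
     (f 0)\<^sup>2 \<le> C1 * energy l f g (A / sqrt l) \<and>
     (\<forall>t\<in>{0..A / sqrt l}. energy l f g t \<le> C1 * (f 0)\<^sup>2 \<and>
        jw m n t * energy l f g t \<le> C1 * (jw m n (A / sqrt l) * energy l f g (A / sqrt l)))"
    using endpoint_bounds[OF A(1), of m n] by blast
  obtain C2 where C2: "C2 > 0" and end2: "\<And>l f g. jacobi_solution n m l f g \<Longrightarrow> A / sqrt l \<le> pi / 2 \<Longrightarrow>
     (f 0)\<^sup>2 \<le> C2 * energy l f g (A / sqrt l) \<and>
     (\<forall>t\<in>{0..A / sqrt l}. energy l f g t \<le> C2 * (f 0)\<^sup>2 \<and>
        jw n m t * energy l f g t \<le> C2 * (jw n m (A / sqrt l) * energy l f g (A / sqrt l)))"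
    using endpoint_bounds[OF A(1), of n m] by blast
  define D where "D = 3 * exp (2::real)"
  have D: "D \<ge> 1" unfolding D_def using exp_ge_add_one_self[of 2] by linarith
  define U where "U = C1 * A ^ m"
  have U: "U > 0" using C1 A by (simp add: U_def)
  define V where "V = 1 / (C1 * pi ^ m * 2 ^ n)"
  have V: "V > 0" using C1 by (simp add: V_def)
  define C where "C = C1 * U + (C2 * D) * U + D * U + D / V"
  \<comment> \<open>From this value on A / sqrt l is at most pi / 2, so that the two boundary layers
    do not overlap.\<close>
  define l0 where "l0 = (2 * A / pi)\<^sup>2"
  have "C > 0" unfolding C_def using C1 C2 D U V by (intro add_pos_pos mult_pos_pos divide_pos_pos) auto
  moreover have "l0 > 0" using A by (simp add: l0_def)
  moreover have "(\<forall>t\<in>{0..pi}. jw m n t * energy l f g t \<le> C / sqrt l ^ m) \<and>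
    (\<forall>t\<in>{A / sqrt l..pi - A / sqrt l}. 1 / (C * sqrt l ^ m) \<le> jw m n t * energy l f g t)"
    if sol: "jacobi_solution m n l f g" and f0: "f 0 = 1" and l: "l \<ge> l0" for l f g
  proof -
    define L where "L = sqrt l"
    have L: "L > 0" using l_pos[OF sol] by (simp add: L_def)
    have "2 * A / pi \<le> L" unfolding L_def using l A by (intro real_le_rsqrt) (simp add: l0_def)
    then have AL: "A / L \<le> pi / 2" "0 < A / L" using L A by (auto simp: field_simps)
    let ?F = "\<lambda>t. jw m n t * energy l f g t"
    have mid: "?F s \<le> D * ?F t" if "A / L \<le> s" "s \<le> pi - A / L" "A / L \<le> t" "t \<le> pi - A / L" for s t
      unfolding D_def using that A by (intro energy_middle[OF sol, of A]) (auto simp: L_def)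
    note e1 = end1[OF sol, folded L_def, OF AL(1), unfolded f0]
    note sol' = jacobi_solution_flip[OF sol]
    note e2 = end2[OF sol', folded L_def, OF AL(1), unfolded energy_flip]
    have E0: "0 \<le> energy l f g t" for t by (rule energy_nonneg[OF sol])
    have ltpi: "A / L < pi" using AL pi_gt_zero by linarith
    have w1: "jw m n (A / L) \<le> A ^ m / L ^ m"
    proof -
      have "jw m n (A / L) \<le> sin (A / L / 2) ^ m" using AL by (intro jw_le_sin) auto
      also have "\<dots> \<le> (A / L) ^ m"
        using AL ltpi sin_half_le[of "A / L"] by (intro power_mono sin_ge_zero) auto
      finally show ?thesis by (simp add: power_divide)
    qed
    have w2: "1 / (pi ^ m * 2 ^ n) / L ^ m \<le> jw m n (A / L)"
    proof -
      have "1 / (pi ^ m * 2 ^ n) / L ^ m = (1 / L / pi) ^ m * (1/2) ^ n" by (simp add: power_divide power_mult_distrib)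
      also have "\<dots> \<le> (A / L / pi) ^ m * (1/2) ^ n"
        using A L by (intro mult_right_mono power_mono divide_right_mono) auto
      also have "\<dots> \<le> sin (A / L / 2) ^ m * (1/2) ^ n"
        using AL ltpi L A by (intro mult_right_mono power_mono sin_half_ge) auto
      also have "\<dots> \<le> jw m n (A / L)" using AL by (intro jw_ge_sin) auto
      finally show ?thesis .
    qed
    have FA_up: "?F (A / L) \<le> U / L ^ m"
    proof -
      have "energy l f g (A / L) \<le> C1" using e1 AL by auto
      then have "?F (A / L) \<le> (A ^ m / L ^ m) * C1"
        using w1 E0 A L by (intro mult_mono) auto
      then show ?thesis by (simp add: U_def mult.commute)
    qed
    have FA_lo: "V / L ^ m \<le> ?F (A / L)"
    proof -
      have "1 / C1 \<le> energy l f g (A / L)" using e1 C1 by (auto simp: field_simps)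
      then have "(1 / (pi ^ m * 2 ^ n) / L ^ m) * (1 / C1) \<le> ?F (A / L)"
        using w2 C1 L AL ltpi by (intro mult_mono jw_nonneg) auto
      then show ?thesis by (simp add: V_def mult_ac)
    qed
    have up: "?F t \<le> C / L ^ m" if t: "t \<in> {0..pi}" for t
    proof -
      have CU: "C1 * U \<le> C" "C2 * D * U \<le> C" "D * U \<le> C"
        using C1 C2 D U V by (auto simp: C_def)
      consider "t \<le> A / L" | "A / L \<le> t" "t \<le> pi - A / L" | "pi - A / L \<le> t" by linarith
      then show ?thesis
      proof cases
        case 1
        then have "?F t \<le> C1 * ?F (A / L)" using e1 t by auto
        also have "\<dots> \<le> C1 * (U / L ^ m)" using C1 by (intro mult_left_mono FA_up) auto
        also have "\<dots> \<le> C / L ^ m" using CU L by (simp add: divide_right_mono)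
        finally show ?thesis .
      next
        case 2
        then have "?F t \<le> D * ?F (A / L)" using AL by (intro mid) auto
        also have "\<dots> \<le> D * (U / L ^ m)" using D by (intro mult_left_mono FA_up) auto
        also have "\<dots> \<le> C / L ^ m" using CU L by (simp add: divide_right_mono)
        finally show ?thesis .
      next
        \<comment> \<open>No value of f at pi is known. The reflected estimate only compares w E
          with its value at the edge of the right layer; \<open>energy_middle\<close> leads from
          there to the left edge, where f 0 = 1 is used.\<close>
        case 3
        then have "pi - t \<in> {0..A / L}" using t by auto
        then have "jw n m (pi - t) * energy l f g (pi - (pi - t)) \<le> C2 * (jw n m (A / L) * energy l f g (pi - A / L))"
          using e2 by blast
        then have "?F t \<le> C2 * ?F (pi - A / L)" by (simp add: jw_flip)
        also have "\<dots> \<le> C2 * (D * ?F (A / L))" using C2 AL by (intro mult_left_mono mid) linarith+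
        also have "\<dots> \<le> C2 * (D * (U / L ^ m))" using C2 D by (intro mult_left_mono FA_up) auto
        also have "\<dots> \<le> C / L ^ m" using CU L by (simp add: divide_right_mono)
        finally show ?thesis .
      qed
    qed
    have lo: "1 / (C * L ^ m) \<le> ?F t" if t: "t \<in> {A / L..pi - A / L}" for t
    proof -
      have "V / L ^ m \<le> D * ?F t" using FA_lo mid[of "A / L" t] t AL by auto
      then have "V / L ^ m / D \<le> ?F t" using D by (subst pos_divide_le_eq) (simp_all add: mult.commute)
      then have "V / D / L ^ m \<le> ?F t" by (simp add: mult.commute)
      moreover have "1 / C \<le> V / D"
      proof -
        have "D / V \<le> C" unfolding C_def using C1 C2 D U V by auto
        then show ?thesis using \<open>C > 0\<close> V D by (simp add: field_simps)
      qed
      then have "1 / C / L ^ m \<le> V / D / L ^ m" using L by (intro divide_right_mono) auto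
      ultimately show ?thesis by simp
    qed
    show ?thesis using up lo by (auto simp: L_def)
  qed
  moreover have "A > 0" using A by simp
  ultimately show ?thesis by (intro exI[of _ C] exI[of _ A] exI[of _ l0] conjI) blast+
qed

section \<open>Octonions\<close>

lemmas oct_defs = oct_mult_def oct_cnj_def oct_one_def quat_mult_def quat_cnj_def

definition oct_re :: "octonion \<Rightarrow> real" where
  "oct_re x = Re (fst (fst x))"

lemma oct_eqI:
  fixes x y :: octonion
  assumes "fst (fst x) = fst (fst y)" "snd (fst x) = snd (fst y)"
    "fst (snd x) = fst (snd y)" "snd (snd x) = snd (snd y)"
  shows "x = y"
  using assms by (simp add: prod_eq_iff)

lemma oct_norm_square:
  fixes x :: octonion
  shows "(norm x)\<^sup>2 = (Re (fst (fst x)))\<^sup>2 + (Im (fst (fst x)))\<^sup>2 + (Re (snd (fst x)))\<^sup>2 + (Im (snd (fst x)))\<^sup>2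
    + (Re (fst (snd x)))\<^sup>2 + (Im (fst (snd x)))\<^sup>2 + (Re (snd (snd x)))\<^sup>2 + (Im (snd (snd x)))\<^sup>2"
  by (simp add: norm_prod_def cmod_power2)

text \<open>A polynomial identity in the real coordinates. It replaces associativity in
  \<open>oct_phase\<close>, where the entries of a matrix are multiplied by \<open>u\<close> on the
  left, on the right, or on both sides.\<close>

lemma oct_moufang: "oct_mult (oct_mult u a) (oct_mult b u) = oct_mult (oct_mult u (oct_mult a b)) u"
  by (rule oct_eqI; simp add: oct_defs complex_eq_iff; (intro conjI)?; algebra)

lemma oct_flexible: "oct_mult (oct_mult u a) u = oct_mult u (oct_mult a u)"
  by (rule oct_eqI; simp add: oct_defs complex_eq_iff; intro conjI; algebra)

lemma norm_oct_mult: "norm (oct_mult x y) = norm x * norm y"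
proof -
  have "(norm (oct_mult x y))\<^sup>2 = (norm x * norm y)\<^sup>2"
    unfolding power_mult_distrib oct_norm_square by (simp add: oct_defs) algebra
  then show ?thesis by (simp add: power2_eq_iff_nonneg)
qed

lemma norm_oct_cnj [simp]: "norm (oct_cnj x) = norm x"
proof -
  have "(norm (oct_cnj x))\<^sup>2 = (norm x)\<^sup>2"
    unfolding oct_norm_square by (simp add: oct_defs)
  then show ?thesis by (simp add: power2_eq_iff_nonneg)
qed

lemma bounded_bilinear_oct_mult: "bounded_bilinear oct_mult"
proof
  show "oct_mult (a + a') b = oct_mult a b + oct_mult a' b"
    and "oct_mult a (b + b') = oct_mult a b + oct_mult a b'"
    and "oct_mult (r *\<^sub>R a) b = r *\<^sub>R oct_mult a b"
    and "oct_mult a (r *\<^sub>R b) = r *\<^sub>R oct_mult a b" for a a' b b' r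
    by (rule oct_eqI; simp add: oct_defs complex_eq_iff; (intro conjI)?; algebra)+
  show "\<exists>K. \<forall>a b. norm (oct_mult a b) \<le> norm a * norm b * K"
    by (rule exI[of _ 1]) (simp add: norm_oct_mult)
qed

interpretation oct_mult: bounded_bilinear oct_mult
  by (rule bounded_bilinear_oct_mult)

lemma bounded_linear_oct_cnj: "bounded_linear oct_cnj"
proof
  show "oct_cnj (a + b) = oct_cnj a + oct_cnj b" and "oct_cnj (r *\<^sub>R a) = r *\<^sub>R oct_cnj a" for a b r
    by (rule oct_eqI; simp add: oct_defs)+
  show "\<exists>K. \<forall>a. norm (oct_cnj a) \<le> norm a * K"
    by (rule exI[of _ 1]) simp
qed

lemmas oct_cnj_scaleR = linear_scale[OF bounded_linear.linear[OF bounded_linear_oct_cnj]]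
  and oct_cnj_sum = linear_sum[OF bounded_linear.linear[OF bounded_linear_oct_cnj]]
  and oct_cnj_0 = linear_0[OF bounded_linear.linear[OF bounded_linear_oct_cnj]]

lemma oct_cnj_cnj [simp]: "oct_cnj (oct_cnj x) = x"
  by (rule oct_eqI) (simp_all add: oct_defs)

lemma oct_cnj_one [simp]: "oct_cnj oct_one = oct_one"
  by (rule oct_eqI) (simp_all add: oct_defs)

lemma oct_cnj_mult: "oct_cnj (oct_mult x y) = oct_mult (oct_cnj y) (oct_cnj x)"
  by (rule oct_eqI; simp add: oct_defs complex_eq_iff; (intro conjI)?; algebra)

lemma oct_mult_one [simp]: "oct_mult oct_one x = x" "oct_mult x oct_one = x"
  by (rule oct_eqI; simp add: oct_defs)+

lemma norm_oct_one [simp]: "norm oct_one = 1"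
  by (simp add: oct_one_def norm_prod_def)

lemma oct_mult_cnj_self: "oct_mult x (oct_cnj x) = (norm x)\<^sup>2 *\<^sub>R oct_one"
  unfolding oct_norm_square
  by (rule oct_eqI; simp add: oct_defs complex_eq_iff scaleR_conv_of_real; (intro conjI)?; algebra)

lemma oct_cnj_mult_self: "oct_mult (oct_cnj x) x = (norm x)\<^sup>2 *\<^sub>R oct_one"
  using oct_mult_cnj_self[of "oct_cnj x"] by simp

lemma oct_cnj_mult_left: "oct_mult (oct_cnj x) (oct_mult x y) = (norm x)\<^sup>2 *\<^sub>R y"
  unfolding oct_norm_square
  by (rule oct_eqI; simp add: oct_defs complex_eq_iff scaleR_conv_of_real; (intro conjI)?; algebra)

lemma oct_cnj_mult_right: "oct_mult (oct_mult y x) (oct_cnj x) = (norm x)\<^sup>2 *\<^sub>R y"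
proof -
  have "oct_cnj (oct_mult (oct_mult y x) (oct_cnj x)) = oct_cnj ((norm x)\<^sup>2 *\<^sub>R y)"
    using oct_cnj_mult_left[of "oct_cnj x" "oct_cnj y"] by (simp add: oct_cnj_mult oct_cnj_scaleR)
  then show ?thesis by (metis oct_cnj_cnj)
qed

lemma oct_re_one [simp]: "oct_re oct_one = 1"
  by (simp add: oct_re_def oct_one_def)

lemma bounded_linear_oct_re: "bounded_linear oct_re"
  unfolding oct_re_def
  by (intro bounded_linear_compose[OF bounded_linear_Re] bounded_linear_compose[OF bounded_linear_fst] bounded_linear_fst)

lemmas oct_re_add = linear_add[OF bounded_linear.linear[OF bounded_linear_oct_re]]
  and oct_re_scaleR = linear_scale[OF bounded_linear.linear[OF bounded_linear_oct_re]]
  and oct_re_sum = linear_sum[OF bounded_linear.linear[OF bounded_linear_oct_re]]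
  and oct_re_0 = linear_0[OF bounded_linear.linear[OF bounded_linear_oct_re]]

lemma oct_self_cnj: "oct_cnj x = x \<Longrightarrow> x = oct_re x *\<^sub>R oct_one"
  by (rule oct_eqI) (auto simp: oct_defs oct_re_def complex_eq_iff prod_eq_iff)

lemma oct_re_cnj [simp]: "oct_re (oct_cnj x) = oct_re x"
  by (simp add: oct_re_def oct_cnj_def quat_cnj_def)

lemma oct_re_eq_inner: "oct_re x = inner x oct_one"
  by (simp add: oct_re_def oct_one_def inner_complex_def inner_prod_def)

text \<open>Polarization. It turns the multiplicativity of the octonion norm into the invariance of
  the inner product under multiplication by a unit.\<close>

lemma inner_eq_of_norm_eq:
  fixes f :: "'a::real_inner \<Rightarrow> 'b::real_inner"
  assumes "\<And>x y. f (x + y) = f x + f y" "\<And>x. norm (f x) = k * norm x"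
  shows "inner (f x) (f y) = k\<^sup>2 * inner x y"
proof -
  have sq: "(norm (f z))\<^sup>2 = k\<^sup>2 * (norm z)\<^sup>2" for z
    by (simp add: assms(2) power_mult_distrib)
  show ?thesis
    unfolding dot_norm[of "f x"] dot_norm[of x] assms(1)[symmetric] sq by (simp add: right_diff_distrib)
qed

lemma inner_oct_mult_left: "inner (oct_mult u x) (oct_mult u y) = (norm u)\<^sup>2 * inner x y"
  by (rule inner_eq_of_norm_eq) (simp_all add: oct_mult.add_right norm_oct_mult)

lemma inner_oct_mult_right: "inner (oct_mult x u) (oct_mult y u) = (norm u)\<^sup>2 * inner x y"
  by (rule inner_eq_of_norm_eq) (simp_all add: oct_mult.add_left norm_oct_mult)

context
  fixes d0 :: nat assumes d0: "d0 \<in> {1, 2, 4, 8}"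
begin

lemma hypercomplex_eq:
  "hypercomplex d0 = {x. (d0 < 8 \<longrightarrow> snd x = 0) \<and> (d0 < 4 \<longrightarrow> snd (fst x) = 0) \<and> (d0 < 2 \<longrightarrow> Im (fst (fst x)) = 0)}"
  using d0
  by (auto simp: hypercomplex_def prod_eq_iff complex_eq_iff zero_prod_def)

lemma hypercomplex_mult: "x \<in> hypercomplex d0 \<Longrightarrow> y \<in> hypercomplex d0 \<Longrightarrow> oct_mult x y \<in> hypercomplex d0"
  using d0 by (auto simp: hypercomplex_eq oct_defs zero_prod_def)

lemma hypercomplex_cnj: "x \<in> hypercomplex d0 \<Longrightarrow> oct_cnj x \<in> hypercomplex d0"
  using d0 by (auto simp: hypercomplex_eq oct_defs zero_prod_def)

lemma hypercomplex_add: "x \<in> hypercomplex d0 \<Longrightarrow> y \<in> hypercomplex d0 \<Longrightarrow> x + y \<in> hypercomplex d0"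
  using d0 by (auto simp: hypercomplex_eq zero_prod_def)

lemma hypercomplex_0: "0 \<in> hypercomplex d0"
  using d0 by (auto simp: hypercomplex_eq zero_prod_def)

lemma hypercomplex_one: "oct_one \<in> hypercomplex d0"
  using d0 by (auto simp: hypercomplex_eq oct_one_def zero_prod_def)

lemma hypercomplex_scaleR: "x \<in> hypercomplex d0 \<Longrightarrow> r *\<^sub>R x \<in> hypercomplex d0"
  using d0 by (auto simp: hypercomplex_eq zero_prod_def)

lemma hypercomplex_sum: "(\<And>i. i \<in> I \<Longrightarrow> f i \<in> hypercomplex d0) \<Longrightarrow> sum f I \<in> hypercomplex d0"
  by (induction I rule: infinite_finite_induct) (auto intro: hypercomplex_add hypercomplex_0)

lemma hypercomplex_snd: "x \<in> hypercomplex d0 \<Longrightarrow> d0 \<noteq> 8 \<Longrightarrow> snd x = 0"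
  using d0 by (auto simp: hypercomplex_def zero_prod_def)

lemma quat_mult_assoc: "quat_mult (quat_mult x y) z = quat_mult x (quat_mult y z)"
  unfolding quat_mult_def prod_eq_iff fst_conv snd_conv complex_eq_iff
  by (intro conjI; simp; algebra)

lemma hypercomplex_assoc:
  assumes "d0 \<noteq> 8" "x \<in> hypercomplex d0" "y \<in> hypercomplex d0" "z \<in> hypercomplex d0"
  shows "oct_mult (oct_mult x y) z = oct_mult x (oct_mult y z)"
proof -
  note [simp] = assms(2-4)[THEN hypercomplex_snd, OF assms(1)]
  have "quat_mult a 0 = 0" "quat_mult 0 a = 0" "quat_cnj 0 = 0" for a
    by (simp_all add: quat_mult_def quat_cnj_def zero_prod_def)
  then show ?thesis
    by (simp add: oct_mult_def quat_mult_assoc)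
qed

end

text \<open>Left multiplication by these units moves every coordinate into the real part.\<close>

definition hypercomplex_units :: "nat \<Rightarrow> octonion set" where
  "hypercomplex_units d0 = set (take d0 [((1, 0), (0, 0)), ((\<i>, 0), (0, 0)), ((0, 1), (0, 0)), ((0, \<i>), (0, 0)),
     ((0, 0), (1, 0)), ((0, 0), (\<i>, 0)), ((0, 0), (0, 1)), ((0, 0), (0, \<i>))])"

lemma hypercomplex_units:
  assumes d0: "d0 \<in> {1, 2, 4, 8}"
  shows "card (hypercomplex_units d0) = d0" (is ?A)
    and "hypercomplex_units d0 \<subseteq> hypercomplex d0" (is ?B)
    and "u \<in> hypercomplex_units d0 \<Longrightarrow> norm u = 1" (is "_ \<Longrightarrow> ?C")
    and "x \<in> hypercomplex d0 \<Longrightarrow> (\<Sum>u\<in>hypercomplex_units d0. (oct_re (oct_mult u x))\<^sup>2) = (norm x)\<^sup>2" (is "_ \<Longrightarrow> ?D")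
proof -
  show ?A using d0 by (auto simp: hypercomplex_units_def numeral_eq_Suc complex_eq_iff)
  show ?B using d0 by (auto simp: hypercomplex_units_def numeral_eq_Suc hypercomplex_eq zero_prod_def)
  show ?C if "u \<in> hypercomplex_units d0"
    using d0 that by (auto simp: hypercomplex_units_def numeral_eq_Suc norm_prod_def)
  show ?D if "x \<in> hypercomplex d0"
    using d0 that unfolding oct_norm_square
    by (auto simp: hypercomplex_units_def numeral_eq_Suc hypercomplex_eq zero_prod_def oct_re_def oct_defs complex_eq_iff)
qed

definition mat_inner :: "nat \<Rightarrow> oct_matrix \<Rightarrow> oct_matrix \<Rightarrow> real" where
  "mat_inner n A B = (\<Sum>i\<le>n. \<Sum>j\<le>n. inner (A i j) (B i j))"

definition diag_re :: "oct_matrix \<Rightarrow> nat \<Rightarrow> real" where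
  "diag_re A i = oct_re (A i i)"

lemma mat_inner_self: "mat_inner n A A = (matrix_norm n A)\<^sup>2"
proof -
  have "0 \<le> (\<Sum>i\<le>n. \<Sum>j\<le>n. (norm (A i j))\<^sup>2)" by (intro sum_nonneg) auto
  then show ?thesis by (simp add: mat_inner_def matrix_norm_def power2_norm_eq_inner)
qed

lemma matrix_norm_diff:
  "(matrix_norm n (\<lambda>i j. A i j - B i j))\<^sup>2 = mat_inner n A A - 2 * mat_inner n A B + mat_inner n B B"
  unfolding mat_inner_self[symmetric]
  by (simp add: mat_inner_def inner_diff inner_commute sum_subtractf sum.distrib sum_distrib_left algebra_simps)

section \<open>Projective spaces\<close>

locale projective =
  fixes n d0 :: nat
  assumes n2: "2 \<le> n" and d0: "d0 \<in> {1, 2, 4, 8}" and oct_plane: "d0 = 8 \<longrightarrow> n = 2"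
begin

abbreviation "PM \<equiv> projective_matrices n d0"
abbreviation "K \<equiv> hypercomplex d0"

lemma PM_iff: "A \<in> PM \<longleftrightarrow> (\<forall>i j. A i j \<in> K) \<and> (\<forall>i j. A j i = oct_cnj (A i j)) \<and>
     (\<forall>i j. n < i \<or> n < j \<longrightarrow> A i j = 0) \<and>
     (\<forall>i\<le>n. \<forall>j\<le>n. (\<Sum>k\<le>n. oct_mult (A i k) (A k j)) = A i j) \<and> (\<Sum>i\<le>n. A i i) = oct_one"
  unfolding projective_matrices_def hermitian_matrices_def mem_Collect_eq by blast

lemma
  assumes "A \<in> PM"
  shows PM_entry: "A i j \<in> K"
    and PM_herm: "oct_cnj (A i j) = A j i"
    and PM_outside: "n < i \<or> n < j \<Longrightarrow> A i j = 0"
    and PM_idem: "i \<le> n \<Longrightarrow> j \<le> n \<Longrightarrow> (\<Sum>k\<le>n. oct_mult (A i k) (A k j)) = A i j"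
    and PM_trace: "(\<Sum>i\<le>n. A i i) = oct_one"
  using assms[unfolded PM_iff] by (blast, metis, blast, blast, blast)

lemma PM_diag: "A \<in> PM \<Longrightarrow> A i i = diag_re A i *\<^sub>R oct_one"
  unfolding diag_re_def by (intro oct_self_cnj PM_herm)

lemma PM_diag_sum: "A \<in> PM \<Longrightarrow> (\<Sum>i\<le>n. diag_re A i) = 1"
  using arg_cong[OF PM_trace, of A oct_re] by (simp add: diag_re_def oct_re_sum)

lemma PM_norm_sym: "A \<in> PM \<Longrightarrow> norm (A i j) = norm (A j i)"
  using PM_herm[of A i j] norm_oct_cnj[of "A i j"] by simp

lemma PM_mult_sym: "A \<in> PM \<Longrightarrow> oct_mult (A i j) (A j i) = (norm (A i j))\<^sup>2 *\<^sub>R oct_one"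
  using oct_mult_cnj_self[of "A i j"] by (simp add: PM_herm)

lemma PM_diag_row:
  assumes "A \<in> PM" "i \<le> n"
  shows "diag_re A i = (\<Sum>k\<le>n. (norm (A i k))\<^sup>2)"
proof -
  have "A i i = (\<Sum>k\<le>n. (norm (A i k))\<^sup>2 *\<^sub>R oct_one)"
    using PM_idem[OF assms(1,2,2)] by (simp add: PM_mult_sym[OF assms(1)])
  then show ?thesis by (simp add: diag_re_def oct_re_sum oct_re_scaleR)
qed

lemma PM_diag_nonneg: "A \<in> PM \<Longrightarrow> 0 \<le> diag_re A i"
  by (cases "i \<le> n") (simp add: PM_diag_row sum_nonneg, simp add: diag_re_def PM_outside oct_re_0)

text \<open>
  Equality in the Cauchy--Schwarz estimate of the entries of \<open>A\<^sup>2\<close> is forced by the trace, and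
  yields the rank one relations even without associativity.
\<close>

lemma PM_norm_entry:
  assumes A: "A \<in> PM" and ij: "i \<le> n" "j \<le> n"
  shows "(norm (A i j))\<^sup>2 = diag_re A i * diag_re A j"
proof -
  let ?r = "diag_re A"
  have le: "(norm (A i j))\<^sup>2 \<le> ?r i * ?r j" if "i \<le> n" "j \<le> n" for i j
  proof -
    have "norm (A i j) \<le> (\<Sum>k\<le>n. norm (oct_mult (A i k) (A k j)))"
      using PM_idem[OF A that] norm_sum[of "\<lambda>k. oct_mult (A i k) (A k j)" "{..n}"] by simp
    also have "\<dots> = (\<Sum>k\<le>n. norm (A i k) * norm (A j k))"
      by (simp add: norm_oct_mult PM_norm_sym[OF A, of _ j])
    finally have "(norm (A i j))\<^sup>2 \<le> (\<Sum>k\<le>n. norm (A i k) * norm (A j k))\<^sup>2"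
      by (intro power_mono) auto
    also have "\<dots> \<le> (\<Sum>k\<le>n. (norm (A i k))\<^sup>2) * (\<Sum>k\<le>n. (norm (A j k))\<^sup>2)"
      by (rule Cauchy_Schwarz_ineq_sum)
    finally show ?thesis using that by (simp add: PM_diag_row[OF A])
  qed
  have tot: "(\<Sum>(i,j)\<in>{..n}\<times>{..n}. (norm (A i j))\<^sup>2) = (\<Sum>(i,j)\<in>{..n}\<times>{..n}. ?r i * ?r j)"
  proof -
    have "(\<Sum>(i,j)\<in>{..n}\<times>{..n}. (norm (A i j))\<^sup>2) = (\<Sum>i\<le>n. ?r i)"
      by (simp add: sum.cartesian_product[symmetric] PM_diag_row[OF A])
    also have "\<dots> = (\<Sum>i\<le>n. ?r i) * (\<Sum>j\<le>n. ?r j)" by (simp add: PM_diag_sum[OF A])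
    also have "\<dots> = (\<Sum>(i,j)\<in>{..n}\<times>{..n}. ?r i * ?r j)"
      by (simp add: sum_product sum.cartesian_product)
    finally show ?thesis .
  qed
  have "(case (i,j) of (i,j) \<Rightarrow> (norm (A i j))\<^sup>2) = (case (i,j) of (i,j) \<Rightarrow> ?r i * ?r j)"
    by (rule sum_mono_inv[OF tot]) (use le ij in auto)
  then show ?thesis by simp
qed

lemma PM_rank_one:
  assumes A: "A \<in> PM" and ijk: "i \<le> n" "j \<le> n" "k \<le> n"
  shows "oct_mult (A i k) (A k j) = diag_re A k *\<^sub>R A i j"
proof -
  let ?r = "diag_re A"
  have r0: "0 \<le> ?r i" for i by (rule PM_diag_nonneg[OF A])
  have nn: "norm (A i j) = sqrt (?r i * ?r j)" if "i \<le> n" "j \<le> n" for i j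
    using PM_norm_entry[OF A that] by (metis norm_ge_zero real_sqrt_abs abs_of_nonneg)
  have nm: "norm (oct_mult (A i k) (A k j)) = ?r k * norm (A i j)" if "k \<le> n" for k
  proof -
    have "norm (oct_mult (A i k) (A k j)) = (sqrt (?r k) * sqrt (?r k)) * (sqrt (?r i) * sqrt (?r j))"
      using that ijk by (simp add: norm_oct_mult nn real_sqrt_mult)
    also have "\<dots> = ?r k * norm (A i j)" using ijk r0 by (simp add: nn real_sqrt_mult)
    finally show ?thesis .
  qed
  have le: "inner (oct_mult (A i k) (A k j)) (A i j) \<le> ?r k * (norm (A i j))\<^sup>2" if "k \<le> n" for k
    using norm_cauchy_schwarz[of "oct_mult (A i k) (A k j)" "A i j"] nm[OF that]
    by (simp add: power2_eq_square mult_ac)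
  have "(\<Sum>k\<le>n. inner (oct_mult (A i k) (A k j)) (A i j)) = (\<Sum>k\<le>n. ?r k * (norm (A i j))\<^sup>2)"
    using PM_idem[OF A ijk(1,2)] PM_diag_sum[OF A]
    by (simp add: inner_sum_left[symmetric] sum_distrib_right[symmetric] power2_norm_eq_inner)
  \<comment> \<open>Each summand is at most its Cauchy-Schwarz bound and the totals agree, so
    equality holds for every k. A vector with the expected norm and the expected inner product with
    \<open>A i j\<close> is the expected multiple of it.\<close>
  from sum_mono_inv[OF this] have eq: "inner (oct_mult (A i k) (A k j)) (A i j) = ?r k * (norm (A i j))\<^sup>2"
    using le ijk by auto
  have "(norm (oct_mult (A i k) (A k j) - ?r k *\<^sub>R A i j))\<^sup>2 = 0"
    unfolding power2_norm_eq_inner inner_diff_left inner_diff_right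
    using eq nm[OF ijk(3)] by (simp add: inner_commute flip: power2_norm_eq_inner) (simp add: power_mult_distrib power2_eq_square)
  then show ?thesis by simp
qed

text \<open>Summing the rank one relations over k gives idempotency because the diagonal sums to 1.
  This criterion is easier to check for transformed matrices than idempotency itself.\<close>

lemma PM_I:
  assumes "\<And>i j. A i j \<in> K" "\<And>i j. oct_cnj (A i j) = A j i" "\<And>i j. n < i \<or> n < j \<Longrightarrow> A i j = 0"
    "(\<Sum>i\<le>n. diag_re A i) = 1"
    "\<And>i j k. i \<le> n \<Longrightarrow> j \<le> n \<Longrightarrow> k \<le> n \<Longrightarrow> oct_mult (A i k) (A k j) = diag_re A k *\<^sub>R A i j"
  shows "A \<in> PM"
proof -
  have d: "A i i = diag_re A i *\<^sub>R oct_one" for i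
    unfolding diag_re_def by (intro oct_self_cnj assms)
  have "(\<Sum>i\<le>n. A i i) = oct_one"
    using assms(4) by (subst d) (simp flip: scaleR_sum_left)
  moreover have "(\<Sum>k\<le>n. oct_mult (A i k) (A k j)) = A i j" if "i \<le> n" "j \<le> n" for i j
    using assms(4,5) that by (simp flip: scaleR_sum_left)
  ultimately show ?thesis
    using assms(1,3) assms(2)[symmetric] unfolding PM_iff by blast
qed

lemma mat_inner_PM: "A \<in> PM \<Longrightarrow> mat_inner n A A = 1"
  by (simp add: mat_inner_def PM_diag_row[symmetric] PM_diag_sum flip: power2_norm_eq_inner)

text \<open>\<open>M s\<close> is the projection onto the line through \<open>(cos (s/2), sin (s/2), 0, \<dots>)\<close>.\<close>

definition M_vec :: "real \<Rightarrow> nat \<Rightarrow> real" where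
  "M_vec s i = (if i = 0 then cos (s / 2) else if i = 1 then sin (s / 2) else 0)"

definition M :: "real \<Rightarrow> oct_matrix" where
  "M s i j = (M_vec s i * M_vec s j) *\<^sub>R oct_one"

lemma sum_M_vec: "(\<Sum>i\<le>n. f (M_vec s i) i) = f (cos (s/2)) 0 + f (sin (s/2)) 1" if "\<And>i. f 0 i = 0" for f :: "real \<Rightarrow> nat \<Rightarrow> 'b::comm_monoid_add"
proof -
  have "(\<Sum>i\<le>n. f (M_vec s i) i) = (\<Sum>i\<in>{0, 1}. f (M_vec s i) i)"
    using n2 that by (intro sum.mono_neutral_right) (auto simp: M_vec_def)
  then show ?thesis by (simp add: M_vec_def)
qed

lemma M_in_PM: "M s \<in> PM"
proof (rule PM_I)
  have v: "diag_re (M s) i = (M_vec s i)\<^sup>2" for i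
    by (simp add: diag_re_def M_def oct_re_scaleR power2_eq_square)
  show "M s i j \<in> K" for i j
    unfolding M_def by (intro hypercomplex_scaleR hypercomplex_one d0)
  show "oct_cnj (M s i j) = M s j i" for i j
    by (simp add: M_def oct_cnj_scaleR mult.commute)
  show "M s i j = 0" if "n < i \<or> n < j" for i j
    using that n2 by (auto simp: M_def M_vec_def)
  show "(\<Sum>i\<le>n. diag_re (M s) i) = 1"
    unfolding v using sum_M_vec[of "\<lambda>x i. x\<^sup>2" s] by simp
  show "oct_mult (M s i k) (M s k j) = diag_re (M s) k *\<^sub>R M s i j" for i j k
    unfolding v by (simp add: M_def oct_mult.scaleR_left oct_mult.scaleR_right power2_eq_square mult_ac)
qed

lemma mat_inner_M:
  assumes "A \<in> PM"
  shows "mat_inner n A (M s) = (cos (s/2))\<^sup>2 * diag_re A 0 + 2 * (cos (s/2) * sin (s/2)) * oct_re (A 0 1) + (sin (s/2))\<^sup>2 * diag_re A 1"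
proof -
  have "mat_inner n A (M s) = (\<Sum>i\<le>n. M_vec s i * (\<Sum>j\<le>n. M_vec s j * oct_re (A i j)))"
    unfolding mat_inner_def M_def by (simp add: oct_re_eq_inner sum_distrib_left mult_ac)
  also have "\<dots> = (\<Sum>i\<le>n. M_vec s i * (cos (s/2) * oct_re (A i 0) + sin (s/2) * oct_re (A i 1)))"
    using sum_M_vec[of "\<lambda>x j. x * oct_re (A i j)" s for i] by simp
  also have "\<dots> = cos (s/2) * (cos (s/2) * oct_re (A 0 0) + sin (s/2) * oct_re (A 0 1))
      + sin (s/2) * (cos (s/2) * oct_re (A 1 0) + sin (s/2) * oct_re (A 1 1))"
    using sum_M_vec[of "\<lambda>x i. x * (cos (s/2) * oct_re (A i 0) + sin (s/2) * oct_re (A i 1))" s] by simp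
  also have "oct_re (A 1 0) = oct_re (A 0 1)"
    unfolding PM_herm[OF assms, of 0 1, symmetric] by (simp add: oct_re_def oct_cnj_def quat_cnj_def)
  finally show ?thesis by (simp add: diag_re_def algebra_simps power2_eq_square)
qed

text \<open>Isometries are described by their action on \<open>PM\<close> alone, since maps such as
  \<open>oct_phase\<close> are not written as conjugation by a matrix.\<close>

definition mat_iso :: "(oct_matrix \<Rightarrow> oct_matrix) \<Rightarrow> bool" where
  "mat_iso G \<longleftrightarrow> bij_betw G PM PM \<and> (\<forall>A\<in>PM. \<forall>B\<in>PM. mat_inner n (G A) (G B) = mat_inner n A B)"

lemma mat_isoI:
  assumes "\<And>A. A \<in> PM \<Longrightarrow> G A \<in> PM" "\<And>A. A \<in> PM \<Longrightarrow> G' A \<in> PM"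
    "\<And>A. A \<in> PM \<Longrightarrow> G' (G A) = A" "\<And>A. A \<in> PM \<Longrightarrow> G (G' A) = A"
    "\<And>A B. A \<in> PM \<Longrightarrow> B \<in> PM \<Longrightarrow> mat_inner n (G A) (G B) = mat_inner n A B"
  shows "mat_iso G"
  unfolding mat_iso_def using assms by (auto intro!: bij_betw_byWitness[of _ G'])

lemma mat_iso_in: "mat_iso G \<Longrightarrow> A \<in> PM \<Longrightarrow> G A \<in> PM"
  by (auto simp: mat_iso_def bij_betw_def)

lemma mat_iso_id: "mat_iso (\<lambda>A. A)"
  by (rule mat_isoI[of _ "\<lambda>A. A"]) auto

lemma mat_iso_comp: "mat_iso G \<Longrightarrow> mat_iso H \<Longrightarrow> mat_iso (\<lambda>A. G (H A))"
  using mat_iso_in[of H] unfolding mat_iso_def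
  by (auto intro: bij_betw_trans[of H PM PM G PM, unfolded comp_def])

definition orthogonal_entries :: "(nat \<Rightarrow> nat \<Rightarrow> real) \<Rightarrow> bool" where
  "orthogonal_entries U \<longleftrightarrow> (\<forall>a\<le>n. \<forall>b\<le>n. (\<Sum>k\<le>n. U k a * U k b) = (if a = b then 1 else 0)) \<and>
     (\<forall>a\<le>n. \<forall>b\<le>n. (\<Sum>k\<le>n. U a k * U b k) = (if a = b then 1 else 0))"

text \<open>Conjugation by a real matrix. Real coefficients commute and associate with octonions, so
  that this is an isometry for every \<open>d0\<close> when U is orthogonal.\<close>

definition rot :: "(nat \<Rightarrow> nat \<Rightarrow> real) \<Rightarrow> oct_matrix \<Rightarrow> oct_matrix" where
  "rot U A i j = (if i \<le> n \<and> j \<le> n then \<Sum>a\<le>n. \<Sum>b\<le>n. (U i a * U j b) *\<^sub>R A a b else 0)"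

text \<open>Parseval's identity for an arbitrary bilinear product. With the octonion product it
  gives idempotency of the rotated matrix, with the inner product the invariance of
  \<open>mat_inner\<close>.\<close>

lemma orthogonal_sum:
  assumes "orthogonal_entries U" "bounded_bilinear p"
  shows "(\<Sum>k\<le>n. p (\<Sum>a\<le>n. U k a *\<^sub>R u a) (\<Sum>b\<le>n. U k b *\<^sub>R v b)) = (\<Sum>a\<le>n. p (u a) (v a))"
proof -
  interpret p: bounded_bilinear p by fact
  have "(\<Sum>k\<le>n. p (\<Sum>a\<le>n. U k a *\<^sub>R u a) (\<Sum>b\<le>n. U k b *\<^sub>R v b))
      = (\<Sum>k\<le>n. \<Sum>a\<le>n. \<Sum>b\<le>n. (U k a * U k b) *\<^sub>R p (u a) (v b))"
    unfolding p.sum_left unfolding p.sum_right p.scaleR_left p.scaleR_right by (simp add: mult.commute)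
  also have "\<dots> = (\<Sum>a\<le>n. \<Sum>b\<le>n. \<Sum>k\<le>n. (U k a * U k b) *\<^sub>R p (u a) (v b))"
    by (subst sum.swap, rule sum.cong[OF refl], rule sum.swap)
  also have "\<dots> = (\<Sum>a\<le>n. \<Sum>b\<le>n. (if a = b then 1 else 0) *\<^sub>R p (u a) (v b))"
    using assms(1) by (intro sum.cong refl) (simp add: orthogonal_entries_def flip: scaleR_sum_left)
  also have "\<dots> = (\<Sum>a\<le>n. p (u a) (v a))"
    by (simp add: if_distrib[of "\<lambda>x. x *\<^sub>R _"] cong: if_cong)
  finally show ?thesis .
qed

lemma rot_left: "i \<le> n \<Longrightarrow> j \<le> n \<Longrightarrow> rot U A i j = (\<Sum>a\<le>n. U i a *\<^sub>R (\<Sum>b\<le>n. U j b *\<^sub>R A a b))"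
  by (simp add: rot_def scaleR_sum_right)

lemma rot_right: "i \<le> n \<Longrightarrow> j \<le> n \<Longrightarrow> rot U A i j = (\<Sum>b\<le>n. U j b *\<^sub>R (\<Sum>a\<le>n. U i a *\<^sub>R A a b))"
  unfolding rot_def by (subst sum.swap) (simp add: scaleR_sum_right mult.commute)

lemma rot_in_PM:
  assumes U: "orthogonal_entries U" and A: "A \<in> PM"
  shows "rot U A \<in> PM"
proof -
  have "rot U A i j \<in> K" for i j
    unfolding rot_def
    by (simp add: hypercomplex_0[OF d0])
       (intro impI hypercomplex_sum[OF d0] hypercomplex_scaleR[OF d0] PM_entry[OF A])
  moreover have "rot U A j i = oct_cnj (rot U A i j)" for i j
  proof (cases "i \<le> n \<and> j \<le> n")
    case True
    then have "oct_cnj (rot U A i j) = (\<Sum>a\<le>n. \<Sum>b\<le>n. (U i a * U j b) *\<^sub>R A b a)"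
      by (simp add: rot_def oct_cnj_sum oct_cnj_scaleR PM_herm[OF A])
    also have "\<dots> = rot U A j i" using True
      unfolding rot_def by (subst sum.swap) (simp add: mult.commute)
    finally show ?thesis by simp
  qed (auto simp: rot_def oct_cnj_0)
  moreover have "rot U A i j = 0" if "n < i \<or> n < j" for i j
    using that by (auto simp: rot_def)
  moreover have "(\<Sum>k\<le>n. oct_mult (rot U A i k) (rot U A k j)) = rot U A i j" if ij: "i \<le> n" "j \<le> n" for i j
  proof -
    have "(\<Sum>k\<le>n. oct_mult (rot U A i k) (rot U A k j)) =
        (\<Sum>k\<le>n. oct_mult (\<Sum>b\<le>n. U k b *\<^sub>R (\<Sum>a\<le>n. U i a *\<^sub>R A a b)) (\<Sum>b\<le>n. U k b *\<^sub>R (\<Sum>c\<le>n. U j c *\<^sub>R A b c)))"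
      using ij by (intro sum.cong refl arg_cong2[where f = oct_mult] rot_right rot_left) auto
    also have "\<dots> = (\<Sum>b\<le>n. oct_mult (\<Sum>a\<le>n. U i a *\<^sub>R A a b) (\<Sum>c\<le>n. U j c *\<^sub>R A b c))"
      by (rule orthogonal_sum[OF U bounded_bilinear_oct_mult])
    also have "\<dots> = (\<Sum>b\<le>n. \<Sum>a\<le>n. \<Sum>c\<le>n. (U i a * U j c) *\<^sub>R oct_mult (A a b) (A b c))"
      unfolding oct_mult.sum_left unfolding oct_mult.sum_right oct_mult.scaleR_left oct_mult.scaleR_right
      by (simp add: mult.commute)
    also have "\<dots> = (\<Sum>a\<le>n. \<Sum>c\<le>n. \<Sum>b\<le>n. (U i a * U j c) *\<^sub>R oct_mult (A a b) (A b c))"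
      by (subst sum.swap, rule sum.cong[OF refl], rule sum.swap)
    also have "\<dots> = rot U A i j"
      using ij by (simp add: rot_def PM_idem[OF A] flip: scaleR_sum_right)
    finally show ?thesis .
  qed
  moreover have "(\<Sum>k\<le>n. rot U A k k) = oct_one"
  proof -
    have "(\<Sum>k\<le>n. rot U A k k) = (\<Sum>k\<le>n. \<Sum>a\<le>n. \<Sum>b\<le>n. (U k a * U k b) *\<^sub>R A a b)"
      by (simp add: rot_def)
    also have "\<dots> = (\<Sum>a\<le>n. \<Sum>b\<le>n. \<Sum>k\<le>n. (U k a * U k b) *\<^sub>R A a b)"
      by (subst sum.swap, rule sum.cong[OF refl], rule sum.swap)
    also have "\<dots> = (\<Sum>a\<le>n. \<Sum>b\<le>n. (if a = b then 1 else 0) *\<^sub>R A a b)"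
      using U by (intro sum.cong refl) (simp add: orthogonal_entries_def flip: scaleR_sum_left)
    also have "\<dots> = (\<Sum>a\<le>n. A a a)"
      by (simp add: if_distrib[of "\<lambda>x. x *\<^sub>R _"] cong: if_cong)
    finally show ?thesis using PM_trace[OF A] by simp
  qed
  ultimately show ?thesis
    unfolding PM_iff by blast
qed

lemma rot_inner:
  assumes U: "orthogonal_entries U"
  shows "mat_inner n (rot U A) (rot U B) = mat_inner n A B"
proof -
  have "mat_inner n (rot U A) (rot U B) = (\<Sum>i\<le>n. \<Sum>j\<le>n.
      inner (\<Sum>b\<le>n. U j b *\<^sub>R (\<Sum>a\<le>n. U i a *\<^sub>R A a b)) (\<Sum>b\<le>n. U j b *\<^sub>R (\<Sum>a\<le>n. U i a *\<^sub>R B a b)))"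
    unfolding mat_inner_def by (intro sum.cong refl arg_cong2[where f = inner] rot_right) auto
  also have "\<dots> = (\<Sum>i\<le>n. \<Sum>b\<le>n. inner (\<Sum>a\<le>n. U i a *\<^sub>R A a b) (\<Sum>a\<le>n. U i a *\<^sub>R B a b))"
    by (intro sum.cong refl orthogonal_sum[OF U bounded_bilinear_inner])
  also have "\<dots> = (\<Sum>b\<le>n. \<Sum>i\<le>n. inner (\<Sum>a\<le>n. U i a *\<^sub>R A a b) (\<Sum>a\<le>n. U i a *\<^sub>R B a b))"
    by (rule sum.swap)
  also have "\<dots> = (\<Sum>b\<le>n. \<Sum>a\<le>n. inner (A a b) (B a b))"
    by (intro sum.cong refl orthogonal_sum[OF U bounded_bilinear_inner])
  also have "\<dots> = mat_inner n A B"
    unfolding mat_inner_def by (rule sum.swap)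
  finally show ?thesis .
qed

lemma orthogonal_entries_transpose: "orthogonal_entries U \<Longrightarrow> orthogonal_entries (\<lambda>i j. U j i)"
  by (auto simp: orthogonal_entries_def)

lemma rot_transpose:
  assumes U: "orthogonal_entries U" and A: "A \<in> PM"
  shows "rot (\<lambda>i j. U j i) (rot U A) = A"
proof (intro ext)
  fix i j
  have del: "(\<Sum>a\<le>n. U a i *\<^sub>R (\<Sum>c\<le>n. U a c *\<^sub>R w c)) = w i" if "i \<le> n" for i and w :: "nat \<Rightarrow> octonion"
  proof -
    have "(\<Sum>a\<le>n. U a i *\<^sub>R (\<Sum>c\<le>n. U a c *\<^sub>R w c)) = (\<Sum>c\<le>n. (\<Sum>a\<le>n. U a i * U a c) *\<^sub>R w c)"
      by (simp add: scaleR_sum_right scaleR_sum_left) (rule sum.swap)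
    also have "\<dots> = (\<Sum>c\<le>n. (if i = c then 1 else 0) *\<^sub>R w c)"
      using U that by (intro sum.cong refl) (simp add: orthogonal_entries_def)
    also have "\<dots> = w i" using that by (simp add: if_distrib[of "\<lambda>x. x *\<^sub>R _"] cong: if_cong)
    finally show ?thesis .
  qed
  show "rot (\<lambda>i j. U j i) (rot U A) i j = A i j"
  proof (cases "i \<le> n \<and> j \<le> n")
    case True
    then have "rot (\<lambda>i j. U j i) (rot U A) i j = (\<Sum>a\<le>n. U a i *\<^sub>R (\<Sum>b\<le>n. U b j *\<^sub>R (\<Sum>d\<le>n. U b d *\<^sub>R (\<Sum>c\<le>n. U a c *\<^sub>R A c d))))"
      by (subst rot_left) (auto intro!: sum.cong simp: rot_right)
    also have "\<dots> = (\<Sum>a\<le>n. U a i *\<^sub>R (\<Sum>c\<le>n. U a c *\<^sub>R A c j))"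
      using True by (simp add: del)
    also have "\<dots> = A i j" using True by (simp add: del)
    finally show ?thesis .
  qed (auto simp: rot_def PM_outside[OF A])
qed

lemma mat_iso_rot:
  assumes U: "orthogonal_entries U" shows "mat_iso (rot U)"
proof (rule mat_isoI)
  show "rot U (rot (\<lambda>i j. U j i) A) = A" if "A \<in> PM" for A
    using rot_transpose[OF orthogonal_entries_transpose[OF U] that] by simp
qed (auto intro: rot_in_PM rot_inner rot_transpose U orthogonal_entries_transpose)

end

section \<open>Phases, normal form and two-point homogeneity\<close>

context projective begin

lemma mat_iso_inner: "mat_iso G \<Longrightarrow> A \<in> PM \<Longrightarrow> B \<in> PM \<Longrightarrow> mat_inner n (G A) (G B) = mat_inner n A B"
  by (auto simp: mat_iso_def)

text \<open>Conjugation by the diagonal matrix with entries w. For unit w it preserves the rank one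
  relations by associativity, whence the exclusion of \<open>d0\<close> = 8 in the lemmas
  below.\<close>

definition phase :: "(nat \<Rightarrow> octonion) \<Rightarrow> oct_matrix \<Rightarrow> oct_matrix" where
  "phase w A i j = oct_mult (oct_mult (w i) (A i j)) (oct_cnj (w j))"

lemma phase_in_PM:
  assumes w: "\<And>i. w i \<in> K" "\<And>i. norm (w i) = 1" and d8: "d0 \<noteq> 8" and A: "A \<in> PM"
  shows "phase w A \<in> PM" and "diag_re (phase w A) i = diag_re A i"
proof -
  note K_simps = hypercomplex_mult[OF d0] hypercomplex_cnj[OF d0] PM_entry[OF A] w(1)
  note assoc = hypercomplex_assoc[OF d0 d8]
  have ww: "oct_mult (w i) (oct_cnj (w i)) = oct_one" "oct_mult (oct_cnj (w i)) (w i) = oct_one" for i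
    using w(2) by (simp_all add: oct_mult_cnj_self oct_cnj_mult_self)
  have dg: "diag_re (phase w A) i = diag_re A i" for i
    unfolding diag_re_def phase_def by (subst PM_diag[OF A])
      (simp add: oct_mult.scaleR_left oct_mult.scaleR_right ww oct_re_scaleR diag_re_def)
  show "diag_re (phase w A) i = diag_re A i" by (rule dg)
  show "phase w A \<in> PM"
  proof (rule PM_I)
    show "phase w A i j \<in> K" for i j unfolding phase_def by (intro K_simps)
    show "oct_cnj (phase w A i j) = phase w A j i" for i j
      by (simp add: phase_def oct_cnj_mult PM_herm[OF A] assoc K_simps)
    show "phase w A i j = 0" if "n < i \<or> n < j" for i j
      by (simp add: phase_def PM_outside[OF A that] oct_mult.zero_left oct_mult.zero_right)
    show "(\<Sum>i\<le>n. diag_re (phase w A) i) = 1"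
      by (simp add: dg PM_diag_sum[OF A])
    show "oct_mult (phase w A i k) (phase w A k j) = diag_re (phase w A) k *\<^sub>R phase w A i j"
      if "i \<le> n" "j \<le> n" "k \<le> n" for i j k
    proof -
      have "oct_mult (phase w A i k) (phase w A k j) =
        oct_mult (w i) (oct_mult (A i k) (oct_mult (oct_mult (oct_cnj (w k)) (w k)) (oct_mult (A k j) (oct_cnj (w j)))))"
        by (simp add: phase_def assoc K_simps)
      also have "\<dots> = oct_mult (w i) (oct_mult (oct_mult (A i k) (A k j)) (oct_cnj (w j)))"
        by (simp add: ww assoc K_simps)
      also have "\<dots> = diag_re A k *\<^sub>R phase w A i j"
        by (simp add: PM_rank_one[OF A that] oct_mult.scaleR_left oct_mult.scaleR_right phase_def assoc K_simps)
      finally show ?thesis by (simp add: dg)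
    qed
  qed
qed

lemma phase_cnj_phase:
  assumes w: "\<And>i. w i \<in> K" "\<And>i. norm (w i) = 1" and d8: "d0 \<noteq> 8" and A: "A \<in> PM"
  shows "phase (\<lambda>i. oct_cnj (w i)) (phase w A) = A"
proof (intro ext)
  fix i j
  note K_simps = hypercomplex_mult[OF d0] hypercomplex_cnj[OF d0] PM_entry[OF A] w(1)
  have "phase (\<lambda>i. oct_cnj (w i)) (phase w A) i j
      = oct_mult (oct_mult (oct_cnj (w i)) (oct_mult (w i) (oct_mult (A i j) (oct_cnj (w j))))) (w j)"
    by (simp add: phase_def hypercomplex_assoc[OF d0 d8] K_simps)
  also have "\<dots> = oct_mult (oct_mult (A i j) (oct_cnj (w j))) (oct_cnj (oct_cnj (w j)))"
    unfolding oct_cnj_mult_left using w(2) by simp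
  also have "\<dots> = A i j"
    unfolding oct_cnj_mult_right using w(2) by simp
  finally show "phase (\<lambda>i. oct_cnj (w i)) (phase w A) i j = A i j" .
qed

lemma mat_iso_phase:
  assumes w: "\<And>i. w i \<in> K" "\<And>i. norm (w i) = 1" and d8: "d0 \<noteq> 8"
  shows "mat_iso (phase w)"
proof (rule mat_isoI)
  let ?v = "\<lambda>i. oct_cnj (w i)"
  have v: "\<And>i. ?v i \<in> K" "\<And>i. norm (?v i) = 1" using w by (auto intro: hypercomplex_cnj[OF d0])
  fix A assume A: "A \<in> PM"
  show "phase w A \<in> PM" by (rule phase_in_PM(1)[OF w d8 A])
  show "phase ?v A \<in> PM" by (rule phase_in_PM(1)[OF v d8 A])
  show "phase ?v (phase w A) = A" by (rule phase_cnj_phase[OF w d8 A])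
  show "phase w (phase ?v A) = A" using phase_cnj_phase[OF v d8 A] by simp
next
  show "mat_inner n (phase w A) (phase w B) = mat_inner n A B" for A B
    by (simp add: mat_inner_def phase_def inner_oct_mult_left inner_oct_mult_right w(2))
qed

text \<open>Conjugation reverses the index triple of a rank one relation. Multiplying the relation
  for (0, 1, 2) by a further entry and cancelling with \<open>oct_cnj_mult_left\<close> or
  \<open>oct_cnj_mult_right\<close> turns the triple cyclically, after division by
  \<open>diag_re A 1\<close>; if that entry is 0, all entries in its row and column vanish. So one
  relation implies those for all six orders of three distinct indices.\<close>

lemma PM_I_oct:
  assumes n: "n = 2" and "\<And>i j. A i j \<in> K" and herm: "\<And>i j. oct_cnj (A i j) = A j i"
    "\<And>i j. n < i \<or> n < j \<Longrightarrow> A i j = 0" "(\<Sum>i\<le>n. diag_re A i) = 1"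
    and nrm: "\<And>i j. i \<le> n \<Longrightarrow> j \<le> n \<Longrightarrow> (norm (A i j))\<^sup>2 = diag_re A i * diag_re A j"
    and main: "oct_mult (A 0 1) (A 1 2) = diag_re A 1 *\<^sub>R A 0 2"
  shows "A \<in> PM"
proof (rule PM_I)
  let ?r = "diag_re A"
  have d: "A i i = ?r i *\<^sub>R oct_one" for i
    unfolding diag_re_def by (intro oct_self_cnj herm)
  have sym: "oct_mult (A i k) (A k i) = ?r k *\<^sub>R A i i" if "i \<le> n" "k \<le> n" for i k
  proof -
    have "oct_mult (A i k) (A k i) = (norm (A i k))\<^sup>2 *\<^sub>R oct_one"
      using oct_mult_cnj_self[of "A i k"] herm by simp
    then show ?thesis using nrm[OF that] by (simp add: d[of i] mult.commute)
  qed
  have cnjs: "oct_mult (A j k) (A k i) = ?r k *\<^sub>R A j i" if "oct_mult (A i k) (A k j) = ?r k *\<^sub>R A i j" for i j k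
    using arg_cong[OF that, of oct_cnj] by (simp add: oct_cnj_mult oct_cnj_scaleR herm)
  have b: "oct_mult (A 1 2) (A 2 0) = ?r 2 *\<^sub>R A 1 0 \<and> oct_mult (A 2 0) (A 0 1) = ?r 0 *\<^sub>R A 2 1"
  proof (cases "?r 1 = 0")
    case True
    then have "A 0 1 = 0" "A 1 0 = 0" "A 1 2 = 0" "A 2 1 = 0"
      using nrm[of 0 1] nrm[of 1 0] nrm[of 1 2] nrm[of 2 1] n by auto
    then show ?thesis by (simp add: oct_mult.zero_left oct_mult.zero_right)
  next
    case False
    have "oct_mult (A 1 2) (oct_mult (A 2 1) (A 1 0)) = (norm (A 2 1))\<^sup>2 *\<^sub>R A 1 0"
      using oct_cnj_mult_left[of "A 2 1" "A 1 0"] by (simp add: herm)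
    moreover have "oct_mult (oct_mult (A 2 1) (A 1 0)) (A 0 1) = (norm (A 1 0))\<^sup>2 *\<^sub>R A 2 1"
      using oct_cnj_mult_right[of "A 2 1" "A 1 0"] by (simp add: herm)
    ultimately have "?r 1 *\<^sub>R oct_mult (A 1 2) (A 2 0) = ?r 1 *\<^sub>R (?r 2 *\<^sub>R A 1 0) \<and>
       ?r 1 *\<^sub>R oct_mult (A 2 0) (A 0 1) = ?r 1 *\<^sub>R (?r 0 *\<^sub>R A 2 1)"
      unfolding cnjs[OF main] using n
      by (simp add: oct_mult.scaleR_left oct_mult.scaleR_right nrm mult_ac)
    then show ?thesis using False unfolding scaleR_cancel_left by blast
  qed
  show "oct_mult (A i k) (A k j) = ?r k *\<^sub>R A i j" if "i \<le> n" "j \<le> n" "k \<le> n" for i j k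
  proof -
    consider "i = k" | "j = k" | "i = j" | "i \<noteq> k" "j \<noteq> k" "i \<noteq> j" by blast
    then show ?thesis
    proof cases
      case 1 then show ?thesis by (simp add: d[of k] oct_mult.scaleR_left)
    next
      case 2 then show ?thesis by (simp add: d[of k] oct_mult.scaleR_right)
    next
      case 3 then show ?thesis using sym that by simp
    next
      case 4
      have "(i, k, j) \<in> {(0,1,2), (1,2,0), (2,0,1), (2,1,0), (0,2,1), (1,0,2)}"
        using that 4 n by (auto simp: le_Suc_eq numeral_2_eq_2)
      then show ?thesis using main b cnjs[OF main] b[THEN conjunct1, THEN cnjs] b[THEN conjunct2, THEN cnjs] by auto
    qed
  qed
qed (use assms in auto)

text \<open>The octonionic substitute for \<open>phase\<close>. With a, b and c in the places 01, 12
  and 02, the relation a b = r c is carried to (u a)(b u) = r (u c u), which is the Moufang identity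
  \<open>oct_moufang\<close>.\<close>

definition oct_phase :: "octonion \<Rightarrow> oct_matrix \<Rightarrow> oct_matrix" where
  "oct_phase u A i j =
     (if (i, j) = (0, 1) then oct_mult u (A 0 1)
      else if (i, j) = (1, 0) then oct_mult (A 1 0) (oct_cnj u)
      else if (i, j) = (1, 2) then oct_mult (A 1 2) u
      else if (i, j) = (2, 1) then oct_mult (oct_cnj u) (A 2 1)
      else if (i, j) = (0, 2) then oct_mult (oct_mult u (A 0 2)) u
      else if (i, j) = (2, 0) then oct_mult (oct_cnj u) (oct_mult (A 2 0) (oct_cnj u))
      else A i j)"

lemma oct_phase_in_PM:
  assumes u: "u \<in> K" "norm u = 1" and n: "n = 2" and A: "A \<in> PM"
  shows "oct_phase u A \<in> PM"
proof -
  have dg: "diag_re (oct_phase u A) i = diag_re A i" for i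
    by (auto simp: diag_re_def oct_phase_def)
  show ?thesis
  proof (rule PM_I_oct[OF n])
    show "oct_phase u A i j \<in> K" for i j
      unfolding oct_phase_def by (auto intro!: hypercomplex_mult[OF d0] hypercomplex_cnj[OF d0] PM_entry[OF A] u)
    show "oct_cnj (oct_phase u A i j) = oct_phase u A j i" for i j
      by (auto simp: oct_phase_def oct_cnj_mult PM_herm[OF A])
    show "oct_phase u A i j = 0" if "n < i \<or> n < j" for i j
      using that n PM_outside[OF A that] by (auto simp: oct_phase_def)
    show "(\<Sum>i\<le>n. diag_re (oct_phase u A) i) = 1" by (simp add: dg PM_diag_sum[OF A])
    show "(norm (oct_phase u A i j))\<^sup>2 = diag_re (oct_phase u A) i * diag_re (oct_phase u A) j" if "i \<le> n" "j \<le> n" for i j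
      using PM_norm_entry[OF A that] unfolding dg by (auto simp: oct_phase_def norm_oct_mult u(2))
    have "oct_mult (oct_mult u (A 0 1)) (oct_mult (A 1 2) u) = oct_mult (oct_mult u (diag_re A 1 *\<^sub>R A 0 2)) u"
      using PM_rank_one[OF A, of 0 2 1] n by (simp add: oct_moufang)
    then show "oct_mult (oct_phase u A 0 1) (oct_phase u A 1 2) = diag_re (oct_phase u A) 1 *\<^sub>R oct_phase u A 0 2"
      unfolding dg by (simp add: oct_phase_def oct_mult.scaleR_left oct_mult.scaleR_right)
  qed
qed

lemma mat_iso_oct_phase:
  assumes u: "u \<in> K" "norm u = 1" and n: "n = 2"
  shows "mat_iso (oct_phase u)"
proof (rule mat_isoI)
  have v: "oct_cnj u \<in> K" "norm (oct_cnj u) = 1" using u by (auto intro: hypercomplex_cnj[OF d0])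
  have c: "oct_mult (oct_cnj u) (oct_mult u x) = x" "oct_mult u (oct_mult (oct_cnj u) x) = x"
    "oct_mult (oct_mult x u) (oct_cnj u) = x" "oct_mult (oct_mult x (oct_cnj u)) u = x" for x
    using oct_cnj_mult_left[of u x] oct_cnj_mult_left[of "oct_cnj u" x]
      oct_cnj_mult_right[of x u] oct_cnj_mult_right[of x "oct_cnj u"] by (simp_all only: u(2) norm_oct_cnj oct_cnj_cnj power_one scaleR_one)
  have c': "oct_mult (oct_mult (oct_cnj u) (oct_mult (oct_mult u x) u)) (oct_cnj u) = x"
    "oct_mult (oct_mult u (oct_mult (oct_mult (oct_cnj u) x) (oct_cnj u))) u = x"
    "oct_mult u (oct_mult (oct_mult (oct_cnj u) (oct_mult x (oct_cnj u))) u) = x"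
    "oct_mult (oct_cnj u) (oct_mult (oct_mult u (oct_mult x u)) (oct_cnj u)) = x" for x
    by (simp_all only: oct_flexible[of u x] oct_flexible[of "oct_cnj u" x] c)
      (simp_all only: oct_flexible[of u x, symmetric] oct_flexible[of "oct_cnj u" x, symmetric] c)
  fix A assume A: "A \<in> PM"
  show "oct_phase u A \<in> PM" "oct_phase (oct_cnj u) A \<in> PM"
    using oct_phase_in_PM u v n A by auto
  show "oct_phase (oct_cnj u) (oct_phase u A) = A" "oct_phase u (oct_phase (oct_cnj u) A) = A"
    by (simp_all add: oct_phase_def fun_eq_iff c c')
next
  fix A B
  show "mat_inner n (oct_phase u A) (oct_phase u B) = mat_inner n A B"
    unfolding mat_inner_def
    by (intro sum.cong refl) (auto simp: oct_phase_def inner_oct_mult_left inner_oct_mult_right u(2))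
qed

text \<open>From here on the associative case and the octonionic plane are treated alike: only the
  effect on the diagonal and on one entry matters. \<open>phase_right\<close> is the analogue for
  the entries in row 1.\<close>

lemma phase_left:
  assumes u: "u \<in> K" "norm u = 1"
  shows "\<exists>G. mat_iso G \<and> (\<forall>A\<in>PM. (\<forall>i. diag_re (G A) i = diag_re A i) \<and> G A 0 1 = oct_mult u (A 0 1))"
proof (cases "d0 = 8")
  case True
  with oct_plane have n: "n = 2" by simp
  show ?thesis
    by (intro exI[of _ "oct_phase u"] conjI mat_iso_oct_phase[OF u n]) (auto simp: diag_re_def oct_phase_def)
next
  case False
  let ?w = "\<lambda>i::nat. if i = 0 then u else oct_one"
  have w: "\<And>i. ?w i \<in> K" "\<And>i. norm (?w i) = 1" using u by (auto intro: hypercomplex_one[OF d0])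
  show ?thesis
    by (intro exI[of _ "phase ?w"] conjI mat_iso_phase w False ballI allI phase_in_PM(2))
       (auto simp: phase_def)
qed

lemma phase_right:
  assumes u: "u \<in> K" "norm u = 1" and j: "2 \<le> j" "j \<le> n"
  shows "\<exists>G. mat_iso G \<and> (\<forall>A\<in>PM. (\<forall>i. diag_re (G A) i = diag_re A i) \<and> G A 1 j = oct_mult (A 1 j) u)"
proof (cases "d0 = 8")
  case True
  with oct_plane have n: "n = 2" by simp
  with j have "j = 2" by simp
  then show ?thesis
    by (intro exI[of _ "oct_phase u"] conjI mat_iso_oct_phase[OF u n]) (auto simp: diag_re_def oct_phase_def)
next
  case False
  \<comment> \<open>\<open>phase\<close> multiplies by the conjugate of w j on the right, so the
    conjugate of u produces the factor u.\<close>
  let ?w = "\<lambda>i. if i = j then oct_cnj u else oct_one"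
  have w: "\<And>i. ?w i \<in> K" "\<And>i. norm (?w i) = 1" using u by (auto intro: hypercomplex_one[OF d0] hypercomplex_cnj[OF d0])
  show ?thesis
    by (intro exI[of _ "phase ?w"] conjI mat_iso_phase w False ballI allI phase_in_PM(2))
       (use j in \<open>auto simp: phase_def\<close>)
qed

lemma make_real:
  assumes "x \<in> K"
  obtains u where "u \<in> K" "norm u = 1" "oct_mult u x = norm x *\<^sub>R oct_one" "oct_mult x u = norm x *\<^sub>R oct_one"
proof (cases "x = 0")
  case True
  then show ?thesis
    by (intro that[of oct_one]) (auto simp: hypercomplex_one[OF d0])
next
  case False
  then show ?thesis
    by (intro that[of "(1 / norm x) *\<^sub>R oct_cnj x"] hypercomplex_scaleR hypercomplex_cnj d0 assms)
       (auto simp: oct_mult.scaleR_left oct_mult.scaleR_right oct_mult_cnj_self oct_cnj_mult_self power2_eq_square)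
qed

definition plane_rot :: "nat \<Rightarrow> nat \<Rightarrow> real \<Rightarrow> real \<Rightarrow> nat \<Rightarrow> nat \<Rightarrow> real" where
  "plane_rot p q c s i j = (if i = p then (if j = p then c else if j = q then s else 0)
     else if i = q then (if j = p then - s else if j = q then c else 0)
     else if i = j then 1 else 0)"

lemma plane_rot_sum:
  fixes v :: "nat \<Rightarrow> 'b::real_vector"
  assumes "p \<noteq> q" "p \<le> n" "q \<le> n" "i \<le> n"
  shows "(\<Sum>a\<le>n. plane_rot p q c s i a *\<^sub>R v a) =
    (if i = p then c *\<^sub>R v p + s *\<^sub>R v q else if i = q then c *\<^sub>R v q - s *\<^sub>R v p else v i)"
proof -
  have "(\<Sum>a\<le>n. plane_rot p q c s i a *\<^sub>R v a) = (\<Sum>a\<in>{p, q, i}. plane_rot p q c s i a *\<^sub>R v a)"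
    using assms by (intro sum.mono_neutral_right) (auto simp: plane_rot_def)
  also have "\<dots> = (if i = p then c *\<^sub>R v p + s *\<^sub>R v q else if i = q then c *\<^sub>R v q - s *\<^sub>R v p else v i)"
    using assms by (auto simp: plane_rot_def insert_commute)
  finally show ?thesis .
qed

lemma plane_rot_transpose: "plane_rot p q c s j i = plane_rot p q c (- s) i j" if "p \<noteq> q"
  using that by (auto simp: plane_rot_def)

lemma plane_rot_orthogonal:
  assumes pq: "p \<noteq> q" "p \<le> n" "q \<le> n" and cs: "c\<^sup>2 + s\<^sup>2 = 1"
  shows "orthogonal_entries (plane_rot p q c s)"
proof -
  have *: "(\<Sum>k\<le>n. plane_rot p q c s a k * plane_rot p q c s b k) = (if a = b then 1 else 0)"
    if "a \<le> n" "b \<le> n" "c\<^sup>2 + s\<^sup>2 = 1" for a b and c s :: real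
    using plane_rot_sum[OF pq that(1), of c s "plane_rot p q c s b"] pq that
    by (auto simp: plane_rot_def power2_eq_square algebra_simps)
  have "(\<Sum>k\<le>n. plane_rot p q c s k a * plane_rot p q c s k b)
      = (\<Sum>k\<le>n. plane_rot p q c (- s) a k * plane_rot p q c (- s) b k)" for a b
    by (intro sum.cong refl arg_cong2[where f = "(*)"] plane_rot_transpose pq)
  then show ?thesis unfolding orthogonal_entries_def
    using *[of _ _ c s] *[of _ _ c "- s"] cs by simp
qed

lemma PM_re_sym: "A \<in> PM \<Longrightarrow> oct_re (A i j) = oct_re (A j i)"
  using PM_herm[of A j i] oct_re_cnj[of "A j i"] by simp

lemma rot_plane_diag:
  assumes pq: "p \<noteq> q" "p \<le> n" "q \<le> n" and A: "A \<in> PM" and i: "i \<le> n"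
  shows "diag_re (rot (plane_rot p q c s) A) i =
     (if i = p then c\<^sup>2 * diag_re A p + 2 * (c * s) * oct_re (A p q) + s\<^sup>2 * diag_re A q
      else if i = q then s\<^sup>2 * diag_re A p - 2 * (c * s) * oct_re (A p q) + c\<^sup>2 * diag_re A q else diag_re A i)"
  unfolding diag_re_def rot_left[OF i i] plane_rot_sum[OF pq i]
  using pq PM_re_sym[OF A, of q p]
  by (auto simp: oct_re_add oct_re_scaleR linear_diff[OF bounded_linear.linear[OF bounded_linear_oct_re]]
      algebra_simps power2_eq_square)

lemma PM_zero_entry: "A \<in> PM \<Longrightarrow> diag_re A i = 0 \<or> diag_re A j = 0 \<Longrightarrow> A i j = 0"
  by (cases "i \<le> n \<and> j \<le> n") (use PM_norm_entry[of A i j] PM_outside[of A i j] in auto)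

text \<open>After a phase the entry in place 1 j is real and equals the square root of the product
  of its two diagonal entries, by \<open>PM_norm_entry\<close>. The block of rows and columns 1 and
  j then has rank one, and a plane rotation moves all of its trace to place 1. Row 0 takes no part
  in the rotation, so \<open>diag_re\<close> at 0 is kept for every matrix.\<close>

lemma eliminate_diag:
  assumes A: "A \<in> PM" and j: "2 \<le> j" "j \<le> n"
  shows "\<exists>G. mat_iso G \<and> (\<forall>B\<in>PM. diag_re (G B) 0 = diag_re B 0) \<and> diag_re (G A) j = 0 \<and>
     (\<forall>i\<le>n. i \<noteq> 1 \<longrightarrow> i \<noteq> j \<longrightarrow> diag_re (G A) i = diag_re A i)"
proof -
  obtain u where u: "u \<in> K" "norm u = 1" "oct_mult (A 1 j) u = norm (A 1 j) *\<^sub>R oct_one"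
    using make_real[OF PM_entry[OF A]] by metis
  obtain G where G: "mat_iso G" "\<And>B i. B \<in> PM \<Longrightarrow> diag_re (G B) i = diag_re B i"
      "\<And>B. B \<in> PM \<Longrightarrow> G B 1 j = oct_mult (B 1 j) u"
    using phase_right[OF u(1,2) j] by blast
  let ?a = "diag_re A 1" and ?b = "diag_re A j"
  have ab: "0 \<le> ?a" "0 \<le> ?b" using PM_diag_nonneg[OF A] by auto
  show ?thesis
  proof (cases "?a + ?b = 0")
    case True
    then have "?b = 0" using ab by linarith
    then show ?thesis using G A by (intro exI[of _ G]) auto
  next
    case False
    with ab have pos: "0 < ?a + ?b" by linarith
    \<comment> \<open>(c, s) is the unit vector in the direction of (sqrt a, sqrt b), which spans
      the range of the rank one block.\<close>
    define c where "c = sqrt (?a / (?a + ?b))"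
    define s where "s = sqrt (?b / (?a + ?b))"
    have c2: "c\<^sup>2 = ?a / (?a + ?b)" and s2: "s\<^sup>2 = ?b / (?a + ?b)" using ab by (simp_all add: c_def s_def)
    then have cs: "c\<^sup>2 + s\<^sup>2 = 1" using pos by (simp flip: add_divide_distrib)
    have "norm (A 1 j) = sqrt (?a * ?b)"
      using PM_norm_entry[OF A, of 1 j] j n2 by (metis norm_ge_zero real_sqrt_abs abs_of_nonneg order.trans one_le_numeral)
    then have re: "oct_re (G A 1 j) = sqrt (?a * ?b)" using G(3)[OF A] u(3) by (simp add: oct_re_scaleR)
    have "c * s = sqrt ((?a * ?b) / (?a + ?b)\<^sup>2)"
      by (simp add: c_def s_def power2_eq_square flip: real_sqrt_mult)
    also have "\<dots> = sqrt (?a * ?b) / (?a + ?b)" using pos by (simp add: real_sqrt_divide)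
    finally have "c * s * sqrt (?a * ?b) = ?a * ?b / (?a + ?b)" using ab by simp
    then have kill: "s\<^sup>2 * ?a - 2 * (c * s) * sqrt (?a * ?b) + c\<^sup>2 * ?b = 0"
      unfolding c2 s2 by (simp only: mult.assoc) (simp add: mult.commute)
    have pq: "1 \<noteq> j" "1 \<le> n" "j \<le> n" using j by auto
    note R = rot_plane_diag[OF pq]
    have GA: "G A \<in> PM" by (rule mat_iso_in[OF G(1) A])
    show ?thesis
    proof (intro exI[of _ "\<lambda>B. rot (plane_rot 1 j c s) (G B)"] conjI ballI allI impI)
      show "mat_iso (\<lambda>B. rot (plane_rot 1 j c s) (G B))"
        by (rule mat_iso_comp[OF mat_iso_rot[OF plane_rot_orthogonal[OF pq cs]] G(1)])
      show "diag_re (rot (plane_rot 1 j c s) (G B)) 0 = diag_re B 0" if "B \<in> PM" for B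
        using R[OF mat_iso_in[OF G(1) that], of 0] j G(2)[OF that] by simp
      show "diag_re (rot (plane_rot 1 j c s) (G A)) j = 0"
        using R[OF GA, of j] j kill by (simp add: re G(2)[OF A] del: One_nat_def)
      show "diag_re (rot (plane_rot 1 j c s) (G A)) i = diag_re A i" if "i \<le> n" "i \<noteq> 1" "i \<noteq> j" for i
        using R[OF GA, of i] that by (simp add: G(2)[OF A])
    qed
  qed
qed

lemma eliminate_diags:
  assumes A: "A \<in> PM" and m: "m \<le> n"
  shows "\<exists>G. mat_iso G \<and> (\<forall>B\<in>PM. diag_re (G B) 0 = diag_re B 0) \<and> (\<forall>j. 2 \<le> j \<longrightarrow> j \<le> m \<longrightarrow> diag_re (G A) j = 0)"
  using m
proof (induction m)
  case 0
  show ?case by (intro exI[of _ "\<lambda>A. A"]) (auto simp: mat_iso_id)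
next
  case (Suc m)
  then obtain G where G: "mat_iso G" "\<And>B. B \<in> PM \<Longrightarrow> diag_re (G B) 0 = diag_re B 0"
    "\<And>j. 2 \<le> j \<Longrightarrow> j \<le> m \<Longrightarrow> diag_re (G A) j = 0" by auto
  show ?case
  proof (cases "2 \<le> Suc m")
    case False
    then show ?thesis using G by (intro exI[of _ G]) auto
  next
    case True
    obtain H where H: "mat_iso H" "\<And>B. B \<in> PM \<Longrightarrow> diag_re (H B) 0 = diag_re B 0"
      "diag_re (H (G A)) (Suc m) = 0"
      "\<And>i. i \<le> n \<Longrightarrow> i \<noteq> 1 \<Longrightarrow> i \<noteq> Suc m \<Longrightarrow> diag_re (H (G A)) i = diag_re (G A) i"
      using eliminate_diag[OF mat_iso_in[OF G(1) A] True Suc.prems] by blast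
    have "diag_re (H (G A)) j = 0" if "2 \<le> j" "j \<le> Suc m" for j
      using H(3,4) G(3)[of j] that Suc.prems by (cases "j = Suc m") auto
    then show ?thesis
      using mat_iso_comp[OF H(1) G(1)] H(2) G(2) mat_iso_in[OF G(1)] by (intro exI[of _ "\<lambda>A. H (G A)"]) auto
  qed
qed

text \<open>A vanishing diagonal entry annihilates its row and column, so only the leading 2 by 2
  block is left. Its trace is 1 and its off-diagonal entry is real and nonnegative, which leaves one
  parameter: the first diagonal entry is cos^2 (s/2).\<close>

lemma PM_eq_M:
  assumes A: "A \<in> PM" and z: "\<And>j. 2 \<le> j \<Longrightarrow> j \<le> n \<Longrightarrow> diag_re A j = 0"
    and r: "A 0 1 = norm (A 0 1) *\<^sub>R oct_one"
  shows "A = M (arccos (2 * diag_re A 0 - 1))"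
proof -
  let ?s = "arccos (2 * diag_re A 0 - 1)"
  have sum: "diag_re A 0 + diag_re A 1 = 1"
  proof -
    have "(\<Sum>i\<le>n. diag_re A i) = (\<Sum>i\<in>{0, 1}. diag_re A i)"
      using n2 z by (intro sum.mono_neutral_right) (auto simp: numeral_2_eq_2 Suc_le_eq not_less le_Suc_eq)
    then show ?thesis using PM_diag_sum[OF A] by simp
  qed
  have b: "0 \<le> diag_re A 0" "0 \<le> diag_re A 1" using PM_diag_nonneg[OF A] by auto
  have cs: "cos ?s = 2 * diag_re A 0 - 1" using b sum by (intro cos_arccos) auto
  have s: "0 \<le> ?s" "?s \<le> pi" using b sum by (auto intro: arccos_lbound arccos_ubound)
  have c2: "(cos (?s/2))\<^sup>2 = diag_re A 0" using cs cos_double_cos[of "?s/2"] by simp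
  have s2: "(sin (?s/2))\<^sup>2 = diag_re A 1" using cs cos_double_sin[of "?s/2"] sum by simp
  have nn: "0 \<le> cos (?s/2)" "0 \<le> sin (?s/2)" using s by (auto intro!: cos_ge_zero sin_ge_zero)
  have "(norm (A 0 1))\<^sup>2 = (cos (?s/2) * sin (?s/2))\<^sup>2"
    using PM_norm_entry[OF A, of 0 1] n2 by (simp add: power_mult_distrib c2 s2)
  then have nrm: "norm (A 0 1) = cos (?s/2) * sin (?s/2)" using nn by (simp add: power2_eq_iff_nonneg)
  have e01: "A 0 1 = (cos (?s/2) * sin (?s/2)) *\<^sub>R oct_one" using r nrm by simp
  have e10: "A 1 0 = (cos (?s/2) * sin (?s/2)) *\<^sub>R oct_one"
    using PM_herm[OF A, of 0 1] e01 by (simp add: oct_cnj_scaleR)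
  have zero: "A i j = 0" if "2 \<le> i \<or> 2 \<le> j" for i j
    using that z PM_zero_entry[OF A, of i j] PM_outside[OF A, of i j] by (meson not_less)
  show ?thesis
  proof (intro ext)
    fix i j :: nat
    consider "2 \<le> i \<or> 2 \<le> j" | "i = 0" "j = 0" | "i = 0" "j = 1" | "i = 1" "j = 0" | "i = 1" "j = 1" by linarith
    then show "A i j = M ?s i j"
    proof cases
      case 1 then show ?thesis by (auto simp: zero M_def M_vec_def)
    next
      case 2 then show ?thesis using PM_diag[OF A, of 0] c2 by (simp add: M_def M_vec_def power2_eq_square)
    next
      case 3 then show ?thesis using e01 by (simp add: M_def M_vec_def)
    next
      case 4 then show ?thesis using e10 by (simp add: M_def M_vec_def mult.commute)
    next
      case 5 then show ?thesis using PM_diag[OF A, of 1] s2 by (simp add: M_def M_vec_def power2_eq_square)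
    qed
  qed
qed

lemma PM_eq_M0:
  assumes A: "A \<in> PM" and "diag_re A 0 = 1"
  shows "A = M 0"
proof -
  have "(\<Sum>i\<in>{..n} - {0}. diag_re A i) = 0"
    using PM_diag_sum[OF A] assms(2) by (subst sum_diff1) auto
  then have z: "diag_re A j = 0" if "1 \<le> j" "j \<le> n" for j
    using that by (subst (asm) sum_nonneg_eq_0_iff) (auto simp: PM_diag_nonneg[OF A])
  have "A 0 1 = 0" using z[of 1] n2 by (intro PM_zero_entry[OF A]) auto
  then show ?thesis using PM_eq_M[OF A] z assms(2) by simp
qed

lemma diag_M: "diag_re (M s) 0 = (cos (s/2))\<^sup>2" "diag_re (M s) 1 = (sin (s/2))\<^sup>2"
  by (simp_all add: diag_re_def M_def M_vec_def oct_re_scaleR power2_eq_square)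

text \<open>All the moves used preserve \<open>diag_re\<close> at 0, and the value 1 there
  characterizes \<open>M 0\<close> by \<open>PM_eq_M0\<close>; hence they fix \<open>M 0\<close>
  while they bring A to the standard circle.\<close>

lemma normal_form:
  assumes A: "A \<in> PM"
  shows "\<exists>G. mat_iso G \<and> G (M 0) = M 0 \<and> G A = M (arccos (2 * diag_re A 0 - 1))"
proof -
  obtain G where G: "mat_iso G" "\<And>B. B \<in> PM \<Longrightarrow> diag_re (G B) 0 = diag_re B 0"
    "\<And>j. 2 \<le> j \<Longrightarrow> j \<le> n \<Longrightarrow> diag_re (G A) j = 0"
    using eliminate_diags[OF A order.refl] by blast
  have GA: "G A \<in> PM" by (rule mat_iso_in[OF G(1) A])
  obtain u where u: "u \<in> K" "norm u = 1" "oct_mult u (G A 0 1) = norm (G A 0 1) *\<^sub>R oct_one"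
    using make_real[OF PM_entry[OF GA]] by metis
  obtain H where H: "mat_iso H" "\<And>B i. B \<in> PM \<Longrightarrow> diag_re (H B) i = diag_re B i"
      "\<And>B. B \<in> PM \<Longrightarrow> H B 0 1 = oct_mult u (B 0 1)"
    using phase_left[OF u(1,2)] by blast
  have HGA: "H (G A) \<in> PM" by (rule mat_iso_in[OF H(1) GA])
  show ?thesis
  proof (intro exI[of _ "\<lambda>A. H (G A)"] conjI mat_iso_comp[OF H(1) G(1)])
    have GM: "G (M 0) \<in> PM" by (rule mat_iso_in[OF G(1) M_in_PM])
    show "H (G (M 0)) = M 0"
      by (intro PM_eq_M0 mat_iso_in[OF H(1) GM]) (simp add: H(2)[OF GM] G(2)[OF M_in_PM] diag_M)
    have "H (G A) = M (arccos (2 * diag_re (H (G A)) 0 - 1))"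
    proof (rule PM_eq_M[OF HGA])
      show "diag_re (H (G A)) j = 0" if "2 \<le> j" "j \<le> n" for j using that by (simp add: H(2)[OF GA] G)
      show "H (G A) 0 1 = norm (H (G A) 0 1) *\<^sub>R oct_one"
        unfolding H(3)[OF GA] u(3) by simp
    qed
    then show "H (G A) = M (arccos (2 * diag_re A 0 - 1))" by (simp add: H(2)[OF GA] G(2)[OF A])
  qed
qed

text \<open>After \<open>normal_form\<close> the point is some \<open>M s\<close>, and the rotation
  through s/2 in the first two coordinates takes it to \<open>M 0\<close>.\<close>

lemma transitive:
  assumes A: "A \<in> PM"
  shows "\<exists>G. mat_iso G \<and> G A = M 0"
proof -
  obtain G s where G: "mat_iso G" "G A = M s" using normal_form[OF A] by blast
  define c where "c = cos (s/2)"
  define d where "d = sin (s/2)"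
  have cd: "c\<^sup>2 + d\<^sup>2 = 1" by (simp add: c_def d_def)
  have pq: "(0::nat) \<noteq> 1" "0 \<le> n" "1 \<le> n" using n2 by auto
  have iso: "mat_iso (rot (plane_rot 0 1 c d))" by (intro mat_iso_rot plane_rot_orthogonal pq cd)
  have "oct_re (M s 0 1) = c * d" by (simp add: M_def M_vec_def oct_re_scaleR c_def d_def)
  then have "diag_re (rot (plane_rot 0 1 c d) (M s)) 0 = c\<^sup>2 * c\<^sup>2 + 2 * (c * d) * (c * d) + d\<^sup>2 * d\<^sup>2"
    using rot_plane_diag[OF pq M_in_PM, of 0 c d s] by (simp add: diag_M[of s, folded c_def d_def] del: One_nat_def)
  also have "\<dots> = (c\<^sup>2 + d\<^sup>2)\<^sup>2" by (simp add: power2_eq_square algebra_simps)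
  finally have "rot (plane_rot 0 1 c d) (M s) = M 0"
    using cd by (intro PM_eq_M0 mat_iso_in[OF iso M_in_PM]) simp
  then show ?thesis
    using G by (intro exI[of _ "\<lambda>A. rot (plane_rot 0 1 c d) (G A)"] conjI mat_iso_comp[OF iso G(1)]) auto
qed

lemma mat_inner_M0: "A \<in> PM \<Longrightarrow> mat_inner n (M 0) A = diag_re A 0"
  using mat_inner_M[of A 0] by (simp add: mat_inner_def inner_commute)

theorem two_point_homogeneous:
  assumes A: "A \<in> PM" and B: "B \<in> PM"
  shows "\<exists>G. mat_iso G \<and> G A = M 0 \<and> G B = M (arccos (2 * mat_inner n A B - 1))"
proof -
  obtain G where G: "mat_iso G" "G A = M 0" using transitive[OF A] by blast
  have GB: "G B \<in> PM" by (rule mat_iso_in[OF G(1) B])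
  obtain H where H: "mat_iso H" "H (M 0) = M 0" "H (G B) = M (arccos (2 * diag_re (G B) 0 - 1))"
    using normal_form[OF GB] by blast
  have "diag_re (G B) 0 = mat_inner n A B"
    using mat_iso_inner[OF G(1) A B] G(2) mat_inner_M0[OF GB] by simp
  then show ?thesis using G H
    by (intro exI[of _ "\<lambda>A. H (G A)"] conjI mat_iso_comp[OF H(1) G(1)]) auto
qed

lemma PM_diag_le_1: "A \<in> PM \<Longrightarrow> i \<le> n \<Longrightarrow> diag_re A i \<le> 1"
  using member_le_sum[of i "{..n}" "diag_re A"] PM_diag_nonneg[of A] PM_diag_sum[of A] by auto

lemma mat_inner_bounds:
  assumes A: "A \<in> PM" and B: "B \<in> PM"
  shows "0 \<le> mat_inner n A B" "mat_inner n A B \<le> 1"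
proof -
  obtain G where G: "mat_iso G" "G A = M 0" using transitive[OF A] by blast
  have GB: "G B \<in> PM" by (rule mat_iso_in[OF G(1) B])
  have "mat_inner n A B = diag_re (G B) 0"
    using mat_iso_inner[OF G(1) A B] G(2) mat_inner_M0[OF GB] by simp
  then show "0 \<le> mat_inner n A B" "mat_inner n A B \<le> 1"
    using PM_diag_nonneg[OF GB] PM_diag_le_1[OF GB] by auto
qed

text \<open>A quarter turn in the coordinates 1 and j. It shows that the diagonal entries 1, ..., n
  have equal means against every function of entry 0.\<close>

lemma swap_diag:
  assumes "1 \<le> j" "j \<le> n"
  shows "\<exists>G. mat_iso G \<and> (\<forall>B\<in>PM. diag_re (G B) 0 = diag_re B 0 \<and> diag_re (G B) 1 = diag_re B j)"
proof (cases "j = 1")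
  case True
  then show ?thesis by (intro exI[of _ "\<lambda>A. A"]) (simp add: mat_iso_id)
next
  case False
  then have pq: "1 \<noteq> j" "1 \<le> n" "j \<le> n" using assms n2 by auto
  show ?thesis
    by (intro exI[of _ "rot (plane_rot 1 j 0 1)"] conjI mat_iso_rot plane_rot_orthogonal pq ballI)
       (use assms pq in \<open>auto simp: rot_plane_diag[OF pq] simp del: One_nat_def\<close>)
qed

end

section \<open>Zonal spaces\<close>

text \<open>
  All that is used about the geometry: \<open>cos \<theta>\<close> is affine in the inner product, the circle
  \<open>Y s = P + cos s R + sin s S\<close> is a geodesic, and the averages over the stabilizer of \<open>Y 0\<close> of
  the first two derivatives of \<open>cos (\<theta> z (Y s))\<close> at \<open>s = 0\<close> are known.
\<close>

locale zonal_space = prob_space \<mu> for \<mu> :: "'a::euclidean_space measure" +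
  fixes \<theta> :: "'a \<Rightarrow> 'a \<Rightarrow> real" and d d0 :: nat and \<alpha> \<beta> :: real and P R S :: 'a
  assumes sets_\<mu>: "sets \<mu> = sets (restrict_space borel (space \<mu>))"
    and d0: "1 \<le> d0" "d0 \<le> d"
    and \<alpha>_pos: "0 < \<alpha>"
    and cos_theta: "x \<in> space \<mu> \<Longrightarrow> y \<in> space \<mu> \<Longrightarrow> cos (\<theta> x y) = \<alpha> * (x \<bullet> y) + \<beta>"
    and theta_range: "x \<in> space \<mu> \<Longrightarrow> y \<in> space \<mu> \<Longrightarrow> 0 \<le> \<theta> x y \<and> \<theta> x y \<le> pi"
    and theta_refl: "x \<in> space \<mu> \<Longrightarrow> \<theta> x x = 0"
    and Y_in: "P + cos s *\<^sub>R R + sin s *\<^sub>R S \<in> space \<mu>"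
    and cos_Y: "\<alpha> * ((P + cos s *\<^sub>R R + sin s *\<^sub>R S) \<bullet> (P + cos t *\<^sub>R R + sin t *\<^sub>R S)) + \<beta> = cos (s - t)"
    and homogeneous: "x \<in> space \<mu> \<Longrightarrow> y \<in> space \<mu> \<Longrightarrow> \<exists>g. g \<in> measurable \<mu> \<mu> \<and> distr \<mu> \<mu> g = \<mu> \<and>
       (\<forall>u\<in>space \<mu>. \<forall>v\<in>space \<mu>. g u \<bullet> g v = u \<bullet> v) \<and>
       g x = P + R \<and> g y = P + cos (\<theta> x y) *\<^sub>R R + sin (\<theta> x y) *\<^sub>R S"
    and average_S: "(\<integral>z. poly p (\<alpha> * ((P + R) \<bullet> z) + \<beta>) * (\<alpha> * (S \<bullet> z))\<^sup>2 \<partial>\<mu>) =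
       (\<integral>z. poly p (\<alpha> * ((P + R) \<bullet> z) + \<beta>) * (1 - (\<alpha> * ((P + R) \<bullet> z) + \<beta>)\<^sup>2) \<partial>\<mu>) / real d"
    and average_R: "(\<integral>z. poly p (\<alpha> * ((P + R) \<bullet> z) + \<beta>) * (\<alpha> * (R \<bullet> z)) \<partial>\<mu>) =
       (\<integral>z. poly p (\<alpha> * ((P + R) \<bullet> z) + \<beta>) * ((1 + (\<alpha> * ((P + R) \<bullet> z) + \<beta>)) / 2
           - (1 - (\<alpha> * ((P + R) \<bullet> z) + \<beta>)) * real d0 / (2 * real d)) \<partial>\<mu>)"

lemma space_restrict_borel_eq:
  assumes "sets \<mu> = sets (restrict_space borel Q)" shows "space \<mu> = Q"
  using sets_eq_imp_space_eq[OF assms] by (simp add: space_restrict_space)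

text \<open>Invariance is given for images, whereas \<open>distr\<close> needs preimages: a preimage
  is the image under the inverse, again an isometry. The hypothesis on the Euclidean distance
  supplies continuity and thereby measurability.\<close>

lemma isometry_preserves_measure:
  fixes \<mu> :: "'a::euclidean_space measure"
  assumes inv: "invariant_measure Q \<theta> \<mu>" and iso: "isometry_of Q \<theta> g"
    and dist: "\<And>u v. u \<in> Q \<Longrightarrow> v \<in> Q \<Longrightarrow> dist (g u) (g v) = dist u v"
  shows "g \<in> measurable \<mu> \<mu>" "distr \<mu> \<mu> g = \<mu>"
proof -
  interpret prob_space \<mu> using inv by (simp add: invariant_measure_def)
  have sets: "sets \<mu> = sets (restrict_space borel Q)" using inv by (simp add: invariant_measure_def)
  have sp: "space \<mu> = Q" by (rule space_restrict_borel_eq[OF sets])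
  have bij: "bij_betw g Q Q" using iso by (simp add: isometry_of_def)
  have "continuous_on Q g"
    unfolding continuous_on_iff using dist by metis
  then have "g \<in> measurable (restrict_space borel Q) borel"
    by (rule borel_measurable_continuous_on_restrict)
  then have "g \<in> measurable (restrict_space borel Q) (restrict_space borel Q)"
    using bij by (intro measurable_restrict_space2) (auto simp: space_restrict_space bij_betw_def)
  then show meas: "g \<in> measurable \<mu> \<mu>" by (simp cong: measurable_cong_sets add: sets)
  let ?g = "inv_into Q g"
  have iso': "isometry_of Q \<theta> ?g"
    unfolding isometry_of_def
  proof (intro conjI ballI)
    show "bij_betw ?g Q Q" by (rule bij_betw_inv_into[OF bij])
    fix x y assume "x \<in> Q" "y \<in> Q"
    then have "?g x \<in> Q" "?g y \<in> Q" "g (?g x) = x" "g (?g y) = y"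
      using bij by (auto simp: bij_betw_def inv_into_into f_inv_into_f)
    then show "\<theta> (?g x) (?g y) = \<theta> x y" using iso by (metis isometry_of_def)
  qed
  show "distr \<mu> \<mu> g = \<mu>"
  proof (rule measure_eqI)
    fix A assume "A \<in> sets (distr \<mu> \<mu> g)"
    then have A: "A \<in> sets \<mu>" by simp
    then have "A \<subseteq> Q" using sets.sets_into_space sp by blast
    have "g -` A \<inter> space \<mu> = ?g ` A"
    proof (intro set_eqI iffI)
      fix x assume "x \<in> g -` A \<inter> space \<mu>"
      then have "g x \<in> A" "?g (g x) = x" using bij unfolding sp bij_betw_def by (auto simp: inv_into_f_f)
      then show "x \<in> ?g ` A" by (metis imageI)
    next
      fix x assume "x \<in> ?g ` A"
      with \<open>A \<subseteq> Q\<close> bij show "x \<in> g -` A \<inter> space \<mu>"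
        unfolding sp bij_betw_def by (auto simp: inv_into_into f_inv_into_f)
    qed
    then have "measure (distr \<mu> \<mu> g) A = measure \<mu> (?g ` A)"
      using A meas by (simp add: measure_distr)
    also have "\<dots> = measure \<mu> A" using inv iso' A by (auto simp: invariant_measure_def)
    finally show "emeasure (distr \<mu> \<mu> g) A = emeasure \<mu> A"
      using prob_space_distr[OF meas] by (simp add: emeasure_eq_measure finite_measure.emeasure_eq_measure prob_space.finite_measure)
  qed simp
qed

lemma integral_isometry:
  fixes F :: "'a \<Rightarrow> real"
  assumes "g \<in> measurable \<mu> \<mu>" "distr \<mu> \<mu> g = \<mu>" "F \<in> borel_measurable \<mu>"
  shows "(\<integral>z. F (g z) \<partial>\<mu>) = (\<integral>z. F z \<partial>\<mu>)"
  using integral_distr[OF assms(1), of F] assms by simp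

lemma borel_measurable_restrict_sets:
  assumes "sets \<mu> = sets (restrict_space borel Q)" "F \<in> borel_measurable borel"
  shows "F \<in> borel_measurable \<mu>"
proof -
  have "F \<in> borel_measurable (restrict_space borel Q)"
    using assms(2) by (rule measurable_restrict_space1)
  then show ?thesis by (simp cong: measurable_cong_sets add: assms(1))
qed

lemma integrable_continuous_bounded_support:
  fixes F :: "'a::euclidean_space \<Rightarrow> real"
  assumes "finite_measure \<mu>" "sets \<mu> = sets (restrict_space borel Q)" "Q \<subseteq> cball 0 B" "continuous_on UNIV F"
  shows "integrable \<mu> F"
proof -
  interpret finite_measure \<mu> by fact
  have "bounded (F ` cball 0 B)"
    by (intro compact_imp_bounded compact_continuous_image continuous_on_subset[OF assms(4)]) auto
  then obtain C where C: "\<And>x. x \<in> cball 0 B \<Longrightarrow> norm (F x) \<le> C" unfolding bounded_iff by fastforce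
  show ?thesis
  proof (rule integrable_const_bound[of _ C])
    show "AE x in \<mu>. norm (F x) \<le> C"
      using C assms(3) space_restrict_borel_eq[OF assms(2)] by (intro AE_I2) auto
  qed (intro borel_measurable_restrict_sets[OF assms(2)] borel_measurable_continuous_onI assms(4))
qed

text \<open>Here P = 0 and R, S are two basis vectors. Reflections suffice: two of them move any
  pair of points to standard position, and one exchanges two coordinates orthogonal to R. For
  \<open>d0\<close> = d the identity for R reduces to (1 + c)/2 - (1 - c)/2 = c.\<close>

lemma sphere_zonal_space:
  fixes Q :: "'a::euclidean_space set"
  assumes Q: "sphere_space Q \<theta> d d0" and inv: "invariant_measure Q \<theta> \<mu>"
  shows "\<exists>\<alpha> \<beta> P R S. zonal_space \<mu> \<theta> d d0 \<alpha> \<beta> P R S"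
proof -
  have d: "1 \<le> d" "d0 = d" "DIM('a) = d + 1" and Qs: "Q = sphere 0 1"
    and th: "\<And>x y. x \<in> Q \<Longrightarrow> y \<in> Q \<Longrightarrow> \<theta> x y = arccos (x \<bullet> y)"
    using Q by (auto simp: sphere_space_def)
  interpret prob_space \<mu> using inv by (simp add: invariant_measure_def)
  have sets: "sets \<mu> = sets (restrict_space borel Q)" using inv by (simp add: invariant_measure_def)
  have sp: "space \<mu> = Q" by (rule space_restrict_borel_eq[OF sets])
  obtain b0 :: 'a where b0: "b0 \<in> Basis" using nonempty_Basis by blast
  have "card (Basis - {b0}) = d" using d(3) b0 by simp
  then have "Basis - {b0} \<noteq> {}" using d(1) by force
  then obtain b1 where b1: "b1 \<in> Basis" "b1 \<noteq> b0" by blast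
  have ip: "b0 \<bullet> b0 = 1" "b1 \<bullet> b1 = 1" "b0 \<bullet> b1 = 0" "b1 \<bullet> b0 = 0"
    using b0 b1 by (auto simp: inner_Basis)
  define refl where "refl v z = z - (2 * (z \<bullet> v) / (v \<bullet> v)) *\<^sub>R v" for v z :: 'a
  have refl_ip: "refl v x \<bullet> refl v y = x \<bullet> y" for v x y
    by (cases "v = 0") (auto simp: refl_def inner_diff inner_commute algebra_simps power2_eq_square)
  have refl_refl: "refl v (refl v x) = x" for v x
    by (cases "v = 0") (auto simp: refl_def inner_diff algebra_simps)
  have refl_swap: "refl (x - y) x = y" if "x \<bullet> x = y \<bullet> y" for x y
  proof (cases "x = y")
    case False
    have "2 * (x \<bullet> (x - y)) = (x - y) \<bullet> (x - y)"
      using that by (simp add: inner_diff inner_commute)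
    moreover have "(x - y) \<bullet> (x - y) \<noteq> 0" using False by simp
    ultimately show ?thesis by (simp add: refl_def)
  qed (simp add: refl_def)
  have refl_fix: "refl v x = x" if "x \<bullet> v = 0" for v x using that by (simp add: refl_def)
  have refl_in: "refl v x \<in> Q" if "x \<in> Q" for v x
    using that refl_ip[of v x x] by (simp add: Qs norm_eq_sqrt_inner)
  have refl_bij: "bij_betw (refl v) Q Q" for v
    by (rule bij_betw_byWitness[of _ "refl v"]) (auto simp: refl_refl refl_in)
  have refl_iso: "isometry_of Q \<theta> (refl v)" for v
    unfolding isometry_of_def using refl_bij[of v] refl_in th refl_ip by auto
  have refl_dist: "dist (refl v x) (refl v y) = dist x y" for v x y
  proof -
    have "refl v x - refl v y = refl v (x - y)" by (simp add: refl_def inner_diff_left algebra_simps diff_divide_distrib)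
    then show ?thesis by (simp add: dist_norm norm_eq_sqrt_inner refl_ip)
  qed
  note refl_meas = isometry_preserves_measure[OF inv refl_iso refl_dist]
  have int: "integrable \<mu> F" if "continuous_on UNIV F" for F :: "'a \<Rightarrow> real"
    by (rule integrable_continuous_bounded_support[OF _ sets _ that, of 1]) (auto simp: Qs finite_measure_axioms)
  have meas: "F \<in> borel_measurable \<mu>" if "continuous_on UNIV F" for F :: "'a \<Rightarrow> real"
    by (intro borel_measurable_restrict_sets[OF sets] borel_measurable_continuous_onI that)
  have "zonal_space \<mu> \<theta> d d0 1 0 0 b0 b1"
  proof (unfold_locales, unfold sp)
    show "sets \<mu> = sets (restrict_space borel Q)" by (rule sets)
    show "1 \<le> d0" "d0 \<le> d" using d by auto
    fix x y assume xy: "x \<in> Q" "y \<in> Q"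
    have b: "\<bar>x \<bullet> y\<bar> \<le> 1" using Cauchy_Schwarz_ineq2[of x y] xy by (simp add: Qs)
    then show "cos (\<theta> x y) = 1 * (x \<bullet> y) + 0" using xy by (simp add: th)
    show "0 \<le> \<theta> x y \<and> \<theta> x y \<le> pi" using b by (simp add: th xy arccos_lbound arccos_ubound)
    define w where "w = cos (\<theta> x y) *\<^sub>R b0 + sin (\<theta> x y) *\<^sub>R b1"
    define x' where "x' = refl (x - b0) y"
    have xx: "x \<bullet> x = 1" "y \<bullet> y = 1" using xy by (auto simp: Qs norm_eq_sqrt_inner)
    have e1: "refl (x - b0) x = b0" by (rule refl_swap) (simp add: xx ip)
    have w1: "w \<bullet> w = 1" by (simp add: w_def inner_add ip flip: power2_eq_square)
    have x'1: "x' \<bullet> x' = 1" unfolding x'_def refl_ip by (rule xx)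
    \<comment> \<open>The image x' of y and its target w have the same inner product with b0. The
      reflection that exchanges them therefore fixes b0, where the first reflection has put
      x.\<close>
    have "b0 \<bullet> x' = x \<bullet> y" unfolding x'_def by (subst e1[symmetric]) (rule refl_ip)
    moreover have "b0 \<bullet> w = x \<bullet> y" using b xy by (simp add: w_def inner_add ip th)
    ultimately have "b0 \<bullet> (x' - w) = 0" by (simp add: inner_diff)
    then have e2: "refl (x' - w) b0 = b0" by (rule refl_fix)
    have e3: "refl (x' - w) x' = w" by (rule refl_swap) (simp add: w1 x'1)
    let ?g = "\<lambda>z. refl (x' - w) (refl (x - b0) z)"
    have m: "?g \<in> measurable \<mu> \<mu>" by (rule measurable_compose[OF refl_meas(1) refl_meas(1)])
    have "distr \<mu> \<mu> ?g = distr (distr \<mu> \<mu> (refl (x - b0))) \<mu> (refl (x' - w))"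
      by (subst distr_distr[OF refl_meas(1) refl_meas(1)]) (simp add: comp_def)
    then have "distr \<mu> \<mu> ?g = \<mu>" by (simp add: refl_meas(2))
    with m e1 e2 e3 show "\<exists>g. g \<in> measurable \<mu> \<mu> \<and> distr \<mu> \<mu> g = \<mu> \<and> (\<forall>u\<in>Q. \<forall>v\<in>Q. g u \<bullet> g v = u \<bullet> v) \<and>
       g x = 0 + b0 \<and> g y = 0 + cos (\<theta> x y) *\<^sub>R b0 + sin (\<theta> x y) *\<^sub>R b1"
      by (intro exI[of _ ?g]) (auto simp: refl_ip x'_def w_def)
  next
    fix x assume "x \<in> Q"
    then show "\<theta> x x = 0" by (simp add: th Qs norm_eq_1)
  next
    fix s t :: real
    have "norm (cos s *\<^sub>R b0 + sin s *\<^sub>R b1) = 1"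
      by (simp add: norm_eq_sqrt_inner inner_add ip flip: power2_eq_square)
    then show "0 + cos s *\<^sub>R b0 + sin s *\<^sub>R b1 \<in> Q" by (simp add: Qs)
    show "1 * ((0 + cos s *\<^sub>R b0 + sin s *\<^sub>R b1) \<bullet> (0 + cos t *\<^sub>R b0 + sin t *\<^sub>R b1)) + 0 = cos (s - t)"
      by (simp add: inner_add ip cos_diff)
  next
    fix p :: "real poly"
    let ?F = "\<lambda>b z. poly p (b0 \<bullet> z) * (b \<bullet> z)\<^sup>2"
    \<comment> \<open>Second moments in all directions orthogonal to b0 agree, and the squares of
      these coordinates sum to 1 - (b0 . z)^2; this produces the divisor d.\<close>
    have eq: "(\<integral>z. ?F b z \<partial>\<mu>) = (\<integral>z. ?F b1 z \<partial>\<mu>)" if b: "b \<in> Basis - {b0}" for b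
    proof -
      have bb: "b0 \<bullet> (b1 - b) = 0" using b b0 b1 by (auto simp: inner_diff inner_Basis)
      have bs: "refl (b1 - b) b1 = b" by (rule refl_swap) (use b b1 in \<open>auto simp: inner_Basis\<close>)
      have "?F b (refl (b1 - b) z) = ?F b1 z" for z
        using refl_ip[of "b1 - b" b0 z] refl_ip[of "b1 - b" b1 z] by (simp add: refl_fix[OF bb] bs)
      then have "(\<integral>z. ?F b1 z \<partial>\<mu>) = (\<integral>z. ?F b (refl (b1 - b) z) \<partial>\<mu>)" by simp
      also have "\<dots> = (\<integral>z. ?F b z \<partial>\<mu>)"
        by (intro integral_isometry refl_meas meas continuous_intros)
      finally show ?thesis by simp
    qed
    have "real d * (\<integral>z. ?F b1 z \<partial>\<mu>) = (\<Sum>b\<in>Basis - {b0}. \<integral>z. ?F b z \<partial>\<mu>)"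
      using eq \<open>card (Basis - {b0}) = d\<close> by simp
    also have "\<dots> = (\<integral>z. (\<Sum>b\<in>Basis - {b0}. ?F b z) \<partial>\<mu>)"
      by (intro Bochner_Integration.integral_sum[symmetric] int continuous_intros)
    also have "\<dots> = (\<integral>z. poly p (b0 \<bullet> z) * (1 - (b0 \<bullet> z)\<^sup>2) \<partial>\<mu>)"
    proof (rule Bochner_Integration.integral_cong[OF refl])
      fix z assume "z \<in> space \<mu>"
      then have "1 = z \<bullet> z" by (simp add: sp Qs norm_eq_1)
      also have "\<dots> = (\<Sum>b\<in>Basis. (b \<bullet> z)\<^sup>2)" by (subst euclidean_inner) (simp add: power2_eq_square inner_commute)
      also have "\<dots> = (b0 \<bullet> z)\<^sup>2 + (\<Sum>b\<in>Basis - {b0}. (b \<bullet> z)\<^sup>2)" by (rule sum.remove) (use b0 in auto)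
      finally show "(\<Sum>b\<in>Basis - {b0}. ?F b z) = poly p (b0 \<bullet> z) * (1 - (b0 \<bullet> z)\<^sup>2)"
        by (simp flip: sum_distrib_left)
    qed
    finally show "(\<integral>z. poly p (1 * ((0 + b0) \<bullet> z) + 0) * (1 * (b1 \<bullet> z))\<^sup>2 \<partial>\<mu>) =
       (\<integral>z. poly p (1 * ((0 + b0) \<bullet> z) + 0) * (1 - (1 * ((0 + b0) \<bullet> z) + 0)\<^sup>2) \<partial>\<mu>) / real d"
      using d by (simp add: field_simps)
    show "(\<integral>z. poly p (1 * ((0 + b0) \<bullet> z) + 0) * (1 * (b0 \<bullet> z)) \<partial>\<mu>) =
       (\<integral>z. poly p (1 * ((0 + b0) \<bullet> z) + 0) * ((1 + (1 * ((0 + b0) \<bullet> z) + 0)) / 2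
           - (1 - (1 * ((0 + b0) \<bullet> z) + 0)) * real d0 / (2 * real d)) \<partial>\<mu>)"
      using d by (intro Bochner_Integration.integral_cong refl) (simp add: field_simps)
  qed simp
  then show ?thesis by blast
qed

text \<open>The constants 2 and -1 come from cos \<theta> = 1 - 2 sin^2 (\<theta>/2) = 1 - |A -
  B|^2, which is 2 <A, B> - 1 because projections have norm 1. The two moment identities follow from
  the symmetry of the diagonal entries under \<open>swap_diag\<close> and of the coordinates of one
  entry under \<open>phase_left\<close>.\<close>

lemma projective_zonal_space:
  fixes Q :: "'a::euclidean_space set"
  assumes Q: "projective_space Q \<theta> d d0" and inv: "invariant_measure Q \<theta> \<mu>"
  shows "\<exists>\<alpha> \<beta> P R S. zonal_space \<mu> \<theta> d d0 \<alpha> \<beta> P R S"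
proof -
  obtain n and h :: "'a \<Rightarrow> oct_matrix" where n: "2 \<le> n" and d0: "d0 \<in> {1, 2, 4, 8}"
    and oct: "d0 = 8 \<longrightarrow> n = 2" and d: "d = n * d0"
    and lin: "\<And>i j. linear (\<lambda>x. h x i j)" and bij: "bij_betw h UNIV (hermitian_matrices n d0)"
    and nrm: "\<And>x. norm x = matrix_norm n (h x)"
    and Q_eq: "Q = {x. h x \<in> projective_matrices n d0}"
    and th: "\<And>x y. x \<in> Q \<Longrightarrow> y \<in> Q \<Longrightarrow> \<theta> x y = 2 * arcsin (matrix_norm n (\<lambda>i j. h x i j - h y i j) / sqrt 2)"
    using Q unfolding projective_space_def by blast
  interpret projective n d0 using n d0 oct by unfold_locales
  interpret prob_space \<mu> using inv by (simp add: invariant_measure_def)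
  have sets: "sets \<mu> = sets (restrict_space borel Q)" using inv by (simp add: invariant_measure_def)
  have sp: "space \<mu> = Q" by (rule space_restrict_borel_eq[OF sets])
  have hQ: "x \<in> Q \<longleftrightarrow> h x \<in> PM" for x by (simp add: Q_eq)
  have h_add: "h (x + y) i j = h x i j + h y i j" and h_diff: "h (x - y) i j = h x i j - h y i j"
    and h_scale: "h (r *\<^sub>R x) i j = r *\<^sub>R h x i j" for x y r i j
    using linear_add[OF lin] linear_diff[OF lin] linear_scale[OF lin] by auto
  have ip: "x \<bullet> y = mat_inner n (h x) (h y)" for x y
  proof -
    have "mat_inner n (h (x + y)) (h (x + y)) = mat_inner n (h x) (h x) + 2 * mat_inner n (h x) (h y) + mat_inner n (h y) (h y)"
      by (simp add: mat_inner_def h_add inner_add inner_commute sum.distrib sum_distrib_left)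
    then show ?thesis
      unfolding dot_norm nrm mat_inner_self[symmetric] by simp
  qed
  define k where "k = inv h"
  have hk: "h (k A) = A" if "A \<in> PM" for A
  proof -
    have "A \<in> range h" using that bij by (auto simp: projective_matrices_def bij_betw_def)
    then show ?thesis by (simp add: k_def f_inv_into_f)
  qed
  have inj: "inj h" using bij by (simp add: bij_betw_def)
  have kh: "k (h x) = x" for x using inj by (simp add: k_def)
  have kQ: "k A \<in> Q" if "A \<in> PM" for A using that by (simp add: hQ hk)
  have bounds: "0 \<le> x \<bullet> y" "x \<bullet> y \<le> 1" if "x \<in> Q" "y \<in> Q" for x y
    using mat_inner_bounds that by (auto simp: ip hQ)
  have mn: "matrix_norm n (\<lambda>i j. h x i j - h y i j) = sqrt (2 - 2 * (x \<bullet> y))" if "x \<in> Q" "y \<in> Q" for x y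
  proof -
    have "(matrix_norm n (\<lambda>i j. h x i j - h y i j))\<^sup>2 = 2 - 2 * (x \<bullet> y)"
      using that by (simp add: matrix_norm_diff mat_inner_PM hQ ip)
    moreover have "0 \<le> matrix_norm n (\<lambda>i j. h x i j - h y i j)"
      unfolding matrix_norm_def by (intro real_sqrt_ge_zero sum_nonneg) auto
    ultimately show ?thesis by (rule real_sqrt_unique[symmetric])
  qed
  have th2: "\<theta> x y = 2 * arcsin (sqrt (1 - x \<bullet> y))" if "x \<in> Q" "y \<in> Q" for x y
  proof -
    have "sqrt (2 - 2 * (x \<bullet> y)) / sqrt 2 = sqrt (1 - x \<bullet> y)"
      by (simp flip: real_sqrt_divide add: diff_divide_distrib)
    then show ?thesis using that by (simp add: th mn)
  qed
  have cos_th: "cos (\<theta> x y) = 2 * (x \<bullet> y) - 1" if "x \<in> Q" "y \<in> Q" for x y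
  proof -
    have "cos (\<theta> x y) = 1 - 2 * (sin (arcsin (sqrt (1 - x \<bullet> y))))\<^sup>2"
      by (simp add: th2 that cos_double_sin)
    also have "sin (arcsin (sqrt (1 - x \<bullet> y))) = sqrt (1 - x \<bullet> y)"
    proof (rule sin_arcsin)
      have "0 \<le> sqrt (1 - x \<bullet> y)" using bounds[OF that] by simp
      then show "-1 \<le> sqrt (1 - x \<bullet> y)" by linarith
      show "sqrt (1 - x \<bullet> y) \<le> 1" using bounds[OF that] by simp
    qed
    finally show ?thesis using bounds[OF that] by simp
  qed
  have th_range: "0 \<le> \<theta> x y" "\<theta> x y \<le> pi" if "x \<in> Q" "y \<in> Q" for x y
  proof -
    have b: "0 \<le> sqrt (1 - x \<bullet> y)" "sqrt (1 - x \<bullet> y) \<le> 1" using bounds[OF that] by auto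
    then have "0 \<le> arcsin (sqrt (1 - x \<bullet> y))" using arcsin_le_arcsin[of 0 "sqrt (1 - x \<bullet> y)"] by simp
    moreover have "arcsin (sqrt (1 - x \<bullet> y)) \<le> pi / 2" using b by (intro arcsin_ubound) linarith+
    ultimately show "0 \<le> \<theta> x y" "\<theta> x y \<le> pi" using that by (auto simp: th2)
  qed
  have iso: "(\<lambda>x. k (G (h x))) \<in> measurable \<mu> \<mu>" "distr \<mu> \<mu> (\<lambda>x. k (G (h x))) = \<mu>"
      "\<forall>u\<in>Q. \<forall>v\<in>Q. k (G (h u)) \<bullet> k (G (h v)) = u \<bullet> v"
    if G: "mat_iso G" for G
  proof -
    let ?g = "\<lambda>x. k (G (h x))"
    have gin: "?g x \<in> Q" if "x \<in> Q" for x using that by (intro kQ mat_iso_in[OF G]) (simp add: hQ)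
    show gip: "\<forall>u\<in>Q. \<forall>v\<in>Q. ?g u \<bullet> ?g v = u \<bullet> v"
      by (auto simp: ip hk mat_iso_in[OF G] hQ mat_iso_inner[OF G])
    have hPM: "bij_betw h Q PM"
      using inj hk by (auto simp: bij_betw_def Q_eq image_iff intro: inj_on_subset) (metis hk)
    have kPM: "bij_betw k PM Q" by (rule bij_betw_byWitness[of _ h]) (auto simp: hk kh kQ hQ)
    have "bij_betw (k \<circ> (G \<circ> h)) Q Q"
      using G by (intro bij_betw_trans[OF bij_betw_trans[OF hPM] kPM]) (simp add: mat_iso_def)
    then have gb: "bij_betw ?g Q Q" by (simp add: comp_def)
    have giso: "isometry_of Q \<theta> ?g"
      unfolding isometry_of_def using gb gip gin by (auto simp: th2)
    have gdist: "dist (?g u) (?g v) = dist u v" if "u \<in> Q" "v \<in> Q" for u v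
    proof -
      have "(dist (?g u) (?g v))\<^sup>2 = (dist u v)\<^sup>2"
        using gip that by (simp add: dist_norm power2_norm_eq_inner inner_diff inner_commute)
      then show ?thesis by (simp add: power2_eq_iff_nonneg)
    qed
    show "?g \<in> measurable \<mu> \<mu>" "distr \<mu> \<mu> ?g = \<mu>"
      by (rule isometry_preserves_measure[OF inv giso gdist]; assumption)+
  qed
  have h_cont: "continuous_on UNIV (\<lambda>x. h x i j)" for i j
    by (rule linear_continuous_on[OF linear_conv_bounded_linear[THEN iffD1, OF lin]])
  have re_cont: "continuous_on UNIV (\<lambda>x. oct_re (h x i j))" for i j
    by (rule continuous_on_compose2[OF linear_continuous_on[OF bounded_linear_oct_re] h_cont]) auto
  have diag_cont: "continuous_on UNIV (\<lambda>x. diag_re (h x) i)" for i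
    unfolding diag_re_def by (rule re_cont)
  have int: "integrable \<mu> F" if "continuous_on UNIV F" for F :: "'a \<Rightarrow> real"
  proof (rule integrable_continuous_bounded_support[OF _ sets _ that, of 1])
    show "Q \<subseteq> cball 0 1"
      by (auto simp: hQ norm_eq_sqrt_inner ip mat_inner_PM)
  qed (rule finite_measure_axioms)
  have meas: "F \<in> borel_measurable \<mu>" if "continuous_on UNIV F" for F :: "'a \<Rightarrow> real"
    by (intro borel_measurable_restrict_sets[OF sets] borel_measurable_continuous_onI that)
  define Y where "Y s = k (M s)" for s
  \<comment> \<open>The matrix \<open>M s\<close> is affine in cos s and sin s. The points at 0 and
    pi are opposite on this circle, so their midpoint is its centre.\<close>
  define P where "P = (1/2) *\<^sub>R (Y 0 + Y pi)"
  define R where "R = (1/2) *\<^sub>R (Y 0 - Y pi)"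
  define S where "S = Y (pi/2) - P"
  have hY: "h (Y s) = M s" for s by (simp add: Y_def hk M_in_PM)
  have YQ: "Y s \<in> Q" for s by (simp add: hQ hY M_in_PM)
  have Y_eq: "P + cos s *\<^sub>R R + sin s *\<^sub>R S = Y s" for s
  proof -
    have "h (P + cos s *\<^sub>R R + sin s *\<^sub>R S) = h (Y s)"
    proof (intro ext)
      fix i j :: nat
      have c: "cos (s/2) * cos (s/2) = (1 + cos s) / 2" and sc: "sin (s/2) * sin (s/2) = (1 - cos s) / 2"
        and s: "cos (s/2) * sin (s/2) = sin s / 2"
        using cos_double_cos[of "s/2"] cos_double_sin[of "s/2"] sin_double[of "s/2"] by (auto simp: power2_eq_square)
      have s4: "cos (pi/4) * cos (pi/4) = 1/2" "sin (pi/4) * sin (pi/4) = 1/2" "cos (pi/4) * sin (pi/4) = 1/2"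
        by (simp_all add: cos_45 sin_45)
      consider "2 \<le> i \<or> 2 \<le> j" | "i = 0" "j = 0" | "i = 0" "j = 1" | "i = 1" "j = 0" | "i = 1" "j = 1" by linarith
      then show "h (P + cos s *\<^sub>R R + sin s *\<^sub>R S) i j = h (Y s) i j"
        by cases (simp_all add: P_def R_def S_def h_add h_diff h_scale hY M_def M_vec_def c sc s s4 mult.commute[of "sin _" "cos _"]
          scaleR_add_left[symmetric] scaleR_diff_left[symmetric] field_simps)
    qed
    then show ?thesis using inj by (simp add: inj_eq)
  qed
  have PR: "P + R = Y 0" using Y_eq[of 0] by simp
  have ip_Y: "Y s \<bullet> z = (cos (s/2))\<^sup>2 * diag_re (h z) 0 + 2 * (cos (s/2) * sin (s/2)) * oct_re (h z 0 1) + (sin (s/2))\<^sup>2 * diag_re (h z) 1"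
    if "z \<in> Q" for s z
    using mat_inner_M[of "h z" s] that unfolding hQ ip[of z "Y s", unfolded hY inner_commute[of z "Y s"], symmetric] by blast
  have c0: "2 * (Y 0 \<bullet> z) + - 1 = 2 * diag_re (h z) 0 - 1" if "z \<in> Q" for z
    using ip_Y[OF that, of 0] by simp
  have Rz: "2 * (R \<bullet> z) = diag_re (h z) 0 - diag_re (h z) 1" if "z \<in> Q" for z
    using ip_Y[OF that, of 0] ip_Y[OF that, of pi] by (simp add: R_def inner_diff)
  have Sz: "2 * (S \<bullet> z) = 2 * oct_re (h z 0 1)" if "z \<in> Q" for z
    using ip_Y[OF that, of 0] ip_Y[OF that, of pi] ip_Y[OF that, of "pi/2"]
    by (simp add: S_def P_def inner_diff inner_add cos_45 sin_45 power_divide field_simps)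
  have dpos: "real d = real n * real d0" "real d > 0" using d n d0 by auto
  \<comment> \<open>The diagonal entries 1, ..., n have equal means against functions of entry 0,
    and they sum to one minus entry 0.\<close>
  have avg1: "(\<integral>z. poly p (2 * diag_re (h z) 0 - 1) * diag_re (h z) 1 * q (diag_re (h z) 0) \<partial>\<mu>)
      = (\<integral>z. poly p (2 * diag_re (h z) 0 - 1) * (1 - diag_re (h z) 0) * q (diag_re (h z) 0) \<partial>\<mu>) / real n"
    if q: "continuous_on UNIV q" for p and q :: "real \<Rightarrow> real"
  proof -
    let ?f = "\<lambda>z. poly p (2 * diag_re (h z) 0 - 1)"
    let ?q = "\<lambda>z. q (diag_re (h z) 0)"
    have qc: "continuous_on UNIV ?q" by (rule continuous_on_compose2[OF q diag_cont]) auto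
    have eq: "(\<integral>z. ?f z * diag_re (h z) j * ?q z \<partial>\<mu>) = (\<integral>z. ?f z * diag_re (h z) 1 * ?q z \<partial>\<mu>)" if j: "j \<in> {1..n}" for j
    proof -
      obtain G where G: "mat_iso G" and G0: "\<And>B. B \<in> PM \<Longrightarrow> diag_re (G B) 0 = diag_re B 0"
          and G1: "\<And>B. B \<in> PM \<Longrightarrow> diag_re (G B) 1 = diag_re B j"
        using swap_diag[of j] j by auto
      have "(\<integral>z. ?f z * diag_re (h z) 1 * ?q z \<partial>\<mu>) =
          (\<integral>z. ?f (k (G (h z))) * diag_re (h (k (G (h z)))) 1 * ?q (k (G (h z))) \<partial>\<mu>)"
        by (rule integral_isometry[OF iso(1,2)[OF G], symmetric]) (intro meas continuous_intros diag_cont qc)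
      also have "\<dots> = (\<integral>z. ?f z * diag_re (h z) j * ?q z \<partial>\<mu>)"
        by (rule Bochner_Integration.integral_cong) (auto simp: sp hQ hk mat_iso_in[OF G] G0 G1 simp del: One_nat_def)
      finally show ?thesis by simp
    qed
    have "real n * (\<integral>z. ?f z * diag_re (h z) 1 * ?q z \<partial>\<mu>) = (\<Sum>j\<in>{1..n}. \<integral>z. ?f z * diag_re (h z) j * ?q z \<partial>\<mu>)"
      by (subst sum.cong[OF refl eq], assumption) simp
    also have "\<dots> = (\<integral>z. (\<Sum>j\<in>{1..n}. ?f z * diag_re (h z) j * ?q z) \<partial>\<mu>)"
      by (intro Bochner_Integration.integral_sum[symmetric] int continuous_intros diag_cont qc)
    also have "\<dots> = (\<integral>z. ?f z * (1 - diag_re (h z) 0) * ?q z \<partial>\<mu>)"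
    proof (rule Bochner_Integration.integral_cong[OF refl])
      fix z assume "z \<in> space \<mu>"
      then have "(\<Sum>i\<le>n. diag_re (h z) i) = 1" by (intro PM_diag_sum) (simp add: sp hQ)
      moreover have "{..n} = insert 0 {1..n}" by auto
      ultimately have "(\<Sum>j\<in>{1..n}. diag_re (h z) j) = 1 - diag_re (h z) 0" by simp
      then show "(\<Sum>j\<in>{1..n}. ?f z * diag_re (h z) j * ?q z) = ?f z * (1 - diag_re (h z) 0) * ?q z"
        by (simp flip: sum_distrib_left sum_distrib_right)
    qed
    finally show ?thesis using n by (simp add: field_simps)
  qed
  \<comment> \<open>The d0 real coordinates of the entry 01 have equal second moments, and their
    squares sum to the product of the diagonal entries 0 and 1 by
    \<open>PM_norm_entry\<close>.\<close>
  have avg2: "(\<integral>z. poly p (2 * diag_re (h z) 0 - 1) * (oct_re (h z 0 1))\<^sup>2 \<partial>\<mu>)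
      = (\<integral>z. poly p (2 * diag_re (h z) 0 - 1) * diag_re (h z) 1 * diag_re (h z) 0 \<partial>\<mu>) / real d0" for p
  proof -
    let ?f = "\<lambda>z. poly p (2 * diag_re (h z) 0 - 1)"
    let ?U = "hypercomplex_units d0"
    have uc: "continuous_on UNIV (\<lambda>z. oct_re (oct_mult u (h z 0 1)))" for u
      by (rule continuous_on_compose2[OF linear_continuous_on[OF
          bounded_linear_compose[OF bounded_linear_oct_re oct_mult.bounded_linear_right]] h_cont]) auto
    have eq: "(\<integral>z. ?f z * (oct_re (oct_mult u (h z 0 1)))\<^sup>2 \<partial>\<mu>) = (\<integral>z. ?f z * (oct_re (h z 0 1))\<^sup>2 \<partial>\<mu>)" if u: "u \<in> ?U" for u
    proof -
      have "u \<in> K" "norm u = 1" using hypercomplex_units(2,3)[OF d0] u by auto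
      then obtain G where G: "mat_iso G" and G0: "\<And>B i. B \<in> PM \<Longrightarrow> diag_re (G B) i = diag_re B i"
          and G1: "\<And>B. B \<in> PM \<Longrightarrow> G B 0 1 = oct_mult u (B 0 1)"
        using phase_left by blast
      have "(\<integral>z. ?f z * (oct_re (h z 0 1))\<^sup>2 \<partial>\<mu>) = (\<integral>z. ?f (k (G (h z))) * (oct_re (h (k (G (h z))) 0 1))\<^sup>2 \<partial>\<mu>)"
        by (rule integral_isometry[OF iso(1,2)[OF G], symmetric]) (intro meas continuous_intros diag_cont re_cont)
      also have "\<dots> = (\<integral>z. ?f z * (oct_re (oct_mult u (h z 0 1)))\<^sup>2 \<partial>\<mu>)"
        by (rule Bochner_Integration.integral_cong) (auto simp: sp hQ hk mat_iso_in[OF G] G0 G1 simp del: One_nat_def)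
      finally show ?thesis by simp
    qed
    have "real d0 * (\<integral>z. ?f z * (oct_re (h z 0 1))\<^sup>2 \<partial>\<mu>) = (\<Sum>u\<in>?U. \<integral>z. ?f z * (oct_re (oct_mult u (h z 0 1)))\<^sup>2 \<partial>\<mu>)"
      using eq hypercomplex_units(1)[OF d0] by simp
    also have "\<dots> = (\<integral>z. (\<Sum>u\<in>?U. ?f z * (oct_re (oct_mult u (h z 0 1)))\<^sup>2) \<partial>\<mu>)"
      by (intro Bochner_Integration.integral_sum[symmetric] int continuous_intros diag_cont uc)
    also have "\<dots> = (\<integral>z. ?f z * diag_re (h z) 1 * diag_re (h z) 0 \<partial>\<mu>)"
    proof (rule Bochner_Integration.integral_cong[OF refl])
      fix z assume "z \<in> space \<mu>"
      then have z: "h z \<in> PM" by (simp add: sp hQ)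
      have "(\<Sum>u\<in>?U. (oct_re (oct_mult u (h z 0 1)))\<^sup>2) = diag_re (h z) 0 * diag_re (h z) 1"
        using hypercomplex_units(4)[OF d0 PM_entry[OF z]] PM_norm_entry[OF z, of 0 1] n by (simp del: One_nat_def)
      then show "(\<Sum>u\<in>?U. ?f z * (oct_re (oct_mult u (h z 0 1)))\<^sup>2) = ?f z * diag_re (h z) 1 * diag_re (h z) 0"
        by (simp add: mult_ac flip: sum_distrib_left)
    qed
    finally show ?thesis using d0 by (auto simp: field_simps)
  qed
  have "zonal_space \<mu> \<theta> d d0 2 (- 1) P R S"
  proof (unfold_locales, unfold sp PR Y_eq)
    show "sets \<mu> = sets (restrict_space borel Q)" by (rule sets)
    show "1 \<le> d0" "d0 \<le> d" using d d0 n by auto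
    fix x y assume xy: "x \<in> Q" "y \<in> Q"
    then show "cos (\<theta> x y) = 2 * (x \<bullet> y) + - 1" by (simp add: cos_th)
    show "0 \<le> \<theta> x y \<and> \<theta> x y \<le> pi" using th_range xy by simp
    obtain G where G: "mat_iso G" "G (h x) = M 0" "G (h y) = M (arccos (2 * mat_inner n (h x) (h y) - 1))"
      using two_point_homogeneous xy by (auto simp: hQ)
    have "arccos (2 * mat_inner n (h x) (h y) - 1) = \<theta> x y"
      using cos_th[OF xy] th_range[OF xy] arccos_cos[of "\<theta> x y"] by (simp add: ip)
    then show "\<exists>g. g \<in> measurable \<mu> \<mu> \<and> distr \<mu> \<mu> g = \<mu> \<and> (\<forall>u\<in>Q. \<forall>v\<in>Q. g u \<bullet> g v = u \<bullet> v) \<and>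
       g x = Y 0 \<and> g y = Y (\<theta> x y)"
      using iso[OF G(1)] G(2,3) by (intro exI[of _ "\<lambda>x. k (G (h x))"]) (simp add: Y_def)
  next
    fix x assume "x \<in> Q"
    then show "\<theta> x x = 0" by (simp add: th2 ip mat_inner_PM hQ)
  next
    fix s t show "Y s \<in> Q" by (rule YQ)
    have "Y s \<bullet> Y t = (cos (s/2))\<^sup>2 * (cos (t/2))\<^sup>2 + 2 * (cos (s/2) * sin (s/2)) * (cos (t/2) * sin (t/2)) + (sin (s/2))\<^sup>2 * (sin (t/2))\<^sup>2"
      using ip_Y[OF YQ, of s t] by (simp add: hY diag_M M_def M_vec_def oct_re_scaleR diag_re_def power2_eq_square)
    also have "\<dots> = (cos (s/2 - t/2))\<^sup>2" by (simp add: cos_diff power2_eq_square algebra_simps)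
    finally show "2 * (Y s \<bullet> Y t) + - 1 = cos (s - t)"
      using cos_double_cos[of "s/2 - t/2"] by (simp add: right_diff_distrib)
  next
    fix p :: "real poly"
    let ?f = "\<lambda>z. poly p (2 * diag_re (h z) 0 - 1)"
    have "(\<integral>z. poly p (2 * (Y 0 \<bullet> z) + - 1) * (2 * (S \<bullet> z))\<^sup>2 \<partial>\<mu>) = (\<integral>z. 4 * (?f z * (oct_re (h z 0 1))\<^sup>2) \<partial>\<mu>)"
      by (rule Bochner_Integration.integral_cong[OF refl]) (unfold sp, simp only: c0 Sz, simp)
    also have "\<dots> = 4 * ((\<integral>z. ?f z * diag_re (h z) 1 * diag_re (h z) 0 \<partial>\<mu>) / real d0)"
      by (simp only: integral_mult_right_zero avg2)
    also have "\<dots> = 4 * ((\<integral>z. ?f z * (1 - diag_re (h z) 0) * diag_re (h z) 0 \<partial>\<mu>) / real d)"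
      using avg1[of "\<lambda>x. x" p] dpos(1) by (simp add: continuous_intros)
    also have "\<dots> = (\<integral>z. 4 * (?f z * (1 - diag_re (h z) 0) * diag_re (h z) 0) \<partial>\<mu>) / real d" by simp
    also have "(\<integral>z. 4 * (?f z * (1 - diag_re (h z) 0) * diag_re (h z) 0) \<partial>\<mu>) =
        (\<integral>z. poly p (2 * (Y 0 \<bullet> z) + - 1) * (1 - (2 * (Y 0 \<bullet> z) + - 1)\<^sup>2) \<partial>\<mu>)"
      by (rule Bochner_Integration.integral_cong[OF refl]) (unfold sp, simp only: c0, simp add: power2_eq_square algebra_simps)
    finally show "(\<integral>z. poly p (2 * (Y 0 \<bullet> z) + - 1) * (2 * (S \<bullet> z))\<^sup>2 \<partial>\<mu>) =
       (\<integral>z. poly p (2 * (Y 0 \<bullet> z) + - 1) * (1 - (2 * (Y 0 \<bullet> z) + - 1)\<^sup>2) \<partial>\<mu>) / real d" .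
    have "(\<integral>z. poly p (2 * (Y 0 \<bullet> z) + - 1) * (2 * (R \<bullet> z)) \<partial>\<mu>) = (\<integral>z. ?f z * diag_re (h z) 0 - ?f z * diag_re (h z) 1 \<partial>\<mu>)"
      by (rule Bochner_Integration.integral_cong[OF refl]) (unfold sp, simp only: c0 Rz, simp add: algebra_simps)
    also have "\<dots> = (\<integral>z. ?f z * diag_re (h z) 0 \<partial>\<mu>) - (\<integral>z. ?f z * diag_re (h z) 1 \<partial>\<mu>)"
      by (intro Bochner_Integration.integral_diff int continuous_intros diag_cont)
    also have "(\<integral>z. ?f z * diag_re (h z) 1 \<partial>\<mu>) = (\<integral>z. ?f z * (1 - diag_re (h z) 0) / real n \<partial>\<mu>)"
      using avg1[of "\<lambda>x. 1" p] by (simp add: continuous_intros)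
    also have "(\<integral>z. ?f z * diag_re (h z) 0 \<partial>\<mu>) - (\<integral>z. ?f z * (1 - diag_re (h z) 0) / real n \<partial>\<mu>) =
        (\<integral>z. ?f z * diag_re (h z) 0 - ?f z * (1 - diag_re (h z) 0) / real n \<partial>\<mu>)"
      using n by (intro Bochner_Integration.integral_diff[symmetric] int continuous_intros diag_cont) auto
    also have "\<dots> = (\<integral>z. poly p (2 * (Y 0 \<bullet> z) + - 1) * ((1 + (2 * (Y 0 \<bullet> z) + - 1)) / 2
           - (1 - (2 * (Y 0 \<bullet> z) + - 1)) * real d0 / (2 * real d)) \<partial>\<mu>)"
    proof (rule Bochner_Integration.integral_cong[OF refl], unfold sp)
      fix z assume z: "z \<in> Q"
      have "real d0 > 0" "real n > 0" using d0 n by auto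
      then show "?f z * diag_re (h z) 0 - ?f z * (1 - diag_re (h z) 0) / real n = poly p (2 * (Y 0 \<bullet> z) + - 1) * ((1 + (2 * (Y 0 \<bullet> z) + - 1)) / 2
           - (1 - (2 * (Y 0 \<bullet> z) + - 1)) * real d0 / (2 * real d))"
        unfolding c0[OF z] dpos(1) by (simp add: field_simps)
    qed
    finally show "(\<integral>z. poly p (2 * (Y 0 \<bullet> z) + - 1) * (2 * (R \<bullet> z)) \<partial>\<mu>) = (\<integral>z. poly p (2 * (Y 0 \<bullet> z) + - 1) * ((1 + (2 * (Y 0 \<bullet> z) + - 1)) / 2
           - (1 - (2 * (Y 0 \<bullet> z) + - 1)) * real d0 / (2 * real d)) \<partial>\<mu>)" .
  qed simp
  then show ?thesis by blast
qed

section \<open>Jacobi polynomials\<close>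

lemma weierstrass_poly:
  fixes f :: "real \<Rightarrow> real"
  assumes "continuous_on {a..b} f" "0 < e"
  obtains p where "\<And>x. x \<in> {a..b} \<Longrightarrow> \<bar>f x - poly p x\<bar> < e"
proof -
  obtain g where g: "real_polynomial_function g" "\<And>x. x \<in> {a..b} \<Longrightarrow> \<bar>f x - g x\<bar> < e"
    by (rule Stone_Weierstrass_real_polynomial_function[OF compact_Icc assms]) blast
  obtain c n where "g = (\<lambda>x. \<Sum>i\<le>n. c i * x ^ i)"
    using g(1) by (auto simp: real_polynomial_function_iff_sum)
  then have "g x = poly (\<Sum>i\<le>n. monom (c i) i) x" for x
    by (simp add: poly_sum poly_monom)
  with g(2) show ?thesis by (intro that) auto
qed

text \<open>Weierstrass approximation on [-1, 1] extends equality from moments to integrals of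
  continuous functions. Applied to cosines and sines this gives equal characteristic functions, and
  Levy's theorem finishes.\<close>

lemma real_distribution_eq_by_moments:
  assumes "real_distribution M" "real_distribution N"
    and M: "AE x in M. x \<in> {-1..1}" and N: "AE x in N. x \<in> {-1..1}"
    and eq: "\<And>p. (\<integral>x. poly p x \<partial>M) = (\<integral>x. poly p x \<partial>N)"
  shows "M = N"
proof -
  interpret M: real_distribution M by fact
  interpret N: real_distribution N by fact
  have close: "\<bar>(\<integral>x. f x \<partial>L) - (\<integral>x. poly p x \<partial>L)\<bar> \<le> e"
    if "real_distribution L" "AE x in L. x \<in> {-1..1}" "continuous_on UNIV f"
      "\<And>x. x \<in> {-1..1} \<Longrightarrow> \<bar>f x - poly p x\<bar> < e" for L p e and f :: "real \<Rightarrow> real"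
  proof -
    interpret L: real_distribution L by fact
    have int: "integrable L g" if g: "continuous_on UNIV g" for g :: "real \<Rightarrow> real"
    proof -
      have "bounded (g ` {-1..1})"
        by (intro compact_imp_bounded compact_continuous_image continuous_on_subset[OF g]) auto
      then obtain C where "\<And>x. x \<in> {-1..1} \<Longrightarrow> norm (g x) \<le> C" unfolding bounded_iff by fastforce
      then show ?thesis
        using \<open>AE x in L. x \<in> {-1..1}\<close> borel_measurable_continuous_onI[OF g]
        by (intro L.integrable_const_bound[of _ C]) (auto simp: measurable_cong_sets[OF L.events_eq_borel refl])
    qed
    have i1: "integrable L f" and i2: "integrable L (poly p)"
      by (intro int that continuous_intros)+
    have "\<bar>(\<integral>x. f x \<partial>L) - (\<integral>x. poly p x \<partial>L)\<bar> = norm (\<integral>x. f x - poly p x \<partial>L)"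
      using i1 i2 by simp
    also have "\<dots> \<le> (\<integral>x. norm (f x - poly p x) \<partial>L)" by (rule integral_norm_bound)
    also have "\<dots> \<le> (\<integral>x. e \<partial>L)"
    proof (rule integral_mono_AE)
      show "AE x in L. norm (f x - poly p x) \<le> e"
        using that(2) by eventually_elim (use that(4) in \<open>auto intro: less_imp_le\<close>)
    qed (use i1 i2 in auto)
    also have "\<dots> = e" using L.prob_space by simp
    finally show ?thesis .
  qed
  have cont: "(\<integral>x. f x \<partial>M) = (\<integral>x. f x \<partial>N)" if f: "continuous_on UNIV f" for f :: "real \<Rightarrow> real"
  proof -
    have "\<bar>(\<integral>x. f x \<partial>M) - (\<integral>x. f x \<partial>N)\<bar> \<le> 0 + e" if "e > 0" for e
    proof -
      have "e / 2 > 0" using that by simp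
      then obtain p where p: "\<And>x. x \<in> {-1..1} \<Longrightarrow> \<bar>f x - poly p x\<bar> < e / 2"
        using weierstrass_poly[OF continuous_on_subset[OF f]] by (metis subset_UNIV)
      from close[OF assms(1) M f p] close[OF assms(2) N f p] eq[of p] show ?thesis by linarith
    qed
    then have "\<bar>(\<integral>x. f x \<partial>M) - (\<integral>x. f x \<partial>N)\<bar> \<le> 0" by (rule field_le_epsilon)
    then show ?thesis by simp
  qed
  have "char L t = Complex (\<integral>x. cos (t * x) \<partial>L) (\<integral>x. sin (t * x) \<partial>L)" if "real_distribution L" for L t
  proof -
    interpret L: real_distribution L by fact
    have "integrable L (\<lambda>x. iexp (t * x))" by (rule L.integrable_iexp) auto
    then show ?thesis
      unfolding char_def by (intro complex_eqI) (simp_all flip: integral_Re integral_Im add: Re_exp Im_exp)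
  qed
  then have "char M t = char N t" for t
    by (simp add: assms cont continuous_intros)
  then show ?thesis by (intro Levy_uniqueness assms) auto
qed

text \<open>The remainder factor is jointly continuous in u and e, hence bounded on compact sets;
  \<open>second_variation\<close> needs this uniformity in z.\<close>

lemma poly_second_order:
  fixes p :: "real poly"
  shows "\<exists>q. continuous_on UNIV q \<and> (\<forall>u e. poly p (u + e) = poly p u + poly (pderiv p) u * e
     + poly (pderiv (pderiv p)) u * e\<^sup>2 / 2 + e ^ 3 * q (u, e))"
proof (induction p)
  case 0
  show ?case by (rule exI[of _ "\<lambda>_. 0"]) simp
next
  case (pCons a p)
  then obtain q where q: "continuous_on UNIV q" "\<And>u e. poly p (u + e) = poly p u + poly (pderiv p) u * e
     + poly (pderiv (pderiv p)) u * e\<^sup>2 / 2 + e ^ 3 * q (u, e)" by blast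
  let ?q = "\<lambda>z. poly (pderiv (pderiv p)) (fst z) / 2 + (fst z + snd z) * q z"
  have "continuous_on UNIV ?q" by (intro continuous_intros q) auto
  moreover have "poly (pCons a p) (u + e) = poly (pCons a p) u + poly (pderiv (pCons a p)) u * e
     + poly (pderiv (pderiv (pCons a p))) u * e\<^sup>2 / 2 + e ^ 3 * ?q (u, e)" for u e
  proof -
    have "poly (pCons a p) (u + e) = a + (u + e) * poly p (u + e)" by simp
    then show ?thesis unfolding q(2)[of u e]
      by (simp add: pderiv_pCons pderiv_add power2_eq_square power3_eq_cube field_simps)
  qed
  ultimately show ?case by blast
qed

text \<open>The sum is even in y, so y enters through y^2 = 1 - x^2 only. For powers this is
  Newton's recurrence for s^k + t^k: the sum s + t has degree at most 1 in x and the product s t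
  degree at most 2, which also keeps the degree at most k.\<close>

lemma even_part_poly:
  fixes a b c :: real and q :: "real poly"
  shows "\<exists>T. degree T \<le> degree q \<and> (\<forall>x y. x\<^sup>2 + y\<^sup>2 = 1 \<longrightarrow>
     poly q (a + b * x + c * y) + poly q (a + b * x - c * y) = poly T x)"
proof -
  let ?u = "[:a, b:]" and ?v = "[:a, b:]\<^sup>2 - smult (c\<^sup>2) [:1, 0, -1:]"
  have pow: "\<exists>T. degree T \<le> k \<and> (\<forall>x y. x\<^sup>2 + y\<^sup>2 = 1 \<longrightarrow>
     (a + b * x + c * y) ^ k + (a + b * x - c * y) ^ k = poly T x)" for k
  proof (induction k rule: induct_nat_012)
    case 0
    show ?case by (rule exI[of _ "[:2:]"]) simp
  next
    case 1
    show ?case by (rule exI[of _ "smult 2 ?u"]) (simp add: degree_pCons_le)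
  next
    case (ge2 k)
    then obtain T0 T1 where T0: "degree T0 \<le> k" "\<And>x y. x\<^sup>2 + y\<^sup>2 = 1 \<Longrightarrow>
        (a + b * x + c * y) ^ k + (a + b * x - c * y) ^ k = poly T0 x"
      and T1: "degree T1 \<le> Suc k" "\<And>x y. x\<^sup>2 + y\<^sup>2 = 1 \<Longrightarrow>
        (a + b * x + c * y) ^ Suc k + (a + b * x - c * y) ^ Suc k = poly T1 x" by blast
    let ?T = "smult 2 ?u * T1 - ?v * T0"
    have du: "degree (smult 2 ?u) \<le> 1" by (rule order.trans[OF degree_smult_le]) simp
    have dv: "degree ?v \<le> 2"
      by (intro degree_diff_le order.trans[OF degree_power_le] order.trans[OF degree_smult_le]) auto
    have "degree ?T \<le> Suc (Suc k)"
    proof (rule degree_diff_le)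
      show "degree (smult 2 ?u * T1) \<le> Suc (Suc k)"
        using degree_mult_le[of "smult 2 ?u" T1] du T1(1) by linarith
      show "degree (?v * T0) \<le> Suc (Suc k)"
        using degree_mult_le[of ?v T0] dv T0(1) by linarith
    qed
    moreover have "(a + b * x + c * y) ^ Suc (Suc k) + (a + b * x - c * y) ^ Suc (Suc k) = poly ?T x"
      if xy: "x\<^sup>2 + y\<^sup>2 = 1" for x y
    proof -
      define s where "s = a + b * x + c * y"
      define t where "t = a + b * x - c * y"
      have st: "2 * (a + b * x) = s + t" by (simp add: s_def t_def)
      have y2: "y\<^sup>2 = 1 - x\<^sup>2" using xy by simp
      have "s * t = (a + b * x)\<^sup>2 - c\<^sup>2 * y\<^sup>2" by (simp add: s_def t_def power2_eq_square algebra_simps)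
      then have v: "poly ?v x = s * t"
        unfolding y2 by (simp add: power2_eq_square algebra_simps)
      have "poly (smult 2 ?u) x = s + t" using st by (simp add: algebra_simps)
      then have "poly ?T x = (s + t) * (s ^ Suc k + t ^ Suc k) - s * t * (s ^ k + t ^ k)"
        unfolding poly_diff[of "_ * _" "_ * _"] poly_mult[of _ T1] poly_mult[of _ T0] v T0(2)[OF xy, symmetric] T1(2)[OF xy, symmetric]
        unfolding s_def[symmetric] t_def[symmetric] by (simp only:)
      then show ?thesis unfolding s_def[symmetric] t_def[symmetric] by (simp add: algebra_simps)
    qed
    ultimately show ?case by blast
  qed
  then obtain T where T: "\<And>k. degree (T k) \<le> k" "\<And>k x y. x\<^sup>2 + y\<^sup>2 = 1 \<Longrightarrow>
     (a + b * x + c * y) ^ k + (a + b * x - c * y) ^ k = poly (T k) x" by metis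
  have "degree (\<Sum>k\<le>degree q. smult (coeff q k) (T k)) \<le> degree q"
    by (intro degree_sum_le) (auto intro: order.trans[OF degree_smult_le] order.trans[OF T(1)])
  moreover have "poly q (a + b * x + c * y) + poly q (a + b * x - c * y) = poly (\<Sum>k\<le>degree q. smult (coeff q k) (T k)) x"
    if "x\<^sup>2 + y\<^sup>2 = 1" for x y
    unfolding poly_altdef[of q] by (simp add: poly_sum T(2)[OF that, symmetric] sum.distrib algebra_simps)
  ultimately show ?thesis by blast
qed

text \<open>A polynomial of degree at most k is a fixed linear expression in k + 1 of its values, so
  integration over a parameter passes to its coefficients. The nodes lie in [-1, 1] in order to be
  cosines.\<close>

lemma lagrange_basis:
  fixes k :: nat
  obtains l :: "nat \<Rightarrow> real poly" and nd :: "nat \<Rightarrow> real"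
  where "\<And>i. i \<le> k \<Longrightarrow> degree (l i) \<le> k" "\<And>i. i \<le> k \<Longrightarrow> nd i \<in> {-1..1}"
    "\<And>p. degree p \<le> k \<Longrightarrow> p = (\<Sum>i\<le>k. smult (poly p (nd i)) (l i))"
proof -
  define nd where "nd i = real i / real (Suc k)" for i
  define l where "l i = (\<Prod>j\<in>{..k} - {i}. smult (1 / (nd i - nd j)) [:- nd j, 1:])" for i
  have inj: "inj_on nd {..k}" by (auto simp: inj_on_def nd_def)
  have dl: "degree (l i) \<le> k" if "i \<le> k" for i
  proof -
    have "degree (l i) \<le> (\<Sum>j\<in>{..k} - {i}. degree (smult (1 / (nd i - nd j)) [:- nd j, 1:]))"
      unfolding l_def by (rule degree_prod_sum_le[unfolded comp_def]) simp
    also have "\<dots> \<le> (\<Sum>j\<in>{..k} - {i}. 1)" by (intro sum_mono order.trans[OF degree_smult_le]) simp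
    also have "\<dots> = k" using that by simp
    finally show ?thesis .
  qed
  have li: "poly (l i) (nd j) = (if i = j then 1 else 0)" if ij: "i \<le> k" "j \<le> k" for i j
  proof (cases "i = j")
    case True
    have "poly (l i) (nd i) = (\<Prod>j\<in>{..k} - {i}. 1)"
      unfolding l_def poly_prod
    proof (intro prod.cong refl)
      fix x assume x: "x \<in> {..k} - {i}"
      then have "nd i - nd x \<noteq> 0" using inj ij by (auto simp: inj_on_def)
      then show "poly (smult (1 / (nd i - nd x)) [:- nd x, 1:]) (nd i) = 1" by (simp flip: diff_divide_distrib)
    qed
    then show ?thesis using True by simp
  next
    case False
    then have "j \<in> {..k} - {i}" using ij by auto
    then show ?thesis using False unfolding l_def poly_prod by (auto intro!: prod_zero)
  qed
  show thesis
  proof (rule that[of l nd])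
    fix p :: "real poly" assume p: "degree p \<le> k"
    let ?s = "\<Sum>i\<le>k. smult (poly p (nd i)) (l i)"
    have ds: "degree ?s \<le> k"
      by (intro degree_sum_le) (auto intro: order.trans[OF degree_smult_le] dl)
    show "p = ?s"
    proof (rule poly_eqI_degree[of "nd ` {..k}"])
      fix x assume "x \<in> nd ` {..k}"
      then obtain j where j: "j \<le> k" "x = nd j" by auto
      have "poly ?s x = (\<Sum>i\<le>k. if i = j then poly p (nd j) else 0)"
        unfolding poly_sum j(2) by (intro sum.cong refl) (use j in \<open>auto simp: li\<close>)
      then show "poly p x = poly ?s x" using j by simp
    qed (use p ds in \<open>auto simp: card_image[OF inj]\<close>)
  next
    fix i assume "i \<le> k"
    then have "0 \<le> nd i" "nd i \<le> 1" by (auto simp: nd_def)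
    then show "nd i \<in> {-1..1}" unfolding atLeastAtMost_iff by linarith
  qed (rule dl)
qed

definition jacobi_eigenvalue :: "nat \<Rightarrow> nat \<Rightarrow> nat \<Rightarrow> real" where
  "jacobi_eigenvalue d d0 k = real k * (real k + ((real d + real d0) / 2 - 1))"

text \<open>The difference of eigenvalues factors as (j - k)(j + k + (d + d0)/2 - 1). These are
  therefore the coefficients of the hypergeometric series with upper parameters -k and k + (d +
  d0)/2 - 1 and lower parameter d/2.\<close>

fun jacobi_coeff :: "nat \<Rightarrow> nat \<Rightarrow> nat \<Rightarrow> nat \<Rightarrow> real" where
  "jacobi_coeff d d0 k 0 = 1"
| "jacobi_coeff d d0 k (Suc j) = jacobi_coeff d d0 k j *
     (jacobi_eigenvalue d d0 j - jacobi_eigenvalue d d0 k) / ((real j + 1) * (real j + real d / 2))"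

text \<open>
  The Jacobi polynomial with parameters \<open>d/2 - 1, d0/2 - 1\<close>, normalized to be \<open>1\<close> at \<open>1\<close>, by its
  hypergeometric series in \<open>(1 - x)/2\<close>.
\<close>

definition jacobi_poly :: "nat \<Rightarrow> nat \<Rightarrow> nat \<Rightarrow> real poly" where
  "jacobi_poly d d0 k = pcompose (\<Sum>j\<le>k. monom (jacobi_coeff d d0 k j) j) [:1/2, -1/2:]"

text \<open>In the variable x = cos t this is f'' + \<open>jb\<close> f' with the exponents d - 1
  and d0 - 1, the radial part of the Laplacian.\<close>

definition jacobi_operator :: "nat \<Rightarrow> nat \<Rightarrow> real poly \<Rightarrow> real poly" where
  "jacobi_operator d d0 p = [:1, 0, -1:] * pderiv (pderiv p) - smult (1/2) [:real d - real d0, real d + real d0:] * pderiv p"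

lemma jacobi_eigenvalue_strict_mono:
  assumes "1 \<le> d" "1 \<le> d0" "j < k"
  shows "jacobi_eigenvalue d d0 j < jacobi_eigenvalue d d0 k"
proof -
  define \<rho> where "\<rho> = (real d + real d0) / 2 - 1"
  have "\<rho> \<ge> 0" using assms by (simp add: \<rho>_def)
  have "real j * (real j + \<rho>) \<le> real j * (real k + \<rho>)" using assms by (intro mult_left_mono) auto
  also have "\<dots> < real k * (real k + \<rho>)" using assms \<open>\<rho> \<ge> 0\<close> by (intro mult_strict_right_mono) auto
  finally show ?thesis by (simp add: jacobi_eigenvalue_def \<rho>_def algebra_simps)
qed

lemma jacobi_eigenvalue_bounds:
  assumes "1 \<le> d" "1 \<le> d0" "1 \<le> k"
  shows "(real k)\<^sup>2 \<le> jacobi_eigenvalue d d0 k" "jacobi_eigenvalue d d0 k \<le> (real d + real d0) * (real k)\<^sup>2"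
proof -
  define c where "c = (real d + real d0) / 2 - 1"
  have c: "0 \<le> c" "c + 1 \<le> real d + real d0" using assms by (auto simp: c_def)
  have e: "jacobi_eigenvalue d d0 k = (real k)\<^sup>2 + real k * c"
    by (simp add: jacobi_eigenvalue_def c_def[symmetric] power2_eq_square algebra_simps)
  show "(real k)\<^sup>2 \<le> jacobi_eigenvalue d d0 k" using c by (simp add: e)
  have "real k * c \<le> (real k)\<^sup>2 * c"
    using assms c by (intro mult_right_mono) (auto simp: power2_eq_square)
  then have "jacobi_eigenvalue d d0 k \<le> (c + 1) * (real k)\<^sup>2" by (simp add: e algebra_simps)
  also have "\<dots> \<le> (real d + real d0) * (real k)\<^sup>2" using c by (intro mult_right_mono) auto
  finally show "jacobi_eigenvalue d d0 k \<le> (real d + real d0) * (real k)\<^sup>2" .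
qed

lemma jacobi_coeff_nonzero:
  assumes "1 \<le> d" "1 \<le> d0" "j \<le> k" shows "jacobi_coeff d d0 k j \<noteq> 0"
  using assms(3)
proof (induction j)
  case (Suc j)
  have "jacobi_eigenvalue d d0 j < jacobi_eigenvalue d d0 k"
    using Suc.prems by (intro jacobi_eigenvalue_strict_mono assms) auto
  moreover have "0 < real j + real d / 2" using assms(1) by simp
  ultimately show ?case using Suc by simp
qed simp

lemma jacobi_coeff_zero: "k < j \<Longrightarrow> jacobi_coeff d d0 k j = 0"
proof (induction j)
  case (Suc j)
  then show ?case by (cases "j = k") auto
qed simp

lemma degree_jacobi_poly:
  assumes "1 \<le> d" "1 \<le> d0" shows "degree (jacobi_poly d d0 k) = k"
proof -
  let ?u = "\<Sum>j\<le>k. monom (jacobi_coeff d d0 k j) j"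
  have "degree ?u = k"
  proof (rule antisym)
    show "degree ?u \<le> k" by (intro degree_sum_le) (auto intro: order.trans[OF degree_monom_le])
    have "coeff ?u k \<noteq> 0" using jacobi_coeff_nonzero[OF assms order.refl] by (simp add: coeff_sum)
    then show "k \<le> degree ?u" by (rule le_degree)
  qed
  then show ?thesis by (simp add: jacobi_poly_def degree_pcompose)
qed

lemma poly_jacobi_1 [simp]: "poly (jacobi_poly d d0 k) 1 = 1"
proof -
  have "poly (jacobi_poly d d0 k) 1 = (\<Sum>j\<le>k. jacobi_coeff d d0 k j * 0 ^ j)"
    by (simp add: jacobi_poly_def poly_pcompose poly_sum poly_monom)
  also have "\<dots> = (\<Sum>j\<in>{0}. jacobi_coeff d d0 k j * 0 ^ j)"
    by (rule sum.mono_neutral_right) auto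
  finally show ?thesis by simp
qed

lemma jacobi_poly_0: "jacobi_poly d d0 0 = 1"
  by (simp add: jacobi_poly_def monom_0 pcompose_const)

text \<open>In the variable s = (1 - x)/2 the equation becomes a two-term recurrence for the
  coefficients, namely the one that defines \<open>jacobi_coeff\<close>.\<close>

lemma jacobi_operator_eigen:
  assumes "1 \<le> d"
  shows "jacobi_operator d d0 (jacobi_poly d d0 k) = smult (- jacobi_eigenvalue d d0 k) (jacobi_poly d d0 k)"
proof -
  define a where "a = jacobi_coeff d d0 k"
  define u where "u = (\<Sum>j\<le>k. monom (a j) j)"
  define ev where "ev = jacobi_eigenvalue d d0 k"
  have cu: "coeff u j = a j" for j
    by (cases "j \<le> k") (auto simp: u_def a_def coeff_sum jacobi_coeff_zero)
  have rec: "(real j + 1) * (real j + real d / 2) * a (Suc j) = a j * (jacobi_eigenvalue d d0 j - ev)" for j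
  proof -
    have "(real j + 1) * (real j + real d / 2) \<noteq> 0" using assms by (intro mult_pos_pos[THEN less_imp_neq, symmetric]) auto
    then show ?thesis by (simp add: a_def ev_def)
  qed
  let ?l = "[:0, 1, -1:] * pderiv (pderiv u) + [:real d / 2, - (real d + real d0) / 2:] * pderiv u + smult ev u"
  have "?l = 0"
  proof (rule poly_eqI)
    fix j
    have "coeff ?l j = (real j + 1) * (real j + real d / 2) * a (Suc j)
        - a j * (jacobi_eigenvalue d d0 j - ev)"
    proof (cases j)
      case 0
      then show ?thesis by (simp add: coeff_pderiv cu jacobi_eigenvalue_def)
    next
      case (Suc i)
      then show ?thesis
        by (cases i) (simp_all add: coeff_pderiv cu jacobi_eigenvalue_def field_simps)
    qed
    then show "coeff ?l j = coeff 0 j" using rec[of j] by simp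
  qed
  then have ode: "[:0, 1, -1:] * pderiv (pderiv u) + [:real d / 2, - (real d + real d0) / 2:] * pderiv u = - smult ev u"
    by (simp add: eq_neg_iff_add_eq_0)
  let ?\<phi> = "jacobi_poly d d0 k" and ?s = "[:1/2, -1/2:] :: real poly"
  have phi: "?\<phi> = pcompose u ?s" by (simp add: jacobi_poly_def u_def a_def)
  have d1: "pderiv ?\<phi> = smult (-1/2) (pcompose (pderiv u) ?s)"
    by (simp add: phi pderiv_pcompose pderiv_pCons)
  have d2: "pderiv (pderiv ?\<phi>) = smult (1/4) (pcompose (pderiv (pderiv u)) ?s)"
    by (simp add: d1 pderiv_smult pderiv_minus pderiv_pcompose pderiv_pCons)
  have "poly (jacobi_operator d d0 ?\<phi>) x = poly (smult (- jacobi_eigenvalue d d0 k) ?\<phi>) x" for x :: real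
  proof -
    define s where "s = (1 - x) / 2"
    have s: "poly ?s x = s" by (simp add: s_def)
    have x: "x = 1 - 2 * s" by (simp add: s_def field_simps)
    have "s * (1 - s) * poly (pderiv (pderiv u)) s + (real d / 2 - (real d + real d0) / 2 * s) * poly (pderiv u) s = - ev * poly u s"
      using arg_cong[OF ode, of "\<lambda>p. poly p s"] by (simp add: field_simps)
    moreover have "(1 - x\<^sup>2) * (A / 4) - 1/2 * ((d - d0) + (d + d0) * x) * (- B / 2) = - ev * U"
      if "s * (1 - s) * A + (d / 2 - (d + d0) / 2 * s) * B = - ev * U" for A B U d d0 :: real
      unfolding that[symmetric] x by (simp add: power2_eq_square field_simps)
    ultimately have "(1 - x\<^sup>2) * (poly (pderiv (pderiv u)) s / 4)
        - 1/2 * ((real d - real d0) + (real d + real d0) * x) * (- poly (pderiv u) s / 2) = - ev * poly u s"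
      by blast
    moreover have "poly (jacobi_operator d d0 ?\<phi>) x = (1 - x\<^sup>2) * (poly (pderiv (pderiv u)) s / 4)
        - 1/2 * ((real d - real d0) + (real d + real d0) * x) * (- poly (pderiv u) s / 2)"
    proof -
      have "poly (pderiv ?\<phi>) x = - 1/2 * poly (pderiv u) s" "poly (pderiv (pderiv ?\<phi>)) x = 1/4 * poly (pderiv (pderiv u)) s"
        unfolding d2 unfolding d1 poly_smult poly_pcompose s by simp_all
      then show ?thesis unfolding jacobi_operator_def by (simp add: power2_eq_square field_simps)
    qed
    moreover have "poly ?\<phi> x = poly u s" unfolding phi poly_pcompose s ..
    ultimately show ?thesis by (simp add: ev_def)
  qed
  then show ?thesis by (intro poly_eq_poly_eq_iff[THEN iffD1] ext)
qed

lemma jacobi_poly_solution: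
  assumes "1 \<le> d" "1 \<le> d0" "1 \<le> k"
  shows "jacobi_solution (d - 1) (d0 - 1) (jacobi_eigenvalue d d0 k)
    (\<lambda>t. poly (jacobi_poly d d0 k) (cos t)) (\<lambda>t. - sin t * poly (pderiv (jacobi_poly d d0 k)) (cos t))"
proof -
  let ?\<phi> = "jacobi_poly d d0 k"
  have 1: "((\<lambda>t. poly ?\<phi> (cos t)) has_real_derivative - sin t * poly (pderiv ?\<phi>) (cos t)) (at t)" for t
    by (rule DERIV_cong[OF DERIV_chain2[OF poly_DERIV DERIV_cos]]) simp
  have 2: "((\<lambda>t. - sin t * poly (pderiv ?\<phi>) (cos t)) has_real_derivative
      - cos t * poly (pderiv ?\<phi>) (cos t) + (sin t)\<^sup>2 * poly (pderiv (pderiv ?\<phi>)) (cos t)) (at t)" for t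
    by (rule DERIV_cong, (rule derivative_intros DERIV_chain2[OF poly_DERIV DERIV_cos])+)
       (simp add: power2_eq_square algebra_simps)
  have eq: "- cos t * poly (pderiv ?\<phi>) (cos t) + (sin t)\<^sup>2 * poly (pderiv (pderiv ?\<phi>)) (cos t)
      = - jb (d - 1) (d0 - 1) t * (- sin t * poly (pderiv ?\<phi>) (cos t)) - jacobi_eigenvalue d d0 k * poly ?\<phi> (cos t)"
    if t: "0 < t" "t < pi" for t
  proof -
    have sc: "sin t = 2 * sin (t/2) * cos (t/2)" using sin_double[of "t/2"] by simp
    have c2: "2 * (cos (t/2) * cos (t/2)) = 1 + cos t" and s2: "2 * (sin (t/2) * sin (t/2)) = 1 - cos t"
      using cos_double_cos[of "t/2"] cos_double_sin[of "t/2"] by (auto simp: power2_eq_square)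
    have "jb (d - 1) (d0 - 1) t * sin t
        = real (d - 1) / 2 * (2 * (cos (t/2) * cos (t/2))) - real (d0 - 1) / 2 * (2 * (sin (t/2) * sin (t/2)))"
      using half_angle_pos[OF t] unfolding jb_def sc by (simp add: field_simps)
    also have "\<dots> = (real d - 1) / 2 * (1 + cos t) - (real d0 - 1) / 2 * (1 - cos t)"
      unfolding c2 s2 using assms by (simp add: of_nat_diff)
    finally have jb: "jb (d - 1) (d0 - 1) t * sin t = (real d - 1) / 2 * (1 + cos t) - (real d0 - 1) / 2 * (1 - cos t)" .
    have "(1 - (cos t)\<^sup>2) * poly (pderiv (pderiv ?\<phi>)) (cos t)
        - 1/2 * ((real d - real d0) + (real d + real d0) * cos t) * poly (pderiv ?\<phi>) (cos t)
        = - jacobi_eigenvalue d d0 k * poly ?\<phi> (cos t)"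
      using arg_cong[OF jacobi_operator_eigen[OF assms(1), of d0 k], of "\<lambda>p. poly p (cos t)"]
      by (simp add: jacobi_operator_def power2_eq_square field_simps)
    moreover have "- jb (d - 1) (d0 - 1) t * (- sin t * poly (pderiv ?\<phi>) (cos t))
      = ((real d - 1) / 2 * (1 + cos t) - (real d0 - 1) / 2 * (1 - cos t)) * poly (pderiv ?\<phi>) (cos t)"
      unfolding jb[symmetric] by simp
    moreover have "- c * B + s * A = ((d - 1) / 2 * (1 + c) - (d0 - 1) / 2 * (1 - c)) * B - l * P"
      if "(1 - c\<^sup>2) * A - 1/2 * ((d - d0) + (d + d0) * c) * B = - l * P" "s = 1 - c\<^sup>2" for A B P c s l d d0 :: real
    proof -
      have "l * P = 1/2 * ((d - d0) + (d + d0) * c) * B - (1 - c\<^sup>2) * A" using that(1) by simp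
      then show ?thesis unfolding that(2) by (simp add: field_simps)
    qed
    ultimately show ?thesis using sin_squared_eq[of t] by presburger
  qed
  have "jacobi_eigenvalue d d0 k > 0"
    using jacobi_eigenvalue_strict_mono[OF assms(1,2), of 0 k] assms(3) by (simp add: jacobi_eigenvalue_def)
  moreover have "continuous_on UNIV (\<lambda>t. - sin t * poly (pderiv ?\<phi>) (cos t))" by (intro continuous_intros)
  moreover have "((\<lambda>t. - sin t * poly (pderiv ?\<phi>) (cos t)) has_real_derivative
      - jb (d - 1) (d0 - 1) t * (- sin t * poly (pderiv ?\<phi>) (cos t)) - jacobi_eigenvalue d d0 k * poly ?\<phi> (cos t)) (at t)"
    if "0 < t" "t < pi" for t
    unfolding eq[OF that, symmetric] by (rule 2)
  ultimately show ?thesis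
    unfolding jacobi_solution_def using 1 by simp
qed

lemma jacobi_span:
  assumes "1 \<le> d" "1 \<le> d0" "degree p \<le> n"
  shows "\<exists>b. p = (\<Sum>j\<le>n. smult (b j) (jacobi_poly d d0 j))"
  using assms(3)
proof (induction n arbitrary: p)
  case 0
  then have "p = [:coeff p 0:]" by (metis degree_0_id le_zero_eq)
  then show ?case by (intro exI[of _ "\<lambda>_. coeff p 0"]) (simp add: jacobi_poly_0 smult_one)
next
  case (Suc n)
  let ?\<phi> = "jacobi_poly d d0 (Suc n)"
  define c where "c = coeff p (Suc n) / coeff ?\<phi> (Suc n)"
  have d: "degree ?\<phi> = Suc n" by (rule degree_jacobi_poly[OF assms(1,2)])
  then have nz: "coeff ?\<phi> (Suc n) \<noteq> 0" by (metis degree_0 leading_coeff_0_iff nat.distinct(1))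
  have "degree (p - smult c ?\<phi>) \<le> n"
  proof (rule degree_le, intro allI impI)
    fix i assume "n < i"
    then consider "i = Suc n" | "Suc n < i" by linarith
    then show "coeff (p - smult c ?\<phi>) i = 0"
    proof cases
      case 1 then show ?thesis using nz by (simp add: c_def)
    next
      case 2 then show ?thesis using Suc.prems d by (simp add: coeff_eq_0)
    qed
  qed
  then obtain b where b: "p - smult c ?\<phi> = (\<Sum>j\<le>n. smult (b j) (jacobi_poly d d0 j))"
    using Suc.IH by blast
  then have "p = (\<Sum>j\<le>n. smult (b j) (jacobi_poly d d0 j)) + smult c ?\<phi>" by (simp add: algebra_simps)
  also have "\<dots> = (\<Sum>j\<le>Suc n. smult ((b(Suc n := c)) j) (jacobi_poly d d0 j))" by simp
  finally show ?case by blast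
qed

text \<open>An eigenvector with nonzero eigenvalue lies in the range of the operator. A functional
  that vanishes on this range kills every Jacobi polynomial of positive degree, so its value at 1
  determines it.\<close>

lemma functional_unique:
  assumes d: "1 \<le> d" "1 \<le> d0"
    and "\<And>p q. E (p + q) = E p + E q" "\<And>c p. E (smult c p) = c * E p" "E 1 = 1" "\<And>p. E (jacobi_operator d d0 p) = 0"
    and "\<And>p q. F (p + q) = F p + F q" "\<And>c p. F (smult c p) = c * F p" "F 1 = 1" "\<And>p. F (jacobi_operator d d0 p) = 0"
  shows "E p = F p"
proof -
  have E0: "E (jacobi_poly d d0 j) = F (jacobi_poly d d0 j)" for j
  proof (cases "j = 0")
    case False
    then have "0 < jacobi_eigenvalue d d0 j"
      using jacobi_eigenvalue_strict_mono[OF d, of 0 j] by (simp add: jacobi_eigenvalue_def)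
    then show ?thesis
      using assms(6)[of "jacobi_poly d d0 j"] assms(10)[of "jacobi_poly d d0 j"]
      by (simp add: jacobi_operator_eigen[OF d(1)] assms(4,8) del: smult_minus_left)
  qed (simp add: jacobi_poly_0 assms(5,9))
  obtain b where b: "p = (\<Sum>j\<le>degree p. smult (b j) (jacobi_poly d d0 j))"
    using jacobi_span[OF d order.refl] by blast
  have z: "E 0 = 0" "F 0 = 0" using assms(4,8)[of 0 0] by simp_all
  have "E (\<Sum>j\<in>A. smult (b j) (jacobi_poly d d0 j)) = F (\<Sum>j\<in>A. smult (b j) (jacobi_poly d d0 j))" if "finite A" for A
    using that by (induction A rule: finite_induct) (auto simp: assms(3,4,7,8) E0 z)
  then show ?thesis by (subst b, subst (2) b) simp
qed

lemma set_integral_Icc: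
  fixes f :: "real \<Rightarrow> real"
  assumes "continuous_on {a..b} f"
  shows "(LINT t:{a..b}|lborel. f t) = integral {a..b} f"
  by (rule set_borel_integral_eq_integral(2)[OF borel_integrable_atLeastAtMost'[OF assms]])

text \<open>The operator in Sturm-Liouville form. The factor sin t makes the boundary terms vanish,
  so the weight \<open>jw\<close> annihilates the range of the operator.\<close>

lemma jacobi_weight_deriv:
  assumes d: "1 \<le> d" "1 \<le> d0" and t: "0 < t" "t < pi"
  shows "((\<lambda>t. jw (d - 1) (d0 - 1) t * sin t * poly (pderiv p) (cos t)) has_real_derivative
     - (poly (jacobi_operator d d0 p) (cos t) * jw (d - 1) (d0 - 1) t)) (at t)"
proof -
  have sc: "sin t = 2 * sin (t/2) * cos (t/2)" using sin_double[of "t/2"] by simp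
  have c2: "2 * (cos (t/2) * cos (t/2)) = 1 + cos t" and s2: "2 * (sin (t/2) * sin (t/2)) = 1 - cos t"
    using cos_double_cos[of "t/2"] cos_double_sin[of "t/2"] by (auto simp: power2_eq_square)
  have "jb (d - 1) (d0 - 1) t * sin t
      = real (d - 1) / 2 * (2 * (cos (t/2) * cos (t/2))) - real (d0 - 1) / 2 * (2 * (sin (t/2) * sin (t/2)))"
    using half_angle_pos[OF t] unfolding jb_def sc by (simp add: field_simps)
  also have "\<dots> = (real d - 1) / 2 * (1 + cos t) - (real d0 - 1) / 2 * (1 - cos t)"
    unfolding c2 s2 using d by (simp add: of_nat_diff)
  finally have jb: "jb (d - 1) (d0 - 1) t * sin t = (real d - 1) / 2 * (1 + cos t) - (real d0 - 1) / 2 * (1 - cos t)" .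
  have "((\<lambda>t. jw (d - 1) (d0 - 1) t * sin t * poly (pderiv p) (cos t)) has_real_derivative
      jw (d - 1) (d0 - 1) t * ((jb (d - 1) (d0 - 1) t * sin t + cos t) * poly (pderiv p) (cos t)
        - (sin t)\<^sup>2 * poly (pderiv (pderiv p)) (cos t))) (at t)"
    by (rule DERIV_cong, (rule derivative_intros jw_has_derivative t DERIV_chain2[OF poly_DERIV DERIV_cos])+)
       (simp add: power2_eq_square algebra_simps)
  also have "(jb (d - 1) (d0 - 1) t * sin t + cos t) * poly (pderiv p) (cos t)
        - (sin t)\<^sup>2 * poly (pderiv (pderiv p)) (cos t) = - poly (jacobi_operator d d0 p) (cos t)"
    unfolding jb sin_squared_eq jacobi_operator_def by (simp add: power2_eq_square field_simps)
  finally show ?thesis by (simp add: mult.commute)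
qed

lemma integral_jacobi_operator:
  assumes "1 \<le> d" "1 \<le> d0"
  shows "integral {0..pi} (\<lambda>t. poly (jacobi_operator d d0 p) (cos t) * jw (d - 1) (d0 - 1) t) = 0"
proof -
  let ?F = "\<lambda>t. - (jw (d - 1) (d0 - 1) t * sin t * poly (pderiv p) (cos t))"
  have "((\<lambda>t. poly (jacobi_operator d d0 p) (cos t) * jw (d - 1) (d0 - 1) t) has_integral ?F pi - ?F 0) {0..pi}"
  proof (rule fundamental_theorem_of_calculus_interior)
    show "continuous_on {0..pi} ?F" by (intro continuous_intros)
    fix x assume "x \<in> {0<..<pi}"
    then show "(?F has_vector_derivative poly (jacobi_operator d d0 p) (cos x) * jw (d - 1) (d0 - 1) x) (at x)"
      using DERIV_minus[OF jacobi_weight_deriv[OF assms, of x p]]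
      by (simp add: has_real_derivative_iff_has_vector_derivative)
  qed simp
  then show ?thesis by (simp add: integral_unique)
qed

section \<open>The distribution of the distance from a point\<close>

context zonal_space
begin

abbreviation "Q \<equiv> space \<mu>"
abbreviation "w \<equiv> jw (d - 1) (d0 - 1)"

definition Y :: "real \<Rightarrow> 'a" where "Y s = P + cos s *\<^sub>R R + sin s *\<^sub>R S"
definition cc :: "'a \<Rightarrow> 'a \<Rightarrow> real" where "cc x y = \<alpha> * (x \<bullet> y) + \<beta>"
definition weight_mass :: real where "weight_mass = integral {0..pi} w"

lemma d_pos: "1 \<le> d" using d0 by simp

lemma Y_space [simp]: "Y s \<in> Q" unfolding Y_def by (rule Y_in)

lemma cc_Y: "cc (Y s) (Y t) = cos (s - t)" unfolding Y_def cc_def by (rule cos_Y)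

lemma cc_sym: "cc x y = cc y x" by (simp add: cc_def inner_commute)

lemma cos_theta': "x \<in> Q \<Longrightarrow> y \<in> Q \<Longrightarrow> cos (\<theta> x y) = cc x y" unfolding cc_def by (rule cos_theta)

lemma theta_eq: "x \<in> Q \<Longrightarrow> y \<in> Q \<Longrightarrow> \<theta> x y = arccos (cc x y)"
  using theta_range[of x y] arccos_cos[of "\<theta> x y"] by (simp add: cos_theta')

lemma cc_self: "x \<in> Q \<Longrightarrow> cc x x = 1"
  using cos_theta'[of x x] theta_refl[of x] by simp

lemma cc_range: "x \<in> Q \<Longrightarrow> y \<in> Q \<Longrightarrow> cc x y \<in> {-1..1}"
  using cos_theta'[of x y] cos_le_one[of "\<theta> x y"] cos_ge_minus_one[of "\<theta> x y"] by simp

lemma Q_bounded: "\<exists>B>0. Q \<subseteq> cball 0 B"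
proof -
  have "norm x \<le> sqrt ((1 - \<beta>) / \<alpha>) + 1" if "x \<in> Q" for x
    using cc_self[OF that] \<alpha>_pos by (simp add: cc_def norm_eq_sqrt_inner eq_divide_eq) (metis add_diff_cancel_right' nonzero_mult_div_cancel_left less_irrefl less_add_one less_imp_le)
  then show ?thesis
    by (intro exI[of _ "max (sqrt ((1 - \<beta>) / \<alpha>) + 1) 1"]) force
qed

lemma measurable_\<mu>: "F \<in> borel_measurable borel \<Longrightarrow> F \<in> borel_measurable \<mu>"
  by (rule borel_measurable_restrict_sets[OF sets_\<mu>])

lemma measurable_\<mu>_continuous: "continuous_on UNIV F \<Longrightarrow> F \<in> borel_measurable \<mu>"
  by (intro measurable_\<mu> borel_measurable_continuous_onI)

lemma integrable_\<mu>_continuous: "continuous_on UNIV F \<Longrightarrow> integrable \<mu> F" for F :: "'a \<Rightarrow> real"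
  using Q_bounded integrable_continuous_bounded_support[OF finite_measure_axioms sets_\<mu>] by metis

lemma cc_continuous [continuous_intros]:
  "continuous_on A f \<Longrightarrow> continuous_on A g \<Longrightarrow> continuous_on A (\<lambda>z. cc (f z) (g z))"
  unfolding cc_def by (intro continuous_intros)

lemma ident_measurable: "(\<lambda>z. z) \<in> borel_measurable \<mu>"
  by (rule measurable_\<mu>) simp

lemma cc_measurable [measurable]: "cc x \<in> borel_measurable \<mu>" "(\<lambda>z. cc z x) \<in> borel_measurable \<mu>"
  unfolding cc_def using ident_measurable by measurable

lemma cc_measurable_pair [measurable]:
  "(\<lambda>p. cc (fst p) (snd p)) \<in> borel_measurable (\<mu> \<Otimes>\<^sub>M \<mu>)"
proof -
  have "fst \<in> borel_measurable (\<mu> \<Otimes>\<^sub>M \<mu>)" "snd \<in> borel_measurable (\<mu> \<Otimes>\<^sub>M \<mu>)"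
    by (rule measurable_compose[OF measurable_fst ident_measurable] measurable_compose[OF measurable_snd ident_measurable])+
  then show ?thesis unfolding cc_def by measurable
qed

lemma homogeneous':
  assumes "x \<in> Q" "y \<in> Q"
  obtains g where "g \<in> measurable \<mu> \<mu>" "distr \<mu> \<mu> g = \<mu>" "\<And>u v. u \<in> Q \<Longrightarrow> v \<in> Q \<Longrightarrow> cc (g u) (g v) = cc u v"
    "g x = Y 0" "g y = Y (\<theta> x y)"
  using homogeneous[OF assms] by (auto simp: Y_def cc_def)

text \<open>Transport by a measure-preserving isometry: such an integral depends on the two points
  through their distance only and may be computed on the standard circle.\<close>

lemma integral_two_point:
  fixes G :: "real \<Rightarrow> real \<Rightarrow> real"
  assumes G: "(\<lambda>p. G (fst p) (snd p)) \<in> borel_measurable borel" and xy: "x \<in> Q" "y \<in> Q"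
  shows "(\<integral>z. G (cc x z) (cc z y) \<partial>\<mu>) = (\<integral>z. G (cc (Y 0) z) (cc z (Y (\<theta> x y))) \<partial>\<mu>)"
proof -
  obtain g where g: "g \<in> measurable \<mu> \<mu>" "distr \<mu> \<mu> g = \<mu>" and gc: "\<And>u v. u \<in> Q \<Longrightarrow> v \<in> Q \<Longrightarrow> cc (g u) (g v) = cc u v"
    and gx: "g x = Y 0" "g y = Y (\<theta> x y)"
    using homogeneous'[OF xy] by blast
  have m: "(\<lambda>z. G (cc (Y 0) z) (cc z (Y (\<theta> x y)))) \<in> borel_measurable \<mu>"
    using measurable_compose[of "\<lambda>z. (cc (Y 0) z, cc z (Y (\<theta> x y)))" \<mu> borel "\<lambda>p. G (fst p) (snd p)"] G
    by (simp add: borel_prod[symmetric])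
  have "(\<integral>z. G (cc (Y 0) z) (cc z (Y (\<theta> x y))) \<partial>\<mu>) = (\<integral>z. G (cc (Y 0) (g z)) (cc (g z) (Y (\<theta> x y))) \<partial>\<mu>)"
    by (rule integral_isometry[OF g m, symmetric])
  also have "\<dots> = (\<integral>z. G (cc x z) (cc z y) \<partial>\<mu>)"
    unfolding gx[symmetric] by (intro Bochner_Integration.integral_cong refl) (simp add: gc xy)
  finally show ?thesis by simp
qed

lemma integral_radial:
  fixes f :: "real \<Rightarrow> real"
  assumes f: "f \<in> borel_measurable borel" and x: "x \<in> Q"
  shows "(\<integral>z. f (cc x z) \<partial>\<mu>) = (\<integral>z. f (cc (Y 0) z) \<partial>\<mu>)"
proof -
  have "(\<lambda>p::real \<times> real. f (fst p)) \<in> borel_measurable borel"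
    by (intro measurable_compose[OF _ f] borel_measurable_continuous_onI continuous_intros)
  from integral_two_point[OF this x x] show ?thesis .
qed

text \<open>The mean of g (cc (Y s) z) over z is independent of s. Expanding it to second order for
  s and -s and adding, the mixed term in R and S cancels; division by 1 - cos s and s -> 0 leave the
  stated equality.\<close>

lemma second_variation:
  fixes g :: "real poly"
  shows "(\<integral>z. poly (pderiv (pderiv g)) (cc (Y 0) z) * (\<alpha> * (S \<bullet> z))\<^sup>2 \<partial>\<mu>) = (\<integral>z. poly (pderiv g) (cc (Y 0) z) * (\<alpha> * (R \<bullet> z)) \<partial>\<mu>)"
proof -
  let ?u = "cc (Y 0)" and ?B = "\<lambda>z. \<alpha> * (R \<bullet> z)" and ?C = "\<lambda>z. \<alpha> * (S \<bullet> z)"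
  obtain q where q: "continuous_on UNIV q" "\<And>u e. poly g (u + e) = poly g u + poly (pderiv g) u * e
     + poly (pderiv (pderiv g)) u * e\<^sup>2 / 2 + e ^ 3 * q (u, e)"
    using poly_second_order[of g] by blast
  define e where "e s z = ?B z * (cos s - 1) + ?C z * sin s" for s z
  have ccY: "cc (Y s) z = ?u z + e s z" for s z
    by (simp add: cc_def Y_def e_def inner_add algebra_simps)
  have cont: "continuous_on UNIV (cc (Y 0))" "continuous_on UNIV (e s)" for s
    unfolding e_def[abs_def] by (intro continuous_intros)+
  have qcont: "continuous_on UNIV (\<lambda>z. q (?u z, e s z))" for s
    by (rule continuous_on_compose2[OF q(1)]) (intro continuous_intros cont, simp)
  let ?r = "\<lambda>s z. (e s z) ^ 3 * q (?u z, e s z) + (e (- s) z) ^ 3 * q (?u z, e (- s) z)"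
  define I1 where "I1 = (\<integral>z. poly (pderiv g) (?u z) * ?B z \<partial>\<mu>)"
  define I2 where "I2 = (\<integral>z. poly (pderiv (pderiv g)) (?u z) * (?B z)\<^sup>2 \<partial>\<mu>)"
  define I3 where "I3 = (\<integral>z. poly (pderiv (pderiv g)) (?u z) * (?C z)\<^sup>2 \<partial>\<mu>)"
  define Rm where "Rm s = (\<integral>z. ?r s z \<partial>\<mu>)" for s
  have id: "2 * (cos s - 1) * I1 + (cos s - 1)\<^sup>2 * I2 + (sin s)\<^sup>2 * I3 + Rm s = 0" for s
  proof -
    have const: "(\<integral>z. poly g (cc (Y s) z) \<partial>\<mu>) = (\<integral>z. poly g (?u z) \<partial>\<mu>)" for s
      by (intro integral_radial borel_measurable_continuous_onI continuous_intros Y_space)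
    have "(\<integral>z. (2 * (cos s - 1)) * (poly (pderiv g) (?u z) * ?B z) + (cos s - 1)\<^sup>2 * (poly (pderiv (pderiv g)) (?u z) * (?B z)\<^sup>2)
        + (sin s)\<^sup>2 * (poly (pderiv (pderiv g)) (?u z) * (?C z)\<^sup>2) + ?r s z \<partial>\<mu>)
      = (\<integral>z. poly g (cc (Y s) z) + poly g (cc (Y (- s)) z) - 2 * poly g (?u z) \<partial>\<mu>)"
      unfolding ccY[of s] ccY[of "- s"] q(2)
      by (intro Bochner_Integration.integral_cong refl) (simp add: e_def power2_eq_square field_simps)
    also have "\<dots> = 0"
    proof -
      have i: "integrable \<mu> (\<lambda>z. poly g (cc (Y s) z))" for s
        by (intro integrable_\<mu>_continuous continuous_intros)
      show ?thesis by (simp add: i const[of s] const[of "- s"])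
    qed
    also have "(\<integral>z. (2 * (cos s - 1)) * (poly (pderiv g) (?u z) * ?B z) + (cos s - 1)\<^sup>2 * (poly (pderiv (pderiv g)) (?u z) * (?B z)\<^sup>2)
        + (sin s)\<^sup>2 * (poly (pderiv (pderiv g)) (?u z) * (?C z)\<^sup>2) + ?r s z \<partial>\<mu>)
      = 2 * (cos s - 1) * I1 + (cos s - 1)\<^sup>2 * I2 + (sin s)\<^sup>2 * I3 + Rm s"
    proof -
      have i: "integrable \<mu> (\<lambda>z. poly (pderiv g) (?u z) * ?B z)" "integrable \<mu> (\<lambda>z. poly (pderiv (pderiv g)) (?u z) * (?B z)\<^sup>2)"
        "integrable \<mu> (\<lambda>z. poly (pderiv (pderiv g)) (?u z) * (?C z)\<^sup>2)" "integrable \<mu> (?r s)"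
        by (intro integrable_\<mu>_continuous continuous_intros cont qcont)+
      show ?thesis unfolding I1_def I2_def I3_def Rm_def
        by (simp only: i Bochner_Integration.integral_add Bochner_Integration.integrable_add integrable_mult_right integral_mult_right_zero)
    qed
    finally show ?thesis .
  qed
  obtain B where B: "B > 0" "Q \<subseteq> cball 0 B" using Q_bounded by blast
  define m where "m = \<bar>\<alpha>\<bar> * (norm R + norm S) * B + 1"
  have BC: "\<bar>?B z\<bar> \<le> m" "\<bar>?C z\<bar> \<le> m" if "z \<in> Q" for z
  proof -
    have nz: "norm z \<le> B" using that B by auto
    have "\<bar>R \<bullet> z\<bar> \<le> (norm R + norm S) * B" "\<bar>S \<bullet> z\<bar> \<le> (norm R + norm S) * B"
      by (rule order.trans[OF Cauchy_Schwarz_ineq2], intro mult_mono; use nz in simp)+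
    then have "\<bar>\<alpha>\<bar> * \<bar>R \<bullet> z\<bar> \<le> \<bar>\<alpha>\<bar> * ((norm R + norm S) * B)" "\<bar>\<alpha>\<bar> * \<bar>S \<bullet> z\<bar> \<le> \<bar>\<alpha>\<bar> * ((norm R + norm S) * B)"
      by (intro mult_left_mono; simp)+
    then show "\<bar>?B z\<bar> \<le> m" "\<bar>?C z\<bar> \<le> m" by (simp_all add: m_def abs_mult)
  qed
  have m0: "m \<ge> 1" using B by (simp add: m_def)
  have e_le: "\<bar>e s z\<bar> \<le> 2 * m * \<bar>s\<bar>" if "z \<in> Q" for s z
  proof -
    have "\<bar>cos s - 1\<bar> \<le> \<bar>s\<bar>"
    proof -
      have "1 - cos s = 2 * (sin (s/2))\<^sup>2" using cos_double_sin[of "s/2"] by simp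
      also have "\<dots> = 2 * (\<bar>sin (s/2)\<bar> * \<bar>sin (s/2)\<bar>)" by (simp add: power2_eq_square)
      also have "\<dots> \<le> 2 * (\<bar>s/2\<bar> * 1)" by (intro mult_left_mono mult_mono abs_sin_x_le_abs_x) auto
      finally show ?thesis by simp
    qed
    then have "\<bar>?B z * (cos s - 1)\<bar> \<le> m * \<bar>s\<bar>" "\<bar>?C z * sin s\<bar> \<le> m * \<bar>s\<bar>"
      using BC[OF that] abs_sin_x_le_abs_x[of s] m0 unfolding abs_mult[of "?B z"] abs_mult[of "?C z"]
      by (intro mult_mono; simp)+
    then show ?thesis unfolding e_def by (simp add: mult.assoc)
  qed
  have "compact ({-1..1::real} \<times> {- (2 * m)..2 * m})" by (intro compact_Times compact_Icc)
  then have "bounded (q ` ({-1..1} \<times> {- (2 * m)..2 * m}))"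
    by (intro compact_imp_bounded compact_continuous_image continuous_on_subset[OF q(1)]) auto
  then obtain K where K: "\<And>p. p \<in> {-1..1} \<times> {- (2 * m)..2 * m} \<Longrightarrow> \<bar>q p\<bar> \<le> K"
    unfolding bounded_iff by fastforce
  have "0 \<le> \<bar>q (0, 0)\<bar>" by simp
  also have "\<dots> \<le> K" using m0 by (intro K) auto
  finally have K0: "0 \<le> K" .
  \<comment> \<open>The remainder is of order s^3, while 1 - cos s is of order s^2, so the quotient
    tends to 0. All bounds are uniform in z because the space is bounded.\<close>
  have Rm_le: "\<bar>Rm s\<bar> \<le> 16 * m ^ 3 * K * s ^ 3" if s: "0 < s" "s \<le> 1" for s
  proof -
    have summand: "\<bar>(e s' z) ^ 3 * q (?u z, e s' z)\<bar> \<le> (2 * m * s) ^ 3 * K" if "z \<in> Q" "\<bar>s'\<bar> = s" for z s'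
    proof -
      have el: "\<bar>e s' z\<bar> \<le> 2 * m * s" using e_le[OF that(1), of s'] that by simp
      also have "\<dots> \<le> 2 * m" using s m0 by (simp add: mult_left_le)
      finally have "\<bar>q (?u z, e s' z)\<bar> \<le> K" using cc_range[OF Y_space that(1), of 0] by (intro K) auto
      then show ?thesis unfolding abs_mult power_abs using el m0 s by (intro mult_mono power_mono) auto
    qed
    have "\<bar>Rm s\<bar> \<le> (\<integral>z. \<bar>?r s z\<bar> \<partial>\<mu>)" unfolding Rm_def by (rule integral_abs_bound)
    also have "\<dots> \<le> (\<integral>z. 2 * ((2 * m * s) ^ 3 * K) \<partial>\<mu>)"
    proof (rule integral_mono)
      show "integrable \<mu> (\<lambda>z. \<bar>?r s z\<bar>)" by (intro integrable_\<mu>_continuous continuous_intros cont qcont)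
      fix z assume "z \<in> Q"
      then show "\<bar>?r s z\<bar> \<le> 2 * ((2 * m * s) ^ 3 * K)"
        using summand[of z s] summand[of z "- s"] s by simp
    qed simp
    also have "\<dots> = 16 * m ^ 3 * K * s ^ 3" by (simp add: prob_space power_mult_distrib)
    finally show ?thesis .
  qed
  have "((\<lambda>s. Rm s / (1 - cos s)) \<longlongrightarrow> 0) (at_right 0)"
  proof (rule tendsto_0_le[where K = 1])
    show "((\<lambda>s::real. 8 * m ^ 3 * K * pi\<^sup>2 * s) \<longlongrightarrow> 0) (at_right 0)"
      by (rule tendsto_eq_intros refl | simp)+
    have "\<forall>\<^sub>F s::real in at_right 0. s \<in> {0<..<1}" by (intro eventually_at_right_real) simp
    then show "\<forall>\<^sub>F s in at_right 0. norm (Rm s / (1 - cos s)) \<le> norm (8 * m ^ 3 * K * pi\<^sup>2 * s) * 1"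
    proof eventually_elim
      case (elim s)
      then have "s / pi \<le> sin (s / 2)" using pi_gt3 by (intro sin_half_ge) auto
      then have "2 * (s / pi)\<^sup>2 \<le> 2 * (sin (s / 2))\<^sup>2" using elim by (intro mult_left_mono power_mono) auto
      also have "\<dots> = 1 - cos s" using cos_double_sin[of "s/2"] by simp
      finally have le: "2 * (s / pi)\<^sup>2 \<le> 1 - cos s" .
      have pos: "0 < 2 * (s / pi)\<^sup>2" using elim by simp
      have "\<bar>Rm s\<bar> / (1 - cos s) \<le> (16 * m ^ 3 * K * s ^ 3) / (2 * (s / pi)\<^sup>2)"
        using Rm_le[of s] elim le pos K0 m0 by (intro frac_le) auto
      also have "\<dots> = 8 * m ^ 3 * K * pi\<^sup>2 * s"
        using elim by (simp add: power_divide power2_eq_square power3_eq_cube)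
      finally show ?case using le pos elim K0 m0 by (simp add: abs_mult)
    qed
  qed
  moreover have "((\<lambda>s. Rm s / (1 - cos s)) \<longlongrightarrow> 2 * I1 - 2 * I3) (at_right 0)"
  proof (rule Lim_transform_eventually)
    have "((\<lambda>s. 2 * I1 - (1 - cos s) * I2 - (1 + cos s) * I3) \<longlongrightarrow> 2 * I1 - (1 - cos 0) * I2 - (1 + cos 0) * I3) (at_right 0)"
      by (intro tendsto_intros)
    then show "((\<lambda>s. 2 * I1 - (1 - cos s) * I2 - (1 + cos s) * I3) \<longlongrightarrow> 2 * I1 - 2 * I3) (at_right 0)" by simp
    have "\<forall>\<^sub>F s::real in at_right 0. s \<in> {0<..<1}" by (intro eventually_at_right_real) simp
    then show "\<forall>\<^sub>F s in at_right 0. 2 * I1 - (1 - cos s) * I2 - (1 + cos s) * I3 = Rm s / (1 - cos s)"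
    proof eventually_elim
      case (elim s)
      have "cos s < cos 0" using elim pi_gt3 by (intro cos_monotone_0_pi) auto
      then have nz: "1 - cos s \<noteq> 0" by simp
      have "Rm s = (1 - cos s) * (2 * I1 - (1 - cos s) * I2 - (1 + cos s) * I3)"
        using id[of s] unfolding sin_squared_eq by (simp add: power2_eq_square algebra_simps)
      then show ?case using nz by simp
    qed
  qed
  ultimately have "2 * I1 - 2 * I3 = 0" by (intro tendsto_unique[of "at_right (0::real)"]) auto
  then show ?thesis by (simp add: I1_def I3_def)
qed

text \<open>\<open>second_variation\<close> with both means replaced by \<open>average_S\<close> and
  \<open>average_R\<close>: after multiplication by d the two sides are exactly the second and first
  order terms of the operator.\<close>

lemma radial_operator: "(\<integral>z. poly (jacobi_operator d d0 p) (cc (Y 0) z) \<partial>\<mu>) = 0"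
proof -
  let ?u = "cc (Y 0)"
  have dp: "real d > 0" using d_pos by simp
  have Y0: "Y 0 = P + R" by (simp add: Y_def)
  have uc: "continuous_on UNIV ?u" by (intro continuous_intros)
  have "(\<integral>z. poly (pderiv (pderiv p)) (?u z) * (1 - (?u z)\<^sup>2) \<partial>\<mu>) / real d =
    (\<integral>z. poly (pderiv p) (?u z) * ((1 + ?u z) / 2 - (1 - ?u z) * real d0 / (2 * real d)) \<partial>\<mu>)"
    using second_variation[of p] average_S[of "pderiv (pderiv p)"] average_R[of "pderiv p"]
    unfolding cc_def Y0 by simp
  then have "0 = (\<integral>z. poly (pderiv (pderiv p)) (?u z) * (1 - (?u z)\<^sup>2) \<partial>\<mu>) -
     real d * (\<integral>z. poly (pderiv p) (?u z) * ((1 + ?u z) / 2 - (1 - ?u z) * real d0 / (2 * real d)) \<partial>\<mu>)"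
    using dp by (simp add: field_simps)
  also have "\<dots> = (\<integral>z. poly (pderiv (pderiv p)) (?u z) * (1 - (?u z)\<^sup>2) -
     real d * (poly (pderiv p) (?u z) * ((1 + ?u z) / 2 - (1 - ?u z) * real d0 / (2 * real d))) \<partial>\<mu>)"
    using dp by (subst Bochner_Integration.integral_diff, (intro integrable_\<mu>_continuous continuous_intros uc; simp)+) simp
  also have "\<dots> = (\<integral>z. poly (jacobi_operator d d0 p) (?u z) \<partial>\<mu>)"
    using dp by (intro Bochner_Integration.integral_cong refl) (simp add: jacobi_operator_def power2_eq_square field_simps)
  finally show ?thesis by simp
qed

end

section \<open>Spherical harmonic analysis\<close>

lemma poly_antiderivative: "\<exists>g. pderiv g = (h :: real poly)"
proof -
  have "pderiv (\<Sum>i\<le>degree h. monom (coeff h i / (1 + real i)) (Suc i)) = h"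
  proof (rule poly_eqI)
    fix n
    show "coeff (pderiv (\<Sum>i\<le>degree h. monom (coeff h i / (1 + real i)) (Suc i))) n = coeff h n"
      by (cases "n \<le> degree h") (auto simp: coeff_pderiv coeff_sum coeff_eq_0)
  qed
  then show ?thesis ..
qed

text \<open>Bounded on [-1, 1] only, since this interval contains all values of \<open>cc\<close> on
  the space; polynomials are thereby included.\<close>

definition bounded_borel :: "(real \<Rightarrow> real) \<Rightarrow> bool" where
  "bounded_borel f \<longleftrightarrow> f \<in> borel_measurable borel \<and> (\<exists>B. \<forall>c\<in>{-1..1}. \<bar>f c\<bar> \<le> B)"

lemma bounded_borel_measurable: "bounded_borel f \<Longrightarrow> f \<in> borel_measurable borel"
  by (simp add: bounded_borel_def)

lemma bounded_borel_continuous: "continuous_on UNIV f \<Longrightarrow> bounded_borel f"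
proof -
  assume f: "continuous_on UNIV f"
  have "bounded (f ` {-1..1})"
    by (intro compact_imp_bounded compact_continuous_image continuous_on_subset[OF f]) auto
  then show "bounded_borel f"
    unfolding bounded_borel_def bounded_iff by (auto intro: borel_measurable_continuous_onI f)
qed

lemma bounded_borel_poly: "bounded_borel (poly p)"
  by (intro bounded_borel_continuous continuous_intros)

lemma bounded_borel_mult: "bounded_borel f \<Longrightarrow> bounded_borel g \<Longrightarrow> bounded_borel (\<lambda>c. f c * g c)"
proof -
  assume "bounded_borel f" "bounded_borel g"
  then obtain A B where m: "f \<in> borel_measurable borel" "g \<in> borel_measurable borel"
    and A: "\<forall>c\<in>{-1..1}. \<bar>f c\<bar> \<le> A" and B: "\<forall>c\<in>{-1..1}. \<bar>g c\<bar> \<le> B"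
    by (auto simp: bounded_borel_def)
  have "\<forall>c\<in>{-1..1}. \<bar>f c * g c\<bar> \<le> \<bar>A\<bar> * \<bar>B\<bar>"
    unfolding abs_mult using A B by (intro ballI mult_mono) force+
  with m show ?thesis by (auto simp: bounded_borel_def)
qed

lemma bounded_borel_diff: "bounded_borel f \<Longrightarrow> bounded_borel g \<Longrightarrow> bounded_borel (\<lambda>c. f c - g c)"
proof -
  assume "bounded_borel f" "bounded_borel g"
  then obtain A B where m: "f \<in> borel_measurable borel" "g \<in> borel_measurable borel"
    and A: "\<forall>c\<in>{-1..1}. \<bar>f c\<bar> \<le> A" and B: "\<forall>c\<in>{-1..1}. \<bar>g c\<bar> \<le> B"
    by (auto simp: bounded_borel_def)
  have "\<forall>c\<in>{-1..1}. \<bar>f c - g c\<bar> \<le> A + B"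
    using A B by (intro ballI order.trans[OF abs_triangle_ineq4] add_mono) auto
  with m show ?thesis by (auto simp: bounded_borel_def)
qed

lemma bounded_borel_power2: "bounded_borel f \<Longrightarrow> bounded_borel (\<lambda>c. (f c)\<^sup>2)"
  unfolding power2_eq_square by (rule bounded_borel_mult)

context zonal_space
begin

lemma weight_mass_pos: "0 < weight_mass"
proof -
  have n: "\<And>t. t \<in> {0..pi} \<Longrightarrow> 0 \<le> w t" by (auto intro: jw_nonneg)
  have "weight_mass \<noteq> 0"
  proof
    assume "weight_mass = 0"
    then have "\<forall>t\<in>{0..pi}. w t = 0"
      unfolding weight_mass_def using integral_eq_0_iff[OF continuous_on_jw pi_gt_zero n] by blast
    then show False using jw_pos[of 1 "d - 1" "d0 - 1"] pi_gt3 by auto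
  qed
  moreover have "0 \<le> weight_mass" unfolding weight_mass_def
    by (intro integral_nonneg n integrable_continuous_real continuous_on_jw)
  ultimately show ?thesis by linarith
qed

text \<open>The law of \<open>cc (Y 0)\<close> and the image under cos of the normalized weight both
  live on [-1, 1], and the integrals against both vanish on the range of
  \<open>jacobi_operator\<close>. By \<open>functional_unique\<close> they have the same moments,
  hence they coincide.\<close>

lemma radial_distribution:
  fixes f :: "real \<Rightarrow> real"
  assumes f: "f \<in> borel_measurable borel" and x: "x \<in> Q"
  shows "(\<integral>z. f (cc x z) \<partial>\<mu>) = (LINT t:{0..pi}|lborel. f (cos t) * w t) / weight_mass"
proof -
  define D where "D = distr \<mu> borel (cc (Y 0))"
  define \<rho> where "\<rho> t = indicator {0..pi} t * (w t / weight_mass)" for t :: real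
  define J where "J = density lborel (\<lambda>t. ennreal (\<rho> t))"
  define N where "N = distr J borel cos"
  have wm: "w \<in> borel_measurable borel" by (intro borel_measurable_continuous_onI continuous_intros)
  have \<rho>_meas [measurable]: "\<rho> \<in> borel_measurable borel" unfolding \<rho>_def[abs_def] using wm by measurable
  have \<rho>_nonneg: "0 \<le> \<rho> t" for t using weight_mass_pos by (auto simp: \<rho>_def indicator_def intro!: divide_nonneg_nonneg jw_nonneg)
  have J_int: "(\<integral>t. g t \<partial>J) = (LINT t:{0..pi}|lborel. g t * w t) / weight_mass"
    if "g \<in> borel_measurable borel" for g :: "real \<Rightarrow> real"
  proof -
    have "(\<integral>t. g t \<partial>J) = (\<integral>t. \<rho> t * g t \<partial>lborel)"
      unfolding J_def using that \<rho>_nonneg by (subst integral_density) auto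
    also have "\<dots> = (\<integral>t. (indicator {0..pi} t * (g t * w t)) / weight_mass \<partial>lborel)"
      by (intro Bochner_Integration.integral_cong refl) (simp add: \<rho>_def)
    finally show ?thesis by (simp add: set_lebesgue_integral_def)
  qed
  have w_int: "(LINT t:{0..pi}|lborel. w t) = weight_mass"
    unfolding weight_mass_def by (intro set_integral_Icc continuous_intros)
  have \<rho>_int: "integrable lborel \<rho>"
  proof -
    have "set_integrable lborel {0..pi} (\<lambda>t. w t / weight_mass)"
      using weight_mass_pos by (intro borel_integrable_atLeastAtMost' continuous_intros) auto
    then show ?thesis by (simp add: set_integrable_def \<rho>_def[abs_def])
  qed
  have "emeasure J (space J) = (\<integral>\<^sup>+ t. ennreal (\<rho> t) \<partial>lborel)"
    unfolding J_def by (subst emeasure_density) auto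
  also have "\<dots> = ennreal (\<integral>t. \<rho> t \<partial>lborel)" by (intro nn_integral_eq_integral \<rho>_int) (simp add: \<rho>_nonneg)
  also have "(\<integral>t. \<rho> t \<partial>lborel) = (LINT t:{0..pi}|lborel. w t) / weight_mass"
    by (simp add: \<rho>_def[abs_def] set_lebesgue_integral_def)
  finally have "emeasure J (space J) = 1" using weight_mass_pos unfolding w_int by simp
  then interpret J: prob_space J by (rule prob_spaceI)
  have J_sets [measurable_cong]: "sets J = sets borel" by (simp add: J_def)
  have cosm: "cos \<in> measurable J borel"
    by (simp add: measurable_cong_sets[OF J_sets refl] borel_measurable_continuous_onI continuous_intros)
  have "D = N"
  proof (rule real_distribution_eq_by_moments)
    show "real_distribution D" unfolding D_def by (intro real_distribution_distr cc_measurable)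
    show "real_distribution N" unfolding N_def by (rule J.real_distribution_distr[OF cosm])
    show "AE x in D. x \<in> {-1..1}" unfolding D_def
      by (subst AE_distr_iff) (use cc_range[OF Y_space] in \<open>auto intro!: AE_I2\<close>)
    show "AE x in N. x \<in> {-1..1}" unfolding N_def
      by (subst AE_distr_iff[OF cosm]) auto
    have De: "(\<integral>x. poly p x \<partial>D) = (\<integral>z. poly p (cc (Y 0) z) \<partial>\<mu>)" for p
      unfolding D_def by (rule integral_distr[OF cc_measurable(1)]) (intro borel_measurable_continuous_onI continuous_intros)
    have Ne: "(\<integral>x. poly p x \<partial>N) = integral {0..pi} (\<lambda>t. poly p (cos t) * w t) / weight_mass" for p
    proof -
      have "(\<integral>x. poly p x \<partial>N) = (\<integral>t. poly p (cos t) \<partial>J)"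
        unfolding N_def by (rule integral_distr[OF cosm]) (intro borel_measurable_continuous_onI continuous_intros)
      also have "\<dots> = (LINT t:{0..pi}|lborel. poly p (cos t) * w t) / weight_mass"
        by (intro J_int borel_measurable_continuous_onI continuous_intros)
      also have "(LINT t:{0..pi}|lborel. poly p (cos t) * w t) = integral {0..pi} (\<lambda>t. poly p (cos t) * w t)"
        by (intro set_integral_Icc continuous_intros)
      finally show ?thesis .
    qed
    have i1: "integrable \<mu> (\<lambda>z. poly p (cc (Y 0) z))" for p by (intro integrable_\<mu>_continuous continuous_intros)
    have i2: "(\<lambda>t. poly p (cos t) * w t) integrable_on {0..pi}" for p
      by (intro integrable_continuous_real continuous_intros)
    show "(\<integral>x. poly p x \<partial>D) = (\<integral>x. poly p x \<partial>N)" for p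
    proof (rule functional_unique[OF d_pos d0(1), where E = "\<lambda>p. \<integral>x. poly p x \<partial>D" and F = "\<lambda>p. \<integral>x. poly p x \<partial>N"])
      show "(\<integral>x. poly (p + q) x \<partial>D) = (\<integral>x. poly p x \<partial>D) + (\<integral>x. poly q x \<partial>D)" for p q
        unfolding De by (simp add: i1)
      show "(\<integral>x. poly (smult c p) x \<partial>D) = c * (\<integral>x. poly p x \<partial>D)" for c p
        unfolding De by simp
      show "(\<integral>x. poly 1 x \<partial>D) = 1" unfolding De by (simp add: prob_space)
      show "(\<integral>x. poly (jacobi_operator d d0 p) x \<partial>D) = 0" for p
        unfolding De by (rule radial_operator)
      show "(\<integral>x. poly (p + q) x \<partial>N) = (\<integral>x. poly p x \<partial>N) + (\<integral>x. poly q x \<partial>N)" for p q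
        unfolding Ne using i2 by (simp add: distrib_right integral_add add_divide_distrib)
      show "(\<integral>x. poly (smult c p) x \<partial>N) = c * (\<integral>x. poly p x \<partial>N)" for c p
        unfolding Ne by (simp add: mult.assoc)
      show "(\<integral>x. poly 1 x \<partial>N) = 1"
        unfolding Ne using weight_mass_pos by (simp add: weight_mass_def)
      show "(\<integral>x. poly (jacobi_operator d d0 p) x \<partial>N) = 0" for p
        unfolding Ne integral_jacobi_operator[OF d_pos d0(1)] by simp
    qed
  qed
  have "(\<integral>z. f (cc x z) \<partial>\<mu>) = (\<integral>c. f c \<partial>D)"
    unfolding integral_radial[OF f x] D_def by (rule integral_distr[OF cc_measurable(1) f, symmetric])
  also have "\<dots> = (\<integral>t. f (cos t) \<partial>J)" unfolding \<open>D = N\<close> N_def by (rule integral_distr[OF cosm f])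
  also have "\<dots> = (LINT t:{0..pi}|lborel. f (cos t) * w t) / weight_mass"
    by (intro J_int measurable_compose[OF _ f] borel_measurable_continuous_onI continuous_intros)
  finally show ?thesis .
qed

definition E :: "(real \<Rightarrow> real) \<Rightarrow> real" where "E f = (\<integral>z. f (cc (Y 0) z) \<partial>\<mu>)"

lemma E_eq: "f \<in> borel_measurable borel \<Longrightarrow> x \<in> Q \<Longrightarrow> (\<integral>z. f (cc x z) \<partial>\<mu>) = E f"
  unfolding E_def by (rule integral_radial)

lemma E_eq': "f \<in> borel_measurable borel \<Longrightarrow> x \<in> Q \<Longrightarrow> (\<integral>z. f (cc z x) \<partial>\<mu>) = E f"
  using E_eq by (simp add: cc_sym[of _ x])

lemma E_weight: "f \<in> borel_measurable borel \<Longrightarrow> E f = (LINT t:{0..pi}|lborel. f (cos t) * w t) / weight_mass"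
  unfolding E_def by (rule radial_distribution) auto

lemma integrable_bounded_borel: "bounded_borel f \<Longrightarrow> x \<in> Q \<Longrightarrow> integrable \<mu> (\<lambda>z. f (cc x z))"
proof -
  assume f: "bounded_borel f" and x: "x \<in> Q"
  then obtain B where B: "\<forall>c\<in>{-1..1}. \<bar>f c\<bar> \<le> B" by (auto simp: bounded_borel_def)
  show ?thesis
    by (rule integrable_const_bound[of _ B])
       (use B cc_range[OF x] measurable_compose[OF cc_measurable(1) bounded_borel_measurable[OF f], of x] in auto)
qed

lemma integrable_bounded_borel': "bounded_borel f \<Longrightarrow> x \<in> Q \<Longrightarrow> integrable \<mu> (\<lambda>z. f (cc z x))"
  using integrable_bounded_borel[of f x] by (simp add: cc_sym[of _ x])

lemma integrable_bounded_borel2: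
  assumes f: "bounded_borel f" and g: "bounded_borel g" and xy: "x \<in> Q" "y \<in> Q"
  shows "integrable \<mu> (\<lambda>z. f (cc x z) * g (cc z y))"
proof -
  obtain A B where A: "\<forall>c\<in>{-1..1}. \<bar>f c\<bar> \<le> A" and B: "\<forall>c\<in>{-1..1}. \<bar>g c\<bar> \<le> B"
    using f g by (auto simp: bounded_borel_def)
  show ?thesis
  proof (rule integrable_const_bound[of _ "\<bar>A\<bar> * \<bar>B\<bar>"])
    have "\<bar>f (cc x z)\<bar> \<le> \<bar>A\<bar>" "\<bar>g (cc z y)\<bar> \<le> \<bar>B\<bar>" if "z \<in> Q" for z
      using A B cc_range[OF xy(1) that] cc_range[OF that xy(2)] by force+
    then show "AE z in \<mu>. norm (f (cc x z) * g (cc z y)) \<le> \<bar>A\<bar> * \<bar>B\<bar>"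
      by (intro AE_I2) (simp add: abs_mult mult_mono)
    show "(\<lambda>z. f (cc x z) * g (cc z y)) \<in> borel_measurable \<mu>"
      by (intro borel_measurable_times measurable_compose[OF cc_measurable(1)] measurable_compose[OF cc_measurable(2)]
          bounded_borel_measurable f g)
  qed
qed

lemma E_add: "bounded_borel f \<Longrightarrow> bounded_borel g \<Longrightarrow> E (\<lambda>c. f c + g c) = E f + E g"
  unfolding E_def by (intro Bochner_Integration.integral_add integrable_bounded_borel Y_space)

lemma E_cmult: "E (\<lambda>c. a * f c) = a * E f"
  unfolding E_def by simp

lemma E_sum:
  "(\<And>i. i \<in> I \<Longrightarrow> bounded_borel (f i)) \<Longrightarrow> E (\<lambda>c. \<Sum>i\<in>I. f i c) = (\<Sum>i\<in>I. E (f i))"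
  unfolding E_def by (intro Bochner_Integration.integral_sum integrable_bounded_borel Y_space)

lemma E_smult: "E (poly (smult a p)) = a * E (poly p)"
  unfolding E_def by simp

lemma E_poly_sum: "E (poly (\<Sum>j\<in>A. smult (b j) (p j))) = (\<Sum>j\<in>A. b j * E (poly (p j)))"
  unfolding E_def poly_sum
  by (subst Bochner_Integration.integral_sum)
     (auto intro!: integrable_mult_right integrable_bounded_borel bounded_borel_poly)

lemma E_mono:
  assumes "bounded_borel f" "bounded_borel g" "\<And>c. c \<in> {-1..1} \<Longrightarrow> f c \<le> g c" shows "E f \<le> E g"
  unfolding E_def using cc_range[OF Y_space]
  by (intro integral_mono integrable_bounded_borel assms Y_space) auto

lemma E_nonneg:
  assumes "\<And>c. c \<in> {-1..1} \<Longrightarrow> 0 \<le> f c" shows "0 \<le> E f"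
  unfolding E_def using cc_range[OF Y_space] by (intro integral_nonneg_AE AE_I2 assms) auto

lemma E_poly_square_0:
  assumes "E (poly (p * p)) = 0" shows "p = 0"
proof -
  have "(LINT t:{0..pi}|lborel. poly (p * p) (cos t) * w t) = integral {0..pi} (\<lambda>t. poly (p * p) (cos t) * w t)"
    by (intro set_integral_Icc continuous_intros)
  then have "integral {0..pi} (\<lambda>t. poly (p * p) (cos t) * w t) = 0"
    using assms E_weight[of "poly (p * p)"] weight_mass_pos
    by (simp add: borel_measurable_continuous_onI continuous_intros)
  then have z: "\<forall>t\<in>{0..pi}. poly (p * p) (cos t) * w t = 0"
  proof (subst (asm) integral_eq_0_iff)
    show "continuous_on {0..pi} (\<lambda>t. poly (p * p) (cos t) * w t)" by (intro continuous_intros)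
    show "0 \<le> poly (p * p) (cos t) * w t" if "t \<in> {0..pi}" for t
      using that by (intro mult_nonneg_nonneg jw_nonneg) auto
  qed auto
  have "poly p c = 0" if "c \<in> {-1<..<1}" for c
  proof -
    have "0 < arccos c" "arccos c < pi" using that arccos_lt_bounded[of c] by auto
    then show ?thesis using z[rule_format, of "arccos c"] jw_pos[of "arccos c" "d - 1" "d0 - 1"] that by auto
  qed
  then have sub: "{-1<..<1} \<subseteq> {x. poly p x = 0}" by auto
  show "p = 0"
  proof (rule ccontr)
    assume "p \<noteq> 0"
    then have "finite {-1<..<1::real}" using finite_subset[OF sub poly_roots_finite] by blast
    then show False by (simp add: infinite_Ioo)
  qed
qed

section \<open>Orthogonality and convolution of zonal polynomials\<close>

abbreviation "\<phi> \<equiv> jacobi_poly d d0"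

definition kap :: "nat \<Rightarrow> real" where "kap k = E (poly (\<phi> k * \<phi> k))"

lemma degree_\<phi>: "degree (\<phi> k) = k" by (rule degree_jacobi_poly[OF d_pos d0(1)])

lemma kap_pos: "0 < kap k"
proof -
  have "\<phi> k \<noteq> 0" by (metis poly_jacobi_1 poly_0 zero_neq_one)
  then have "kap k \<noteq> 0" using E_poly_square_0 by (auto simp: kap_def)
  moreover have "0 \<le> kap k" unfolding kap_def by (rule E_nonneg) simp
  ultimately show ?thesis by linarith
qed

text \<open>Lagrange's identity without integration by parts: an antiderivative g of the Wronskian
  of the two polynomials is mapped by the operator to \<phi> j M \<phi> k - \<phi> k M \<phi> j, a
  multiple of their product, and E vanishes on the range of M.\<close>

lemma E_orthogonal:
  assumes "j \<noteq> k" shows "E (poly (\<phi> j * \<phi> k)) = 0"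
proof -
  let ?M = "jacobi_operator d d0" and ?e = "jacobi_eigenvalue d d0"
  obtain g where g: "pderiv g = \<phi> j * pderiv (\<phi> k) - \<phi> k * pderiv (\<phi> j)" using poly_antiderivative by blast
  have "?M g = \<phi> j * ?M (\<phi> k) - \<phi> k * ?M (\<phi> j)"
    unfolding jacobi_operator_def g
    by (intro poly_eq_poly_eq_iff[THEN iffD1] ext) (simp add: pderiv_diff pderiv_mult field_simps)
  also have "\<dots> = smult (?e j - ?e k) (\<phi> j * \<phi> k)"
    unfolding jacobi_operator_eigen[OF d_pos] by (simp add: smult_diff_left mult.commute)
  finally have eq: "?M g = smult (?e j - ?e k) (\<phi> j * \<phi> k)" .
  have "E (poly (?M g)) = 0" unfolding E_def by (rule radial_operator)
  then have "(?e j - ?e k) * E (poly (\<phi> j * \<phi> k)) = 0"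
    unfolding eq E_smult .
  moreover have "?e j \<noteq> ?e k"
    using jacobi_eigenvalue_strict_mono[OF d_pos d0(1)] assms by (metis less_irrefl linorder_neqE_nat)
  ultimately show ?thesis by simp
qed

lemma E_lower:
  assumes "degree q < k" shows "E (poly (q * \<phi> k)) = 0"
proof -
  obtain b where b: "q = (\<Sum>j\<le>degree q. smult (b j) (\<phi> j))" using jacobi_span[OF d_pos d0(1) order.refl] by blast
  have "E (poly (q * \<phi> k)) = E (poly (\<Sum>j\<le>degree q. smult (b j) (\<phi> j * \<phi> k)))"
    by (subst b) (simp add: sum_distrib_right)
  also have "\<dots> = (\<Sum>j\<le>degree q. b j * E (poly (\<phi> j * \<phi> k)))" by (rule E_poly_sum)
  also have "\<dots> = 0" using assms by (intro sum.neutral) (auto simp: E_orthogonal)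
  finally show ?thesis .
qed

lemma poly_eq_multiple:
  assumes "degree h \<le> k" "\<And>j. j < k \<Longrightarrow> E (poly (h * \<phi> j)) = 0"
  shows "h = smult (E (poly (h * \<phi> k)) / kap k) (\<phi> k)"
proof -
  obtain b where b: "h = (\<Sum>j\<le>k. smult (b j) (\<phi> j))" using jacobi_span[OF d_pos d0(1) assms(1)] by blast
  have bi: "E (poly (h * \<phi> i)) = b i * kap i" if "i \<le> k" for i
  proof -
    have "E (poly (h * \<phi> i)) = E (poly (\<Sum>j\<le>k. smult (b j) (\<phi> j * \<phi> i)))"
      by (subst b) (simp add: sum_distrib_right)
    also have "\<dots> = (\<Sum>j\<le>k. b j * E (poly (\<phi> j * \<phi> i)))" by (rule E_poly_sum)
    also have "\<dots> = (\<Sum>j\<in>{i}. b j * E (poly (\<phi> j * \<phi> i)))"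
      using that by (intro sum.mono_neutral_right) (auto simp: E_orthogonal)
    finally show ?thesis by (simp add: kap_def)
  qed
  have "b j = 0" if "j < k" for j
    using bi[of j] assms(2)[OF that] kap_pos[of j] that by auto
  then have "h = (\<Sum>j\<in>{k}. smult (b j) (\<phi> j))"
    by (subst b, intro sum.mono_neutral_right) auto
  then show ?thesis using bi[of k] kap_pos[of k] by simp
qed

text \<open>Along the geodesic \<open>Y\<close> a polynomial of degree \<open>k\<close> is a trigonometric polynomial of degree \<open>k\<close>.\<close>

lemma convolution_poly:
  assumes f: "bounded_borel f"
  shows "\<exists>h. degree h \<le> degree q \<and> (\<forall>x\<in>Q. \<forall>y\<in>Q. (\<integral>z. f (cc x z) * poly q (cc z y) \<partial>\<mu>) = poly h (cc x y))"
proof -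
  define k where "k = degree q"
  have ccY: "cc z (Y s) = (\<alpha> * (P \<bullet> z) + \<beta>) + (\<alpha> * (R \<bullet> z)) * cos s + (\<alpha> * (S \<bullet> z)) * sin s" for z s
    by (simp add: cc_def Y_def inner_add inner_commute algebra_simps)
  have "\<forall>z. \<exists>T. degree T \<le> k \<and> (\<forall>s. poly q (cc z (Y s)) + poly q (cc z (Y (- s))) = poly T (cos s))"
  proof
    fix z
    obtain T where "degree T \<le> degree q" "\<And>x y. x\<^sup>2 + y\<^sup>2 = 1 \<Longrightarrow>
      poly q ((\<alpha> * (P \<bullet> z) + \<beta>) + (\<alpha> * (R \<bullet> z)) * x + (\<alpha> * (S \<bullet> z)) * y)
       + poly q ((\<alpha> * (P \<bullet> z) + \<beta>) + (\<alpha> * (R \<bullet> z)) * x - (\<alpha> * (S \<bullet> z)) * y) = poly T x"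
      using even_part_poly[of q "\<alpha> * (P \<bullet> z) + \<beta>" "\<alpha> * (R \<bullet> z)" "\<alpha> * (S \<bullet> z)"] by blast
    then show "\<exists>T. degree T \<le> k \<and> (\<forall>s. poly q (cc z (Y s)) + poly q (cc z (Y (- s))) = poly T (cos s))"
      unfolding ccY k_def by (intro exI[of _ T]) auto
  qed
  then obtain T where T: "\<And>z. degree (T z) \<le> k" "\<And>z s. poly q (cc z (Y s)) + poly q (cc z (Y (- s))) = poly (T z) (cos s)"
    by metis
  \<comment> \<open>The polynomials T z are chosen separately for each z, without any measurability.
    Interpolation at fixed nodes expresses them through values of q, which can be integrated over
    z.\<close>
  obtain l :: "nat \<Rightarrow> real poly" and nd where l: "\<And>i. i \<le> k \<Longrightarrow> degree (l i) \<le> k" and nd: "\<And>i. i \<le> k \<Longrightarrow> nd i \<in> {-1..1}"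
    and lag: "\<And>p. degree p \<le> k \<Longrightarrow> p = (\<Sum>i\<le>k. smult (poly p (nd i)) (l i))"
    by (rule lagrange_basis[of k], rule that, assumption+)
  define v where "v i = (\<integral>z. f (cc (Y 0) z) * poly q (cc z (Y (arccos (nd i)))) \<partial>\<mu>)
     + (\<integral>z. f (cc (Y 0) z) * poly q (cc z (Y (- arccos (nd i)))) \<partial>\<mu>)" for i
  define h where "h = smult (1/2) (\<Sum>i\<le>k. smult (v i) (l i))"
  have int: "integrable \<mu> (\<lambda>z. f (cc (Y 0) z) * poly q (cc z (Y s)))" for s
    by (intro integrable_bounded_borel2 f bounded_borel_poly Y_space)
  have "degree h \<le> k" unfolding h_def
    by (intro order.trans[OF degree_smult_le] degree_sum_le) (auto intro: order.trans[OF degree_smult_le] l)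
  moreover have "(\<integral>z. f (cc x z) * poly q (cc z y) \<partial>\<mu>) = poly h (cc x y)" if xy: "x \<in> Q" "y \<in> Q" for x y
  proof -
    define s where "s = \<theta> x y"
    have s: "cos s = cc x y" "0 \<le> s" "s \<le> pi" using theta_range[OF xy] by (auto simp: s_def cos_theta' xy)
    have "(\<lambda>p::real\<times>real. f (fst p)) \<in> borel_measurable borel" "(\<lambda>p::real\<times>real. poly q (snd p)) \<in> borel_measurable borel"
      by (intro measurable_compose[OF _ bounded_borel_measurable[OF f]] borel_measurable_continuous_onI continuous_intros)+
    then have m: "(\<lambda>p. f (fst p) * poly q (snd p)) \<in> borel_measurable borel"
      by (rule borel_measurable_times)
    have 1: "(\<integral>z. f (cc x z) * poly q (cc z y) \<partial>\<mu>) = (\<integral>z. f (cc (Y 0) z) * poly q (cc z (Y s)) \<partial>\<mu>)"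
      unfolding s_def by (rule integral_two_point[OF m xy])
    \<comment> \<open>The points \<open>Y s\<close> and \<open>Y (- s)\<close> have the same
      distance from \<open>Y 0\<close>, so the convolution may be averaged over both signs. This
      removes sin s and leaves a polynomial in cos s.\<close>
    have "\<theta> (Y 0) (Y (- s)) = s" using arccos_cos[OF s(2,3)] by (simp add: theta_eq cc_Y)
    then have 2: "(\<integral>z. f (cc (Y 0) z) * poly q (cc z (Y (- s))) \<partial>\<mu>) = (\<integral>z. f (cc (Y 0) z) * poly q (cc z (Y s)) \<partial>\<mu>)"
      using integral_two_point[OF m Y_space Y_space, of 0 "- s"] by simp
    have "2 * (\<integral>z. f (cc x z) * poly q (cc z y) \<partial>\<mu>) =
        (\<integral>z. f (cc (Y 0) z) * poly q (cc z (Y s)) + f (cc (Y 0) z) * poly q (cc z (Y (- s))) \<partial>\<mu>)"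
      using 1 2 by (simp add: Bochner_Integration.integral_add[OF int int])
    also have "\<dots> = (\<integral>z. (\<Sum>i\<le>k. (f (cc (Y 0) z) * poly q (cc z (Y (arccos (nd i)))) + f (cc (Y 0) z) * poly q (cc z (Y (- arccos (nd i))))) * poly (l i) (cos s)) \<partial>\<mu>)"
    proof (rule Bochner_Integration.integral_cong[OF refl])
      fix z
      have "poly q (cc z (Y s)) + poly q (cc z (Y (- s))) = poly (\<Sum>i\<le>k. smult (poly (T z) (nd i)) (l i)) (cos s)"
        unfolding T(2) by (subst lag[OF T(1)]) (rule refl)
      also have "\<dots> = (\<Sum>i\<le>k. (poly q (cc z (Y (arccos (nd i)))) + poly q (cc z (Y (- arccos (nd i))))) * poly (l i) (cos s))"
        unfolding poly_sum T(2) using nd by (intro sum.cong refl) (auto simp: cos_arccos)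
      finally show "f (cc (Y 0) z) * poly q (cc z (Y s)) + f (cc (Y 0) z) * poly q (cc z (Y (- s))) =
        (\<Sum>i\<le>k. (f (cc (Y 0) z) * poly q (cc z (Y (arccos (nd i)))) + f (cc (Y 0) z) * poly q (cc z (Y (- arccos (nd i))))) * poly (l i) (cos s))"
        by (simp add: sum_distrib_left mult.assoc flip: distrib_left)
    qed
    also have "\<dots> = (\<Sum>i\<le>k. v i * poly (l i) (cos s))"
      unfolding v_def
      by (subst Bochner_Integration.integral_sum) (auto simp: int)
    also have "\<dots> = 2 * poly h (cc x y)" by (simp add: h_def poly_sum s)
    finally show ?thesis by simp
  qed
  ultimately show ?thesis unfolding k_def by blast
qed

text \<open>Associativity of convolution: both sides are the triple convolution of f, q and r at the
  pair (\<open>Y 0\<close>, \<open>Y 0\<close>), integrated in the two orders.\<close>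

lemma convolution_adjoint:
  assumes f: "bounded_borel f"
    and h: "\<And>x y. x \<in> Q \<Longrightarrow> y \<in> Q \<Longrightarrow> (\<integral>z. f (cc x z) * poly q (cc z y) \<partial>\<mu>) = poly h (cc x y)"
    and h': "\<And>x y. x \<in> Q \<Longrightarrow> y \<in> Q \<Longrightarrow> (\<integral>z. poly q (cc x z) * poly r (cc z y) \<partial>\<mu>) = poly h' (cc x y)"
  shows "E (poly (h * r)) = E (\<lambda>c. f c * poly h' c)"
proof -
  interpret pair_prob_space \<mu> \<mu> ..
  let ?y0 = "Y 0"
  let ?F = "\<lambda>z y. f (cc ?y0 z) * poly q (cc z y) * poly r (cc y ?y0)"
  obtain A where A: "\<forall>c\<in>{-1..1}. \<bar>f c\<bar> \<le> A" using f by (auto simp: bounded_borel_def)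
  obtain B where B: "\<forall>c\<in>{-1..1}. \<bar>poly q c\<bar> \<le> B" using bounded_borel_poly[of q] by (auto simp: bounded_borel_def)
  obtain C where C: "\<forall>c\<in>{-1..1}. \<bar>poly r c\<bar> \<le> C" using bounded_borel_poly[of r] by (auto simp: bounded_borel_def)
  have int: "integrable (\<mu> \<Otimes>\<^sub>M \<mu>) (case_prod ?F)"
  proof (rule integrable_const_bound[of _ "\<bar>A\<bar> * \<bar>B\<bar> * \<bar>C\<bar>"])
    show "AE p in \<mu> \<Otimes>\<^sub>M \<mu>. norm (case_prod ?F p) \<le> \<bar>A\<bar> * \<bar>B\<bar> * \<bar>C\<bar>"
    proof (rule AE_I2)
      fix p assume "p \<in> space (\<mu> \<Otimes>\<^sub>M \<mu>)"
      then obtain z y where p: "p = (z, y)" "z \<in> Q" "y \<in> Q" by (auto simp: space_pair_measure)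
      have "\<bar>f (cc ?y0 z)\<bar> \<le> \<bar>A\<bar>" "\<bar>poly q (cc z y)\<bar> \<le> \<bar>B\<bar>" "\<bar>poly r (cc y ?y0)\<bar> \<le> \<bar>C\<bar>"
        using A[rule_format, OF cc_range[OF Y_space p(2)]] B[rule_format, OF cc_range[OF p(2,3)]]
          C[rule_format, OF cc_range[OF p(3) Y_space]] abs_ge_self order.trans by blast+
      then show "norm (case_prod ?F p) \<le> \<bar>A\<bar> * \<bar>B\<bar> * \<bar>C\<bar>"
        unfolding p(1) prod.case real_norm_def abs_mult by (intro mult_mono mult_nonneg_nonneg) auto
    qed
    have "(\<lambda>p. f (cc ?y0 (fst p)) * poly q (cc (fst p) (snd p)) * poly r (cc (snd p) ?y0)) \<in> borel_measurable (\<mu> \<Otimes>\<^sub>M \<mu>)"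
      by (intro borel_measurable_times measurable_compose[OF _ bounded_borel_measurable[OF f]]
        measurable_compose[OF _ bounded_borel_measurable[OF bounded_borel_poly]] cc_measurable_pair
        measurable_compose[OF measurable_fst cc_measurable(1)] measurable_compose[OF measurable_snd cc_measurable(2)])
    then show "case_prod ?F \<in> borel_measurable (\<mu> \<Otimes>\<^sub>M \<mu>)" by (simp add: case_prod_beta')
  qed
  have "E (poly (h * r)) = (\<integral>y. (\<integral>z. ?F z y \<partial>\<mu>) \<partial>\<mu>)"
    unfolding E_def
    by (intro Bochner_Integration.integral_cong refl) (simp add: h cc_sym[of _ ?y0])
  also have "\<dots> = (\<integral>z. (\<integral>y. ?F z y \<partial>\<mu>) \<partial>\<mu>)"
    by (rule Fubini_integral[OF int])
  also have "\<dots> = E (\<lambda>c. f c * poly h' c)"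
    unfolding E_def
    by (intro Bochner_Integration.integral_cong refl) (simp add: h' mult.assoc, simp add: cc_sym[of _ ?y0])
  finally show ?thesis .
qed

text \<open>The convolution is a polynomial h of degree at most j. By adjunction E (h h) is the
  pairing of \<phi> k with a polynomial of degree at most j, which is 0 by \<open>E_lower\<close>;
  hence h = 0.\<close>

lemma convolution_lower:
  assumes "j < k" "x \<in> Q" "y \<in> Q"
  shows "(\<integral>z. poly (\<phi> k) (cc x z) * poly (\<phi> j) (cc z y) \<partial>\<mu>) = 0"
proof -
  obtain h where h: "degree h \<le> j" "\<And>x y. x \<in> Q \<Longrightarrow> y \<in> Q \<Longrightarrow>
      (\<integral>z. poly (\<phi> k) (cc x z) * poly (\<phi> j) (cc z y) \<partial>\<mu>) = poly h (cc x y)"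
    using convolution_poly[OF bounded_borel_poly, of "\<phi> j" "\<phi> k"] by (auto simp: degree_\<phi>)
  obtain h' where h': "degree h' \<le> degree h" "\<And>x y. x \<in> Q \<Longrightarrow> y \<in> Q \<Longrightarrow>
      (\<integral>z. poly (\<phi> j) (cc x z) * poly h (cc z y) \<partial>\<mu>) = poly h' (cc x y)"
    using convolution_poly[OF bounded_borel_poly, of h "\<phi> j"] by auto
  have "E (poly (h * h)) = E (poly (h' * \<phi> k))"
    using convolution_adjoint[OF bounded_borel_poly h(2) h'(2)] by (simp add: mult.commute poly_mult[abs_def] E_def)
  also have "\<dots> = 0" using h(1) h'(1) assms(1) by (intro E_lower) auto
  finally have "h = 0" by (rule E_poly_square_0)
  then show ?thesis using h(2)[OF assms(2,3)] by simp
qed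

text \<open>By adjunction and \<open>convolution_lower\<close> the result is orthogonal to all lower
  degrees, hence a multiple of \<phi> k; the factor is read off at x = y. This is the addition
  formula in integrated form.\<close>

lemma convolution_same:
  assumes "x \<in> Q" "y \<in> Q"
  shows "(\<integral>z. poly (\<phi> k) (cc x z) * poly (\<phi> k) (cc z y) \<partial>\<mu>) = kap k * poly (\<phi> k) (cc x y)"
proof -
  obtain h where h: "degree h \<le> k" "\<And>x y. x \<in> Q \<Longrightarrow> y \<in> Q \<Longrightarrow>
      (\<integral>z. poly (\<phi> k) (cc x z) * poly (\<phi> k) (cc z y) \<partial>\<mu>) = poly h (cc x y)"
    using convolution_poly[OF bounded_borel_poly, of "\<phi> k" "\<phi> k"] by (auto simp: degree_\<phi>)
  have "E (poly (h * \<phi> j)) = 0" if "j < k" for j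
    using convolution_adjoint[OF bounded_borel_poly h(2), of "\<phi> j" 0] convolution_lower[OF that] by (simp add: E_def)
  from poly_eq_multiple[OF h(1) this] obtain b where b: "h = smult b (\<phi> k)" by blast
  have "b = poly h (cc (Y 0) (Y 0))" by (simp add: b cc_self)
  also have "\<dots> = kap k" unfolding h(2)[OF Y_space Y_space, symmetric] kap_def E_def by (simp add: cc_sym[of _ "Y 0"])
  finally show ?thesis using h(2)[OF assms] b by simp
qed

definition fc :: "(real \<Rightarrow> real) \<Rightarrow> nat \<Rightarrow> real" where "fc f k = E (\<lambda>c. f c * poly (\<phi> k) c)"

text \<open>As in \<open>convolution_same\<close> the convolution is a multiple of \<phi> k. The
  factor comes from pairing with \<phi> k and moving f to the other side by
  \<open>convolution_adjoint\<close>.\<close>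

theorem funk_hecke:
  assumes f: "bounded_borel f" and xy: "x \<in> Q" "y \<in> Q"
  shows "(\<integral>z. f (cc x z) * poly (\<phi> k) (cc z y) \<partial>\<mu>) = fc f k * poly (\<phi> k) (cc x y)"
proof -
  obtain h where h: "degree h \<le> k" "\<And>x y. x \<in> Q \<Longrightarrow> y \<in> Q \<Longrightarrow>
      (\<integral>z. f (cc x z) * poly (\<phi> k) (cc z y) \<partial>\<mu>) = poly h (cc x y)"
    using convolution_poly[OF f, of "\<phi> k"] by (auto simp: degree_\<phi>)
  have low: "E (poly (h * \<phi> j)) = 0" if "j < k" for j
    using convolution_adjoint[OF f h(2), of "\<phi> j" 0] convolution_lower[OF that] by (simp add: E_def)
  have "E (poly (h * \<phi> k)) = E (\<lambda>c. f c * poly (smult (kap k) (\<phi> k)) c)"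
    by (rule convolution_adjoint[OF f h(2)]) (auto simp: convolution_same)
  also have "\<dots> = kap k * fc f k" unfolding fc_def E_def by (simp add: mult.left_commute)
  finally have "E (poly (h * \<phi> k)) / kap k = fc f k" using kap_pos[of k] by simp
  then show ?thesis using h(2)[OF xy] poly_eq_multiple[OF h(1) low] by simp
qed

lemma fc_poly: "fc (poly (\<Sum>j\<le>n. smult (b j) (\<phi> j))) k = (if k \<le> n then b k * kap k else 0)"
proof -
  have "fc (poly (\<Sum>j\<le>n. smult (b j) (\<phi> j))) k = E (poly (\<Sum>j\<le>n. smult (b j) (\<phi> j * \<phi> k)))"
    unfolding fc_def by (intro arg_cong[where f = E] ext) (simp add: sum_distrib_right poly_sum mult.assoc)
  also have "\<dots> = (\<Sum>j\<le>n. b j * E (poly (\<phi> j * \<phi> k)))" by (rule E_poly_sum)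
  also have "\<dots> = (\<Sum>j\<le>n. if k = j then b k * kap k else 0)"
    by (intro sum.cong refl) (auto simp: E_orthogonal kap_def)
  finally show ?thesis by simp
qed

lemma convolution_expansion:
  assumes f: "bounded_borel f" and xy: "x \<in> Q" "y \<in> Q"
  shows "(\<integral>z. f (cc x z) * poly (\<Sum>k\<le>n. smult (b k) (\<phi> k)) (cc z y) \<partial>\<mu>) = (\<Sum>k\<le>n. b k * fc f k * poly (\<phi> k) (cc x y))"
proof -
  have "(\<integral>z. f (cc x z) * poly (\<Sum>k\<le>n. smult (b k) (\<phi> k)) (cc z y) \<partial>\<mu>) =
    (\<integral>z. (\<Sum>k\<le>n. b k * (f (cc x z) * poly (\<phi> k) (cc z y))) \<partial>\<mu>)"
    by (intro Bochner_Integration.integral_cong refl) (simp add: poly_sum sum_distrib_left mult_ac)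
  also have "\<dots> = (\<Sum>k\<le>n. b k * (\<integral>z. f (cc x z) * poly (\<phi> k) (cc z y) \<partial>\<mu>))"
    by (subst Bochner_Integration.integral_sum)
       (auto intro!: integrable_mult_right integrable_bounded_borel2 f bounded_borel_poly xy)
  also have "\<dots> = (\<Sum>k\<le>n. b k * fc f k * poly (\<phi> k) (cc x y))" by (simp add: funk_hecke[OF f xy] mult.assoc)
  finally show ?thesis .
qed

text \<open>By \<open>convolution_same\<close> the function is, up to the positive factor
  \<open>kap k\<close>, a Gram kernel with 1 on the diagonal. The bound is Cauchy-Schwarz, obtained
  by expanding a square with either sign.\<close>

lemma \<phi>_bound:
  assumes xy: "x \<in> Q" "y \<in> Q"
  shows "\<bar>poly (\<phi> k) (cc x y)\<bar> \<le> 1"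
proof -
  have "0 \<le> 1 + e * poly (\<phi> k) (cc x y)" if e: "e\<^sup>2 = 1" for e :: real
  proof -
    let ?p = "poly (\<phi> k)"
    have i: "integrable \<mu> (\<lambda>z. ?p (cc u z) * ?p (cc z v))" if "u \<in> Q" "v \<in> Q" for u v
      by (intro integrable_bounded_borel2 bounded_borel_poly that)
    have "0 \<le> (\<integral>z. (?p (cc x z) + e * ?p (cc y z))\<^sup>2 \<partial>\<mu>)" by (rule integral_nonneg_AE) simp
    also have "\<dots> = (\<integral>z. ?p (cc x z) * ?p (cc z x) + (2 * e) * (?p (cc x z) * ?p (cc z y)) + e\<^sup>2 * (?p (cc y z) * ?p (cc z y)) \<partial>\<mu>)"
      by (intro Bochner_Integration.integral_cong refl) (simp add: cc_sym[of _ x] cc_sym[of _ y] power2_eq_square algebra_simps)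
    also have "\<dots> = kap k + 2 * e * (kap k * ?p (cc x y)) + e\<^sup>2 * kap k"
      by (simp add: i xy convolution_same cc_self)
    also have "\<dots> = 2 * kap k * (1 + e * ?p (cc x y))" by (simp add: e algebra_simps)
    finally show ?thesis using kap_pos[of k] by (simp add: zero_le_mult_iff)
  qed
  from this[of 1] this[of "-1"] show ?thesis by simp
qed

lemma \<phi>_cos_bound: "\<bar>poly (\<phi> k) (cos t)\<bar> \<le> 1"
  using \<phi>_bound[of "Y t" "Y 0" k] by (simp add: cc_Y)

text \<open>\<open>kap k\<close> times the quantity g of the overview for this k.\<close>

definition pair_sum :: "nat \<Rightarrow> (nat \<Rightarrow> 'a) \<Rightarrow> nat \<Rightarrow> real" where
  "pair_sum N x k = (\<Sum>i<N. \<Sum>j<N. poly (\<phi> k) (cc (x i) (x j)))"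

lemma integral_square_sum:
  assumes f: "bounded_borel f" and x: "\<And>i. i < N \<Longrightarrow> x i \<in> Q"
  shows "(\<integral>z. (\<Sum>i<N. f (cc (x i) z))\<^sup>2 \<partial>\<mu>) = (\<Sum>i<N. \<Sum>j<N. \<integral>z. f (cc (x i) z) * f (cc z (x j)) \<partial>\<mu>)"
    and "integrable \<mu> (\<lambda>z. (\<Sum>i<N. f (cc (x i) z))\<^sup>2)"
proof -
  have eq: "(\<Sum>i<N. f (cc (x i) z))\<^sup>2 = (\<Sum>i<N. \<Sum>j<N. f (cc (x i) z) * f (cc z (x j)))" for z
    by (simp add: power2_eq_square sum_product cc_sym[of z])
  have i: "integrable \<mu> (\<lambda>z. f (cc (x i) z) * f (cc z (x j)))" if "i < N" "j < N" for i j
    by (intro integrable_bounded_borel2 f x that)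
  show "(\<integral>z. (\<Sum>i<N. f (cc (x i) z))\<^sup>2 \<partial>\<mu>) = (\<Sum>i<N. \<Sum>j<N. \<integral>z. f (cc (x i) z) * f (cc z (x j)) \<partial>\<mu>)"
    unfolding eq by (subst Bochner_Integration.integral_sum, (auto intro!: Bochner_Integration.integrable_sum i)[1],
      intro sum.cong refl Bochner_Integration.integral_sum) (auto intro: i)
  show "integrable \<mu> (\<lambda>z. (\<Sum>i<N. f (cc (x i) z))\<^sup>2)"
    unfolding eq by (intro Bochner_Integration.integrable_sum) (auto intro: i)
qed

lemma pair_sum_nonneg:
  assumes x: "\<And>i. i < N \<Longrightarrow> x i \<in> Q"
  shows "0 \<le> pair_sum N x k"
proof -
  have "0 \<le> (\<integral>z. (\<Sum>i<N. poly (\<phi> k) (cc (x i) z))\<^sup>2 \<partial>\<mu>)" by (rule integral_nonneg_AE) simp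
  also have "\<dots> = kap k * pair_sum N x k"
    unfolding pair_sum_def by (subst integral_square_sum[OF bounded_borel_poly x]) (auto simp: convolution_same x sum_distrib_left)
  finally show ?thesis using kap_pos[of k] by (simp add: zero_le_mult_iff)
qed

lemma pair_sum_0: "pair_sum N x 0 = (real N)\<^sup>2"
  by (simp add: pair_sum_def jacobi_poly_0 power2_eq_square)

text \<open>Valid for arbitrary coefficients b: with the Fourier coefficients it gives
  \<open>bessel\<close>, and for a single point it compares all choices of b in
  \<open>best_approximation\<close>.\<close>

lemma integral_square_diff:
  assumes f: "bounded_borel f" and x: "\<And>i. i < N \<Longrightarrow> x i \<in> Q"
  defines "r \<equiv> \<lambda>b n. \<Sum>k\<le>n. smult (b k) (\<phi> k)"
  shows "(\<integral>z. (\<Sum>i<N. f (cc (x i) z) - poly (r b n) (cc (x i) z))\<^sup>2 \<partial>\<mu>) =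
    (\<integral>z. (\<Sum>i<N. f (cc (x i) z))\<^sup>2 \<partial>\<mu>) + (\<Sum>k\<le>n. (kap k * (b k)\<^sup>2 - 2 * b k * fc f k) * pair_sum N x k)"
proof -
  let ?r = "poly (r b n)"
  have g: "bounded_borel (\<lambda>c. f c - ?r c)" by (intro bounded_borel_diff f bounded_borel_poly)
  have "(\<integral>z. (f (cc u z) - ?r (cc u z)) * (f (cc z v) - ?r (cc z v)) \<partial>\<mu>) =
     (\<integral>z. f (cc u z) * f (cc z v) \<partial>\<mu>) + (\<Sum>k\<le>n. (kap k * (b k)\<^sup>2 - 2 * b k * fc f k) * poly (\<phi> k) (cc u v))"
    if uv: "u \<in> Q" "v \<in> Q" for u v
  proof -
    have i: "integrable \<mu> (\<lambda>z. f (cc u z) * f (cc z v))" "integrable \<mu> (\<lambda>z. f (cc u z) * ?r (cc z v))"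
      "integrable \<mu> (\<lambda>z. f (cc v z) * ?r (cc z u))" "integrable \<mu> (\<lambda>z. ?r (cc u z) * ?r (cc z v))"
      by (intro integrable_bounded_borel2 f bounded_borel_poly uv)+
    have "(\<integral>z. (f (cc u z) - ?r (cc u z)) * (f (cc z v) - ?r (cc z v)) \<partial>\<mu>) =
      (\<integral>z. f (cc u z) * f (cc z v) - f (cc u z) * ?r (cc z v) - f (cc v z) * ?r (cc z u) + ?r (cc u z) * ?r (cc z v) \<partial>\<mu>)"
      by (intro Bochner_Integration.integral_cong refl) (simp add: cc_sym[of _ u] cc_sym[of _ v] algebra_simps)
    also have "\<dots> = (\<integral>z. f (cc u z) * f (cc z v) \<partial>\<mu>) - (\<integral>z. f (cc u z) * ?r (cc z v) \<partial>\<mu>)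
       - (\<integral>z. f (cc v z) * ?r (cc z u) \<partial>\<mu>) + (\<integral>z. ?r (cc u z) * ?r (cc z v) \<partial>\<mu>)"
      by (simp add: i)
    also have "\<dots> = (\<integral>z. f (cc u z) * f (cc z v) \<partial>\<mu>) + (\<Sum>k\<le>n. (kap k * (b k)\<^sup>2 - 2 * b k * fc f k) * poly (\<phi> k) (cc u v))"
    proof -
      have "(\<integral>z. f (cc u z) * ?r (cc z v) \<partial>\<mu>) = (\<Sum>k\<le>n. b k * fc f k * poly (\<phi> k) (cc u v))"
        "(\<integral>z. f (cc v z) * ?r (cc z u) \<partial>\<mu>) = (\<Sum>k\<le>n. b k * fc f k * poly (\<phi> k) (cc u v))"
        unfolding r_def using convolution_expansion[OF f uv] convolution_expansion[OF f uv(2,1)] by (simp_all add: cc_sym[of v u])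
      moreover have "(\<integral>z. ?r (cc u z) * ?r (cc z v) \<partial>\<mu>) = (\<Sum>k\<le>n. kap k * (b k)\<^sup>2 * poly (\<phi> k) (cc u v))"
        unfolding r_def convolution_expansion[OF bounded_borel_poly uv]
        by (intro sum.cong refl) (simp add: fc_poly power2_eq_square mult_ac)
      moreover have "(\<Sum>k\<le>n. (kap k * (b k)\<^sup>2 - 2 * b k * fc f k) * poly (\<phi> k) (cc u v)) =
         (\<Sum>k\<le>n. kap k * (b k)\<^sup>2 * poly (\<phi> k) (cc u v)) - 2 * (\<Sum>k\<le>n. b k * fc f k * poly (\<phi> k) (cc u v))"
        by (simp add: left_diff_distrib sum_subtractf sum_distrib_left mult.assoc)
      ultimately show ?thesis by simp
    qed
    finally show ?thesis .
  qed
  note eq = this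
  have "(\<integral>z. (\<Sum>i<N. f (cc (x i) z) - ?r (cc (x i) z))\<^sup>2 \<partial>\<mu>) =
    (\<Sum>i<N. \<Sum>j<N. \<integral>z. (f (cc (x i) z) - ?r (cc (x i) z)) * (f (cc z (x j)) - ?r (cc z (x j))) \<partial>\<mu>)"
    by (rule integral_square_sum(1)[OF g x])
  also have "\<dots> = (\<Sum>i<N. \<Sum>j<N. \<integral>z. f (cc (x i) z) * f (cc z (x j)) \<partial>\<mu>)
     + (\<Sum>i<N. \<Sum>j<N. \<Sum>k\<le>n. (kap k * (b k)\<^sup>2 - 2 * b k * fc f k) * poly (\<phi> k) (cc (x i) (x j)))"
    by (simp add: eq x sum.distrib)
  also have "(\<Sum>i<N. \<Sum>j<N. \<integral>z. f (cc (x i) z) * f (cc z (x j)) \<partial>\<mu>) = (\<integral>z. (\<Sum>i<N. f (cc (x i) z))\<^sup>2 \<partial>\<mu>)"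
    by (rule integral_square_sum(1)[OF f x, symmetric])
  also have "(\<Sum>i<N. \<Sum>j<N. \<Sum>k\<le>n. (kap k * (b k)\<^sup>2 - 2 * b k * fc f k) * poly (\<phi> k) (cc (x i) (x j)))
     = (\<Sum>k\<le>n. (kap k * (b k)\<^sup>2 - 2 * b k * fc f k) * pair_sum N x k)"
    unfolding pair_sum_def sum_distrib_left
    by (rule trans[OF sum.cong[OF refl sum.swap] sum.swap])
  finally show ?thesis .
qed

lemma bessel:
  assumes f: "bounded_borel f" and x: "\<And>i. i < N \<Longrightarrow> x i \<in> Q"
  shows "(\<Sum>k\<le>n. (fc f k)\<^sup>2 / kap k * pair_sum N x k) \<le> (\<integral>z. (\<Sum>i<N. f (cc (x i) z))\<^sup>2 \<partial>\<mu>)"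
    and "(\<integral>z. (\<Sum>i<N. f (cc (x i) z))\<^sup>2 \<partial>\<mu>) - (\<Sum>k\<le>n. (fc f k)\<^sup>2 / kap k * pair_sum N x k) =
       (\<integral>z. (\<Sum>i<N. f (cc (x i) z) - poly (\<Sum>k\<le>n. smult (fc f k / kap k) (\<phi> k)) (cc (x i) z))\<^sup>2 \<partial>\<mu>)"
proof -
  have "kap k * (fc f k / kap k)\<^sup>2 - 2 * (fc f k / kap k) * fc f k = - ((fc f k)\<^sup>2 / kap k)" for k
    using kap_pos[of k] by (simp add: power2_eq_square field_simps)
  then show eq: "(\<integral>z. (\<Sum>i<N. f (cc (x i) z))\<^sup>2 \<partial>\<mu>) - (\<Sum>k\<le>n. (fc f k)\<^sup>2 / kap k * pair_sum N x k) =
       (\<integral>z. (\<Sum>i<N. f (cc (x i) z) - poly (\<Sum>k\<le>n. smult (fc f k / kap k) (\<phi> k)) (cc (x i) z))\<^sup>2 \<partial>\<mu>)"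
    using integral_square_diff[OF f x, where N = N and b = "\<lambda>k. fc f k / kap k" and n = n] by (simp add: sum_negf)
  have "0 \<le> (\<integral>z. (\<Sum>i<N. f (cc (x i) z) - poly (\<Sum>k\<le>n. smult (fc f k / kap k) (\<phi> k)) (cc (x i) z))\<^sup>2 \<partial>\<mu>)"
    by (rule integral_nonneg_AE) simp
  with eq show "(\<Sum>k\<le>n. (fc f k)\<^sup>2 / kap k * pair_sum N x k) \<le> (\<integral>z. (\<Sum>i<N. f (cc (x i) z))\<^sup>2 \<partial>\<mu>)" by linarith
qed

text \<open>Apply \<open>integral_square_diff\<close> to the single point \<open>Y 0\<close>, where
  every \<open>pair_sum\<close> is 1, and complete the square in each coefficient.\<close>

lemma best_approximation:
  assumes f: "bounded_borel f" and p: "degree p \<le> n"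
  shows "E (\<lambda>c. (f c - poly (\<Sum>k\<le>n. smult (fc f k / kap k) (\<phi> k)) c)\<^sup>2) \<le> E (\<lambda>c. (f c - poly p c)\<^sup>2)"
proof -
  obtain b where b: "p = (\<Sum>k\<le>n. smult (b k) (\<phi> k))" using jacobi_span[OF d_pos d0(1) p] by blast
  let ?x = "\<lambda>_::nat. Y 0"
  have ps: "pair_sum 1 ?x k = 1" for k by (simp add: pair_sum_def cc_self)
  have eq: "E (\<lambda>c. (f c - poly (\<Sum>k\<le>n. smult (b k) (\<phi> k)) c)\<^sup>2) =
    E (\<lambda>c. (f c)\<^sup>2) + (\<Sum>k\<le>n. kap k * (b k)\<^sup>2 - 2 * b k * fc f k)" for b
    using integral_square_diff[OF f, where N = 1 and x = ?x and b = b and n = n] by (simp add: E_def ps del: One_nat_def)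
  have "kap k * (fc f k / kap k)\<^sup>2 - 2 * (fc f k / kap k) * fc f k \<le> kap k * (b k)\<^sup>2 - 2 * b k * fc f k" for k
  proof -
    have "0 \<le> kap k * (b k - fc f k / kap k)\<^sup>2" using kap_pos[of k] by simp
    also have "\<dots> = kap k * (b k)\<^sup>2 - 2 * b k * fc f k + (fc f k)\<^sup>2 / kap k"
      using kap_pos[of k] by (simp add: power2_eq_square field_simps)
    finally have "- ((fc f k)\<^sup>2 / kap k) \<le> kap k * (b k)\<^sup>2 - 2 * b k * fc f k" by simp
    moreover have "kap k * (fc f k / kap k)\<^sup>2 - 2 * (fc f k / kap k) * fc f k = - ((fc f k)\<^sup>2 / kap k)"
      using kap_pos[of k] by (simp add: power2_eq_square field_simps)
    ultimately show ?thesis by simp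
  qed
  then show ?thesis unfolding b eq by (intro add_left_mono sum_mono)
qed

section \<open>Caps and their quadratic discrepancy\<close>

definition cap :: "real \<Rightarrow> real \<Rightarrow> real" where "cap r c = (if cos r < c then 1 else 0)"

lemma bounded_borel_cap: "bounded_borel (cap r)"
proof -
  have "cap r \<in> borel_measurable borel" unfolding cap_def[abs_def] by measurable
  then show ?thesis unfolding bounded_borel_def by (auto simp: cap_def intro!: exI[of _ 1])
qed

text \<open>The step function is the pointwise limit of the ramps g n, hence their limit in mean
  square by dominated convergence; one ramp is then approximated uniformly by a polynomial.\<close>

lemma cap_approximation:
  assumes "0 < e"
  shows "\<exists>p. E (\<lambda>c. (cap r c - poly p c)\<^sup>2) < e"
proof -
  define g where "g n c = max 0 (min 1 (real n * (c - cos r)))" for n c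
  have g01: "0 \<le> g n c" "g n c \<le> 1" for n c by (auto simp: g_def)
  have gc: "continuous_on UNIV (g n)" for n unfolding g_def[abs_def] by (intro continuous_intros)
  have bb: "bounded_borel (\<lambda>c. (cap r c - g n c)\<^sup>2)" for n
    by (intro bounded_borel_power2 bounded_borel_diff bounded_borel_cap bounded_borel_continuous gc)
  have lim: "(\<lambda>n. (cap r c - g n c)\<^sup>2) \<longlonglongrightarrow> 0" for c
  proof (rule tendsto_eventually)
    show "\<forall>\<^sub>F n in sequentially. (cap r c - g n c)\<^sup>2 = 0"
    proof (cases "cos r < c")
      case True
      obtain n0 where "1 < real n0 * (c - cos r)" using reals_Archimedean3[of "c - cos r"] True by auto
      then have "g n c = 1" if "n0 \<le> n" for n
      proof -
        have "real n0 * (c - cos r) \<le> real n * (c - cos r)" using that True by (intro mult_right_mono) auto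
        then show ?thesis using \<open>1 < real n0 * (c - cos r)\<close> by (simp add: g_def)
      qed
      then show ?thesis using True by (auto simp: eventually_sequentially cap_def intro!: exI[of _ n0])
    next
      case False
      then have "real n * (c - cos r) \<le> 0" for n by (intro mult_nonneg_nonpos) auto
      then have "g n c = 0" for n unfolding g_def by (intro max_absorb1) (meson min.coboundedI2)
      then show ?thesis using False by (simp add: cap_def)
    qed
  qed
  have "(\<lambda>n. E (\<lambda>c. (cap r c - g n c)\<^sup>2)) \<longlonglongrightarrow> (\<integral>z. 0 \<partial>\<mu>)"
    unfolding E_def
  proof (rule integral_dominated_convergence[where w = "\<lambda>_. 1"])
    show "AE z in \<mu>. norm ((cap r (cc (Y 0) z) - g n (cc (Y 0) z))\<^sup>2) \<le> 1" for n
    proof (rule AE_I2)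
      fix z
      have "\<bar>cap r (cc (Y 0) z) - g n (cc (Y 0) z)\<bar> \<le> 1" using g01[of n "cc (Y 0) z"] by (auto simp: cap_def)
      then show "norm ((cap r (cc (Y 0) z) - g n (cc (Y 0) z))\<^sup>2) \<le> 1" by (simp add: abs_square_le_1)
    qed
    show "(\<lambda>z. (cap r (cc (Y 0) z) - g n (cc (Y 0) z))\<^sup>2) \<in> borel_measurable \<mu>" for n
      using integrable_bounded_borel[OF bb Y_space] by (rule borel_measurable_integrable)
    show "AE z in \<mu>. (\<lambda>n. (cap r (cc (Y 0) z) - g n (cc (Y 0) z))\<^sup>2) \<longlonglongrightarrow> 0" using lim by simp
  qed auto
  then have "\<forall>\<^sub>F n in sequentially. E (\<lambda>c. (cap r c - g n c)\<^sup>2) < e / 4"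
    using assms by (intro order_tendstoD(2)) auto
  then obtain n where n: "E (\<lambda>c. (cap r c - g n c)\<^sup>2) < e / 4" by (auto simp: eventually_sequentially)
  have "0 < sqrt (e / 4)" using assms by simp
  then obtain p where p: "\<And>c. c \<in> {-1..1} \<Longrightarrow> \<bar>g n c - poly p c\<bar> < sqrt (e / 4)"
    using weierstrass_poly[OF continuous_on_subset[OF gc]] by (metis subset_UNIV)
  have bb1: "bounded_borel (\<lambda>c. 2 * (cap r c - g n c)\<^sup>2)" and bb2: "bounded_borel (\<lambda>c. e / 2)"
    by (intro bounded_borel_mult bb bounded_borel_continuous continuous_intros)+
  have "E (\<lambda>c. (cap r c - poly p c)\<^sup>2) \<le> E (\<lambda>c. 2 * (cap r c - g n c)\<^sup>2 + e / 2)"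
  proof (rule E_mono)
    show "bounded_borel (\<lambda>c. (cap r c - poly p c)\<^sup>2)"
      by (intro bounded_borel_power2 bounded_borel_diff bounded_borel_cap bounded_borel_poly)
    show "bounded_borel (\<lambda>c. 2 * (cap r c - g n c)\<^sup>2 + e / 2)"
      using bounded_borel_diff[OF bb1, of "\<lambda>c. - (e / 2)"] bounded_borel_continuous[of "\<lambda>c. - (e / 2)"] by simp
    fix c :: real assume c: "c \<in> {-1..1}"
    have "(g n c - poly p c)\<^sup>2 \<le> (sqrt (e / 4))\<^sup>2"
      using p[OF c] assms by (intro power2_le_iff_abs_le[THEN iffD2]) auto
    then have gp: "(g n c - poly p c)\<^sup>2 \<le> e / 4" using assms by simp
    have "0 \<le> ((cap r c - g n c) - (g n c - poly p c))\<^sup>2" by simp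
    then have "(cap r c - poly p c)\<^sup>2 \<le> 2 * (cap r c - g n c)\<^sup>2 + 2 * (g n c - poly p c)\<^sup>2"
      by (simp add: power2_eq_square algebra_simps)
    with gp show "(cap r c - poly p c)\<^sup>2 \<le> 2 * (cap r c - g n c)\<^sup>2 + e / 2" by simp
  qed
  also have "\<dots> = 2 * E (\<lambda>c. (cap r c - g n c)\<^sup>2) + e / 2"
    unfolding E_add[OF bb1 bb2] E_cmult by (simp add: E_def prob_space)
  also have "\<dots> < e" using n by simp
  finally show ?thesis by blast
qed

definition vol :: "real \<Rightarrow> real" where "vol r = E (cap r)"

definition cap_disc :: "nat \<Rightarrow> (nat \<Rightarrow> 'a) \<Rightarrow> real \<Rightarrow> real" where
  "cap_disc N x r = (\<integral>z. ((\<Sum>i<N. cap r (cc (x i) z)) - real N * vol r)\<^sup>2 \<partial>\<mu>)"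

lemma fc_cap_0: "fc (cap r) 0 = vol r"
  by (simp add: fc_def vol_def jacobi_poly_0)

lemma kap_0: "kap 0 = 1"
  by (simp add: kap_def E_def jacobi_poly_0 prob_space)

lemma cap_disc_eq:
  assumes x: "\<And>i. i < N \<Longrightarrow> x i \<in> Q"
  shows "cap_disc N x r = (\<integral>z. (\<Sum>i<N. cap r (cc (x i) z))\<^sup>2 \<partial>\<mu>) - (real N * vol r)\<^sup>2"
proof -
  let ?S = "\<lambda>z. \<Sum>i<N. cap r (cc (x i) z)"
  have i1: "integrable \<mu> (\<lambda>z. (?S z)\<^sup>2)" by (rule integral_square_sum(2)[OF bounded_borel_cap x])
  have i2: "integrable \<mu> (\<lambda>z. cap r (cc (x i) z))" if "i < N" for i
    by (intro integrable_bounded_borel bounded_borel_cap x that)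
  have i3: "integrable \<mu> ?S" by (intro Bochner_Integration.integrable_sum i2) auto
  have "(\<integral>z. ?S z \<partial>\<mu>) = (\<Sum>i<N. vol r)"
    by (subst Bochner_Integration.integral_sum) (auto simp: i2 E_eq[OF bounded_borel_measurable[OF bounded_borel_cap]] x vol_def)
  then have S: "(\<integral>z. ?S z \<partial>\<mu>) = real N * vol r" by simp
  have "cap_disc N x r = (\<integral>z. (?S z)\<^sup>2 - (2 * (real N * vol r)) * ?S z + (real N * vol r)\<^sup>2 \<partial>\<mu>)"
    unfolding cap_disc_def by (intro Bochner_Integration.integral_cong refl) (simp add: power2_diff mult_ac)
  also have "\<dots> = (\<integral>z. (?S z)\<^sup>2 \<partial>\<mu>) - (2 * (real N * vol r)) * (real N * vol r) + (real N * vol r)\<^sup>2"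
    by (simp add: i1 i3 S prob_space)
  finally show ?thesis by (simp add: power2_eq_square)
qed

lemma cap_disc_bessel:
  assumes x: "\<And>i. i < N \<Longrightarrow> x i \<in> Q"
  shows "(\<Sum>k=1..n. (fc (cap r) k)\<^sup>2 / kap k * pair_sum N x k) \<le> cap_disc N x r"
proof -
  have "{..n} = insert 0 {1..n}" by auto
  then show ?thesis
    using bessel(1)[where x = x and N = N and n = n, OF bounded_borel_cap[of r] x] cap_disc_eq[where x = x and N = N and r = r, OF x]
    by (simp add: fc_cap_0 kap_0 pair_sum_0 power_mult_distrib mult.commute[of "(vol r)\<^sup>2"])
qed

text \<open>The error for N points is at most N^2 times the error for one point, by Cauchy-Schwarz.
  The one-point error of the truncated expansion is at most that of the polynomial from
  \<open>cap_approximation\<close>, so its degree serves as n.\<close>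

lemma cap_disc_parseval:
  assumes x: "\<And>i. i < N \<Longrightarrow> x i \<in> Q" and e: "0 < e"
  shows "\<exists>n. cap_disc N x r \<le> (\<Sum>k=1..n. (fc (cap r) k)\<^sup>2 / kap k * pair_sum N x k) + e"
proof -
  \<comment> \<open>Adding 1 avoids a separate case for N = 0.\<close>
  have "0 < e / ((real N)\<^sup>2 + 1)" using e by (simp add: add_nonneg_pos)
  then obtain p where p: "E (\<lambda>c. (cap r c - poly p c)\<^sup>2) < e / ((real N)\<^sup>2 + 1)"
    using cap_approximation by blast
  let ?n = "degree p"
  let ?f = "\<lambda>c. cap r c - poly (\<Sum>k\<le>?n. smult (fc (cap r) k / kap k) (\<phi> k)) c"
  have bb: "bounded_borel (\<lambda>c. (?f c)\<^sup>2)" by (intro bounded_borel_power2 bounded_borel_diff bounded_borel_cap bounded_borel_poly)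
  have bf: "bounded_borel ?f" by (intro bounded_borel_diff bounded_borel_cap bounded_borel_poly)
  have i: "integrable \<mu> (\<lambda>z. (?f (cc (x i) z))\<^sup>2)" if "i < N" for i
    by (rule integrable_bounded_borel[OF bb x[OF that]])
  have "(\<integral>z. (\<Sum>i<N. ?f (cc (x i) z))\<^sup>2 \<partial>\<mu>) \<le> (\<integral>z. real N * (\<Sum>i<N. (?f (cc (x i) z))\<^sup>2) \<partial>\<mu>)"
  proof (rule integral_mono)
    show "integrable \<mu> (\<lambda>z. (\<Sum>i<N. ?f (cc (x i) z))\<^sup>2)" by (rule integral_square_sum(2)[OF bf x])
    show "integrable \<mu> (\<lambda>z. real N * (\<Sum>i<N. (?f (cc (x i) z))\<^sup>2))"
      by (intro integrable_mult_right Bochner_Integration.integrable_sum i) auto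
    show "(\<Sum>i<N. ?f (cc (x i) z))\<^sup>2 \<le> real N * (\<Sum>i<N. (?f (cc (x i) z))\<^sup>2)" for z
      using Cauchy_Schwarz_ineq_sum[of "\<lambda>_. 1" "\<lambda>i. ?f (cc (x i) z)" "{..<N}"] by simp
  qed
  also have "\<dots> = real N * (\<Sum>i<N. E (\<lambda>c. (?f c)\<^sup>2))"
    using i by (simp add: E_eq[OF bounded_borel_measurable[OF bb]] x Bochner_Integration.integral_sum)
  also have "\<dots> \<le> real N * (\<Sum>i<N. E (\<lambda>c. (cap r c - poly p c)\<^sup>2))"
    by (intro mult_left_mono sum_mono best_approximation bounded_borel_cap) auto
  also have "\<dots> = (real N)\<^sup>2 * E (\<lambda>c. (cap r c - poly p c)\<^sup>2)" by (simp add: power2_eq_square)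
  also have "\<dots> \<le> (real N)\<^sup>2 * (e / ((real N)\<^sup>2 + 1))" using p by (intro mult_left_mono) auto
  also have "\<dots> \<le> e" using e by (subst times_divide_eq_right, subst pos_divide_le_eq) (auto simp: add_nonneg_pos add_pos_nonneg algebra_simps)
  finally have "(\<integral>z. (\<Sum>i<N. ?f (cc (x i) z))\<^sup>2 \<partial>\<mu>) \<le> e" .
  then have "(\<integral>z. (\<Sum>i<N. cap r (cc (x i) z))\<^sup>2 \<partial>\<mu>) - (\<Sum>k\<le>?n. (fc (cap r) k)\<^sup>2 / kap k * pair_sum N x k) \<le> e"
    using bessel(2)[where x = x and N = N and n = ?n, OF bounded_borel_cap[of r] x] by linarith
  moreover have "{..?n} = insert 0 {1..?n}" by auto
  ultimately show ?thesis
    using cap_disc_eq[where x = x and N = N and r = r, OF x]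
    by (intro exI[of _ ?n]) (simp add: fc_cap_0 kap_0 pair_sum_0 power_mult_distrib mult.commute[of "(vol r)\<^sup>2"])
qed

end

section \<open>Size of the Fourier coefficients\<close>

text \<open>Stands in for the Lebesgue density theorem.\<close>

lemma interval_of_high_density:
  fixes F :: "real set"
  assumes F: "F \<in> lmeasurable" "F \<subseteq> {a..b}" "0 < measure lebesgue F" and e: "0 < e" "e < 1"
  shows "\<exists>u v. u < v \<and> {u..v} \<subseteq> {a..b} \<and> measure lebesgue ({u..v} - F) \<le> e * (v - u)"
proof (rule ccontr)
  assume "\<not> ?thesis"
  then have bad: "e * (v - u) < measure lebesgue ({u..v} - F)" if "u < v" "{u..v} \<subseteq> {a..b}" for u v
    using that by (meson not_le)
  let ?\<mu> = "measure lebesgue"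
  \<comment> \<open>If F left out more than the proportion e of every interval, an interval cover U
    of F with excess at most \<delta> would satisfy e |U| <= |U - F| <= \<delta>, and therefore |F|
    <= |U| <= |F| / 2.\<close>
  define \<delta> where "\<delta> = e * ?\<mu> F / 2"
  have \<delta>: "0 < \<delta>" using F(3) e by (simp add: \<delta>_def)
  obtain \<D> where D: "countable \<D>" "\<And>K. K \<in> \<D> \<Longrightarrow> K \<subseteq> cbox a b \<and> K \<noteq> {} \<and> (\<exists>c d. K = cbox c d)"
    "pairwise (\<lambda>A B. interior A \<inter> interior B = {}) \<D>" "F \<subseteq> \<Union>\<D>" "\<Union>\<D> \<in> lmeasurable" "?\<mu> (\<Union>\<D>) \<le> ?\<mu> F + \<delta>"
    using measurable_outer_intervals_bounded[of F a b \<delta>] F \<delta> by (metis box_real(2))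
  have K: "K \<in> lmeasurable" if "K \<in> \<D>" for K using D(2)[OF that] by auto
  have Kd: "e * ?\<mu> K \<le> ?\<mu> (K - F)" if KD: "K \<in> \<D>" for K
  proof -
    obtain u v where uv: "K = {u..v}" "u \<le> v" "{u..v} \<subseteq> {a..b}"
      using D(2)[OF KD] by (auto simp: box_real)
    show ?thesis
    proof (cases "u < v")
      case True
      then show ?thesis using bad[OF True uv(3)] by (simp add: uv)
    qed (use uv in simp)
  qed
  have neg: "negligible (A \<inter> B)" if AB: "A \<in> \<D>" "B \<in> \<D>" "A \<noteq> B" for A B
  proof -
    have "interior A \<inter> interior B = {}" using D(3) AB by (auto simp: pairwise_def)
    moreover obtain c d where "A = cbox c d" using D(2)[OF AB(1)] by blast
    moreover obtain c' d' where "B = cbox c' d'" using D(2)[OF AB(2)] by blast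
    ultimately have "interior (A \<inter> B) = {}" "convex (A \<inter> B)" by (auto intro: convex_Int)
    then show ?thesis using negligible_convex_interior by blast
  qed
  have sumU: "?\<mu> (\<Union>C) = (\<Sum>K\<in>C. ?\<mu> K)" if "finite C" "C \<subseteq> \<D>" for C
    by (intro measure_negligible_finite_Union that(1) pairwiseI neg K) (use that(2) in blast)+
  have sumUF: "?\<mu> (\<Union>C - F) = (\<Sum>K\<in>C. ?\<mu> (K - F))" if "finite C" "C \<subseteq> \<D>" for C
  proof -
    have "?\<mu> (\<Union>((\<lambda>K. K - F) ` C)) = (\<Sum>K\<in>C. ?\<mu> (K - F))"
    proof (rule measure_negligible_finite_Union_image[OF that(1)])
      show "K - F \<in> lmeasurable" if "K \<in> C" for K using \<open>C \<subseteq> \<D>\<close> that by (intro fmeasurable.Diff K F(1)) blast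
      show "pairwise (\<lambda>A B. negligible ((A - F) \<inter> (B - F))) C"
      proof (rule pairwiseI)
        fix A B assume "A \<in> C" "B \<in> C" "A \<noteq> B"
        then have "negligible (A \<inter> B)" using \<open>C \<subseteq> \<D>\<close> by (intro neg) blast+
        then show "negligible ((A - F) \<inter> (B - F))" by (rule negligible_subset) blast
      qed
    qed
    moreover have "\<Union>((\<lambda>K. K - F) ` C) = \<Union>C - F" by auto
    ultimately show ?thesis by simp
  qed
  have UF: "?\<mu> (\<Union>\<D> - F) \<le> \<delta>"
    using D(6) F(1) D(4) by (subst measurable_measure_Diff[OF D(5)]) (auto intro: fmeasurableD)
  have fin: "e * ?\<mu> (\<Union>C) \<le> \<delta>" if "finite C" "C \<subseteq> \<D>" for C
  proof -
    have "e * ?\<mu> (\<Union>C) = (\<Sum>K\<in>C. e * ?\<mu> K)" by (simp add: sumU[OF that] sum_distrib_left)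
    also have "\<dots> \<le> (\<Sum>K\<in>C. ?\<mu> (K - F))" using that by (intro sum_mono Kd) auto
    also have "\<dots> = ?\<mu> (\<Union>C - F)" by (simp add: sumUF[OF that])
    also have "\<dots> \<le> ?\<mu> (\<Union>\<D> - F)"
    proof (rule measure_mono_fmeasurable)
      show "\<Union>C - F \<subseteq> \<Union>\<D> - F" using that by auto
      show "\<Union>C - F \<in> sets lebesgue"
        using that(2) by (intro sets.Diff sets.finite_Union that(1) fmeasurableD[OF F(1)]) (use K fmeasurableD in blast)
      show "\<Union>\<D> - F \<in> lmeasurable" by (intro fmeasurable.Diff D(5) F(1))
    qed
    finally show ?thesis using UF by linarith
  qed
  have "?\<mu> (\<Union>\<D>) \<le> \<delta> / e"
  proof (rule measure_Union_bound)
    show "countable \<D>" by fact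
    show "K \<in> lmeasurable" if "K \<in> \<D>" for K by (rule K[OF that])
    show "?\<mu> (\<Union>C) \<le> \<delta> / e" if "C \<subseteq> \<D>" "finite C" for C
      using fin[OF that(2,1)] e by (simp add: field_simps)
  qed
  moreover have "?\<mu> F \<le> ?\<mu> (\<Union>\<D>)" by (intro measure_mono_fmeasurable D(4,5) fmeasurableD F(1))
  ultimately have "?\<mu> F \<le> ?\<mu> F / 2" using e by (simp add: \<delta>_def)
  then show False using F(3) by simp
qed

section \<open>Energy of the spherical functions\<close>

context zonal_space
begin

abbreviation "lam \<equiv> jacobi_eigenvalue d d0"

definition zf :: "nat \<Rightarrow> real \<Rightarrow> real" where "zf k t = poly (\<phi> k) (cos t)"
definition zg :: "nat \<Rightarrow> real \<Rightarrow> real" where "zg k t = - sin t * poly (pderiv (\<phi> k)) (cos t)"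
definition en :: "nat \<Rightarrow> real \<Rightarrow> real" where "en k = energy (lam k) (zf k) (zg k)"

lemma zf_solution: "1 \<le> k \<Longrightarrow> jacobi_solution (d - 1) (d0 - 1) (lam k) (zf k) (zg k)"
  using jacobi_poly_solution[OF d_pos d0(1), of k] by (simp add: zf_def[abs_def] zg_def[abs_def])

lemma zf_continuous: "continuous_on A (zf k)" and zg_continuous: "continuous_on A (zg k)"
  unfolding zf_def[abs_def] zg_def[abs_def] by (intro continuous_intros)+

lemma en_continuous: "1 \<le> k \<Longrightarrow> continuous_on A (en k)"
  unfolding en_def by (intro energy_cont[OF zf_solution])

lemma zf_0: "zf k 0 = 1" by (simp add: zf_def)

lemma w_nonneg: "t \<in> {0..pi} \<Longrightarrow> 0 \<le> w t" by (simp add: jw_nonneg)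

lemma lam_bounds: "1 \<le> k \<Longrightarrow> (real k)\<^sup>2 \<le> lam k" "1 \<le> k \<Longrightarrow> lam k \<le> (real d + real d0) * (real k)\<^sup>2"
  using jacobi_eigenvalue_bounds[OF d_pos d0(1), of k] by auto

lemma en_split: "1 \<le> k \<Longrightarrow> en k t = (zf k t)\<^sup>2 + (zg k t)\<^sup>2 / lam k"
  by (simp add: en_def energy_def)

lemma en_nonneg: "1 \<le> k \<Longrightarrow> 0 \<le> en k t"
  unfolding en_def by (rule energy_nonneg[OF zf_solution])

text \<open>\<open>jacobi_energy_bounds\<close> in terms of k in place of the square root of the
  eigenvalue; the two differ at most by the factor sqrt (d + d0).\<close>

lemma energy_estimate:
  obtains C A k0 where "C \<ge> 1" "A > 0" "k0 \<ge> (1::nat)"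
    "\<And>k t. k \<ge> k0 \<Longrightarrow> t \<in> {0..pi} \<Longrightarrow> w t * en k t \<le> C / real k ^ (d - 1)"
    "\<And>k t. k \<ge> k0 \<Longrightarrow> t \<in> {A / real k..pi - A / real k} \<Longrightarrow> 1 / (C * real k ^ (d - 1)) \<le> w t * en k t"
proof -
  let ?m = "d - 1"
  obtain C A l0 where C: "C > 0" and A: "A > 0" and l0: "l0 > 0"
    and est: "\<And>l f g. jacobi_solution ?m (d0 - 1) l f g \<Longrightarrow> f 0 = 1 \<Longrightarrow> l \<ge> l0 \<Longrightarrow>
      (\<forall>t\<in>{0..pi}. w t * energy l f g t \<le> C / sqrt l ^ ?m) \<and>
      (\<forall>t\<in>{A / sqrt l..pi - A / sqrt l}. 1 / (C * sqrt l ^ ?m) \<le> w t * energy l f g t)"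
    using jacobi_energy_bounds[of ?m "d0 - 1"] by blast
  define D where "D = sqrt (real d + real d0)"
  have D: "D \<ge> 1" using d_pos by (simp add: D_def)
  define C' where "C' = max 1 (C * D ^ ?m)"
  define k0 where "k0 = max 1 (nat \<lceil>l0\<rceil>)"
  show thesis
  proof (rule that)
    show "C' \<ge> 1" "A > 0" "k0 \<ge> 1" using A by (auto simp: C'_def k0_def)
    fix k t assume k: "k \<ge> k0"
    then have k1: "1 \<le> k" by (simp add: k0_def)
    have "l0 \<le> real k" using k unfolding k0_def by linarith
    also have "\<dots> \<le> (real k)\<^sup>2" using k1 by (simp add: power2_eq_square)
    finally have l: "l0 \<le> lam k" using lam_bounds(1)[OF k1] by linarith
    have sq: "real k \<le> sqrt (lam k)" using lam_bounds(1)[OF k1] by (rule real_le_rsqrt)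
    have sqp: "0 < sqrt (lam k)" using l_pos[OF zf_solution[OF k1]] by simp
    have "sqrt (lam k) \<le> sqrt ((real d + real d0) * (real k)\<^sup>2)" using lam_bounds(2)[OF k1] by simp
    then have sq2: "sqrt (lam k) \<le> D * real k" by (simp add: D_def real_sqrt_mult)
    note e = est[OF zf_solution[OF k1] zf_0 l, folded en_def]
    have kp: "0 < real k ^ ?m" using k1 by simp
    show "w t * en k t \<le> C' / real k ^ ?m" if "t \<in> {0..pi}"
    proof -
      have "w t * en k t \<le> C / sqrt (lam k) ^ ?m" using e that by blast
      also have "\<dots> \<le> C / real k ^ ?m" using C sq k1 sqp by (intro divide_left_mono power_mono mult_pos_pos zero_less_power) auto
      also have "\<dots> \<le> C' / real k ^ ?m"
      proof (rule divide_right_mono)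
        have "C * 1 \<le> C * D ^ ?m" using C D by (intro mult_left_mono one_le_power) auto
        then show "C \<le> C'" by (simp add: C'_def)
      qed (use kp in simp)
      finally show ?thesis .
    qed
    show "1 / (C' * real k ^ ?m) \<le> w t * en k t" if t: "t \<in> {A / real k..pi - A / real k}"
    proof -
      have "A / sqrt (lam k) \<le> A / real k" using A sq k1 sqp by (intro divide_left_mono mult_pos_pos) auto
      then have "1 / (C * sqrt (lam k) ^ ?m) \<le> w t * en k t" using e t by auto
      moreover have "C * sqrt (lam k) ^ ?m \<le> C' * real k ^ ?m"
      proof -
        have "C * sqrt (lam k) ^ ?m \<le> C * (D * real k) ^ ?m"
          using C sq2 sqp by (intro mult_left_mono power_mono) auto
        also have "\<dots> = (C * D ^ ?m) * real k ^ ?m" by (simp add: power_mult_distrib)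
        also have "\<dots> \<le> C' * real k ^ ?m" using kp by (intro mult_right_mono) (auto simp: C'_def)
        finally show ?thesis .
      qed
      moreover have "0 < C * sqrt (lam k) ^ ?m" using C sqp by (intro mult_pos_pos zero_less_power)
      ultimately show ?thesis by (meson frac_le le_numeral_extra(4) order.trans zero_le_one)
    qed
  qed
qed

text \<open>Integrating the derivative of w f g / lam shows that the two parts of the energy have
  equal integrals up to boundary terms of order B / k. A lower bound for the whole energy thus
  passes to the part with the derivative.\<close>

lemma energy_equipartition:
  assumes k: "1 \<le> k" and uv: "0 \<le> u" "u \<le> v" "v \<le> pi" and B: "\<And>t. t \<in> {0..pi} \<Longrightarrow> w t * en k t \<le> B"
  shows "\<bar>integral {u..v} (\<lambda>t. w t * (zg k t)\<^sup>2 / lam k) - integral {u..v} (\<lambda>t. w t * (zf k t)\<^sup>2)\<bar> \<le> B / real k"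
proof -
  note sol = zf_solution[OF k]
  have evp: "0 < lam k" by (rule l_pos[OF sol])
  let ?F = "\<lambda>t. w t * zf k t * zg k t / lam k"
  have "((\<lambda>t. w t * (zg k t)\<^sup>2 / lam k - w t * (zf k t)\<^sup>2) has_integral ?F v - ?F u) {u..v}"
  proof (rule fundamental_theorem_of_calculus_interior[OF uv(2)])
    show "continuous_on {u..v} ?F" using evp by (intro continuous_intros zf_continuous zg_continuous) auto
    fix x assume "x \<in> {u<..<v}"
    then have x: "0 < x" "x < pi" using uv by auto
    have "(?F has_real_derivative (w x * (zg k x)\<^sup>2 - lam k * (w x * (zf k x)\<^sup>2)) / lam k) (at x)"
      by (rule DERIV_cdivide[OF wfg_deriv[OF sol x]])
    also have "(w x * (zg k x)\<^sup>2 - lam k * (w x * (zf k x)\<^sup>2)) / lam k = w x * (zg k x)\<^sup>2 / lam k - w x * (zf k x)\<^sup>2"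
      using evp by (simp add: diff_divide_distrib)
    finally show "(?F has_vector_derivative w x * (zg k x)\<^sup>2 / lam k - w x * (zf k x)\<^sup>2) (at x)"
      by (simp add: has_real_derivative_iff_has_vector_derivative)
  qed
  moreover have "((\<lambda>t. w t * (zg k t)\<^sup>2 / lam k - w t * (zf k t)\<^sup>2) has_integral
     integral {u..v} (\<lambda>t. w t * (zg k t)\<^sup>2 / lam k) - integral {u..v} (\<lambda>t. w t * (zf k t)\<^sup>2)) {u..v}"
    using evp by (intro has_integral_diff integrable_integral integrable_continuous_real continuous_intros zf_continuous zg_continuous) auto
  ultimately have "integral {u..v} (\<lambda>t. w t * (zg k t)\<^sup>2 / lam k) - integral {u..v} (\<lambda>t. w t * (zf k t)\<^sup>2) = ?F v - ?F u"
    by (rule has_integral_unique[symmetric])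
  moreover have "\<bar>?F t\<bar> \<le> B / (2 * real k)" if t: "t \<in> {0..pi}" for t
  proof -
    have sq: "real k \<le> sqrt (lam k)" using lam_bounds(1)[OF k] by (rule real_le_rsqrt)
    have ss: "sqrt (lam k) * sqrt (lam k) = lam k" using evp by simp
    have B0: "0 \<le> B" using B[of 0] en_nonneg[OF k, of 0] w_nonneg[of 0] pi_ge_zero
      by (meson atLeastAtMost_iff mult_nonneg_nonneg order.trans order.refl)
    have "\<bar>?F t\<bar> = w t * \<bar>zf k t * zg k t\<bar> / lam k" using evp w_nonneg[OF t] by (simp add: abs_mult)
    also have "\<dots> \<le> w t * (sqrt (lam k) * en k t / 2) / lam k"
      using fg_le_energy[OF sol, of t] evp w_nonneg[OF t] by (intro divide_right_mono mult_left_mono) (auto simp: en_def)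
    also have "\<dots> = (w t * en k t) / (2 * sqrt (lam k))"
    proof -
      have "a * (s * b / 2) / (s * s) = a * b / (2 * s)" if "0 < s" for a b s :: real
        using that by (simp add: field_simps)
      from this[of "sqrt (lam k)" "w t" "en k t"] evp show ?thesis by (simp add: ss)
    qed
    also have "\<dots> \<le> B / (2 * real k)"
      using B[OF t] B0 sq k by (intro frac_le) auto
    finally show ?thesis .
  qed
  then have "\<bar>?F v\<bar> \<le> B / (2 * real k)" "\<bar>?F u\<bar> \<le> B / (2 * real k)" using uv by auto
  then have "\<bar>?F v - ?F u\<bar> \<le> B / (2 * real k) + B / (2 * real k)" using abs_triangle_ineq4[of "?F v" "?F u"] by linarith
  ultimately show ?thesis by simp
qed

lemma E_cap:
  assumes r: "r \<in> {0..pi}" and h: "continuous_on UNIV h"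
  shows "E (\<lambda>c. cap r c * h c) = integral {0..r} (\<lambda>t. h (cos t) * w t) / weight_mass"
proof -
  have hc: "continuous_on A (\<lambda>t. h (cos t) * w t)" for A
    by (intro continuous_intros continuous_on_compose2[OF h]) auto
  have m: "(\<lambda>c. cap r c * h c) \<in> borel_measurable borel"
    by (intro borel_measurable_times bounded_borel_measurable bounded_borel_cap borel_measurable_continuous_onI h)
  have "E (\<lambda>c. cap r c * h c) = (LINT t:{0..pi}|lborel. cap r (cos t) * h (cos t) * w t) / weight_mass"
    by (rule E_weight[OF m])
  also have "(LINT t:{0..pi}|lborel. cap r (cos t) * h (cos t) * w t) = (LINT t:{0..r}|lborel. h (cos t) * w t)"
    unfolding set_lebesgue_integral_def
  proof (rule integral_cong_AE)
    have hm: "(\<lambda>t. h (cos t) * w t) \<in> borel_measurable borel" by (intro borel_measurable_continuous_onI hc)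
    have "(\<lambda>t. cap r (cos t)) \<in> borel_measurable borel"
      by (intro measurable_compose[OF _ bounded_borel_measurable[OF bounded_borel_cap]] borel_measurable_continuous_onI continuous_intros)
    then have "(\<lambda>t. indicator {0..pi} t *\<^sub>R (cap r (cos t) * (h (cos t) * w t))) \<in> borel_measurable borel"
      using hm by (intro borel_measurable_scaleR borel_measurable_times[OF _ hm]) auto
    then show "(\<lambda>t. indicator {0..pi} t *\<^sub>R (cap r (cos t) * h (cos t) * w t)) \<in> borel_measurable lborel"
      by (simp add: mult.assoc)
    show "(\<lambda>t. indicator {0..r} t *\<^sub>R (h (cos t) * w t)) \<in> borel_measurable lborel"
      using hm by simp
    have "AE t in lborel. t \<noteq> r" by (rule AE_lborel_singleton)
    then show "AE t in lborel. indicator {0..pi} t *\<^sub>R (cap r (cos t) * h (cos t) * w t) = indicator {0..r} t *\<^sub>R (h (cos t) * w t)"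
    proof eventually_elim
      case (elim t)
      show ?case
      proof (cases "t \<in> {0..pi}")
        case True
        have "cos r < cos t \<longleftrightarrow> t < r" using True r by (intro cos_mono_less_eq) auto
        then show ?thesis using True r elim by (auto simp: cap_def indicator_def)
      qed (use r in \<open>auto simp: indicator_def\<close>)
    qed
  qed
  also have "\<dots> = integral {0..r} (\<lambda>t. h (cos t) * w t)" by (intro set_integral_Icc hc)
  finally show ?thesis .
qed

lemma vol_eq: "r \<in> {0..pi} \<Longrightarrow> vol r = integral {0..r} w / weight_mass"
  using E_cap[of r "\<lambda>_. 1"] by (simp add: vol_def)

lemma fc_cap_integral: "r \<in> {0..pi} \<Longrightarrow> fc (cap r) k = integral {0..r} (\<lambda>t. zf k t * w t) / weight_mass"
  unfolding fc_def zf_def by (rule E_cap) (auto intro: continuous_intros)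

text \<open>Because (w g)' = - lam w f, the integral over a cap is a boundary value of the
  derivative. Hence the coefficients are governed by \<open>zg\<close>, not by
  \<open>zf\<close>.\<close>

lemma fc_cap:
  assumes k: "1 \<le> k" and r: "r \<in> {0..pi}"
  shows "fc (cap r) k = - (w r * zg k r / (lam k * weight_mass))"
proof -
  note sol = zf_solution[OF k]
  have evp: "0 < lam k" by (rule l_pos[OF sol])
  let ?F = "\<lambda>t. - (w t * zg k t / lam k)"
  have "((\<lambda>t. zf k t * w t) has_integral ?F r - ?F 0) {0..r}"
  proof (rule fundamental_theorem_of_calculus_interior)
    show "continuous_on {0..r} ?F" using evp by (intro continuous_intros zg_continuous) auto
    fix x assume "x \<in> {0<..<r}"
    then have x: "0 < x" "x < pi" using r by auto
    have "(?F has_real_derivative - ((- lam k * (w x * zf k x)) / lam k)) (at x)"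
      by (intro DERIV_minus DERIV_cdivide wg_deriv[OF sol] x)
    then show "(?F has_vector_derivative zf k x * w x) (at x)"
      using evp by (simp add: has_real_derivative_iff_has_vector_derivative mult.commute)
  qed (use r in simp)
  then have "integral {0..r} (\<lambda>t. zf k t * w t) = - (w r * zg k r / lam k)"
    using g_0[OF sol] by (simp add: integral_unique)
  then show ?thesis by (simp add: fc_cap_integral[OF r])
qed

lemma kap_integral: "kap k = integral {0..pi} (\<lambda>t. w t * (zf k t)\<^sup>2) / weight_mass"
proof -
  have "kap k = (LINT t:{0..pi}|lborel. poly (\<phi> k * \<phi> k) (cos t) * w t) / weight_mass"
    unfolding kap_def by (intro E_weight borel_measurable_continuous_onI continuous_intros)
  also have "(LINT t:{0..pi}|lborel. poly (\<phi> k * \<phi> k) (cos t) * w t) = integral {0..pi} (\<lambda>t. poly (\<phi> k * \<phi> k) (cos t) * w t)"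
    by (intro set_integral_Icc continuous_intros)
  also have "(\<lambda>t. poly (\<phi> k * \<phi> k) (cos t) * w t) = (\<lambda>t. w t * (zf k t)\<^sup>2)"
    by (simp add: zf_def power2_eq_square mult_ac)
  finally show ?thesis .
qed

end

lemma jw_le_right:
  assumes "0 \<le> t" "t \<le> r" "r \<le> pi / 2" shows "jw m n t \<le> 2 ^ n * jw m n r"
proof -
  have "jw m n t \<le> sin (t / 2) ^ m" using assms by (intro jw_le_sin) auto
  also have "\<dots> \<le> sin (r / 2) ^ m" using assms by (intro power_mono sin_monotone_2pi_le sin_ge_zero) auto
  also have "\<dots> = 2 ^ n * (sin (r / 2) ^ m * (1 / 2) ^ n)" by (simp add: power_divide)
  also have "\<dots> \<le> 2 ^ n * jw m n r" using assms by (intro mult_left_mono jw_ge_sin) auto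
  finally show ?thesis .
qed

lemma jw_le_left:
  assumes "pi / 2 \<le> r" "r \<le> t" "t \<le> pi" shows "jw m n t \<le> 2 ^ m * jw m n r"
  using jw_le_right[of "pi - t" "pi - r" n m] assms by (simp add: jw_flip)

section \<open>Fourier coefficients of caps\<close>

context zonal_space
begin

lemma w_integrable: "w integrable_on {a..b}"
  by (intro integrable_continuous_real continuous_intros)

lemma vol_nonneg: "0 \<le> vol r" unfolding vol_def by (rule E_nonneg) (simp add: cap_def)

lemma vol_le:
  assumes "r \<in> {0..pi}" shows "vol r \<le> r ^ d / weight_mass"
proof -
  have "w t \<le> r ^ (d - 1)" if t: "t \<in> {0..r}" for t
  proof -
    have "w t \<le> sin (t / 2) ^ (d - 1) * 1"
      unfolding jw_def using t assms by (intro mult_left_mono power_le_one zero_le_power cos_ge_zero sin_ge_zero) auto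
    also have "\<dots> \<le> r ^ (d - 1) * 1"
      using sin_half_le[of t] t assms by (intro mult_right_mono power_mono sin_ge_zero) auto
    finally show ?thesis by simp
  qed
  then have "integral {0..r} w \<le> integral {0..r} (\<lambda>_. r ^ (d - 1))" by (intro integral_le w_integrable) auto
  also have "\<dots> = r ^ d" using assms d_pos by (cases d) auto
  finally show ?thesis using weight_mass_pos assms by (simp add: vol_eq divide_right_mono)
qed

lemma vol_ge: "\<exists>c>0. \<forall>r\<in>{0..pi / 2}. c * r ^ d \<le> vol r"
proof (intro exI[of _ "1 / 2 * ((1 / (2 * pi)) ^ (d - 1) * (1 / 2) ^ (d0 - 1)) / weight_mass"] conjI ballI)
  show "0 < 1 / 2 * ((1 / (2 * pi)) ^ (d - 1) * (1 / 2) ^ (d0 - 1)) / weight_mass" using weight_mass_pos by simp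
  fix r assume r: "r \<in> {0..pi / 2}"
  let ?b = "(r / (2 * pi)) ^ (d - 1) * (1 / 2) ^ (d0 - 1)"
  have b: "?b \<le> w t" if t: "t \<in> {r / 2..r}" for t
  proof -
    have "r / (2 * pi) = (r / 2) / pi" by simp
    also have "\<dots> \<le> t / pi" using t by (intro divide_right_mono) auto
    also have "\<dots> \<le> sin (t / 2)" using t r by (intro sin_half_ge) auto
    finally have "?b \<le> sin (t / 2) ^ (d - 1) * (1 / 2) ^ (d0 - 1)" using r by (intro mult_right_mono power_mono) auto
    also have "\<dots> \<le> w t" using t r by (intro jw_ge_sin) auto
    finally show ?thesis .
  qed
  have "r / 2 * ?b = integral {r / 2..r} (\<lambda>_. ?b)" using r by simp
  also have "\<dots> \<le> integral {r / 2..r} w" using b by (intro integral_le w_integrable) auto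
  also have "\<dots> \<le> integral {0..r} w"
    using r pi_gt_zero by (intro integral_subset_le w_integrable ballI jw_nonneg) auto
  finally have "r / 2 * ?b / weight_mass \<le> integral {0..r} w / weight_mass"
    using weight_mass_pos by (intro divide_right_mono) auto
  also have "\<dots> = vol r" using r pi_gt_zero by (subst vol_eq) auto
  finally have "r / 2 * ?b / weight_mass \<le> vol r" .
  moreover have "r / 2 * ?b = 1 / 2 * ((1 / (2 * pi)) ^ (d - 1) * (1 / 2) ^ (d0 - 1)) * r ^ d"
    using d_pos by (cases d) (auto simp: power_divide)
  ultimately show "1 / 2 * ((1 / (2 * pi)) ^ (d - 1) * (1 / 2) ^ (d0 - 1)) / weight_mass * r ^ d \<le> vol r"
    by (simp only: times_divide_eq_left)
qed

text \<open>For r up to pi / 2 the weight on [0, r] is at most a multiple of its value at r, and for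
  larger r the same holds on [r, pi]. A quantity below both \<open>vol r\<close> and 1 -
  \<open>vol r\<close> is thus O(w r), which is what integrability against \<eta> requires.\<close>

lemma vol_le_w: "\<exists>K>0. \<forall>r\<in>{0..pi}. vol r \<le> K * w r \<or> 1 - vol r \<le> K * w r"
proof (intro exI[of _ "pi * 2 ^ (d + d0) / weight_mass"] conjI ballI)
  let ?K = "pi * 2 ^ (d + d0) / weight_mass"
  show "0 < ?K" using weight_mass_pos by simp
  fix r assume r: "r \<in> {0..pi}"
  have bound: "integral {a..b} w / weight_mass \<le> ?K * w r"
    if ab: "0 \<le> a" "a \<le> b" "b \<le> pi" and le: "\<And>t. t \<in> {a..b} \<Longrightarrow> w t \<le> 2 ^ n * w r" "n \<le> d + d0" for a b n
  proof -
    have "integral {a..b} w \<le> integral {a..b} (\<lambda>_. 2 ^ n * w r)" using le by (intro integral_le w_integrable) auto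
    also have "\<dots> = (b - a) * (2 ^ n * w r)" using ab by simp
    also have "\<dots> \<le> pi * (2 ^ (d + d0) * w r)"
      using ab le(2) w_nonneg[OF r] by (intro mult_mono mult_right_mono power_increasing) auto
    finally show ?thesis using weight_mass_pos by (simp add: divide_right_mono)
  qed
  show "vol r \<le> ?K * w r \<or> 1 - vol r \<le> ?K * w r"
  proof (cases "r \<le> pi / 2")
    case True
    then have "vol r \<le> ?K * w r" unfolding vol_eq[OF r] using r
      by (intro bound[of 0 r "d0 - 1"] jw_le_right) auto
    then show ?thesis ..
  next
    case False
    have "weight_mass = integral {0..r} w + integral {r..pi} w"
      unfolding weight_mass_def using r w_integrable by (subst Henstock_Kurzweil_Integration.integral_combine) auto
    then have "1 - vol r = integral {r..pi} w / weight_mass"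
      using weight_mass_pos unfolding vol_eq[OF r] by (simp add: field_simps)
    also have "\<dots> \<le> ?K * w r" using r False
      by (intro bound[of r pi "d - 1"] jw_le_left) auto
    finally show ?thesis ..
  qed
qed

lemma zg_sq_le: "1 \<le> k \<Longrightarrow> (zg k t)\<^sup>2 / lam k \<le> en k t" and zf_sq_le: "1 \<le> k \<Longrightarrow> (zf k t)\<^sup>2 \<le> en k t"
  using l_pos[OF zf_solution, of k] by (auto simp: en_split)

lemma fc_cap_square:
  assumes "1 \<le> k" "r \<in> {0..pi}"
  shows "(fc (cap r) k)\<^sup>2 = w r * (w r * (zg k r)\<^sup>2 / lam k) / (lam k * weight_mass\<^sup>2)"
  unfolding fc_cap[OF assms] by (simp add: power2_eq_square mult_ac)

text \<open>The square of the coefficient contains the weight twice. One factor is absorbed by the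
  energy bound; the other is kept, because \<eta> is integrable only together with it.\<close>

lemma fc_cap_upper: "\<exists>C>0. \<exists>k0\<ge>1. \<forall>k\<ge>k0. \<forall>r\<in>{0..pi}. (fc (cap r) k)\<^sup>2 \<le> C * w r / real k ^ (d + 1)"
proof -
  obtain C A k0 where C: "C \<ge> 1" and k0: "k0 \<ge> (1::nat)"
    and up: "\<And>k t. k \<ge> k0 \<Longrightarrow> t \<in> {0..pi} \<Longrightarrow> w t * en k t \<le> C / real k ^ (d - 1)"
    using energy_estimate by metis
  have "(fc (cap r) k)\<^sup>2 \<le> C / weight_mass\<^sup>2 * w r / real k ^ (d + 1)" if k: "k \<ge> k0" and r: "r \<in> {0..pi}" for k r
  proof -
    have k1: "1 \<le> k" using k k0 by simp
    have evp: "0 < lam k" by (rule l_pos[OF zf_solution[OF k1]])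
    have "w r * (zg k r)\<^sup>2 / lam k = w r * ((zg k r)\<^sup>2 / lam k)" by simp
    also have "\<dots> \<le> w r * en k r" using w_nonneg[OF r] zg_sq_le[OF k1] by (intro mult_left_mono)
    also have "\<dots> \<le> C / real k ^ (d - 1)" using up k r by blast
    finally have "(fc (cap r) k)\<^sup>2 \<le> w r * (C / real k ^ (d - 1)) / (lam k * weight_mass\<^sup>2)"
      unfolding fc_cap_square[OF k1 r] using w_nonneg[OF r] evp by (intro divide_right_mono mult_left_mono) auto
    also have "\<dots> \<le> w r * (C / real k ^ (d - 1)) / ((real k)\<^sup>2 * weight_mass\<^sup>2)"
      using lam_bounds(1)[OF k1] w_nonneg[OF r] C k1 evp weight_mass_pos
      by (intro divide_left_mono mult_right_mono mult_nonneg_nonneg mult_pos_pos) auto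
    also have "\<dots> = C / weight_mass\<^sup>2 * w r / (real k ^ (d - 1) * (real k)\<^sup>2)" by (simp add: mult_ac)
    also have "real k ^ (d - 1) * (real k)\<^sup>2 = real k ^ (d + 1)"
      using d_pos by (cases d) (auto simp: power2_eq_square)
    finally show ?thesis .
  qed
  then show ?thesis using C k0 weight_mass_pos by (intro exI[of _ "C / weight_mass\<^sup>2"] conjI exI[of _ k0]) auto
qed

lemma kap_upper: "\<exists>C>0. \<exists>k0\<ge>1. \<forall>k\<ge>k0. kap k \<le> C / real k ^ (d - 1)"
proof -
  obtain C A k0 where C: "C \<ge> 1" and k0: "k0 \<ge> (1::nat)"
    and up: "\<And>k t. k \<ge> k0 \<Longrightarrow> t \<in> {0..pi} \<Longrightarrow> w t * en k t \<le> C / real k ^ (d - 1)"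
    using energy_estimate by metis
  have "kap k \<le> pi * C / weight_mass / real k ^ (d - 1)" if k: "k \<ge> k0" for k
  proof -
    have k1: "1 \<le> k" using k k0 by simp
    have "w t * (zf k t)\<^sup>2 \<le> C / real k ^ (d - 1)" if "t \<in> {0..pi}" for t
      using up[OF k that] w_nonneg[OF that] zf_sq_le[OF k1, of t] by (meson mult_left_mono order.trans)
    then have "integral {0..pi} (\<lambda>t. w t * (zf k t)\<^sup>2) \<le> integral {0..pi} (\<lambda>_. C / real k ^ (d - 1))"
      by (intro integral_le integrable_continuous_real continuous_intros zf_continuous) auto
    then show ?thesis unfolding kap_integral using weight_mass_pos by (simp add: field_simps)
  qed
  then show ?thesis using C k0 weight_mass_pos by (intro exI[of _ "pi * C / weight_mass"] conjI exI[of _ k0]) auto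
qed

text \<open>On [0, a / k] the spherical function of degree k stays at least 1/2 by
  \<open>f_near_zero\<close>. This is the only range in which the coefficients do not oscillate, and
  it suffices for Bessel's inequality with small balls.\<close>

lemma fc_cap_lower: "\<exists>a>0. a \<le> pi / 2 \<and> (\<forall>k\<ge>1. \<forall>s\<in>{0..a / real k}. vol s / 2 \<le> fc (cap s) k)"
proof -
  define K where "K = (real d + real d0) * (2 ^ (d0 - 1) * exp (real (d0 - 1) * pi / 4))"
  have K: "0 < K" using d_pos by (simp add: K_def add_pos_nonneg)
  \<comment> \<open>With lam k at most (d + d0) k^2 the error in \<open>f_near_zero\<close> is at
    most K k^2 t^2 / 2, that is, at most 1/2 for k t <= 1 / sqrt K.\<close>
  define a where "a = min (pi / 2) (1 / sqrt K)"
  have a: "0 < a" "a \<le> pi / 2" "a \<le> 1 / sqrt K" using K by (auto simp: a_def)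
  have "vol s / 2 \<le> fc (cap s) k" if k: "1 \<le> k" and s: "s \<in> {0..a / real k}" for k s
  proof -
    have "a / real k \<le> a / 1" using a k by (intro divide_left_mono) auto
    then have sp: "s \<le> pi / 2" "s \<in> {0..pi}" using s a by auto
    have f: "1 / 2 \<le> zf k t" if t: "t \<in> {0..s}" for t
    proof -
      have "real k * t \<le> a" using mult_left_mono[of t "a / real k" "real k"] t s k by simp
      then have "(real k * t)\<^sup>2 \<le> (1 / sqrt K)\<^sup>2" using t a by (intro power_mono) auto
      then have kt: "K * ((real k)\<^sup>2 * t\<^sup>2) \<le> 1" using K by (simp add: power_mult_distrib power_divide field_simps)
      have "\<bar>zf k t - zf k 0\<bar> \<le> lam k * (2 ^ (d0 - 1) * (exp (real (d0 - 1) * pi / 4) * \<bar>zf k 0\<bar>)) * t\<^sup>2 / 2"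
        using t sp by (intro f_near_zero[OF zf_solution[OF k]]) auto
      also have "\<dots> \<le> (real d + real d0) * (real k)\<^sup>2 * (2 ^ (d0 - 1) * (exp (real (d0 - 1) * pi / 4) * \<bar>zf k 0\<bar>)) * t\<^sup>2 / 2"
        using lam_bounds(2)[OF k] by (intro divide_right_mono mult_right_mono) auto
      also have "\<dots> = K * ((real k)\<^sup>2 * t\<^sup>2) / 2" by (simp add: zf_0 K_def)
      finally have "\<bar>zf k t - 1\<bar> \<le> 1 / 2" using kt by (simp add: zf_0)
      then show ?thesis by linarith
    qed
    have "integral {0..s} (\<lambda>t. w t / 2) \<le> integral {0..s} (\<lambda>t. zf k t * w t)"
    proof (intro integral_le integrable_continuous_real continuous_intros zf_continuous)
      fix t assume t: "t \<in> {0..s}"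
      then have "0 \<le> w t" using sp by (intro w_nonneg) auto
      then show "w t / 2 \<le> zf k t * w t" using mult_right_mono[OF f[OF t]] by simp
    qed auto
    then show ?thesis unfolding vol_eq[OF sp(2)] fc_cap_integral[OF sp(2)] using weight_mass_pos
      by (simp add: field_simps)
  qed
  then show ?thesis using a by blast
qed

lemma weight_class_integrable:
  assumes \<eta>: "\<eta> \<in> weight_class d d0" and f: "f \<in> borel_measurable borel" and K: "\<And>r. r \<in> {0..pi} \<Longrightarrow> \<bar>f r\<bar> \<le> K * w r"
  shows "set_integrable lebesgue {0..pi} (\<lambda>r. f r * \<eta> r)"
proof -
  have m: "\<eta> \<in> borel_measurable (lebesgue_on {0..pi})" and n: "\<And>r. r \<in> {0..pi} \<Longrightarrow> 0 \<le> \<eta> r"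
    and i: "set_integrable lebesgue {0..pi} (\<lambda>r. w r * \<eta> r)"
    using \<eta> by (auto simp: weight_class_def jw_def)
  have m': "(\<lambda>r. indicator {0..pi} r *\<^sub>R \<eta> r) \<in> borel_measurable lebesgue"
    using m by (simp add: borel_measurable_restrict_space_iff)
  have f': "f \<in> borel_measurable lebesgue" using f by (simp add: measurable_completion)
  show ?thesis
    unfolding set_integrable_def
  proof (rule Bochner_Integration.integrable_bound)
    show "integrable lebesgue (\<lambda>r. K * (indicator {0..pi} r *\<^sub>R (w r * \<eta> r)))"
      using i by (intro integrable_mult_right) (simp add: set_integrable_def)
    have "(\<lambda>r. f r * (indicator {0..pi} r *\<^sub>R \<eta> r)) \<in> borel_measurable lebesgue"
      by (intro borel_measurable_times f' m')
    then show "(\<lambda>r. indicator {0..pi} r *\<^sub>R (f r * \<eta> r)) \<in> borel_measurable lebesgue"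
      by (simp add: mult.left_commute)
    show "AE r in lebesgue. norm (indicator {0..pi} r *\<^sub>R (f r * \<eta> r)) \<le> norm (K * (indicator {0..pi} r *\<^sub>R (w r * \<eta> r)))"
    proof (rule AE_I2)
      fix r
      show "norm (indicator {0..pi} r *\<^sub>R (f r * \<eta> r)) \<le> norm (K * (indicator {0..pi} r *\<^sub>R (w r * \<eta> r)))"
      proof (cases "r \<in> {0..pi}")
        case True
        have "\<bar>f r\<bar> * \<eta> r \<le> K * w r * \<eta> r" using K n True by (intro mult_right_mono) auto
        also have "\<dots> \<le> \<bar>K * (w r * \<eta> r)\<bar>" by (simp add: mult.assoc)
        finally show ?thesis using True n[OF True] by (simp add: abs_mult)
      qed simp
    qed
  qed
qed

lemma fc_cap_integrable:
  assumes \<eta>: "\<eta> \<in> weight_class d d0" and k: "1 \<le> k"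
  shows "set_integrable lebesgue {0..pi} (\<lambda>r. (fc (cap r) k)\<^sup>2 * \<eta> r)"
proof -
  let ?f = "\<lambda>r. w r * (w r * (zg k r)\<^sup>2 / lam k) / (lam k * weight_mass\<^sup>2)"
  have evp: "0 < lam k" by (rule l_pos[OF zf_solution[OF k]])
  define g where "g r = w r * (zg k r)\<^sup>2 / lam k / (lam k * weight_mass\<^sup>2)" for r
  have "continuous_on {0..pi} g"
    unfolding g_def using evp weight_mass_pos by (intro continuous_intros zg_continuous) auto
  then have "bounded (g ` {0..pi})"
    by (intro compact_imp_bounded compact_continuous_image) auto
  then obtain K where "\<forall>y\<in>g ` {0..pi}. norm y \<le> K" unfolding bounded_iff by blast
  then have K: "\<bar>g r\<bar> \<le> K" if "r \<in> {0..pi}" for r using that by simp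
  have "set_integrable lebesgue {0..pi} (\<lambda>r. ?f r * \<eta> r)"
  proof (rule weight_class_integrable[OF \<eta>])
    show "?f \<in> borel_measurable borel"
      using evp weight_mass_pos by (intro borel_measurable_continuous_onI continuous_intros zg_continuous) auto
    fix r assume r: "r \<in> {0..pi}"
    have "?f r = w r * g r" by (simp add: g_def)
    then have "\<bar>?f r\<bar> = w r * \<bar>g r\<bar>" using w_nonneg[OF r] by (simp add: abs_mult)
    also have "\<dots> \<le> w r * K" by (intro mult_left_mono K r w_nonneg)
    finally show "\<bar>?f r\<bar> \<le> K * w r" by (simp add: mult.commute)
  qed
  then show ?thesis
    using fc_cap_square[OF k] by (subst set_integrable_cong[OF refl]) auto
qed

text \<open>
  The squared Fourier coefficients oscillate in \<open>r\<close>, so \<open>\<eta>\<close> might concentrate near their zeros;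
  an interval in which \<open>\<eta> \<ge> \<epsilon>\<close> up to a small proportion rules this out.
\<close>

lemma fc_cap_integral_lower:
  assumes \<eta>: "\<eta> \<in> weight_class d d0" and nz: "\<not> (AE r in lebesgue. r \<in> {0..pi} \<longrightarrow> \<eta> r = 0)"
  shows "\<exists>c>0. \<exists>k0\<ge>1. \<forall>k\<ge>k0. c / real k ^ (d + 1) \<le> (LINT r:{0..pi}|lebesgue. (fc (cap r) k)\<^sup>2 * \<eta> r)"
proof -
  have \<eta>m: "\<eta> \<in> borel_measurable (lebesgue_on {0..pi})" and \<eta>n: "\<And>r. r \<in> {0..pi} \<Longrightarrow> 0 \<le> \<eta> r"
    using \<eta> by (auto simp: weight_class_def)
  have \<eta>m': "(\<lambda>r. indicator {0..pi} r * \<eta> r) \<in> borel_measurable lebesgue"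
    using \<eta>m by (simp add: borel_measurable_restrict_space_iff)
  obtain C A k0 where C: "C \<ge> 1" and A: "A > 0" and k0: "k0 \<ge> (1::nat)"
    and up: "\<And>k t. k \<ge> k0 \<Longrightarrow> t \<in> {0..pi} \<Longrightarrow> w t * en k t \<le> C / real k ^ (d - 1)"
    and low: "\<And>k t. k \<ge> k0 \<Longrightarrow> t \<in> {A / real k..pi - A / real k} \<Longrightarrow> 1 / (C * real k ^ (d - 1)) \<le> w t * en k t"
    using energy_estimate by metis
  \<comment> \<open>Up to the two endpoints these sets exhaust the set where \<eta> is positive, so
    one of them has positive measure. On it \<eta> is bounded below, at a positive distance from 0
    and pi.\<close>
  define F where "F n = {r \<in> {1 / real (Suc n)..pi - 1 / real (Suc n)}. 1 / real (Suc n) \<le> indicator {0..pi} r * \<eta> r}" for n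
  have Fm: "F n \<in> sets lebesgue" for n
  proof -
    have "{r. 1 / real (Suc n) \<le> indicator {0..pi} r * \<eta> r} \<in> sets lebesgue"
      using borel_measurable_le[OF borel_measurable_const \<eta>m'] by simp
    moreover have "F n = {1 / real (Suc n)..pi - 1 / real (Suc n)} \<inter> {r. 1 / real (Suc n) \<le> indicator {0..pi} r * \<eta> r}"
      by (auto simp: F_def)
    ultimately show ?thesis by auto
  qed
  have Ff: "F n \<in> lmeasurable" for n
    by (rule fmeasurableI2[OF lmeasurable_interval(1) _ Fm]) (auto simp: F_def)
  have "\<exists>n. 0 < measure lebesgue (F n)"
  proof (rule ccontr)
    assume "\<not> ?thesis"
    then have "negligible (F n)" for n
      using Ff[of n] by (simp add: negligible_iff_measure) (meson antisym_conv2 measure_nonneg not_le)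
    then have "negligible (\<Union>n. F n)" by (intro negligible_Union_nat) auto
    then have "negligible ({0, pi} \<union> (\<Union>n. F n))" using negligible_Un[OF negligible_finite] by simp
    then have "{0, pi} \<union> (\<Union>n. F n) \<in> null_sets lebesgue" by (simp add: negligible_iff_null_sets)
    then have "AE r in lebesgue. r \<notin> {0, pi} \<union> (\<Union>n. F n)" by (rule AE_not_in)
    then have "AE r in lebesgue. r \<in> {0..pi} \<longrightarrow> \<eta> r = 0"
    proof eventually_elim
      case (elim r)
      show ?case
      proof (intro impI, rule ccontr)
        assume r: "r \<in> {0..pi}" and "\<eta> r \<noteq> 0"
        then have "0 < min (\<eta> r) (min r (pi - r))" using \<eta>n[OF r] elim by auto
        then obtain n where "1 / real (Suc n) < min (\<eta> r) (min r (pi - r))"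
          using reals_Archimedean[of "min (\<eta> r) (min r (pi - r))"] by (auto simp: inverse_eq_divide)
        then have "r \<in> F n" using r by (auto simp: F_def)
        then show False using elim by blast
      qed
    qed
    with nz show False by simp
  qed
  then obtain n where pos: "0 < measure lebesgue (F n)" by blast
  define \<epsilon> where "\<epsilon> = 1 / real (Suc n)"
  have \<epsilon>: "0 < \<epsilon>" by (simp add: \<epsilon>_def)
  have "1 * 1 \<le> C * C" using C by (intro mult_mono) auto
  then have e: "0 < 1 / (8 * C\<^sup>2)" "1 / (8 * C\<^sup>2) < 1" by (auto simp: power2_eq_square)
  have Fsub: "F n \<subseteq> {\<epsilon>..pi - \<epsilon>}" by (auto simp: F_def \<epsilon>_def)
  \<comment> \<open>The proportion 1 / (8 C^2) weighs the upper bound C / k^(d-1) for the integrand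
    on the exceptional set against the lower bound 1 / (C k^(d-1)) for the energy.\<close>
  obtain u v where uv: "u < v" "{u..v} \<subseteq> {\<epsilon>..pi - \<epsilon>}" and dense: "measure lebesgue ({u..v} - F n) \<le> 1 / (8 * C\<^sup>2) * (v - u)"
    using interval_of_high_density[OF Ff Fsub pos e] by blast
  then have uv': "\<epsilon> \<le> u" "v \<le> pi - \<epsilon>" by auto
  obtain s where s: "s \<in> {u..v}" "\<And>t. t \<in> {u..v} \<Longrightarrow> w s \<le> w t"
    using continuous_attains_inf[of "{u..v}" w, OF compact_Icc _ continuous_on_jw] uv(1) by auto
  have ws: "0 < w s" using s(1) uv' \<epsilon> by (intro jw_pos) auto
  define c where "c = w s * \<epsilon> / ((real d + real d0) * weight_mass\<^sup>2) * ((v - u) / (8 * C))"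
  have dd: "0 < real d + real d0" using d_pos by simp
  have c: "0 < c" using ws \<epsilon> dd weight_mass_pos uv C by (simp add: c_def)
  \<comment> \<open>The second entry puts [u, v] into the range of the lower energy bound, the third
    makes the equipartition error small compared with the energy on [u, v].\<close>
  define k1 where "k1 = max k0 (max (nat \<lceil>A / \<epsilon>\<rceil>) (nat \<lceil>2 * C\<^sup>2 / (v - u)\<rceil>))"
  have "c / real k ^ (d + 1) \<le> (LINT r:{0..pi}|lebesgue. (fc (cap r) k)\<^sup>2 * \<eta> r)" if "k \<ge> k1" for k
  proof -
    have k: "k \<ge> k0" "1 \<le> k" and kA: "A / \<epsilon> \<le> real k" and kC: "2 * C\<^sup>2 / (v - u) \<le> real k"
      using that k0 by (auto simp: k1_def)
    have kp: "0 < real k" using k by simp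
    have Ak: "A / real k \<le> \<epsilon>" using kA kp \<epsilon> by (simp add: field_simps)
    have kC': "C / (2 * real k) \<le> (v - u) / (4 * C)" using kC kp uv C by (simp add: field_simps power2_eq_square)
    have evp: "0 < lam k" by (rule l_pos[OF zf_solution[OF k(2)]])
    define B where "B = C / real k ^ (d - 1)"
    have B: "0 \<le> B" using C by (simp add: B_def)
    define h where "h t = w t * (zg k t)\<^sup>2 / lam k" for t
    have hc: "continuous_on S h" for S unfolding h_def using evp by (intro continuous_intros zg_continuous) auto
    have h0: "0 \<le> h t" and hB: "h t \<le> B" if "t \<in> {0..pi}" for t
    proof -
      show "0 \<le> h t" using evp w_nonneg[OF that] by (simp add: h_def)
      have "h t \<le> w t * en k t"
        using w_nonneg[OF that] zg_sq_le[OF k(2), of t] mult_left_mono by (fastforce simp: h_def)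
      then show "h t \<le> B" using up[OF k(1) that] by (simp add: B_def)
    qed
    have int_h: "(v - u) * (1 / (C * real k ^ (d - 1))) \<le> 2 * integral {u..v} h + B / real k"
    proof -
      have "(v - u) * (1 / (C * real k ^ (d - 1))) = integral {u..v} (\<lambda>_. 1 / (C * real k ^ (d - 1)))" using uv by simp
      also have "\<dots> \<le> integral {u..v} (\<lambda>t. w t * en k t)"
        using uv' Ak by (intro integral_le integrable_continuous_real continuous_intros en_continuous k low) auto
      also have "\<dots> = integral {u..v} (\<lambda>t. w t * (zf k t)\<^sup>2 + h t)"
        by (simp add: en_split[OF k(2)] h_def distrib_left)
      also have "\<dots> = integral {u..v} (\<lambda>t. w t * (zf k t)\<^sup>2) + integral {u..v} h"
        by (intro integral_add integrable_continuous_real hc continuous_intros zf_continuous)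
      also have "integral {u..v} (\<lambda>t. w t * (zf k t)\<^sup>2) \<le> integral {u..v} h + B / real k"
      proof -
        have "\<bar>integral {u..v} (\<lambda>t. w t * (zg k t)\<^sup>2 / lam k) - integral {u..v} (\<lambda>t. w t * (zf k t)\<^sup>2)\<bar> \<le> B / real k"
          using uv' uv(1) \<epsilon> up[OF k(1)] by (intro energy_equipartition k) (auto simp: B_def)
        then show ?thesis unfolding h_def by linarith
      qed
      finally show ?thesis by linarith
    qed
    define \<kappa> where "\<kappa> = w s * \<epsilon> / (lam k * weight_mass\<^sup>2)"
    have \<kappa>: "0 < \<kappa>" using ws \<epsilon> evp weight_mass_pos by (simp add: \<kappa>_def)
    \<comment> \<open>A minorant of the integrand: on F n it uses \<eta> >= \<epsilon>, and on the
      rest of [u, v] it is nonpositive because h is at most B.\<close>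
    let ?L = "\<lambda>r. \<kappa> * (indicator {u..v} r *\<^sub>R h r - B * indicator ({u..v} - F n) r)"
    have D: "{u..v} - F n \<in> lmeasurable" by (intro fmeasurable.Diff Ff lmeasurable_interval)
    have i1: "integrable lebesgue (\<lambda>r. indicator {u..v} r *\<^sub>R h r)"
      using absolutely_integrable_continuous_real[OF hc] by (simp add: set_integrable_def)
    have i2: "integrable lebesgue (\<lambda>r. indicator ({u..v} - F n) r :: real)"
      using D by (intro integrable_real_indicator) (auto simp: fmeasurable_def)
    have "c / real k ^ (d + 1) \<le> \<kappa> * (integral {u..v} h - B * measure lebesgue ({u..v} - F n))"
    proof -
      have "(v - u) / (8 * C) / real k ^ (d - 1) \<le> integral {u..v} h - B * measure lebesgue ({u..v} - F n)"
      proof -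
        have "B * measure lebesgue ({u..v} - F n) \<le> B * (1 / (8 * C\<^sup>2) * (v - u))" by (intro mult_left_mono dense B)
        also have "\<dots> = (v - u) / (8 * C) / real k ^ (d - 1)" using C by (simp add: B_def power2_eq_square)
        finally have 1: "B * measure lebesgue ({u..v} - F n) \<le> (v - u) / (8 * C) / real k ^ (d - 1)" .
        have "B / (2 * real k) = C / (2 * real k) / real k ^ (d - 1)" by (simp add: B_def)
        also have "\<dots> \<le> (v - u) / (4 * C) / real k ^ (d - 1)" using kC' by (intro divide_right_mono) auto
        finally have 2: "B / (2 * real k) \<le> (v - u) / (4 * C) / real k ^ (d - 1)" .
        \<comment> \<open>Everything is measured in the unit (v - u) / (8 C) / k^(d-1). The energy
          integral is at least 8 units and the equipartition error at most 4, so the integral of h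
          is at least 2; the exceptional set costs at most 1.\<close>
        have 3: "(v - u) * (1 / (C * real k ^ (d - 1))) = 8 * ((v - u) / (8 * C) / real k ^ (d - 1))"
          "(v - u) / (4 * C) / real k ^ (d - 1) = 2 * ((v - u) / (8 * C) / real k ^ (d - 1))"
          "B / real k = 2 * (B / (2 * real k))"
        proof -
          have "a * (1 / (C * q)) = 8 * (a / (8 * C) / q)" "a / (4 * C) / q = 2 * (a / (8 * C) / q)" for a q :: real
            by simp_all
          then show "(v - u) * (1 / (C * real k ^ (d - 1))) = 8 * ((v - u) / (8 * C) / real k ^ (d - 1))"
            "(v - u) / (4 * C) / real k ^ (d - 1) = 2 * ((v - u) / (8 * C) / real k ^ (d - 1))" by blast+
        qed simp
        show ?thesis using 1 2 int_h unfolding 3 by linarith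
      qed
      then have "\<kappa> * ((v - u) / (8 * C) / real k ^ (d - 1)) \<le> \<kappa> * (integral {u..v} h - B * measure lebesgue ({u..v} - F n))"
        using \<kappa> by (intro mult_left_mono) auto
      moreover have "c / real k ^ (d + 1) \<le> \<kappa> * ((v - u) / (8 * C) / real k ^ (d - 1))"
      proof -
        have "w s * \<epsilon> / ((real d + real d0) * (real k)\<^sup>2 * weight_mass\<^sup>2) \<le> \<kappa>"
          unfolding \<kappa>_def using lam_bounds(2)[OF k(2)] ws \<epsilon> evp dd kp weight_mass_pos
          by (intro divide_left_mono mult_right_mono mult_pos_pos) auto
        then have "w s * \<epsilon> / ((real d + real d0) * (real k)\<^sup>2 * weight_mass\<^sup>2) * ((v - u) / (8 * C) / real k ^ (d - 1))
            \<le> \<kappa> * ((v - u) / (8 * C) / real k ^ (d - 1))"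
          using uv C by (intro mult_right_mono) auto
        moreover have "real k ^ (d + 1) = (real k)\<^sup>2 * real k ^ (d - 1)"
          using d_pos by (cases d) (auto simp: power2_eq_square)
        ultimately show ?thesis by (simp add: c_def mult_ac)
      qed
      ultimately show ?thesis by linarith
    qed
    also have "\<dots> = (LINT r|lebesgue. ?L r)"
    proof -
      have "(LINT r|lebesgue. indicator {u..v} r *\<^sub>R h r) = integral {u..v} h"
        using set_lebesgue_integral_eq_integral(2)[OF absolutely_integrable_continuous_real[OF hc]]
        by (simp add: set_lebesgue_integral_def)
      then show ?thesis using i1 i2 D by (simp add: fmeasurableD)
    qed
    also have "\<dots> \<le> (LINT r:{0..pi}|lebesgue. (fc (cap r) k)\<^sup>2 * \<eta> r)"
      unfolding set_lebesgue_integral_def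
    proof (rule integral_mono)
      show "integrable lebesgue ?L" using i1 i2 by (intro integrable_mult_right Bochner_Integration.integrable_diff)
      show "integrable lebesgue (\<lambda>r. indicator {0..pi} r *\<^sub>R ((fc (cap r) k)\<^sup>2 * \<eta> r))"
        using fc_cap_integrable[OF \<eta> k(2)] by (simp add: set_integrable_def)
      fix r
      have nn: "0 \<le> indicator {0..pi} r *\<^sub>R ((fc (cap r) k)\<^sup>2 * \<eta> r)" using \<eta>n by (auto simp: indicator_def)
      show "?L r \<le> indicator {0..pi} r *\<^sub>R ((fc (cap r) k)\<^sup>2 * \<eta> r)"
      proof (cases "r \<in> {u..v}")
        case True
        then have r: "r \<in> {0..pi}" using uv' \<epsilon> by auto
        show ?thesis
        proof (cases "r \<in> F n")
          case F: True
          then have \<eta>r: "\<epsilon> \<le> \<eta> r" using r by (auto simp: F_def \<epsilon>_def)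
          have "?L r = w s * h r / (lam k * weight_mass\<^sup>2) * \<epsilon>" using True F by (simp add: \<kappa>_def)
          also have "\<dots> \<le> w r * h r / (lam k * weight_mass\<^sup>2) * \<eta> r"
            using s(2)[OF True] \<eta>r h0[OF r] evp w_nonneg[OF r] \<epsilon>
            by (intro mult_mono divide_right_mono mult_right_mono divide_nonneg_nonneg mult_nonneg_nonneg) auto
          finally show ?thesis using r by (simp add: fc_cap_square[OF k(2) r] h_def)
        next
          case False
          then have "?L r \<le> 0" using True hB[OF r] \<kappa> by (simp add: mult_nonneg_nonpos)
          then show ?thesis using nn by linarith
        qed
      next
        case False
        then have "r \<notin> {u..v} - F n" by blast
        then have "?L r = 0" using False by (simp only: indicator_def if_False) simp
        then show ?thesis using nn by linarith
      qed
    qed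
    finally show ?thesis .
  qed
  then show ?thesis using c k0 by (intro exI[of _ c] conjI exI[of _ k1]) (auto simp: k1_def)
qed

end

section \<open>Sums over the points\<close>

text \<open>Summation by parts: partial sums of order L^d against the weights k^-(d+1) leave a
  convergent tail of order 1 / t.\<close>

lemma tail_sum_bound:
  fixes g :: "nat \<Rightarrow> real"
  assumes g: "\<And>k. 0 \<le> g k" and U: "\<And>L. t \<le> L \<Longrightarrow> (\<Sum>k=1..L. g k) \<le> B * real L ^ d" and t: "1 \<le> t" "t \<le> n"
  shows "(\<Sum>k=t+1..n. g k / real k ^ (d + 1)) \<le> B * (real d + 2) / real t"
proof -
  define U' where "U' L = (\<Sum>k=1..L. g k)" for L
  have U0: "0 \<le> U' L" for L unfolding U'_def by (intro sum_nonneg g)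
  have "0 \<le> B * real t ^ d" using U0[of t] U[of t] by (simp add: U'_def)
  then have B: "0 \<le> B" using t zero_less_power[of "real t" d] by (metis less_le_trans mult_less_0_iff not_le of_nat_0_less_iff zero_less_one)
  \<comment> \<open>The induction keeps the boundary term at n and the telescoped sum of 1 / (n (n +
    1)). Bernoulli's inequality bounds the relative decrease of n^-(d+1) by (d + 1) / (n +
    1).\<close>
  have "(\<Sum>k=t+1..n. g k / real k ^ (d + 1)) \<le> U' n / real n ^ (d + 1) + B * (real d + 1) * (1 / real t - 1 / real n)"
    using t(2)
  proof (induction n rule: dec_induct)
    case base
    then show ?case using U0[of t] by simp
  next
    case (step n)
    have n: "0 < real n" using step t by simp
    have "1 + real (d + 1) * (- 1 / (real n + 1)) \<le> (1 + (- 1 / (real n + 1))) ^ (d + 1)"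
      using n by (intro Bernoulli_inequality) (simp add: field_simps)
    also have "1 + (- 1 / (real n + 1)) = real n / (real n + 1)" using n by (simp add: field_simps)
    finally have ber: "1 - (real n / (real n + 1)) ^ (d + 1) \<le> (real d + 1) / (real n + 1)"
      by (simp add: add.commute[of 1] del: power_Suc)
    have "U' n / real n ^ (d + 1) - U' n / real (Suc n) ^ (d + 1) = U' n / real n ^ (d + 1) * (1 - (real n / (real n + 1)) ^ (d + 1))"
      using n by (simp add: power_divide field_simps)
    also have "\<dots> \<le> U' n / real n ^ (d + 1) * ((real d + 1) / (real n + 1))"
      using U0 n by (intro mult_left_mono ber) auto
    also have "\<dots> \<le> B * real n ^ d / real n ^ (d + 1) * ((real d + 1) / (real n + 1))"
      using U[OF step(1)] n by (intro mult_right_mono divide_right_mono) (auto simp: U'_def)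
    also have "\<dots> = B * (real d + 1) * (1 / (real n * (real n + 1)))" using n by simp
    also have "1 / (real n * (real n + 1)) = 1 / real n - 1 / real (Suc n)" using n by (simp add: field_simps)
    finally have key: "U' n / real n ^ (d + 1) - U' n / real (Suc n) ^ (d + 1) \<le> B * (real d + 1) * (1 / real n - 1 / real (Suc n))" .
    have "(\<Sum>k=t+1..Suc n. g k / real k ^ (d + 1)) = (\<Sum>k=t+1..n. g k / real k ^ (d + 1)) + g (Suc n) / real (Suc n) ^ (d + 1)"
      using step by simp
    moreover have "U' (Suc n) / real (Suc n) ^ (d + 1) = U' n / real (Suc n) ^ (d + 1) + g (Suc n) / real (Suc n) ^ (d + 1)"
      by (simp add: U'_def add_divide_distrib del: power_Suc of_nat_Suc)
    moreover have "B * (real d + 1) * (1 / real t - 1 / real (Suc n)) =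
       B * (real d + 1) * (1 / real t - 1 / real n) + B * (real d + 1) * (1 / real n - 1 / real (Suc n))"
      by (simp add: right_diff_distrib)
    ultimately show ?case using step(3) key by linarith
  qed
  also have "\<dots> \<le> B / real t + B * (real d + 1) * (1 / real t)"
  proof (rule add_mono)
    have "U' n / real n ^ (d + 1) \<le> B * real n ^ d / real n ^ (d + 1)"
      using U[OF t(2)] by (intro divide_right_mono) (auto simp: U'_def)
    also have "\<dots> = B / real n" using t by simp
    also have "\<dots> \<le> B / real t" using t B by (intro divide_left_mono) auto
    finally show "U' n / real n ^ (d + 1) \<le> B / real t" .
    show "B * (real d + 1) * (1 / real t - 1 / real n) \<le> B * (real d + 1) * (1 / real t)"
      using B by (intro mult_left_mono) auto
  qed
  also have "\<dots> = B * (real d + 2) / real t" by (simp add: algebra_simps flip: add_divide_distrib)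
  finally show ?thesis .
qed

text \<open>The definition runs over a set of multi-indices; here a family may repeat them, and
  coefficients of equal multi-indices are collected. Sums and products can then be written down
  without merging like terms.\<close>

lemma polynomial_of_degree_le_family:
  fixes m :: "'i \<Rightarrow> 'a::euclidean_space \<Rightarrow> nat"
  assumes I: "finite I" and m: "\<And>i. i \<in> I \<Longrightarrow> (\<Sum>b\<in>Basis. m i b) \<le> t"
    and F: "\<And>x. F x = (\<Sum>i\<in>I. c i * (\<Prod>b\<in>Basis. (x \<bullet> b) ^ m i b))"
  shows "polynomial_of_degree_le t F"
  unfolding polynomial_of_degree_le_def
proof (intro exI conjI)
  show "finite (m ` I)" using I by simp
  show "\<forall>\<gamma>\<in>m ` I. (\<Sum>b\<in>Basis. \<gamma> b) \<le> t" using m by auto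
  show "F = (\<lambda>x. \<Sum>\<gamma>\<in>m ` I. (\<Sum>i\<in>{i \<in> I. m i = \<gamma>}. c i) * (\<Prod>b\<in>Basis. (x \<bullet> b) ^ \<gamma> b))"
  proof
    fix x
    have "F x = (\<Sum>\<gamma>\<in>m ` I. \<Sum>i\<in>{i \<in> I. m i = \<gamma>}. c i * (\<Prod>b\<in>Basis. (x \<bullet> b) ^ m i b))"
      unfolding F by (rule sum.image_gen[OF I])
    also have "\<dots> = (\<Sum>\<gamma>\<in>m ` I. (\<Sum>i\<in>{i \<in> I. m i = \<gamma>}. c i) * (\<Prod>b\<in>Basis. (x \<bullet> b) ^ \<gamma> b))"
      unfolding sum_distrib_right by (intro sum.cong refl) auto
    finally show "F x = (\<Sum>\<gamma>\<in>m ` I. (\<Sum>i\<in>{i \<in> I. m i = \<gamma>}. c i) * (\<Prod>b\<in>Basis. (x \<bullet> b) ^ \<gamma> b))" .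
  qed
qed

lemma polynomial_of_degree_le_const: "polynomial_of_degree_le t (\<lambda>x::'a::euclidean_space. a)"
  by (rule polynomial_of_degree_le_family[where I = "{()}" and m = "\<lambda>_ _. 0" and c = "\<lambda>_. a"]) auto

lemma polynomial_of_degree_le_add:
  fixes F G :: "'a::euclidean_space \<Rightarrow> real"
  assumes "polynomial_of_degree_le t F" "polynomial_of_degree_le t G"
  shows "polynomial_of_degree_le t (\<lambda>x. F x + G x)"
proof -
  obtain A c where A: "finite A" "\<forall>\<alpha>\<in>A. (\<Sum>b\<in>Basis. \<alpha> b) \<le> t" "F = (\<lambda>x. \<Sum>\<alpha>\<in>A. c \<alpha> * (\<Prod>b\<in>Basis. (x \<bullet> b) ^ \<alpha> b))"
    using assms(1) unfolding polynomial_of_degree_le_def by blast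
  obtain B c' where B: "finite B" "\<forall>\<alpha>\<in>B. (\<Sum>b\<in>Basis. \<alpha> b) \<le> t" "G = (\<lambda>x. \<Sum>\<alpha>\<in>B. c' \<alpha> * (\<Prod>b\<in>Basis. (x \<bullet> b) ^ \<alpha> b))"
    using assms(2) unfolding polynomial_of_degree_le_def by blast
  show ?thesis
    by (rule polynomial_of_degree_le_family[where I = "A <+> B" and m = "case_sum id id" and c = "case_sum c c'"])
       (use A B in \<open>auto simp: sum.Plus\<close>)
qed

lemma polynomial_of_degree_le_affine_mult:
  fixes F :: "'a::euclidean_space \<Rightarrow> real"
  assumes "polynomial_of_degree_le t F"
  shows "polynomial_of_degree_le (Suc t) (\<lambda>x. (e + v \<bullet> x) * F x)"
proof -
  obtain A c where A: "finite A" "\<forall>\<alpha>\<in>A. (\<Sum>b\<in>Basis. \<alpha> b) \<le> t" "F = (\<lambda>x. \<Sum>\<alpha>\<in>A. c \<alpha> * (\<Prod>b\<in>Basis. (x \<bullet> b) ^ \<alpha> b))"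
    using assms unfolding polynomial_of_degree_le_def by blast
  let ?up = "\<lambda>\<alpha> b. \<alpha>(b := Suc (\<alpha> b))"
  have mono: "(\<Prod>b\<in>Basis. (x \<bullet> b) ^ ?up \<alpha> b' b) = (x \<bullet> b') * (\<Prod>b\<in>Basis. (x \<bullet> b) ^ \<alpha> b)"
    if "b' \<in> Basis" for x b' :: 'a and \<alpha>
    by (subst (1 2) prod.remove[OF finite_Basis that]) (auto intro!: prod.cong)
  have deg: "(\<Sum>b\<in>Basis. ?up \<alpha> b' b) = Suc (\<Sum>b\<in>Basis. \<alpha> b)" if "b' \<in> Basis" for b' :: 'a and \<alpha>
    by (subst (1 2) sum.remove[OF finite_Basis that]) (auto intro!: sum.cong)
  show ?thesis
  proof (rule polynomial_of_degree_le_family[where I = "A <+> (Basis \<times> A)"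
      and m = "case_sum id (\<lambda>(b, \<alpha>). ?up \<alpha> b)" and c = "case_sum (\<lambda>\<alpha>. e * c \<alpha>) (\<lambda>(b, \<alpha>). (v \<bullet> b) * c \<alpha>)"])
    show "finite (A <+> ((Basis :: 'a set) \<times> A))" using A(1) by simp
    show "(\<Sum>b\<in>Basis. case_sum id (\<lambda>(b, \<alpha>). ?up \<alpha> b) i b) \<le> Suc t" if "i \<in> A <+> ((Basis :: 'a set) \<times> A)" for i
      using that A(2) by (auto simp: deg le_SucI simp del: fun_upd_apply)
    fix x
    have v: "v \<bullet> x = (\<Sum>b\<in>Basis. (v \<bullet> b) * (x \<bullet> b))" by (rule euclidean_inner)
    have "(\<Sum>b\<in>Basis. (v \<bullet> b) * (x \<bullet> b)) * F x
        = (\<Sum>b\<in>Basis. \<Sum>\<alpha>\<in>A. (v \<bullet> b) * c \<alpha> * ((x \<bullet> b) * (\<Prod>b\<in>Basis. (x \<bullet> b) ^ \<alpha> b)))"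
      unfolding A(3) sum_product by (intro sum.cong refl) (simp add: mult_ac)
    then have "(e + v \<bullet> x) * F x = (\<Sum>\<alpha>\<in>A. e * c \<alpha> * (\<Prod>b\<in>Basis. (x \<bullet> b) ^ \<alpha> b))
       + (\<Sum>b\<in>Basis. \<Sum>\<alpha>\<in>A. (v \<bullet> b) * c \<alpha> * ((x \<bullet> b) * (\<Prod>b\<in>Basis. (x \<bullet> b) ^ \<alpha> b)))"
      unfolding distrib_right v by (simp add: A(3) sum_distrib_left mult.assoc)
    also have "\<dots> = (\<Sum>i\<in>A <+> (Basis \<times> A). case_sum (\<lambda>\<alpha>. e * c \<alpha>) (\<lambda>(b, \<alpha>). (v \<bullet> b) * c \<alpha>) i *
        (\<Prod>b\<in>Basis. (x \<bullet> b) ^ case_sum id (\<lambda>(b, \<alpha>). ?up \<alpha> b) i b))"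
    proof -
      have "(\<Sum>b\<in>Basis. \<Sum>\<alpha>\<in>A. (v \<bullet> b) * c \<alpha> * ((x \<bullet> b) * (\<Prod>b\<in>Basis. (x \<bullet> b) ^ \<alpha> b)))
         = (\<Sum>b\<in>Basis. \<Sum>\<alpha>\<in>A. (v \<bullet> b) * c \<alpha> * (\<Prod>b'\<in>Basis. (x \<bullet> b') ^ ?up \<alpha> b b'))"
        by (intro sum.cong refl arg_cong[where f = "\<lambda>y. _ * y"] mono[symmetric])
      then show ?thesis
        using A(1) by (simp add: sum.Plus sum.cartesian_product case_prod_beta' del: fun_upd_apply)
    qed
    finally show "(e + v \<bullet> x) * F x = (\<Sum>i\<in>A <+> (Basis \<times> A). case_sum (\<lambda>\<alpha>. e * c \<alpha>) (\<lambda>(b, \<alpha>). (v \<bullet> b) * c \<alpha>) i *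
        (\<Prod>b\<in>Basis. (x \<bullet> b) ^ case_sum id (\<lambda>(b, \<alpha>). ?up \<alpha> b) i b))" .
  qed
qed

lemma polynomial_of_degree_le_mono: "polynomial_of_degree_le s F \<Longrightarrow> s \<le> t \<Longrightarrow> polynomial_of_degree_le t F"
  unfolding polynomial_of_degree_le_def by (fast intro: order.trans)

lemma polynomial_of_degree_le_poly:
  "polynomial_of_degree_le (degree p) (\<lambda>x. poly p (e + v \<bullet> x))"
proof (induction p rule: pCons_induct)
  case 0
  show ?case using polynomial_of_degree_le_const[of 0 0] by simp
next
  case (pCons a p)
  show ?case
  proof (cases "p = 0")
    case True
    then show ?thesis using polynomial_of_degree_le_const[of 0 a] by simp
  next
    case False
    then show ?thesis
      using polynomial_of_degree_le_add[OF polynomial_of_degree_le_const polynomial_of_degree_le_affine_mult[OF pCons.IH]]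
      by simp
  qed
qed

section \<open>Points in small balls\<close>

context zonal_space
begin

lemma cap_iff: "r \<in> {0..pi} \<Longrightarrow> x \<in> Q \<Longrightarrow> y \<in> Q \<Longrightarrow> cap r (cc x y) = (if \<theta> x y < r then 1 else 0)"
  using cos_mono_less_eq[of r "\<theta> x y"] theta_range[of x y] by (simp add: cap_def cos_theta' flip: cos_theta')

lemma theta_sym: "x \<in> Q \<Longrightarrow> y \<in> Q \<Longrightarrow> \<theta> x y = \<theta> y x"
  by (simp add: theta_eq cc_sym)

lemma sin_half_theta:
  assumes "x \<in> Q" "y \<in> Q" shows "sin (\<theta> x y / 2) = sqrt \<alpha> / 2 * dist x y"
proof (rule power2_eq_imp_eq)
  have "(sin (\<theta> x y / 2))\<^sup>2 = (1 - cc x y) / 2"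
    using cos_double_sin[of "\<theta> x y / 2"] by (simp add: cos_theta' assms)
  also have "\<dots> = \<alpha> / 4 * ((x - y) \<bullet> (x - y))"
  proof -
    have "\<alpha> / 4 * ((x - y) \<bullet> (x - y)) = ((\<alpha> * (x \<bullet> x) + \<beta>) + (\<alpha> * (y \<bullet> y) + \<beta>) - 2 * (\<alpha> * (x \<bullet> y) + \<beta>)) / 4"
      by (simp add: inner_diff inner_commute algebra_simps)
    then show ?thesis using cc_self[OF assms(1)] cc_self[OF assms(2)] by (simp add: cc_def)
  qed
  also have "\<dots> = (sqrt \<alpha> / 2 * dist x y)\<^sup>2"
    using \<alpha>_pos by (simp add: dist_norm power_mult_distrib power_divide power2_norm_eq_inner)
  finally show "(sin (\<theta> x y / 2))\<^sup>2 = (sqrt \<alpha> / 2 * dist x y)\<^sup>2" .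
  show "0 \<le> sin (\<theta> x y / 2)" using theta_range[OF assms] by (intro sin_ge_zero) auto
qed (use \<alpha>_pos in simp)

lemma sin_half_triangle:
  assumes "x \<in> Q" "y \<in> Q" "z \<in> Q" shows "sin (\<theta> x z / 2) \<le> sin (\<theta> x y / 2) + sin (\<theta> y z / 2)"
  unfolding sin_half_theta[OF assms(1,2)] sin_half_theta[OF assms(2,3)] sin_half_theta[OF assms(1,3)]
  using dist_triangle[of x z y] \<alpha>_pos by (simp flip: distrib_left)

text \<open>From the triangle inequality for chords and t / pi <= sin (t / 2) <= t / 2. The factor
  pi / 2 is harmless, since radii matter only up to constants.\<close>

lemma theta_quasi_triangle:
  assumes "x \<in> Q" "y \<in> Q" "z \<in> Q" shows "\<theta> x z \<le> pi / 2 * (\<theta> x y + \<theta> y z)"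
proof -
  have "\<theta> x z / pi \<le> sin (\<theta> x z / 2)" using theta_range[OF assms(1,3)] by (intro sin_half_ge) auto
  also have "\<dots> \<le> \<theta> x y / 2 + \<theta> y z / 2"
    using sin_half_triangle[OF assms] sin_half_le[of "\<theta> x y"] sin_half_le[of "\<theta> y z"] theta_range assms by fastforce
  finally show ?thesis by (simp add: field_simps)
qed

lemma theta_measurable: "y \<in> Q \<Longrightarrow> (\<lambda>z. \<theta> y z) \<in> borel_measurable \<mu>"
proof -
  assume y: "y \<in> Q"
  \<comment> \<open>The argument is clamped to [-1, 1], where arccos is continuous; on the space
    itself this changes nothing.\<close>
  have "(\<lambda>z. arccos (max (-1) (min 1 (cc y z)))) \<in> borel_measurable \<mu>"
    unfolding cc_def by (intro measurable_\<mu>_continuous continuous_intros continuous_on_arccos) auto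
  also have "?this \<longleftrightarrow> ?thesis"
    using cc_range[OF y] by (intro measurable_cong) (simp add: theta_eq[OF y])
  finally show ?thesis .
qed

lemma ball_sets: "y \<in> Q \<Longrightarrow> {z \<in> Q. \<theta> y z < \<rho>} \<in> sets \<mu>"
  using theta_measurable[of y] by measurable

lemma ball_measure:
  assumes y: "y \<in> Q" and r: "r \<in> {0..pi}" shows "measure \<mu> {z \<in> Q. \<theta> y z < r} = vol r"
proof -
  have "vol r = (\<integral>z. cap r (cc y z) \<partial>\<mu>)"
    unfolding vol_def by (rule E_eq[symmetric, OF bounded_borel_measurable[OF bounded_borel_cap] y])
  also have "\<dots> = (\<integral>z. indicator {z \<in> Q. \<theta> y z < r} z \<partial>\<mu>)"
    by (intro Bochner_Integration.integral_cong refl) (simp add: cap_iff[OF r y] indicator_def)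
  also have "\<dots> = measure \<mu> {z \<in> Q. \<theta> y z < r}" using ball_sets[OF y] by simp
  finally show ?thesis by simp
qed

lemma vol_pi: "vol pi = 1"
  using vol_eq[of pi] weight_mass_pos by (simp add: weight_mass_def)

lemma ball_measure_le:
  assumes y: "y \<in> Q" and \<rho>: "0 \<le> \<rho>" shows "measure \<mu> {z \<in> Q. \<theta> y z < \<rho>} \<le> \<rho> ^ d / weight_mass"
proof (cases "\<rho> \<le> pi")
  case True
  then show ?thesis using ball_measure[OF y, of \<rho>] vol_le[of \<rho>] \<rho> by simp
next
  case False
  have "measure \<mu> {z \<in> Q. \<theta> y z < \<rho>} \<le> vol pi" by (simp add: vol_pi)
  also have "\<dots> \<le> pi ^ d / weight_mass" by (intro vol_le) auto
  also have "\<dots> \<le> \<rho> ^ d / weight_mass" using False weight_mass_pos by (intro divide_right_mono power_mono) auto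
  finally show ?thesis .
qed

text \<open>The volume argument common to both conditions: essentially disjoint sets of measure at
  least v around points of a small ball fit into a slightly larger ball. Measures are those of the
  completion because the pieces of a partition are measurable only there.\<close>

lemma packing:
  assumes y: "y \<in> Q" and x: "\<And>i. i \<in> I \<Longrightarrow> x i \<in> Q" and I: "finite I"
    and A: "\<And>i. i \<in> I \<Longrightarrow> A i \<in> sets (completion \<mu>)" "\<And>i. i \<in> I \<Longrightarrow> v \<le> measure (completion \<mu>) (A i)"
    and null: "\<And>i j. i \<in> I \<Longrightarrow> j \<in> I \<Longrightarrow> i \<noteq> j \<Longrightarrow> measure (completion \<mu>) (A i \<inter> A j) = 0"
    and near: "\<And>i z. i \<in> I \<Longrightarrow> z \<in> A i \<Longrightarrow> z \<in> Q \<and> \<theta> (x i) z \<le> \<rho>" and s: "\<And>i. i \<in> I \<Longrightarrow> \<theta> y (x i) < s"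
    and nonneg: "0 \<le> \<rho>" "0 \<le> s"
  shows "real (card I) * v \<le> (pi / 2 * (s + \<rho>)) ^ d / weight_mass"
proof -
  interpret C: prob_space "completion \<mu>" by (rule prob_space_completion)
  let ?B = "{z \<in> Q. \<theta> y z < pi / 2 * (s + \<rho>)}"
  have Bm: "?B \<in> sets \<mu>" by (rule ball_sets[OF y])
  then have Bc: "?B \<in> sets (completion \<mu>)" by auto
  have sub: "A i \<subseteq> ?B" if i: "i \<in> I" for i
  proof
    fix z assume z: "z \<in> A i"
    have "\<theta> y z \<le> pi / 2 * (\<theta> y (x i) + \<theta> (x i) z)"
      using near[OF i z] by (intro theta_quasi_triangle y x i) auto
    also have "\<dots> < pi / 2 * (s + \<rho>)" using s[OF i] near[OF i z] by (intro mult_strict_left_mono) auto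
    finally show "z \<in> ?B" using near[OF i z] by simp
  qed
  have ae: "AE z in completion \<mu>. \<forall>i\<in>I. \<forall>j\<in>I. i \<noteq> j \<longrightarrow> z \<notin> A i \<inter> A j"
  proof (intro AE_finite_allI I)
    fix i j assume ij: "i \<in> I" "j \<in> I"
    show "AE z in completion \<mu>. i \<noteq> j \<longrightarrow> z \<notin> A i \<inter> A j"
    proof (cases "i = j")
      case False
      then have "A i \<inter> A j \<in> null_sets (completion \<mu>)"
        using null[OF ij] A(1) ij by (intro null_setsI) (auto simp: C.emeasure_eq_measure)
      then show ?thesis by (rule AE_mp[OF AE_not_in]) auto
    qed simp
  qed
  have "real (card I) * v \<le> (\<Sum>i\<in>I. measure (completion \<mu>) (A i))"
    using sum_mono[of I "\<lambda>_. v", OF A(2)] by simp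
  also have "\<dots> = (\<integral>z. (\<Sum>i\<in>I. indicator (A i) z) \<partial>completion \<mu>)"
  proof -
    have "A i \<inter> Q = A i" if "i \<in> I" for i using near[OF that] by blast
    then show ?thesis using A(1)
      by (subst Bochner_Integration.integral_sum) (auto intro!: integrable_real_indicator sum.cong simp: C.emeasure_eq_measure)
  qed
  also have "\<dots> \<le> (\<integral>z. indicator ?B z \<partial>completion \<mu>)"
  proof (rule integral_mono_AE)
    show "integrable (completion \<mu>) (\<lambda>z. \<Sum>i\<in>I. indicator (A i) z :: real)"
      using A(1) by (intro Bochner_Integration.integrable_sum integrable_real_indicator) (auto simp: C.emeasure_eq_measure)
    show "integrable (completion \<mu>) (\<lambda>z. indicator ?B z :: real)"
      using Bc by (intro integrable_real_indicator) (auto simp: C.emeasure_eq_measure)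
    show "AE z in completion \<mu>. (\<Sum>i\<in>I. indicator (A i) z) \<le> (indicator ?B z :: real)"
      using ae
    proof eventually_elim
      case (elim z)
      show ?case
      proof (cases "\<exists>i\<in>I. z \<in> A i")
        case True
        then obtain i where i: "i \<in> I" "z \<in> A i" by blast
        then have "(\<Sum>j\<in>I. indicator (A j) z) = (\<Sum>j\<in>I. if j = i then 1 else 0 :: real)"
          using elim by (intro sum.cong refl) (auto simp: indicator_def)
        then show ?thesis using i sub[OF i(1)] I by (simp add: subset_iff)
      next
        case False
        then have "(\<Sum>j\<in>I. indicator (A j) z) = (0 :: real)" by (intro sum.neutral) (auto simp: indicator_def)
        then show ?thesis by simp
      qed
    qed
  qed
  also have "\<dots> = measure \<mu> ?B" using Bc Bm by (simp add: measure_completion)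
  also have "\<dots> \<le> (pi / 2 * (s + \<rho>)) ^ d / weight_mass" using nonneg by (intro ball_measure_le y) auto
  finally show ?thesis .
qed

lemma multiplicity_separated:
  assumes c: "0 < c'" and \<kappa>: "0 < \<kappa>"
  shows "\<exists>M>0. \<forall>N x s y. 2 \<le> N \<longrightarrow> (\<forall>i<N. x i \<in> Q) \<longrightarrow> well_separated \<theta> d c' N x \<longrightarrow>
    0 \<le> s \<longrightarrow> s \<le> \<kappa> * real N powr (- 1 / real d) \<longrightarrow> y \<in> Q \<longrightarrow> real (card {i. i < N \<and> \<theta> y (x i) < s}) \<le> M"
proof -
  obtain cv where cv: "cv > 0" "\<And>r. r \<in> {0..pi / 2} \<Longrightarrow> cv * r ^ d \<le> vol r" using vol_ge by blast
  let ?M = "(pi / 2 * (\<kappa> * pi / (2 * c') + 1)) ^ d / (weight_mass * cv)"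
  have "real (card {i. i < N \<and> \<theta> y (x i) < s}) \<le> ?M"
    if N: "2 \<le> N" and x: "\<forall>i<N. x i \<in> Q" and sep: "well_separated \<theta> d c' N x"
      and s: "0 \<le> s" "s \<le> \<kappa> * real N powr (- 1 / real d)" and y: "y \<in> Q" for N x s y
  proof -
    define q where "q = real N powr (- 1 / real d)"
    have q: "0 < q" using N by (simp add: q_def)
    have far: "2 * c' * q \<le> \<theta> (x i) (x j)" if "i < N" "j < N" "i \<noteq> j" for i j
    proof -
      let ?S = "{\<theta> (x i) (x j) | i j. i < N \<and> j < N \<and> i \<noteq> j}"
      have "finite ?S"
        by (rule finite_subset[of _ "(\<lambda>(i, j). \<theta> (x i) (x j)) ` ({..<N} \<times> {..<N})"]) auto
      then have "Min ?S \<le> \<theta> (x i) (x j)" using that by (intro Min_le) auto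
      then show ?thesis using sep by (simp add: well_separated_def separation_def q_def)
    qed
    \<comment> \<open>If two balls of this radius about distinct points met,
      \<open>theta_quasi_triangle\<close> would put their centres at distance less than pi \<rho> =
      2 c' q, contrary to the separation, which is defined as half the minimal distance.\<close>
    define \<rho> where "\<rho> = 2 * c' * q / pi"
    have \<rho>: "0 < \<rho>" "pi * \<rho> = 2 * c' * q" using c q by (simp_all add: \<rho>_def)
    \<comment> \<open>Two distinct indices exist because N is at least 2; their distance is at most
      pi, so the radius is at most 1 and \<open>vol_ge\<close> applies.\<close>
    have "pi * \<rho> \<le> pi * 1"
      using far[of 0 1] theta_range[of "x 0" "x 1"] x N \<rho> by (simp del: One_nat_def)
    then have \<rho>1: "\<rho> \<le> 1" by simp
    have "real (card {i. i < N \<and> \<theta> y (x i) < s}) * (cv * \<rho> ^ d) \<le> (pi / 2 * (s + \<rho>)) ^ d / weight_mass"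
    proof (rule packing[where A = "\<lambda>i. {z \<in> Q. \<theta> (x i) z < \<rho>}" and x = x])
      fix i assume i: "i \<in> {i. i < N \<and> \<theta> y (x i) < s}"
      then have xi: "x i \<in> Q" using x by simp
      show "x i \<in> Q" by fact
      show "{z \<in> Q. \<theta> (x i) z < \<rho>} \<in> sets (completion \<mu>)" using ball_sets[OF xi] by auto
      show "cv * \<rho> ^ d \<le> measure (completion \<mu>) {z \<in> Q. \<theta> (x i) z < \<rho>}"
      proof -
        have "measure (completion \<mu>) {z \<in> Q. \<theta> (x i) z < \<rho>} = vol \<rho>"
          using ball_sets[OF xi] ball_measure[OF xi, of \<rho>] \<rho> \<rho>1 pi_gt3 by (simp add: measure_completion)
        then show ?thesis using cv(2)[of \<rho>] \<rho> \<rho>1 pi_gt3 by simp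
      qed
      show "\<theta> y (x i) < s" using i by simp
      show "z \<in> Q \<and> \<theta> (x i) z \<le> \<rho>" if "z \<in> {z \<in> Q. \<theta> (x i) z < \<rho>}" for z using that by simp
      fix j assume j: "j \<in> {i. i < N \<and> \<theta> y (x i) < s}" and ij: "i \<noteq> j"
      then have xj: "x j \<in> Q" using x by simp
      have "{z \<in> Q. \<theta> (x i) z < \<rho>} \<inter> {z \<in> Q. \<theta> (x j) z < \<rho>} = {}"
      proof (rule ccontr)
        assume "\<not> ?thesis"
        then obtain z where z: "z \<in> Q" "\<theta> (x i) z < \<rho>" "\<theta> (x j) z < \<rho>" by auto
        have "\<theta> (x i) (x j) \<le> pi / 2 * (\<theta> (x i) z + \<theta> z (x j))" by (intro theta_quasi_triangle xi xj z)
        also have "\<dots> < pi / 2 * (\<rho> + \<rho>)" using z theta_sym[OF xj z(1)] by (intro mult_strict_left_mono) auto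
        finally have "\<theta> (x i) (x j) < pi * \<rho>" by simp
        then show False using far[of i j] i j ij \<rho>(2) by simp
      qed
      then show "measure (completion \<mu>) ({z \<in> Q. \<theta> (x i) z < \<rho>} \<inter> {z \<in> Q. \<theta> (x j) z < \<rho>}) = 0" by simp
    qed (use \<rho> s y in auto)
    also have "\<dots> \<le> (pi / 2 * ((\<kappa> * pi / (2 * c') + 1) * \<rho>)) ^ d / weight_mass"
    proof (intro divide_right_mono power_mono mult_left_mono)
      have "s \<le> \<kappa> * q" using s by (simp add: q_def)
      also have "\<kappa> * q = \<kappa> * pi / (2 * c') * \<rho>" using c by (simp add: \<rho>_def)
      finally show "s + \<rho> \<le> (\<kappa> * pi / (2 * c') + 1) * \<rho>" by (simp add: distrib_right)
    qed (use \<rho> s weight_mass_pos in auto)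
    also have "\<dots> = ?M * (cv * \<rho> ^ d)"
    proof -
      have "(b * (e * \<rho>)) ^ d / W = (b * e) ^ d / (W * cv) * (cv * \<rho> ^ d)" for b e W :: real
        using cv(1) by (simp add: power_mult_distrib)
      then show ?thesis .
    qed
    finally show ?thesis using cv(1) \<rho>(1) by (elim mult_right_le_imp_le) simp
  qed
  moreover have "0 < ?M" using cv \<kappa> c weight_mass_pos by (intro divide_pos_pos mult_pos_pos zero_less_power add_pos_pos) auto
  ultimately show ?thesis by (intro exI[of _ ?M] conjI allI impI)
qed

lemma multiplicity_subordinated:
  assumes c: "0 < c0" and \<kappa>: "0 < \<kappa>"
  shows "\<exists>M>0. \<forall>N x s y. 2 \<le> N \<longrightarrow> (\<forall>i<N. x i \<in> Q) \<longrightarrow> subordinated_small \<mu> \<theta> d c0 N x \<longrightarrow>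
    0 \<le> s \<longrightarrow> s \<le> \<kappa> * real N powr (- 1 / real d) \<longrightarrow> y \<in> Q \<longrightarrow> real (card {i. i < N \<and> \<theta> y (x i) < s}) \<le> M"
proof -
  let ?M = "(pi / 2 * (\<kappa> + c0)) ^ d / weight_mass"
  have "real (card {i. i < N \<and> \<theta> y (x i) < s}) \<le> ?M"
    if N: "2 \<le> N" and x: "\<forall>i<N. x i \<in> Q" and sub: "subordinated_small \<mu> \<theta> d c0 N x"
      and s: "0 \<le> s" "s \<le> \<kappa> * real N powr (- 1 / real d)" and y: "y \<in> Q" for N x s y
  proof -
    define q where "q = real N powr (- 1 / real d)"
    have q: "0 < q" using N by (simp add: q_def)
    \<comment> \<open>This makes the measure 1 / N of a piece cancel against the volume of a ball of
      radius of order q.\<close>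
    have qd: "q ^ d = 1 / real N"
      using N d_pos powr_power[of "real N" "- 1 / real d" d] by (simp add: q_def powr_minus_divide)
    obtain P where P0: "small_equal_measure_partition \<mu> \<theta> d c0 N P" "\<forall>i<N. x i \<in> P i"
      using sub unfolding subordinated_small_def by blast
    then have P: "\<And>i. i < N \<Longrightarrow> P i \<in> sets (completion \<mu>)" "(\<Union>i<N. P i) = Q"
      "\<And>i j. i < N \<Longrightarrow> j < N \<Longrightarrow> i \<noteq> j \<Longrightarrow> measure (completion \<mu>) (P i \<inter> P j) = 0"
      "\<And>i. i < N \<Longrightarrow> measure (completion \<mu>) (P i) = 1 / real N"
      "\<And>i. i < N \<Longrightarrow> theta_diameter \<theta> (P i) \<le> c0 * q" "\<And>i. i < N \<Longrightarrow> x i \<in> P i"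
      unfolding small_equal_measure_partition_def q_def by - (elim conjE; simp)+
    have "real (card {i. i < N \<and> \<theta> y (x i) < s}) * (1 / real N) \<le> (pi / 2 * (s + c0 * q)) ^ d / weight_mass"
    proof (rule packing[where A = P and x = x])
      fix i assume i: "i \<in> {i. i < N \<and> \<theta> y (x i) < s}"
      then have iN: "i < N" by simp
      show "x i \<in> Q" using x iN by blast
      show "P i \<in> sets (completion \<mu>)" by (rule P(1)[OF iN])
      show "1 / real N \<le> measure (completion \<mu>) (P i)" using P(4)[OF iN] by simp
      show "\<theta> y (x i) < s" using i by simp
      show "z \<in> Q \<and> \<theta> (x i) z \<le> c0 * q" if z: "z \<in> P i" for z
      proof
        have PQ: "P i \<subseteq> Q" using P(2) iN by blast
        then show "z \<in> Q" using z by blast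
        have "\<theta> (x i) z \<le> Sup {\<theta> x y | x y. x \<in> P i \<and> y \<in> P i}"
        proof (rule cSup_upper)
          show "\<theta> (x i) z \<in> {\<theta> x y | x y. x \<in> P i \<and> y \<in> P i}" using z P(6)[OF iN] by blast
          show "bdd_above {\<theta> x y | x y. x \<in> P i \<and> y \<in> P i}"
            using theta_range PQ by (intro bdd_aboveI[of _ pi]) blast
        qed
        then show "\<theta> (x i) z \<le> c0 * q" using P(5)[OF iN] by (simp add: theta_diameter_def)
      qed
      show "measure (completion \<mu>) (P i \<inter> P j) = 0" if "j \<in> {i. i < N \<and> \<theta> y (x i) < s}" "i \<noteq> j" for j
        using P(3)[OF iN, of j] that by simp
    qed (use c q s y in auto)
    also have "\<dots> \<le> (pi / 2 * ((\<kappa> + c0) * q)) ^ d / weight_mass"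
      using s c q weight_mass_pos by (intro divide_right_mono power_mono mult_left_mono) (auto simp: q_def distrib_right)
    also have "\<dots> = ?M * q ^ d"
    proof -
      have "(b * (e * q)) ^ d / W = (b * e) ^ d / W * q ^ d" for b e W :: real by (simp add: power_mult_distrib)
      then show ?thesis .
    qed
    also have "\<dots> = ?M * (1 / real N)" by (simp only: qd)
    finally show ?thesis using N by (elim mult_right_le_imp_le) simp
  qed
  moreover have "0 < ?M" using \<kappa> c weight_mass_pos by (intro divide_pos_pos mult_pos_pos zero_less_power add_pos_pos) auto
  ultimately show ?thesis by (intro exI[of _ ?M] conjI allI impI)
qed

text \<open>For s = a / L all coefficients of the cap up to degree L are at least
  \<open>vol s\<close> / 2. Bessel's inequality bounds (vol s)^2 / 4 times the sum by the mean
  square of the counting function, and this is at most M times its mean N \<open>vol s\<close>. One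
  factor \<open>vol s\<close>, of order L^-d, remains.\<close>

lemma partial_sum_upper:
  "\<exists>a>0. \<exists>C>0. \<forall>N x L M. 1 \<le> L \<longrightarrow> (\<forall>i<N. x i \<in> Q) \<longrightarrow>
     (\<forall>y\<in>Q. real (card {i. i < N \<and> \<theta> y (x i) < a / real L}) \<le> M) \<longrightarrow>
     (\<Sum>k=1..L. pair_sum N x k / kap k) \<le> C * M * real N * real L ^ d"
proof -
  obtain cv where cv: "cv > 0" "\<And>r. r \<in> {0..pi / 2} \<Longrightarrow> cv * r ^ d \<le> vol r" using vol_ge by blast
  obtain a where a: "0 < a" "a \<le> pi / 2" and low: "\<And>k s. 1 \<le> k \<Longrightarrow> s \<in> {0..a / real k} \<Longrightarrow> vol s / 2 \<le> fc (cap s) k"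
    using fc_cap_lower by blast
  have "(\<Sum>k=1..L. pair_sum N x k / kap k) \<le> 4 / (cv * a ^ d) * M * real N * real L ^ d"
    if L: "1 \<le> L" and x: "\<forall>i<N. x i \<in> Q" and M: "\<forall>y\<in>Q. real (card {i. i < N \<and> \<theta> y (x i) < a / real L}) \<le> M" for N x L M
  proof -
    define s where "s = a / real L"
    have "a / real L \<le> a / 1" using a L by (intro divide_left_mono) auto
    then have s: "0 < s" "s \<le> pi / 2" unfolding s_def using a L by (simp, linarith)
    have s': "s \<in> {0..pi}" "s \<in> {0..pi / 2}" using s by auto
    have M0: "0 \<le> M" using M Y_space[of 0] by (meson of_nat_0_le_iff order.trans)
    have vs: "cv * s ^ d \<le> vol s" by (rule cv(2)[OF s'(2)])
    have vs0: "0 < cv * s ^ d" using cv s by simp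
    have x': "\<And>i. i < N \<Longrightarrow> x i \<in> Q" using x by simp
    let ?S = "\<lambda>z. \<Sum>i<N. cap s (cc (x i) z)"
    have S: "?S z = real (card {i. i < N \<and> \<theta> z (x i) < s})" if z: "z \<in> Q" for z
    proof -
      have "?S z = (\<Sum>i<N. if \<theta> z (x i) < s then 1 else 0)"
        using x z by (intro sum.cong refl) (simp add: cap_iff[OF s'(1)] theta_sym)
      also have "\<dots> = real (card ({..<N} \<inter> {i. \<theta> z (x i) < s}))" by (simp add: sum.If_cases)
      also have "{..<N} \<inter> {i. \<theta> z (x i) < s} = {i. i < N \<and> \<theta> z (x i) < s}" by auto
      finally show ?thesis .
    qed
    have i1: "integrable \<mu> (\<lambda>z. cap s (cc (x i) z))" if "i < N" for i
      by (intro integrable_bounded_borel bounded_borel_cap x' that)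
    have "(\<Sum>k=1..L. (vol s / 2)\<^sup>2 * (pair_sum N x k / kap k)) \<le> (\<Sum>k=1..L. (fc (cap s) k)\<^sup>2 / kap k * pair_sum N x k)"
    proof (rule sum_mono)
      fix k assume k: "k \<in> {1..L}"
      have "a / real L \<le> a / real k" using a k by (intro divide_left_mono) auto
      then have "vol s / 2 \<le> fc (cap s) k" using k s by (intro low) (auto simp: s_def)
      then have "(vol s / 2)\<^sup>2 * (pair_sum N x k / kap k) \<le> (fc (cap s) k)\<^sup>2 * (pair_sum N x k / kap k)"
        using vol_nonneg[of s] pair_sum_nonneg[where x = x and N = N, OF x', of k] kap_pos[of k]
        by (intro mult_right_mono power_mono divide_nonneg_pos) auto
      then show "(vol s / 2)\<^sup>2 * (pair_sum N x k / kap k) \<le> (fc (cap s) k)\<^sup>2 / kap k * pair_sum N x k" by simp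
    qed
    also have "\<dots> \<le> cap_disc N x s" by (rule cap_disc_bessel[where x = x and N = N, OF x'])
    also have "\<dots> \<le> (\<integral>z. (?S z)\<^sup>2 \<partial>\<mu>)" by (simp add: cap_disc_eq[where x = x and N = N, OF x'])
    also have "\<dots> \<le> (\<integral>z. M * ?S z \<partial>\<mu>)"
    proof (rule integral_mono)
      show "integrable \<mu> (\<lambda>z. (?S z)\<^sup>2)" by (rule integral_square_sum(2)[OF bounded_borel_cap x'])
      show "integrable \<mu> (\<lambda>z. M * ?S z)" by (intro integrable_mult_right Bochner_Integration.integrable_sum i1) simp
      fix z assume z: "z \<in> Q"
      have "?S z \<le> M" "0 \<le> ?S z" unfolding S[OF z] using M z by (auto simp: s_def)
      then show "(?S z)\<^sup>2 \<le> M * ?S z" unfolding power2_eq_square by (rule mult_right_mono)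
    qed
    also have "\<dots> = M * (\<Sum>i<N. vol s)"
      using i1 x by (simp add: Bochner_Integration.integral_sum vol_def E_eq[OF bounded_borel_measurable[OF bounded_borel_cap]])
    finally have "(vol s)\<^sup>2 / 4 * (\<Sum>k=1..L. pair_sum N x k / kap k) \<le> M * real N * vol s"
      by (simp add: sum_distrib_left power_divide mult.assoc)
    then have "vol s * (\<Sum>k=1..L. pair_sum N x k / kap k) \<le> 4 * (M * real N)"
      using vs vs0 by (simp add: power2_eq_square field_simps)
    then have "(\<Sum>k=1..L. pair_sum N x k / kap k) \<le> 4 * (M * real N) / vol s"
      using vs vs0 by (simp add: field_simps)
    also have "\<dots> \<le> 4 * (M * real N) / (cv * s ^ d)"
      using vs vs0 M0 by (intro divide_left_mono mult_pos_pos[OF _ vs0]) auto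
    also have "\<dots> = 4 / (cv * a ^ d) * M * real N * real L ^ d" using L a by (simp add: s_def power_divide)
    finally show ?thesis .
  qed
  then show ?thesis using a(1) cv(1) by (intro exI[of _ a] conjI exI[of _ "4 / (cv * a ^ d)"] allI impI) auto
qed

text \<open>The kernel p has degree at most 2 m and mean 1, so |\<phi> k| <= 1 bounds its
  coefficients by 1 / \<open>kap k\<close>. Summed over all pairs it is at least its diagonal part N
  D(1), while the constant term contributes N^2. The order m^d of D(1) comes from
  \<open>kap_upper\<close>.\<close>

lemma partial_sum_lower:
  "\<exists>c>0. \<exists>m0. \<forall>N x m. m0 \<le> m \<longrightarrow> (\<forall>i<N. x i \<in> Q) \<longrightarrow>
     real N * (c * real m ^ d - real N) \<le> (\<Sum>k=1..2*m. pair_sum N x k / kap k)"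
proof -
  obtain C k0 where C: "C > 0" and k0: "1 \<le> k0" and ku: "\<And>k. k0 \<le> k \<Longrightarrow> kap k \<le> C / real k ^ (d - 1)"
    using kap_upper by blast
  let ?c = "1 / (C * 4 ^ d)"
  have "real N * (?c * real m ^ d - real N) \<le> (\<Sum>k=1..2*m. pair_sum N x k / kap k)"
    if m: "4 * k0 \<le> m" and x: "\<forall>i<N. x i \<in> Q" for N x m
  proof -
    have x': "\<And>i. i < N \<Longrightarrow> x i \<in> Q" using x by simp
    define D where "D = (\<Sum>k\<le>m. smult (1 / kap k) (\<phi> k))"
    define D1 where "D1 = (\<Sum>k\<le>m. 1 / kap k)"
    have D1: "poly D 1 = D1" by (simp add: D_def D1_def poly_sum poly_jacobi_1)
    have D1pos: "0 < D1" unfolding D1_def using kap_pos by (intro sum_pos) auto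
    have D1ge: "?c * real m ^ d \<le> D1"
    proof -
      \<comment> \<open>The upper half of the degrees already gives the right order: there are at
        least m / 4 of them, each at least m / 4 and beyond k0.\<close>
      define j where "j = m div 2"
      have j: "k0 \<le> j" "real m / 4 \<le> real j" "j \<le> m" "real m / 4 \<le> real (card {j..m})" using m k0 by (auto simp: j_def)
      have "?c * real m ^ d = real m / 4 * ((real m / 4) ^ (d - 1) / C)"
        using d_pos by (cases d) (auto simp: power_divide)
      also have "\<dots> \<le> real (card {j..m}) * ((real m / 4) ^ (d - 1) / C)" using j C by (intro mult_right_mono) auto
      also have "\<dots> = (\<Sum>k\<in>{j..m}. (real m / 4) ^ (d - 1) / C)" by simp
      also have "\<dots> \<le> (\<Sum>k\<in>{j..m}. 1 / kap k)"
      proof (rule sum_mono)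
        fix k assume k: "k \<in> {j..m}"
        then have "real m / 4 \<le> real k" "k0 \<le> k" "0 < real k" using j k0 by auto
        then have "(real m / 4) ^ (d - 1) / C \<le> real k ^ (d - 1) / C" using C by (intro divide_right_mono power_mono) auto
        also have "\<dots> = 1 / (C / real k ^ (d - 1))" by simp
        also have "\<dots> \<le> 1 / kap k" using ku[OF \<open>k0 \<le> k\<close>] kap_pos[of k] C \<open>0 < real k\<close>
          by (intro divide_left_mono mult_pos_pos) auto
        finally show "(real m / 4) ^ (d - 1) / C \<le> 1 / kap k" .
      qed
      also have "\<dots> \<le> D1" unfolding D1_def using kap_pos by (intro sum_mono2) (auto intro: less_imp_le)
      finally show ?thesis .
    qed
    define p where "p = smult (1 / D1) (D * D)"
    have "degree D \<le> m" unfolding D_def by (intro degree_sum_le) (auto simp: degree_\<phi>)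
    then have "degree p \<le> 2 * m"
      unfolding p_def by (intro order.trans[OF degree_smult_le] order.trans[OF degree_mult_le]) simp
    then obtain b where b: "p = (\<Sum>k\<le>2*m. smult (b k) (\<phi> k))" using jacobi_span[OF d_pos d0(1)] by blast
    \<comment> \<open>All Fourier coefficients of D up to degree m are 1, so D reproduces itself and
      the mean of D^2 is D(1). This is why p has mean 1.\<close>
    have EDD: "E (poly (D * D)) = D1"
    proof -
      have "E (poly (D * D)) = E (\<lambda>c. (\<Sum>k\<le>m. 1 / kap k * (poly D c * poly (\<phi> k) c)))"
        unfolding poly_mult[abs_def] by (subst (2) D_def) (simp add: poly_sum sum_distrib_left mult_ac)
      also have "\<dots> = (\<Sum>k\<le>m. 1 / kap k * fc (poly D) k)"
        unfolding fc_def by (subst E_sum, (intro bounded_borel_mult bounded_borel_poly bounded_borel_continuous continuous_on_const)[1])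
          (simp only: E_cmult)
      also have "\<dots> = D1" unfolding D1_def D_def
        using kap_pos by (intro sum.cong refl) (simp add: fc_poly less_imp_neq[THEN not_sym])
      finally show ?thesis .
    qed
    have bk: "b k * kap k \<le> 1" if "k \<le> 2 * m" for k
    proof -
      have "b k * kap k = fc (poly p) k" using that by (simp add: b fc_poly)
      also have "\<dots> \<le> E (poly p)" unfolding fc_def
      proof (rule E_mono)
        fix c :: real assume c: "c \<in> {-1..1}"
        have "\<bar>poly (\<phi> k) c\<bar> \<le> 1" using \<phi>_cos_bound[of k "arccos c"] c by simp
        then have "poly p c * poly (\<phi> k) c \<le> poly p c * 1"
          using D1pos by (intro mult_left_mono) (auto simp: p_def)
        then show "poly p c * poly (\<phi> k) c \<le> poly p c" by simp
      qed (intro bounded_borel_mult bounded_borel_poly)+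
      also have "\<dots> = 1" unfolding p_def E_smult EDD using D1pos by simp
      finally show ?thesis .
    qed
    have "real N * D1 = (\<Sum>i<N. poly p (cc (x i) (x i)))"
      using D1pos by (simp add: cc_self x p_def D1)
    also have "\<dots> \<le> (\<Sum>i<N. \<Sum>j<N. poly p (cc (x i) (x j)))"
      using D1pos by (intro sum_mono member_le_sum) (auto simp: p_def)
    also have "\<dots> = (\<Sum>k\<le>2*m. b k * pair_sum N x k)"
    proof -
      have "(\<Sum>i<N. \<Sum>j<N. poly p (cc (x i) (x j))) = (\<Sum>i<N. \<Sum>j<N. \<Sum>k\<le>2*m. b k * poly (\<phi> k) (cc (x i) (x j)))"
        by (simp add: b poly_sum)
      also have "\<dots> = (\<Sum>k\<le>2*m. b k * pair_sum N x k)"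
        unfolding pair_sum_def sum_distrib_left
        by (rule trans[OF sum.cong[OF refl sum.swap] sum.swap])
      finally show ?thesis .
    qed
    also have "\<dots> \<le> (\<Sum>k\<le>2*m. pair_sum N x k / kap k)"
    proof (rule sum_mono)
      fix k assume "k \<in> {..2*m}"
      then have "b k * kap k * pair_sum N x k \<le> 1 * pair_sum N x k"
        using bk[of k] pair_sum_nonneg[where x = x and N = N, OF x', of k] by (intro mult_right_mono) auto
      then show "b k * pair_sum N x k \<le> pair_sum N x k / kap k"
        using kap_pos[of k] by (simp add: pos_le_divide_eq mult_ac)
    qed
    also have "\<dots> = (real N)\<^sup>2 + (\<Sum>k=1..2*m. pair_sum N x k / kap k)"
    proof -
      have "{..2*m} = insert 0 {1..2*m}" by auto
      then show ?thesis by (simp add: pair_sum_0 kap_0)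
    qed
    finally have "real N * D1 - (real N)\<^sup>2 \<le> (\<Sum>k=1..2*m. pair_sum N x k / kap k)" by simp
    moreover have "real N * (?c * real m ^ d) \<le> real N * D1" by (intro mult_left_mono D1ge) simp
    ultimately show ?thesis by (simp add: right_diff_distrib power2_eq_square)
  qed
  moreover have "0 < ?c" using C by simp
  ultimately show ?thesis by blast
qed

end

section \<open>Stolarsky's identity\<close>

text \<open>The weight \<eta> is only Lebesgue measurable, whereas product measures require a Borel
  function. Its integrals are therefore rewritten with an almost everywhere equal Borel
  version.\<close>

lemma set_lebesgue_integral_borel_version:
  fixes k k' u :: "real \<Rightarrow> real"
  assumes k: "k' \<in> borel_measurable borel" "AE r in lborel. indicator A r * k r = k' r"
      "(\<lambda>r. indicator A r * k r) \<in> borel_measurable lebesgue"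
    and u: "u \<in> borel_measurable borel"
  shows "(LINT r:A|lebesgue. u r * k r) = (\<integral>r. u r * k' r \<partial>lborel)"
    and "set_integrable lebesgue A (\<lambda>r. u r * k r) \<longleftrightarrow> integrable lborel (\<lambda>r. u r * k' r)"
proof -
  have m: "(\<lambda>r. u r * k' r) \<in> borel_measurable lborel" using k u by simp
  have ae: "AE r in lebesgue. indicator A r *\<^sub>R (u r * k r) = u r * k' r"
  proof -
    have "AE r in lebesgue. indicator A r * k r = k' r" by (rule AE_completion[OF k(2)])
    then show ?thesis by eventually_elim (simp add: mult.left_commute)
  qed
  have ml: "(\<lambda>r. u r * k' r) \<in> borel_measurable lebesgue" by (rule measurable_completion[OF m])
  have ml': "(\<lambda>r. indicator A r *\<^sub>R (u r * k r)) \<in> borel_measurable lebesgue"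
    using borel_measurable_times[OF measurable_completion[of u lborel] k(3)] u by (simp add: mult.left_commute)
  show "(LINT r:A|lebesgue. u r * k r) = (\<integral>r. u r * k' r \<partial>lborel)"
    unfolding set_lebesgue_integral_def using integral_cong_AE[OF ml' ml ae] integral_completion[OF m] by simp
  show "set_integrable lebesgue A (\<lambda>r. u r * k r) \<longleftrightarrow> integrable lborel (\<lambda>r. u r * k' r)"
    unfolding set_integrable_def using integrable_cong_AE[OF ml' ml ae] integrable_completion[OF m] by simp
qed

lemma set_lebesgue_sum:
  fixes f :: "'i \<Rightarrow> 'b \<Rightarrow> real"
  assumes "\<And>i. i \<in> I \<Longrightarrow> set_integrable M A (f i)"
  shows "(LINT r:A|M. \<Sum>i\<in>I. f i r) = (\<Sum>i\<in>I. LINT r:A|M. f i r)"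
    and "set_integrable M A (\<lambda>r. \<Sum>i\<in>I. f i r)"
  using assms unfolding set_lebesgue_integral_def set_integrable_def scaleR_sum_right
  by (auto intro: Bochner_Integration.integral_sum)

context zonal_space
begin

text \<open>Fubini's theorem for the Borel version of the weight. The majorant D depends on r alone,
  so integrability over the product reduces to that of D against \<eta>, because \<mu> has mass
  1.\<close>

lemma fubini_weight:
  fixes f :: "real \<Rightarrow> 'a \<Rightarrow> real" and \<eta> D :: "real \<Rightarrow> real"
  assumes f: "(\<lambda>p. f (fst p) (snd p)) \<in> borel_measurable (borel \<Otimes>\<^sub>M \<mu>)"
    and bound: "\<And>r z. r \<in> {0..pi} \<Longrightarrow> z \<in> Q \<Longrightarrow> \<bar>f r z\<bar> \<le> D r"
    and D: "D \<in> borel_measurable borel" "set_integrable lebesgue {0..pi} (\<lambda>r. D r * \<eta> r)"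
    and \<eta>: "\<eta> \<in> borel_measurable (lebesgue_on {0..pi})"
  shows "(LINT r:{0..pi}|lebesgue. (\<integral>z. f r z \<partial>\<mu>) * \<eta> r) = (\<integral>z. (LINT r:{0..pi}|lebesgue. f r z * \<eta> r) \<partial>\<mu>)"
proof -
  have \<eta>m: "(\<lambda>r. indicator {0..pi} r * \<eta> r) \<in> borel_measurable lebesgue"
    using \<eta> by (simp add: borel_measurable_restrict_space_iff)
  then obtain k where k: "k \<in> borel_measurable borel" "AE r in lborel. indicator {0..pi} r * \<eta> r = k r"
    using completion_ex_borel_measurable_real[OF \<eta>m] by auto
  note k = k \<eta>m
  have ae0: "AE r in lborel. r \<in> {0..pi} \<or> k r = 0"
    using k(2) by eventually_elim (metis indicator_simps(2) mult_zero_left)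
  interpret pair_sigma_finite lborel \<mu> ..
  have fb[measurable]: "(\<lambda>p. f (fst p) (snd p)) \<in> borel_measurable (lborel \<Otimes>\<^sub>M \<mu>)"
    using f measurable_cong_sets[OF sets_pair_measure_cong[of lborel borel \<mu> \<mu>] refl] by simp
  have fz: "(\<lambda>r. f r z) \<in> borel_measurable borel" if "z \<in> Q" for z
    using measurable_compose[OF measurable_Pair2'[OF that] f] by simp
  have fr: "f r \<in> borel_measurable \<mu>" for r
    using measurable_compose[OF measurable_Pair1'[of r borel \<mu>] f] by simp
  have fi: "integrable \<mu> (f r)" if "r \<in> {0..pi}" for r
    by (rule integrable_const_bound[of _ "D r"]) (use bound that fr in auto)
  have int: "integrable (lborel \<Otimes>\<^sub>M \<mu>) (case_prod (\<lambda>r z. f r z * k r))"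
  proof (rule Fubini_integrable)
    have km: "(\<lambda>p. k (fst p)) \<in> borel_measurable (lborel \<Otimes>\<^sub>M \<mu>)" by (rule measurable_compose[OF measurable_fst]) (use k in simp)
    then have "(\<lambda>p. f (fst p) (snd p) * k (fst p)) \<in> borel_measurable (lborel \<Otimes>\<^sub>M \<mu>)" by measurable
    then show "case_prod (\<lambda>r z. f r z * k r) \<in> borel_measurable (lborel \<Otimes>\<^sub>M \<mu>)" by (simp add: case_prod_beta')
    show "integrable lborel (\<lambda>r. \<integral>z. norm (case (r, z) of (r, z) \<Rightarrow> f r z * k r) \<partial>\<mu>)"
    proof (rule Bochner_Integration.integrable_bound)
      show "integrable lborel (\<lambda>r. D r * k r)" using D(2) set_lebesgue_integral_borel_version(2)[OF k D(1)] by blast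
      have "(\<lambda>p. norm (f (fst p) (snd p) * k (fst p))) \<in> borel_measurable (lborel \<Otimes>\<^sub>M \<mu>)" using km by measurable
      then have "(\<lambda>(r, z). norm (f r z * k r)) \<in> borel_measurable (lborel \<Otimes>\<^sub>M \<mu>)" by (simp add: case_prod_beta')
      then show "(\<lambda>r. \<integral>z. norm (case (r, z) of (r, z) \<Rightarrow> f r z * k r) \<partial>\<mu>) \<in> borel_measurable lborel"
        using borel_measurable_lebesgue_integral by simp
      show "AE r in lborel. norm (\<integral>z. norm (case (r, z) of (r, z) \<Rightarrow> f r z * k r) \<partial>\<mu>) \<le> norm (D r * k r)"
        using ae0
      proof eventually_elim
        case (elim r)
        show ?case
        proof (cases "r \<in> {0..pi}")
          case True
          have "(\<integral>z. \<bar>f r z\<bar> \<partial>\<mu>) \<le> (\<integral>z. D r \<partial>\<mu>)"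
            using bound[OF True] fi[OF True] by (intro integral_mono) auto
          then have "(\<integral>z. \<bar>f r z\<bar> \<partial>\<mu>) * \<bar>k r\<bar> \<le> \<bar>D r\<bar> * \<bar>k r\<bar>" by (intro mult_right_mono) (auto simp: prob_space)
          moreover have "0 \<le> (\<integral>z. \<bar>f r z\<bar> \<partial>\<mu>)" by simp
          ultimately show ?thesis by (simp add: abs_mult)
        next
          case False
          then have "k r = 0" using elim by blast
          then show ?thesis by simp
        qed
      qed
    qed
    show "AE r in lborel. integrable \<mu> (\<lambda>z. case (r, z) of (r, z) \<Rightarrow> f r z * k r)"
      using ae0 by eventually_elim (use fi in auto)
  qed
  have "(\<lambda>(r, z). f r z) \<in> borel_measurable (borel \<Otimes>\<^sub>M \<mu>)" using f by (simp add: case_prod_beta')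
  then have "(\<lambda>r. \<integral>z. f r z \<partial>\<mu>) \<in> borel_measurable borel" using borel_measurable_lebesgue_integral by simp
  then have "(LINT r:{0..pi}|lebesgue. (\<integral>z. f r z \<partial>\<mu>) * \<eta> r) = (\<integral>r. (\<integral>z. f r z \<partial>\<mu>) * k r \<partial>lborel)"
    by (rule set_lebesgue_integral_borel_version(1)[OF k])
  also have "\<dots> = (\<integral>r. (\<integral>z. f r z * k r \<partial>\<mu>) \<partial>lborel)" by simp
  also have "\<dots> = (\<integral>z. (\<integral>r. f r z * k r \<partial>lborel) \<partial>\<mu>)" by (rule Fubini_integral[OF int, symmetric])
  also have "\<dots> = (\<integral>z. (LINT r:{0..pi}|lebesgue. f r z * \<eta> r) \<partial>\<mu>)"
    by (intro Bochner_Integration.integral_cong refl set_lebesgue_integral_borel_version(1)[OF k, symmetric] fz)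
  finally show ?thesis .
qed

text \<open>The measure of the intersection of the balls of radius r about x and y, for r in
  [0, pi].\<close>

definition cap_pair :: "'a \<Rightarrow> 'a \<Rightarrow> real \<Rightarrow> real" where
  "cap_pair x y r = (\<integral>z. cap r (cc x z) * cap r (cc z y) \<partial>\<mu>)"

lemma cap_measurable_pair: "(\<lambda>p. cap (fst p) (snd p)) \<in> borel_measurable (borel \<Otimes>\<^sub>M borel)"
proof -
  have "(\<lambda>p. cos (fst p)) \<in> borel_measurable (borel \<Otimes>\<^sub>M borel :: (real \<times> real) measure)"
    by (intro measurable_compose[OF measurable_fst] borel_measurable_continuous_onI continuous_intros)
  then show ?thesis unfolding cap_def[abs_def] by measurable
qed

lemma cap_measurable [measurable (raw)]:
  "f \<in> borel_measurable M \<Longrightarrow> g \<in> borel_measurable M \<Longrightarrow> (\<lambda>p. cap (f p) (g p)) \<in> borel_measurable M"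
  using measurable_compose[OF measurable_Pair cap_measurable_pair, of f M g] by simp

lemma cc_measurable' [measurable (raw)]:
  assumes "f \<in> measurable M \<mu>" "g \<in> measurable M \<mu>" shows "(\<lambda>p. cc (f p) (g p)) \<in> borel_measurable M"
  using measurable_compose[OF measurable_Pair[OF assms] cc_measurable_pair] by simp

lemma cap_pair_measurable:
  assumes x: "x \<in> Q"
  shows "(\<lambda>p. cap_pair x (snd p) (fst p)) \<in> borel_measurable (borel \<Otimes>\<^sub>M \<mu>)"
proof -
  have "(\<lambda>(p, z). cap (fst p) (cc x z) * cap (fst p) (cc z (snd p))) \<in> borel_measurable ((borel \<Otimes>\<^sub>M \<mu>) \<Otimes>\<^sub>M \<mu>)"
    using x by measurable
  then show ?thesis unfolding cap_pair_def by (rule borel_measurable_lebesgue_integral)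
qed

lemma cap_pair_measurable':
  assumes "x \<in> Q" "y \<in> Q" shows "cap_pair x y \<in> borel_measurable borel"
  using measurable_compose[OF measurable_Pair2'[OF assms(2)] cap_pair_measurable[OF assms(1)]] by simp

lemma vol_measurable: "vol \<in> borel_measurable borel"
proof -
  have "vol r = cap_pair (Y 0) (Y 0) r" for r
    unfolding vol_def cap_pair_def E_def
    by (intro Bochner_Integration.integral_cong refl) (simp add: cap_def cc_sym[of _ "Y 0"])
  then show ?thesis using cap_pair_measurable'[OF Y_space Y_space, of 0 0] by (simp add: cong: measurable_cong)
qed

lemma vol_le_1: "vol r \<le> 1"
proof -
  have "vol r \<le> E (\<lambda>_. 1)" unfolding vol_def
    by (intro E_mono bounded_borel_cap bounded_borel_continuous continuous_intros) (simp add: cap_def)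
  then show ?thesis by (simp add: E_def prob_space)
qed

lemma integral_cap: "x \<in> Q \<Longrightarrow> (\<integral>z. cap r (cc x z) \<partial>\<mu>) = vol r" "x \<in> Q \<Longrightarrow> (\<integral>z. cap r (cc z x) \<partial>\<mu>) = vol r"
  unfolding vol_def using E_eq[OF bounded_borel_measurable[OF bounded_borel_cap]] E_eq'[OF bounded_borel_measurable[OF bounded_borel_cap]] by auto

lemma cap_pair_bounds:
  assumes "x \<in> Q" "y \<in> Q" shows "0 \<le> vol r - cap_pair x y r" "vol r - cap_pair x y r \<le> vol r" "vol r - cap_pair x y r \<le> 1 - vol r"
proof -
  note i = integrable_bounded_borel[OF bounded_borel_cap assms(1)] integrable_bounded_borel'[OF bounded_borel_cap assms(2)]
    integrable_bounded_borel2[OF bounded_borel_cap bounded_borel_cap assms]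
  have "cap_pair x y r \<le> (\<integral>z. cap r (cc x z) \<partial>\<mu>)"
    unfolding cap_pair_def using i by (intro integral_mono) (auto simp: cap_def)
  then show "0 \<le> vol r - cap_pair x y r" by (simp add: integral_cap assms)
  show "vol r - cap_pair x y r \<le> vol r" unfolding cap_pair_def by (simp add: cap_def)
  have "(\<integral>z. cap r (cc x z) + cap r (cc z y) - 1 \<partial>\<mu>) \<le> cap_pair x y r"
    unfolding cap_pair_def using i by (intro integral_mono) (auto simp: cap_def)
  then show "vol r - cap_pair x y r \<le> 1 - vol r" using i by (simp add: integral_cap assms prob_space)
qed

lemma cap_pair_le_w: "\<exists>K>0. \<forall>r\<in>{0..pi}. \<forall>x\<in>Q. \<forall>y\<in>Q. \<bar>vol r - cap_pair x y r\<bar> \<le> K * w r"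
proof -
  obtain K where K: "K > 0" "\<And>r. r \<in> {0..pi} \<Longrightarrow> vol r \<le> K * w r \<or> 1 - vol r \<le> K * w r" using vol_le_w by blast
  have "\<bar>vol r - cap_pair x y r\<bar> \<le> K * w r" if "r \<in> {0..pi}" "x \<in> Q" "y \<in> Q" for r x y
    using K(2)[OF that(1)] cap_pair_bounds[OF that(2,3), of r] by linarith
  with K(1) show ?thesis by blast
qed

lemma theta_ball_eq: "y \<in> Q \<Longrightarrow> theta_ball \<mu> \<theta> r y = {z \<in> Q. \<theta> y z < r}"
  unfolding theta_ball_def using theta_sym by auto

lemma symdiff_metric_at_eq:
  assumes x: "x \<in> Q" and y: "y \<in> Q" and r: "r \<in> {0..pi}"
  shows "symdiff_metric_at \<mu> \<theta> r x y = vol r - cap_pair x y r"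
    and "symdiff_metric_at \<mu> \<theta> r x y = (\<integral>z. \<bar>cap r (cc x z) - cap r (cc z y)\<bar> \<partial>\<mu>) / 2"
proof -
  note i = integrable_bounded_borel[OF bounded_borel_cap x] integrable_bounded_borel'[OF bounded_borel_cap y]
    integrable_bounded_borel2[OF bounded_borel_cap bounded_borel_cap x y]
  let ?B = "sym_diff (theta_ball \<mu> \<theta> r x) (theta_ball \<mu> \<theta> r y)"
  have B: "?B \<in> sets \<mu>" unfolding theta_ball_eq[OF x] theta_ball_eq[OF y] by (intro sets.Un sets.Diff ball_sets x y)
  have "measure \<mu> ?B = (\<integral>z. indicator ?B z \<partial>\<mu>)" using B by simp
  also have "\<dots> = (\<integral>z. \<bar>cap r (cc x z) - cap r (cc z y)\<bar> \<partial>\<mu>)"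
    by (intro Bochner_Integration.integral_cong refl)
       (use theta_sym[OF _ y] in \<open>simp add: cap_iff[OF r] x y indicator_def theta_ball_eq\<close>)
  finally have 1: "measure \<mu> ?B = (\<integral>z. \<bar>cap r (cc x z) - cap r (cc z y)\<bar> \<partial>\<mu>)" .
  then show "symdiff_metric_at \<mu> \<theta> r x y = (\<integral>z. \<bar>cap r (cc x z) - cap r (cc z y)\<bar> \<partial>\<mu>) / 2"
    by (simp add: symdiff_metric_at_def)
  have "(\<integral>z. \<bar>cap r (cc x z) - cap r (cc z y)\<bar> \<partial>\<mu>) = (\<integral>z. cap r (cc x z) + cap r (cc z y) - 2 * (cap r (cc x z) * cap r (cc z y)) \<partial>\<mu>)"
    by (intro Bochner_Integration.integral_cong refl) (simp add: cap_def)
  also have "\<dots> = 2 * (vol r - cap_pair x y r)" using i by (simp add: integral_cap x y cap_pair_def)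
  finally show "symdiff_metric_at \<mu> \<theta> r x y = vol r - cap_pair x y r" by (simp add: symdiff_metric_at_def 1)
qed

lemma cap_disc_cap_pair:
  assumes x: "\<And>i. i < N \<Longrightarrow> x i \<in> Q"
  shows "cap_disc N x r = (\<Sum>i<N. \<Sum>j<N. cap_pair (x i) (x j) r) - (real N * vol r)\<^sup>2"
  using cap_disc_eq[where x = x and N = N and r = r, OF x]
    integral_square_sum(1)[where x = x and N = N, OF bounded_borel_cap[of r] x] by (simp add: cap_pair_def)

lemma ball_discrepancy_eq:
  assumes x: "\<And>i. i < N \<Longrightarrow> x i \<in> Q" and r: "r \<in> {0..pi}"
  shows "ball_discrepancy \<mu> \<theta> N x r = cap_disc N x r"
  unfolding ball_discrepancy_def cap_disc_def
proof (intro Bochner_Integration.integral_cong refl arg_cong[where f = "\<lambda>u. u\<^sup>2"] arg_cong2[where f = "(-)"])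
  fix y assume y: "y \<in> Q"
  show "real N * measure \<mu> (theta_ball \<mu> \<theta> r y) = real N * vol r"
    by (simp add: theta_ball_eq[OF y] ball_measure[OF y r])
  have "(\<Sum>i<N. cap r (cc (x i) y)) = (\<Sum>i<N. if x i \<in> theta_ball \<mu> \<theta> r y then 1 else 0)"
    using x y by (intro sum.cong refl) (simp add: cap_iff[OF r] theta_ball_def)
  also have "\<dots> = real (card ({..<N} \<inter> {i. x i \<in> theta_ball \<mu> \<theta> r y}))" by (simp add: sum.If_cases)
  also have "{..<N} \<inter> {i. x i \<in> theta_ball \<mu> \<theta> r y} = {i. i < N \<and> x i \<in> theta_ball \<mu> \<theta> r y}" by auto
  finally show "real (card {i. i < N \<and> x i \<in> theta_ball \<mu> \<theta> r y}) = (\<Sum>i<N. cap r (cc (x i) y))" by simp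
qed

lemma discrepancy_eq:
  assumes "\<And>i. i < N \<Longrightarrow> x i \<in> Q"
  shows "discrepancy \<mu> \<theta> \<eta> N x = (LINT r:{0..pi}|lebesgue. cap_disc N x r * \<eta> r)"
  unfolding discrepancy_def
  by (rule set_lebesgue_integral_cong) (use ball_discrepancy_eq[where x = x and N = N, OF assms] in auto)

lemma symdiff_metric_eq:
  assumes "x \<in> Q" "y \<in> Q"
  shows "symdiff_metric \<mu> \<theta> \<eta> x y = (LINT r:{0..pi}|lebesgue. (vol r - cap_pair x y r) * \<eta> r)"
  unfolding symdiff_metric_def
  by (rule set_lebesgue_integral_cong) (use symdiff_metric_at_eq(1)[OF assms] in auto)

lemma symdiff_integrable:
  assumes \<eta>: "\<eta> \<in> weight_class d d0" and xy: "x \<in> Q" "y \<in> Q"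
  shows "set_integrable lebesgue {0..pi} (\<lambda>r. (vol r - cap_pair x y r) * \<eta> r)"
proof -
  obtain K where K: "\<forall>r\<in>{0..pi}. \<forall>x\<in>Q. \<forall>y\<in>Q. \<bar>vol r - cap_pair x y r\<bar> \<le> K * w r" using cap_pair_le_w by blast
  show ?thesis
    by (rule weight_class_integrable[OF \<eta>, of _ K])
       (use K xy in \<open>auto intro!: borel_measurable_diff vol_measurable cap_pair_measurable'\<close>)
qed

text \<open>The integrand without \<eta> is the variance of the indicator of a ball of radius
  r.\<close>

definition variance_mean :: "(real \<Rightarrow> real) \<Rightarrow> real" where
  "variance_mean \<eta> = (LINT r:{0..pi}|lebesgue. (vol r - (vol r)\<^sup>2) * \<eta> r)"

lemma variance_integrable:
  assumes \<eta>: "\<eta> \<in> weight_class d d0"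
  shows "set_integrable lebesgue {0..pi} (\<lambda>r. (vol r - (vol r)\<^sup>2) * \<eta> r)"
proof -
  obtain K where K: "K > 0" "\<And>r. r \<in> {0..pi} \<Longrightarrow> vol r \<le> K * w r \<or> 1 - vol r \<le> K * w r" using vol_le_w by blast
  show ?thesis
  proof (rule weight_class_integrable[OF \<eta>, of _ K])
    show "(\<lambda>r. vol r - (vol r)\<^sup>2) \<in> borel_measurable borel"
      by (intro borel_measurable_diff borel_measurable_power vol_measurable)
    fix r assume r: "r \<in> {0..pi}"
    have eq: "vol r - (vol r)\<^sup>2 = vol r * (1 - vol r)" by (simp add: power2_eq_square algebra_simps)
    have "vol r * (1 - vol r) \<le> vol r" "vol r * (1 - vol r) \<le> 1 - vol r" "0 \<le> vol r * (1 - vol r)"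
      using vol_nonneg[of r] vol_le_1[of r] by (auto intro: mult_left_le mult_left_le_one_le)
    then show "\<bar>vol r - (vol r)\<^sup>2\<bar> \<le> K * w r" using K(2)[OF r] unfolding eq by linarith
  qed
qed

text \<open>By Fubini the mean of the intersection measure over one centre is (vol r)^2, whatever
  the other centre is.\<close>

lemma average_symdiff:
  assumes \<eta>: "\<eta> \<in> weight_class d d0"
  shows "average_distance \<mu> (symdiff_metric \<mu> \<theta> \<eta>) = variance_mean \<eta>"
proof -
  obtain K where K: "K > 0" "\<forall>r\<in>{0..pi}. \<forall>x\<in>Q. \<forall>y\<in>Q. \<bar>vol r - cap_pair x y r\<bar> \<le> K * w r" using cap_pair_le_w by blast
  have "(\<integral>y. symdiff_metric \<mu> \<theta> \<eta> x y \<partial>\<mu>) = variance_mean \<eta>" if x: "x \<in> Q" for x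
  proof -
    have "(\<integral>y. symdiff_metric \<mu> \<theta> \<eta> x y \<partial>\<mu>) = (\<integral>y. (LINT r:{0..pi}|lebesgue. (vol r - cap_pair x y r) * \<eta> r) \<partial>\<mu>)"
      by (intro Bochner_Integration.integral_cong refl symdiff_metric_eq x)
    also have "\<dots> = (LINT r:{0..pi}|lebesgue. (\<integral>y. vol r - cap_pair x y r \<partial>\<mu>) * \<eta> r)"
    proof (rule fubini_weight[symmetric])
      show "(\<lambda>p. vol (fst p) - cap_pair x (snd p) (fst p)) \<in> borel_measurable (borel \<Otimes>\<^sub>M \<mu>)"
        by (intro borel_measurable_diff cap_pair_measurable x measurable_compose[OF measurable_fst vol_measurable])
      show "\<bar>vol r - cap_pair x y r\<bar> \<le> K * w r" if "r \<in> {0..pi}" "y \<in> Q" for r y using K(2) x that by blast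
      show "(\<lambda>r. K * w r) \<in> borel_measurable borel" by (intro borel_measurable_continuous_onI continuous_intros)
      show "set_integrable lebesgue {0..pi} (\<lambda>r. K * w r * \<eta> r)"
        using K(1) w_nonneg
        by (intro weight_class_integrable[OF \<eta>, of _ K] borel_measurable_continuous_onI continuous_intros) (auto simp: abs_mult)
      show "\<eta> \<in> borel_measurable (lebesgue_on {0..pi})" using \<eta> by (simp add: weight_class_def)
    qed
    also have "\<dots> = variance_mean \<eta>" unfolding variance_mean_def
    proof (rule set_lebesgue_integral_cong)
      show "\<forall>r. r \<in> {0..pi} \<longrightarrow> (\<integral>y. vol r - cap_pair x y r \<partial>\<mu>) * \<eta> r = (vol r - (vol r)\<^sup>2) * \<eta> r"
      proof (intro allI impI)
        fix r
        note prob_Q = prob_space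
        interpret pair_prob_space \<mu> \<mu> ..
        have int: "integrable (\<mu> \<Otimes>\<^sub>M \<mu>) (case_prod (\<lambda>z y. cap r (cc x z) * cap r (cc z y)))"
        proof (rule integrable_const_bound[of _ 1])
          show "AE p in \<mu> \<Otimes>\<^sub>M \<mu>. norm (case p of (z, y) \<Rightarrow> cap r (cc x z) * cap r (cc z y)) \<le> 1"
            by (rule AE_I2) (auto simp: cap_def)
          show "(\<lambda>(z, y). cap r (cc x z) * cap r (cc z y)) \<in> borel_measurable (\<mu> \<Otimes>\<^sub>M \<mu>)" using x by measurable
        qed
        have "(\<integral>y. cap_pair x y r \<partial>\<mu>) = (\<integral>z. (\<integral>y. cap r (cc x z) * cap r (cc z y) \<partial>\<mu>) \<partial>\<mu>)"
          unfolding cap_pair_def by (rule Fubini_integral[OF int])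
        also have "\<dots> = (\<integral>z. cap r (cc x z) * vol r \<partial>\<mu>)"
          by (intro Bochner_Integration.integral_cong refl) (simp add: integral_cap)
        also have "\<dots> = (vol r)\<^sup>2" by (simp add: integral_cap x power2_eq_square)
        finally have "(\<integral>y. cap_pair x y r \<partial>\<mu>) = (vol r)\<^sup>2" .
        moreover have "integrable \<mu> (\<lambda>y. cap_pair x y r)"
          unfolding cap_pair_def using integrable_snd[OF int] by simp
        ultimately show "(\<integral>y. vol r - cap_pair x y r \<partial>\<mu>) * \<eta> r = (vol r - (vol r)\<^sup>2) * \<eta> r" by (simp add: prob_Q)
      qed
    qed simp
    finally show ?thesis .
  qed
  then have "average_distance \<mu> (symdiff_metric \<mu> \<theta> \<eta>) = (\<integral>x. variance_mean \<eta> \<partial>\<mu>)"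
    unfolding average_distance_def by (intro Bochner_Integration.integral_cong refl)
  then show ?thesis by (simp add: prob_space)
qed

text \<open>An identity already for each fixed r: the sum of \<open>cap_pair\<close> over all pairs
  occurs in the discrepancy and, with the opposite sign, in the sum of distances, and what is left
  is N^2 times the variance. Integrability of the separate terms against \<eta> permits integrating
  it.\<close>

theorem stolarsky:
  assumes \<eta>: "\<eta> \<in> weight_class d d0" and x: "\<And>i. i < N \<Longrightarrow> x i \<in> Q"
  shows "sum_of_distances (symdiff_metric \<mu> \<theta> \<eta>) N x =
     average_distance \<mu> (symdiff_metric \<mu> \<theta> \<eta>) * (real N)\<^sup>2 - discrepancy \<mu> \<theta> \<eta> N x"
    and "set_integrable lebesgue {0..pi} (\<lambda>r. cap_disc N x r * \<eta> r)"
proof -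
  have disc: "cap_disc N x r * \<eta> r = (real N)\<^sup>2 * ((vol r - (vol r)\<^sup>2) * \<eta> r)
     - (\<Sum>i<N. \<Sum>j<N. (vol r - cap_pair (x i) (x j) r) * \<eta> r)" for r
  proof -
    have "(\<Sum>i<N. \<Sum>j<N. (vol r - cap_pair (x i) (x j) r) * \<eta> r)
       = ((real N)\<^sup>2 * vol r - (\<Sum>i<N. \<Sum>j<N. cap_pair (x i) (x j) r)) * \<eta> r"
      by (simp add: sum_subtractf power2_eq_square mult.assoc flip: sum_distrib_right)
    moreover have "cap_disc N x r = (\<Sum>i<N. \<Sum>j<N. cap_pair (x i) (x j) r) - (real N * vol r)\<^sup>2"
      by (rule cap_disc_cap_pair[where x = x and N = N, OF x])
    moreover have "(C - (n * v)\<^sup>2) * h = n\<^sup>2 * ((v - v\<^sup>2) * h) - (n\<^sup>2 * v - C) * h" for C n v h :: real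
      by (simp add: power_mult_distrib algebra_simps)
    ultimately show ?thesis by (simp only:)
  qed
  have i1: "set_integrable lebesgue {0..pi} (\<lambda>r. (real N)\<^sup>2 * ((vol r - (vol r)\<^sup>2) * \<eta> r))"
    by (intro set_integrable_mult_right impI variance_integrable \<eta>)
  have i2: "set_integrable lebesgue {0..pi} (\<lambda>r. (vol r - cap_pair (x i) (x j) r) * \<eta> r)" if "i < N" "j < N" for i j
    by (intro symdiff_integrable \<eta> x that)
  have i3: "set_integrable lebesgue {0..pi} (\<lambda>r. \<Sum>j<N. (vol r - cap_pair (x i) (x j) r) * \<eta> r)" if "i < N" for i
    by (rule set_lebesgue_sum(2)) (use i2 that in simp)
  have i4: "set_integrable lebesgue {0..pi} (\<lambda>r. \<Sum>i<N. \<Sum>j<N. (vol r - cap_pair (x i) (x j) r) * \<eta> r)"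
    by (rule set_lebesgue_sum(2)) (use i3 in simp)
  show "set_integrable lebesgue {0..pi} (\<lambda>r. cap_disc N x r * \<eta> r)"
    unfolding disc by (intro set_integral_diff i1 i4)
  have "discrepancy \<mu> \<theta> \<eta> N x = (LINT r:{0..pi}|lebesgue. cap_disc N x r * \<eta> r)"
    by (rule discrepancy_eq) (rule x)
  also have "\<dots> = (LINT r:{0..pi}|lebesgue. (real N)\<^sup>2 * ((vol r - (vol r)\<^sup>2) * \<eta> r)) -
     (LINT r:{0..pi}|lebesgue. (\<Sum>i<N. \<Sum>j<N. (vol r - cap_pair (x i) (x j) r) * \<eta> r))"
    unfolding disc by (rule set_integral_diff(2)[OF i1 i4])
  also have "(LINT r:{0..pi}|lebesgue. (\<Sum>i<N. \<Sum>j<N. (vol r - cap_pair (x i) (x j) r) * \<eta> r)) =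
     (\<Sum>i<N. \<Sum>j<N. LINT r:{0..pi}|lebesgue. (vol r - cap_pair (x i) (x j) r) * \<eta> r)"
    by (subst set_lebesgue_sum(1), use i3 in simp, intro sum.cong refl set_lebesgue_sum(1)) (use i2 in simp)
  also have "\<dots> = sum_of_distances (symdiff_metric \<mu> \<theta> \<eta>) N x"
    unfolding sum_of_distances_def by (intro sum.cong refl) (simp add: symdiff_metric_eq x)
  finally show "sum_of_distances (symdiff_metric \<mu> \<theta> \<eta>) N x =
     average_distance \<mu> (symdiff_metric \<mu> \<theta> \<eta>) * (real N)\<^sup>2 - discrepancy \<mu> \<theta> \<eta> N x"
    by (simp add: average_symdiff[OF \<eta>] variance_mean_def mult.commute)
qed

text \<open>The two step functions of r differ exactly between arccos of the larger and arccos of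
  the smaller argument, and sin integrates over this interval to the difference of the
  cosines.\<close>

lemma integral_abs_cap_diff:
  assumes "a \<in> {-1..1}" "b \<in> {-1..1}"
  shows "(LINT r:{0..pi}|lebesgue. \<bar>cap r a - cap r b\<bar> * sin r) = \<bar>a - b\<bar>"
proof -
  have *: "(LINT r:{0..pi}|lebesgue. \<bar>cap r a - cap r b\<bar> * sin r) = b - a" if ab: "a \<le> b" "a \<in> {-1..1}" "b \<in> {-1..1}" for a b
  proof -
    define u v where "u = arccos b" and "v = arccos a"
    have uv: "0 \<le> u" "u \<le> v" "v \<le> pi" "cos u = b" "cos v = a"
      using ab by (auto simp: u_def v_def arccos_lbound arccos_ubound arccos_le_arccos)
    have "((\<lambda>r. sin r) has_integral (- cos v) - (- cos u)) {u..v}"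
      by (intro fundamental_theorem_of_calculus uv)
         (auto intro!: derivative_eq_intros simp flip: has_real_derivative_iff_has_vector_derivative)
    then have "integral {u..v} sin = b - a" using uv by (simp add: integral_unique)
    moreover have "(LINT r:{u..v}|lebesgue. sin r) = integral {u..v} sin"
      by (intro set_lebesgue_integral_eq_integral(2) absolutely_integrable_continuous_real continuous_intros)
    moreover have "(LINT r:{0..pi}|lebesgue. \<bar>cap r a - cap r b\<bar> * sin r) = (LINT r:{u..v}|lebesgue. sin r)"
      unfolding set_lebesgue_integral_def
    proof (rule integral_cong_AE)
      have "(\<lambda>r. \<bar>cap r a - cap r b\<bar> * sin r) \<in> borel_measurable borel"
        by (intro borel_measurable_times borel_measurable_abs borel_measurable_diff cap_measurable
          borel_measurable_continuous_onI continuous_intros)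
      then have "(\<lambda>r. indicator {0..pi} r *\<^sub>R (\<bar>cap r a - cap r b\<bar> * sin r)) \<in> borel_measurable borel" by simp
      then show "(\<lambda>r. indicator {0..pi} r *\<^sub>R (\<bar>cap r a - cap r b\<bar> * sin r)) \<in> borel_measurable lebesgue"
        by (simp add: measurable_completion)
      have "(\<lambda>r. indicator {u..v} r *\<^sub>R sin r) \<in> borel_measurable (borel :: real measure)"
        by (intro borel_measurable_scaleR borel_measurable_indicator borel_measurable_continuous_onI continuous_intros) simp
      then show "(\<lambda>r. indicator {u..v} r *\<^sub>R sin r) \<in> borel_measurable lebesgue"
        by (simp add: measurable_completion)
      have "AE r in lebesgue. r \<notin> {u, v}" by (intro AE_not_in) (simp add: negligible_iff_null_sets[symmetric])
      then show "AE r in lebesgue. indicator {0..pi} r *\<^sub>R (\<bar>cap r a - cap r b\<bar> * sin r) = indicator {u..v} r *\<^sub>R sin r"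
      proof eventually_elim
        case (elim r)
        show ?case
        proof (cases "r \<in> {0..pi}")
          case True
          have "cos r < b \<longleftrightarrow> u < r" "cos r < a \<longleftrightarrow> v < r"
            using cos_mono_less_eq[of r u] cos_mono_less_eq[of r v] True uv by auto
          then show ?thesis using True elim uv by (auto simp: cap_def indicator_def)
        qed (use uv in \<open>auto simp: indicator_def\<close>)
      qed
    qed
    ultimately show ?thesis by simp
  qed
  show ?thesis
  proof (cases "a \<le> b")
    case False
    then have "(LINT r:{0..pi}|lebesgue. \<bar>cap r b - cap r a\<bar> * sin r) = a - b" using assms by (intro *) auto
    then show ?thesis using False by (simp add: abs_minus_commute)
  qed (use * assms in simp)
qed

text \<open>The value, by \<open>symdiff_sin\<close>, of the metric with weight sin at two points of
  maximal distance pi.\<close>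

definition chord_factor :: real where "chord_factor = (\<integral>z. \<bar>\<alpha> * (R \<bullet> z)\<bar> \<partial>\<mu>)"

text \<open>If it were 0, R . z would vanish almost everywhere. Taking for p in
  \<open>average_R\<close> the linear factor l of its right-hand side then gives E (l^2) = 0,
  although l(1) = 1.\<close>

lemma chord_factor_pos: "0 < chord_factor"
proof (rule ccontr)
  assume "\<not> 0 < chord_factor"
  moreover have "0 \<le> chord_factor" by (simp add: chord_factor_def)
  ultimately have "chord_factor = 0" by simp
  moreover have "integrable \<mu> (\<lambda>z. \<bar>\<alpha> * (R \<bullet> z)\<bar>)" by (intro integrable_\<mu>_continuous continuous_intros)
  ultimately have ae: "AE z in \<mu>. \<alpha> * (R \<bullet> z) = 0"
    by (simp add: chord_factor_def integral_nonneg_eq_0_iff_AE)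
  define l where "l = [:1 / 2 - real d0 / (2 * real d), 1 / 2 + real d0 / (2 * real d):]"
  have l: "poly l c = (1 + c) / 2 - (1 - c) * real d0 / (2 * real d)" for c
    using d_pos by (simp add: l_def field_simps)
  have Y0: "cc (Y 0) z = \<alpha> * ((P + R) \<bullet> z) + \<beta>" for z by (simp add: cc_def Y_def)
  have "E (poly (l * l)) = (\<integral>z. poly l (cc (Y 0) z) * (\<alpha> * (R \<bullet> z)) \<partial>\<mu>)"
    unfolding E_def Y0 average_R by (simp add: l)
  also have "\<dots> = (\<integral>z. 0 \<partial>\<mu>)"
  proof (rule integral_cong_AE)
    show "(\<lambda>z. poly l (cc (Y 0) z) * (\<alpha> * (R \<bullet> z))) \<in> borel_measurable \<mu>"
      unfolding cc_def by (intro measurable_\<mu>_continuous continuous_intros)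
    show "AE z in \<mu>. poly l (cc (Y 0) z) * (\<alpha> * (R \<bullet> z)) = 0" using ae by eventually_elim (simp only: mult_zero_right)
  qed simp
  finally have "l = 0" by (intro E_poly_square_0) simp
  then have "poly l 1 = 0" by simp
  then show False by (simp add: l)
qed

text \<open>For the weight sin the integral over r is explicit and leaves the mean of |cc x z - cc z
  y| / 2. Placing the pair symmetrically on the circle separates the variables: the difference
  becomes 2 sin (\<theta>/2) times a function of z alone.\<close>

lemma symdiff_sin:
  assumes x: "x \<in> Q" and y: "y \<in> Q"
  shows "symdiff_metric \<mu> \<theta> sin x y = chord_factor * chordal_metric \<theta> x y"
proof -
  have "symdiff_metric \<mu> \<theta> sin x y = (LINT r:{0..pi}|lebesgue. (\<integral>z. \<bar>cap r (cc x z) - cap r (cc z y)\<bar> / 2 \<partial>\<mu>) * sin r)"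
    unfolding symdiff_metric_def
    by (rule set_lebesgue_integral_cong) (use symdiff_metric_at_eq(2)[OF x y] in auto)
  also have "\<dots> = (\<integral>z. (LINT r:{0..pi}|lebesgue. \<bar>cap r (cc x z) - cap r (cc z y)\<bar> / 2 * sin r) \<partial>\<mu>)"
  proof (rule fubini_weight[where D = "\<lambda>_. 1"])
    show "(\<lambda>p. \<bar>cap (fst p) (cc x (snd p)) - cap (fst p) (cc (snd p) y)\<bar> / 2) \<in> borel_measurable (borel \<Otimes>\<^sub>M \<mu>)"
      using x y by measurable
    show "\<bar>\<bar>cap r (cc x z) - cap r (cc z y)\<bar> / 2\<bar> \<le> 1" for r z by (simp add: cap_def)
    show "set_integrable lebesgue {0..pi} (\<lambda>r. 1 * sin r)"
      using absolutely_integrable_continuous_real[OF continuous_on_sin[OF continuous_on_id], of 0 pi] by simp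
    show "sin \<in> borel_measurable (lebesgue_on {0..pi})"
      by (intro continuous_imp_measurable_on_sets_lebesgue continuous_intros) simp
  qed simp
  also have "\<dots> = (\<integral>z. \<bar>cc x z - cc z y\<bar> / 2 \<partial>\<mu>)"
  proof (intro Bochner_Integration.integral_cong refl)
    fix z assume z: "z \<in> Q"
    have "(LINT r:{0..pi}|lebesgue. \<bar>cap r (cc x z) - cap r (cc z y)\<bar> / 2 * sin r)
      = (LINT r:{0..pi}|lebesgue. \<bar>cap r (cc x z) - cap r (cc z y)\<bar> * sin r) / 2"
      by (simp flip: set_integral_divide_zero)
    then show "(LINT r:{0..pi}|lebesgue. \<bar>cap r (cc x z) - cap r (cc z y)\<bar> / 2 * sin r) = \<bar>cc x z - cc z y\<bar> / 2"
      using integral_abs_cap_diff[OF cc_range[OF x z] cc_range[OF z y]] by simp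
  qed
  also have "\<dots> = (\<integral>z. \<bar>cc (Y 0) z - cc z (Y (\<theta> x y))\<bar> / 2 \<partial>\<mu>)"
    by (rule integral_two_point[OF _ x y]) (intro borel_measurable_continuous_onI continuous_intros ballI, simp)
  also have "\<dots> = chord_factor * sin (\<theta> x y / 2)"
  proof -
    \<comment> \<open>The points \<open>Y s\<close> and \<open>Y (pi - s)\<close> have the distance
      of x and y and lie symmetrically about \<open>Y (pi / 2)\<close>, so the components along P
      and S cancel in their difference.\<close>
    define s where "s = (pi - \<theta> x y) / 2"
    have th: "0 \<le> \<theta> x y" "\<theta> x y \<le> pi" using theta_range[OF x y] by auto
    have "s - (pi - s) = - \<theta> x y" by (simp add: s_def field_simps)
    then have "cc (Y s) (Y (pi - s)) = cos (\<theta> x y)" by (simp add: cc_Y)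
    then have "\<theta> (Y s) (Y (pi - s)) = \<theta> x y"
      by (simp add: theta_eq[OF Y_space Y_space] arccos_cos th)
    then have "(\<integral>z. \<bar>cc (Y 0) z - cc z (Y (\<theta> x y))\<bar> / 2 \<partial>\<mu>) = (\<integral>z. \<bar>cc (Y s) z - cc z (Y (pi - s))\<bar> / 2 \<partial>\<mu>)"
      using integral_two_point[of "\<lambda>a b. \<bar>a - b\<bar> / 2", OF _ Y_space Y_space, of s "pi - s"]
      by (simp add: borel_measurable_continuous_onI continuous_intros)
    also have "\<dots> = (\<integral>z. sin (\<theta> x y / 2) * \<bar>\<alpha> * (R \<bullet> z)\<bar> \<partial>\<mu>)"
    proof (intro Bochner_Integration.integral_cong refl)
      fix z
      have cs: "cos s = sin (\<theta> x y / 2)" by (simp add: s_def cos_diff diff_divide_distrib)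
      have "cc (Y s) z - cc z (Y (pi - s)) = 2 * (sin (\<theta> x y / 2) * (\<alpha> * (R \<bullet> z)))"
        by (simp add: cc_def Y_def inner_add inner_commute cs algebra_simps)
      moreover have "0 \<le> sin (\<theta> x y / 2)" using th by (intro sin_ge_zero) auto
      ultimately show "\<bar>cc (Y s) z - cc z (Y (pi - s))\<bar> / 2 = sin (\<theta> x y / 2) * \<bar>\<alpha> * (R \<bullet> z)\<bar>" by (simp add: abs_mult)
    qed
    finally show ?thesis by (simp add: chord_factor_def)
  qed
  finally show ?thesis by (simp add: chordal_metric_def)
qed

section \<open>Designs and the final estimates\<close>

lemma sin_weight_class: "sin \<in> weight_class d d0"
proof -
  have "set_integrable lebesgue {0..pi} (\<lambda>r. sin (r / 2) ^ (d - 1) * cos (r / 2) ^ (d0 - 1) * sin r)"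
    by (intro absolutely_integrable_continuous_real continuous_intros) auto
  moreover have "sin \<in> borel_measurable (lebesgue_on {0..pi})"
    by (intro continuous_imp_measurable_on_sets_lebesgue continuous_intros) simp
  ultimately show ?thesis by (auto simp: weight_class_def intro: sin_ge_zero)
qed

lemma sin_nonzero: "\<not> (AE r in lebesgue. r \<in> {0..pi} \<longrightarrow> sin r = 0)"
proof
  assume "AE r in lebesgue. r \<in> {0..pi} \<longrightarrow> sin r = 0"
  then have "AE r in lebesgue. r \<notin> {0<..<pi}"
    by eventually_elim (use sin_gt_zero in force)
  then have "{0<..<pi} \<in> null_sets lebesgue" by (subst AE_iff_null_sets) auto
  then have "measure lebesgue {0<..<pi} = 0" by (simp add: null_sets_def measure_def)
  then show False using pi_gt_zero by (simp add: content_real_if)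
qed

text \<open>As a function of the second point, \<phi> k of \<open>cc\<close> is a polynomial of
  total degree at most k in the ambient coordinates, and its mean is 0 for positive k. So the inner
  sum vanishes for each fixed first point.\<close>

lemma design_pair_sum:
  assumes d: "design \<mu> t N x" and k: "1 \<le> k" "k \<le> t" shows "pair_sum N x k = 0"
proof -
  have "(\<Sum>j<N. poly (\<phi> k) (cc (x i) (x j))) = 0" if i: "i < N" for i
  proof -
    have xi: "x i \<in> Q" using d i by (simp add: design_def)
    have "polynomial_of_degree_le t (\<lambda>z. poly (\<phi> k) (\<beta> + (\<alpha> *\<^sub>R x i) \<bullet> z))"
      using k(2) by (intro polynomial_of_degree_le_mono[OF polynomial_of_degree_le_poly]) (simp add: degree_\<phi>)
    moreover have "(\<lambda>z. poly (\<phi> k) (\<beta> + (\<alpha> *\<^sub>R x i) \<bullet> z)) = (\<lambda>z. poly (\<phi> k) (cc (x i) z))"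
      by (simp add: cc_def add.commute)
    ultimately have p: "polynomial_of_degree_le t (\<lambda>z. poly (\<phi> k) (cc (x i) z))" by (simp only:)
    have "\<forall>F. polynomial_of_degree_le t F \<longrightarrow> (\<Sum>j<N. F (x j)) = real N * (\<integral>y. F y \<partial>\<mu>)"
      using d unfolding design_def by (rule conjunct2)
    from this[rule_format, OF p]
    have "(\<Sum>j<N. poly (\<phi> k) (cc (x i) (x j))) = real N * (\<integral>z. poly (\<phi> k) (cc (x i) z) \<partial>\<mu>)" .
    also have "(\<integral>z. poly (\<phi> k) (cc (x i) z) \<partial>\<mu>) = E (poly (\<phi> k))"
      by (rule E_eq[OF bounded_borel_measurable[OF bounded_borel_poly] xi])
    also have "\<dots> = 0" using E_lower[of 1 k] k(1) by simp
    finally show ?thesis by simp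
  qed
  then show ?thesis by (simp add: pair_sum_def)
qed

text \<open>From N <= \<open>cplus\<close> t^d and L >= t the radius a / L is at most a constant
  times N^(-1/d), the scale on which either condition bounds the number of points in a ball.\<close>

lemma admissible_partial_sum:
  assumes c: "0 < c'" "0 < c0" "0 < cplus"
  shows "\<exists>B>0. \<forall>N x t. 2 \<le> N \<longrightarrow> admissible \<mu> \<theta> d cminus cplus c' c0 N x \<longrightarrow> (\<forall>i<N. x i \<in> Q) \<longrightarrow>
     real N \<le> cplus * real t ^ d \<longrightarrow> (\<forall>L\<ge>t. (\<Sum>k=1..L. pair_sum N x k / kap k) \<le> B * real N * real L ^ d)"
proof -
  obtain a C where a: "0 < a" and C: "0 < C" and up: "\<And>N x L M. 1 \<le> L \<Longrightarrow> \<forall>i<N. x i \<in> Q \<Longrightarrow>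
      \<forall>y\<in>Q. real (card {i. i < N \<and> \<theta> y (x i) < a / real L}) \<le> M \<Longrightarrow>
      (\<Sum>k=1..L. pair_sum N x k / kap k) \<le> C * M * real N * real L ^ d"
    using partial_sum_upper by meson
  define \<kappa> where "\<kappa> = a * cplus powr (1 / real d)"
  have \<kappa>: "0 < \<kappa>" using a c by (simp add: \<kappa>_def)
  obtain M1 where M1: "0 < M1" "\<And>N x s y. 2 \<le> N \<Longrightarrow> \<forall>i<N. x i \<in> Q \<Longrightarrow> well_separated \<theta> d c' N x \<Longrightarrow>
    0 \<le> s \<Longrightarrow> s \<le> \<kappa> * real N powr (- 1 / real d) \<Longrightarrow> y \<in> Q \<Longrightarrow> real (card {i. i < N \<and> \<theta> y (x i) < s}) \<le> M1"
    using multiplicity_separated[OF c(1) \<kappa>] by meson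
  obtain M2 where M2: "0 < M2" "\<And>N x s y. 2 \<le> N \<Longrightarrow> \<forall>i<N. x i \<in> Q \<Longrightarrow> subordinated_small \<mu> \<theta> d c0 N x \<Longrightarrow>
    0 \<le> s \<Longrightarrow> s \<le> \<kappa> * real N powr (- 1 / real d) \<Longrightarrow> y \<in> Q \<Longrightarrow> real (card {i. i < N \<and> \<theta> y (x i) < s}) \<le> M2"
    using multiplicity_subordinated[OF c(2) \<kappa>] by meson
  have "(\<Sum>k=1..L. pair_sum N x k / kap k) \<le> C * max M1 M2 * real N * real L ^ d"
    if N: "2 \<le> N" and adm: "admissible \<mu> \<theta> d cminus cplus c' c0 N x" and x: "\<forall>i<N. x i \<in> Q"
      and t: "real N \<le> cplus * real t ^ d" and L: "t \<le> L" for N x t L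
  proof (rule up)
    have "0 < cplus * real t ^ d" using t N by linarith
    then have t0: "0 < t" using c(3) d_pos by (auto simp: zero_less_mult_iff intro: Nat.gr0I)
    then show L1: "1 \<le> L" using L by simp
    show "\<forall>i<N. x i \<in> Q" by fact
    have "real N powr (1 / real d) \<le> (cplus * real t ^ d) powr (1 / real d)" using t by (intro powr_mono2) auto
    also have "\<dots> = cplus powr (1 / real d) * real t"
      using c(3) t0 d_pos by (simp add: powr_mult powr_powr flip: powr_realpow)
    also have "\<dots> \<le> cplus powr (1 / real d) * real L" using L by (intro mult_left_mono) auto
    finally have u: "real N powr (1 / real d) \<le> cplus powr (1 / real d) * real L" .
    have u0: "0 < real N powr (1 / real d)" using N by simp
    have "a / real L \<le> \<kappa> / real N powr (1 / real d)"
      using u u0 L1 a by (simp add: \<kappa>_def field_simps)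
    then have s: "a / real L \<le> \<kappa> * real N powr (- 1 / real d)" by (simp add: powr_minus divide_inverse)
    show "\<forall>y\<in>Q. real (card {i. i < N \<and> \<theta> y (x i) < a / real L}) \<le> max M1 M2"
    proof
      fix y assume y: "y \<in> Q"
      have s0: "0 \<le> a / real L" using a by simp
      from adm consider "well_separated \<theta> d c' N x" | "subordinated_small \<mu> \<theta> d c0 N x" by (auto simp: admissible_def)
      then show "real (card {i. i < N \<and> \<theta> y (x i) < a / real L}) \<le> max M1 M2"
      proof cases
        case 1
        then show ?thesis using M1(2)[OF N x 1 s0 s y] by simp
      next
        case 2
        then show ?thesis using M2(2)[OF N x 2 s0 s y] by simp
      qed
    qed
  qed
  then show ?thesis using C M1(1) by (intro exI[of _ "C * max M1 M2"] conjI allI impI) auto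
qed

lemma cap_disc_upper:
  assumes c: "0 < c'" "0 < c0" "0 < cplus"
  shows "\<exists>B>0. \<exists>k0\<ge>1. \<forall>N x t. 2 \<le> N \<longrightarrow> admissible \<mu> \<theta> d cminus cplus c' c0 N x \<longrightarrow> design \<mu> t N x \<longrightarrow>
     real N \<le> cplus * real t ^ d \<longrightarrow> k0 \<le> t \<longrightarrow> (\<forall>r\<in>{0..pi}. cap_disc N x r \<le> B * w r * real N / real t)"
proof -
  obtain B where B: "B > 0" and part: "\<And>N x t L. 2 \<le> N \<Longrightarrow> admissible \<mu> \<theta> d cminus cplus c' c0 N x \<Longrightarrow> \<forall>i<N. x i \<in> Q \<Longrightarrow>
     real N \<le> cplus * real t ^ d \<Longrightarrow> t \<le> L \<Longrightarrow> (\<Sum>k=1..L. pair_sum N x k / kap k) \<le> B * real N * real L ^ d"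
    using admissible_partial_sum[OF c] by meson
  obtain C k0 where C: "C > 0" and k0: "1 \<le> k0"
    and f: "\<And>k r. k0 \<le> k \<Longrightarrow> r \<in> {0..pi} \<Longrightarrow> (fc (cap r) k)\<^sup>2 \<le> C * w r / real k ^ (d + 1)"
    using fc_cap_upper by meson
  have "cap_disc N x r \<le> C * B * (real d + 2) * w r * real N / real t"
    if N: "2 \<le> N" and adm: "admissible \<mu> \<theta> d cminus cplus c' c0 N x" and des: "design \<mu> t N x"
     and t: "real N \<le> cplus * real t ^ d" "k0 \<le> t" and r: "r \<in> {0..pi}" for N x t r
  proof -
    have x: "\<And>i. i < N \<Longrightarrow> x i \<in> Q" using des by (simp add: design_def)
    let ?g = "\<lambda>k. pair_sum N x k / kap k"
    have g: "0 \<le> ?g k" for k using pair_sum_nonneg[where x = x and N = N, OF x, of k] kap_pos[of k] by simp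
    have g0: "?g k = 0" if "1 \<le> k" "k \<le> t" for k using design_pair_sum[OF des that] by simp
    have wr: "0 \<le> w r" by (rule w_nonneg[OF r])
    have rhs: "0 \<le> C * B * (real d + 2) * w r * real N / real t" using C B wr by simp
    have fin: "(\<Sum>k=1..n. (fc (cap r) k)\<^sup>2 / kap k * pair_sum N x k) \<le> C * B * (real d + 2) * w r * real N / real t" for n
    proof (cases "t \<le> n")
      case True
      have "(\<Sum>k=1..n. (fc (cap r) k)\<^sup>2 / kap k * pair_sum N x k) = (\<Sum>k=1..n. (fc (cap r) k)\<^sup>2 * ?g k)"
        by simp
      also have "\<dots> = (\<Sum>k=t+1..n. (fc (cap r) k)\<^sup>2 * ?g k)"
      proof (rule sum.mono_neutral_right)
        show "\<forall>k\<in>{1..n} - {t+1..n}. (fc (cap r) k)\<^sup>2 * ?g k = 0"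
        proof
          fix k assume "k \<in> {1..n} - {t+1..n}"
          then have "1 \<le> k" "k \<le> t" by auto
          then show "(fc (cap r) k)\<^sup>2 * ?g k = 0" by (simp only: g0 mult_zero_right)
        qed
      qed auto
      also have "\<dots> \<le> (\<Sum>k=t+1..n. C * w r * (?g k / real k ^ (d + 1)))"
      proof (rule sum_mono)
        fix k assume "k \<in> {t+1..n}"
        then have "(fc (cap r) k)\<^sup>2 * ?g k \<le> C * w r / real k ^ (d + 1) * ?g k"
          using t(2) by (intro mult_right_mono f r g) auto
        then show "(fc (cap r) k)\<^sup>2 * ?g k \<le> C * w r * (?g k / real k ^ (d + 1))" by (simp add: mult_ac)
      qed
      also have "\<dots> = C * w r * (\<Sum>k=t+1..n. ?g k / real k ^ (d + 1))" by (simp only: sum_distrib_left)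
      also have "\<dots> \<le> C * w r * (B * real N * (real d + 2) / real t)"
        using part[OF N adm _ t(1)] x g t(2) k0 True C wr by (intro mult_left_mono tail_sum_bound) auto
      finally show ?thesis by (simp add: mult_ac)
    next
      case False
      have "(\<Sum>k=1..n. (fc (cap r) k)\<^sup>2 / kap k * pair_sum N x k) = 0"
        using False design_pair_sum[OF des] by (intro sum.neutral) auto
      then show ?thesis using rhs by simp
    qed
    \<comment> \<open>The truncation degree depends on e, whereas the bound on the truncated sums is
      the same for all n; hence e may tend to 0.\<close>
    show ?thesis
    proof (rule field_le_epsilon)
      fix e :: real assume e: "0 < e"
      obtain n where "cap_disc N x r \<le> (\<Sum>k=1..n. (fc (cap r) k)\<^sup>2 / kap k * pair_sum N x k) + e"
        using cap_disc_parseval[where x = x and N = N, OF x e] by blast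
      then show "cap_disc N x r \<le> C * B * (real d + 2) * w r * real N / real t + e" using fin[of n] by linarith
    qed
  qed
  then show ?thesis using C B k0 by (intro exI[of _ "C * B * (real d + 2)"] conjI exI[of _ k0]) auto
qed

theorem discrepancy_bounds:
  assumes \<eta>: "\<eta> \<in> weight_class d d0" and nz: "\<not> (AE r in lebesgue. r \<in> {0..pi} \<longrightarrow> \<eta> r = 0)"
    and c: "0 < c'" "0 < c0" "0 < cplus"
  shows "\<exists>c>0. \<exists>C>0. \<forall>\<^sub>F N in sequentially. \<forall>x. admissible \<mu> \<theta> d cminus cplus c' c0 N x \<longrightarrow>
        c * real N powr (1 - 1 / real d) < discrepancy \<mu> \<theta> \<eta> N x \<and>
        discrepancy \<mu> \<theta> \<eta> N x < C * real N powr (1 - 1 / real d)"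
proof -
  have \<eta>0: "\<And>r. r \<in> {0..pi} \<Longrightarrow> 0 \<le> \<eta> r" using \<eta> by (simp add: weight_class_def)
  have w\<eta>: "set_integrable lebesgue {0..pi} (\<lambda>r. w r * \<eta> r)"
    using w_nonneg by (intro weight_class_integrable[OF \<eta>, of _ 1] borel_measurable_continuous_onI continuous_intros) auto
  obtain B k0 where B: "B > 0" and k0: "1 \<le> k0"
    and up: "\<And>N x t r. 2 \<le> N \<Longrightarrow> admissible \<mu> \<theta> d cminus cplus c' c0 N x \<Longrightarrow> design \<mu> t N x \<Longrightarrow>
     real N \<le> cplus * real t ^ d \<Longrightarrow> k0 \<le> t \<Longrightarrow> r \<in> {0..pi} \<Longrightarrow> cap_disc N x r \<le> B * w r * real N / real t"
    using cap_disc_upper[OF c] by meson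
  obtain A k1 where A: "A > 0" and k1: "1 \<le> k1"
    and low: "\<And>k. k1 \<le> k \<Longrightarrow> A / real k ^ (d + 1) \<le> (LINT r:{0..pi}|lebesgue. (fc (cap r) k)\<^sup>2 * \<eta> r)"
    using fc_cap_integral_lower[OF \<eta> nz] by meson
  obtain D m0 where D: "D > 0" and ker: "\<And>N x m. m0 \<le> m \<Longrightarrow> \<forall>i<N. x i \<in> Q \<Longrightarrow>
     real N * (D * real m ^ d - real N) \<le> (\<Sum>k=1..2*m. pair_sum N x k / kap k)"
    using partial_sum_lower by meson
  define I where "I = (LINT r:{0..pi}|lebesgue. w r * \<eta> r)"
  define b where "b = cplus powr (1 / real d)"
  \<comment> \<open>With u = N^(1/d) one has D (h u)^d = 2 N, so the lower bound of
    \<open>partial_sum_lower\<close> at m of size h u is at least N^2.\<close>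
  define h where "h = (2 / D) powr (1 / real d)"
  have I: "0 \<le> I" unfolding I_def set_lebesgue_integral_def
    using \<eta>0 w_nonneg by (intro integral_nonneg_AE AE_I2) (auto simp: indicator_def)
  have b: "0 < b" using c by (simp add: b_def)
  have h: "0 < h" "h ^ d = 2 / D" using D d_pos powr_power[of "2 / D" "1 / real d" d] by (auto simp: h_def)
  \<comment> \<open>As u is at least 1, 2 m is at most 2 (h + 1) u, whence (2 m)^(d+1) is at most H
    N u.\<close>
  define H where "H = (2 * (h + 1)) ^ (d + 1)"
  have H: "0 < H" using h by (simp add: H_def)
  \<comment> \<open>Large enough that t exceeds k0 and k1, from which on the coefficient estimates
    hold, and that m reaches m0.\<close>
  define N0 where "N0 = max 2 (max (nat \<lceil>cplus * real (max k0 k1) ^ d\<rceil> + 1) (nat \<lceil>(real m0 / h) ^ d\<rceil>))"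
  have main: "A / (2 * H) * real N powr (1 - 1 / real d) < discrepancy \<mu> \<theta> \<eta> N x \<and>
      discrepancy \<mu> \<theta> \<eta> N x < (B * b * I + 1) * real N powr (1 - 1 / real d)"
    if N: "N0 \<le> N" and adm: "admissible \<mu> \<theta> d cminus cplus c' c0 N x" for N x
  proof -
    have N2: "2 \<le> N" and Nk: "cplus * real (max k0 k1) ^ d < real N" and Nm: "(real m0 / h) ^ d \<le> real N"
      using N unfolding N0_def by (simp, linarith+)
    obtain t where des: "design \<mu> t N x" and tN: "real N \<le> cplus * real t ^ d"
      using adm by (auto simp: admissible_def optimal_design_def)
    have x: "\<And>i. i < N \<Longrightarrow> x i \<in> Q" using des by (simp add: design_def)
    have "real (max k0 k1) ^ d < real t ^ d" using Nk tN c(3) by (smt (verit) mult_le_cancel_left_pos)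
    then have "real (max k0 k1) < real t" by (rule power_less_imp_less_base) simp
    then have t: "k0 \<le> t" "k1 \<le> t" "0 < t" by auto
    define u where "u = real N powr (1 / real d)"
    have ud: "u ^ d = real N" using N2 d_pos powr_power[of "real N" "1 / real d" d] by (simp add: u_def)
    have u1: "1 \<le> u" using N2 by (simp add: u_def ge_one_powr_ge_zero)
    have Nu: "real N powr (1 - 1 / real d) = real N / u" using N2 by (simp add: u_def powr_diff)
    have "u \<le> (cplus * real t ^ d) powr (1 / real d)" unfolding u_def using tN by (intro powr_mono2) auto
    also have "\<dots> = b * real t"
      using c(3) t(3) d_pos by (simp add: b_def powr_mult powr_powr flip: powr_realpow)
    finally have ub: "u \<le> b * real t" .
    have disc: "discrepancy \<mu> \<theta> \<eta> N x = (LINT r:{0..pi}|lebesgue. cap_disc N x r * \<eta> r)" by (rule discrepancy_eq) (rule x)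
    have cint: "set_integrable lebesgue {0..pi} (\<lambda>r. cap_disc N x r * \<eta> r)" by (rule stolarsky(2)[OF \<eta>]) (rule x)
    have "discrepancy \<mu> \<theta> \<eta> N x \<le> (LINT r:{0..pi}|lebesgue. B * real N / real t * (w r * \<eta> r))"
      unfolding disc
    proof (rule set_integral_mono[OF cint])
      show "set_integrable lebesgue {0..pi} (\<lambda>r. B * real N / real t * (w r * \<eta> r))" by (intro set_integrable_mult_right impI w\<eta>)
      fix r assume r: "r \<in> {0..pi}"
      have "cap_disc N x r * \<eta> r \<le> B * w r * real N / real t * \<eta> r"
        by (intro mult_right_mono up[OF N2 adm des tN t(1) r] \<eta>0 r)
      then show "cap_disc N x r * \<eta> r \<le> B * real N / real t * (w r * \<eta> r)" by (simp add: mult_ac)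
    qed
    also have "\<dots> = B * I * real N * (1 / real t)" by (simp add: I_def)
    also have "\<dots> \<le> B * I * real N * (b / u)"
      using ub u1 t(3) B I b by (intro mult_left_mono) (auto simp: field_simps)
    \<comment> \<open>The added 1 makes the bound strict and its constant positive.\<close>
    also have "\<dots> < (B * b * I + 1) * (real N / u)" using N2 u1 by (simp add: field_simps)
    finally have upper: "discrepancy \<mu> \<theta> \<eta> N x < (B * b * I + 1) * real N powr (1 - 1 / real d)" by (simp only: Nu)
    define m where "m = nat \<lceil>h * u\<rceil>"
    have hu: "0 < h * u" using h u1 by simp
    have m: "h * u \<le> real m" "real m \<le> h * u + 1" using hu unfolding m_def by linarith+
    have m1: "1 \<le> m" using m(1) hu by linarith
    have "m0 \<le> m"
    proof -
      have "(real m0 / h) ^ d \<le> u ^ d" using Nm ud by simp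
      then have "real m0 / h \<le> u" using u1 d_pos by (subst (asm) power_mono_iff) (use h in auto)
      then have "real m0 \<le> h * u" using h by (simp add: field_simps)
      then show ?thesis using m by linarith
    qed
    have "2 * real N \<le> D * real m ^ d"
    proof -
      have "2 * real N = D * (h * u) ^ d" using D by (simp add: power_mult_distrib h ud)
      also have "\<dots> \<le> D * real m ^ d" using D hu m by (intro mult_left_mono power_mono) auto
      finally show ?thesis .
    qed
    then have "real N * real N \<le> real N * (D * real m ^ d - real N)" by (intro mult_left_mono) auto
    also have "\<dots> \<le> (\<Sum>k=1..2*m. pair_sum N x k / kap k)" using ker[OF \<open>m0 \<le> m\<close>] x by blast
    finally have kern: "real N * real N \<le> (\<Sum>k=1..2*m. pair_sum N x k / kap k)" .
    have "real (2 * m) ^ (d + 1) \<le> (2 * (h + 1) * u) ^ (d + 1)"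
    proof (rule power_mono)
      have "h * u + 1 \<le> h * u + u" using u1 by simp
      then show "real (2 * m) \<le> 2 * (h + 1) * u" using m(2) by (simp add: algebra_simps)
    qed simp
    also have "\<dots> = H * (real N * u)" by (simp add: H_def power_mult_distrib ud[symmetric])
    finally have m2: "real (2 * m) ^ (d + 1) \<le> H * (real N * u)" .
    have "A / (H * (real N * u)) * (real N * real N) \<le> (\<Sum>k=1..2*m. pair_sum N x k / kap k * (LINT r:{0..pi}|lebesgue. (fc (cap r) k)\<^sup>2 * \<eta> r))"
    proof -
      have "A / (H * (real N * u)) * (real N * real N) \<le> A / (H * (real N * u)) * (\<Sum>k=1..2*m. pair_sum N x k / kap k)"
        using A H u1 by (intro mult_left_mono kern) auto
      also have "\<dots> = (\<Sum>k=1..2*m. pair_sum N x k / kap k * (A / (H * (real N * u))))"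
        by (simp only: sum_distrib_left mult.commute)
      also have "\<dots> \<le> (\<Sum>k=1..2*m. pair_sum N x k / kap k * (LINT r:{0..pi}|lebesgue. (fc (cap r) k)\<^sup>2 * \<eta> r))"
      proof (rule sum_mono)
        fix k assume k: "k \<in> {1..2*m}"
        show "pair_sum N x k / kap k * (A / (H * (real N * u))) \<le>
           pair_sum N x k / kap k * (LINT r:{0..pi}|lebesgue. (fc (cap r) k)\<^sup>2 * \<eta> r)"
        \<comment> \<open>The lower bound for the coefficients holds only from k1 on. Since t is at
          least k1, all smaller degrees are among those that the design annihilates.\<close>
        proof (cases "k \<le> t")
          case True
          then show ?thesis using design_pair_sum[OF des, of k] k by simp
        next
          case False
          have "real k ^ (d + 1) \<le> real (2 * m) ^ (d + 1)" using k by (intro power_mono) auto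
          then have "real k ^ (d + 1) \<le> H * (real N * u)" using m2 by linarith
          then have "A / (H * (real N * u)) \<le> A / real k ^ (d + 1)"
            using A k H N2 u1 by (intro divide_left_mono mult_pos_pos) auto
          also have "\<dots> \<le> (LINT r:{0..pi}|lebesgue. (fc (cap r) k)\<^sup>2 * \<eta> r)" using False t by (intro low) auto
          finally show ?thesis
            using pair_sum_nonneg[where x = x and N = N, OF x, of k] kap_pos[of k] by (intro mult_left_mono) auto
        qed
      qed
      finally show ?thesis .
    qed
    also have "\<dots> = (LINT r:{0..pi}|lebesgue. \<Sum>k=1..2*m. pair_sum N x k / kap k * ((fc (cap r) k)\<^sup>2 * \<eta> r))"
      by (subst set_lebesgue_sum(1)) (auto intro!: set_integrable_mult_right fc_cap_integrable[OF \<eta>])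
    also have "\<dots> \<le> discrepancy \<mu> \<theta> \<eta> N x" unfolding disc
    proof (rule set_integral_mono[OF _ cint])
      show "set_integrable lebesgue {0..pi} (\<lambda>r. \<Sum>k=1..2*m. pair_sum N x k / kap k * ((fc (cap r) k)\<^sup>2 * \<eta> r))"
        by (rule set_lebesgue_sum(2)) (auto intro!: set_integrable_mult_right fc_cap_integrable[OF \<eta>])
      fix r assume r: "r \<in> {0..pi}"
      have "(\<Sum>k=1..2*m. (fc (cap r) k)\<^sup>2 / kap k * pair_sum N x k) * \<eta> r \<le> cap_disc N x r * \<eta> r"
        by (intro mult_right_mono cap_disc_bessel[where x = x and N = N, OF x] \<eta>0 r)
      then show "(\<Sum>k=1..2*m. pair_sum N x k / kap k * ((fc (cap r) k)\<^sup>2 * \<eta> r)) \<le> cap_disc N x r * \<eta> r"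
        unfolding sum_distrib_right by (simp add: mult_ac)
    qed
    finally have "A / (H * (real N * u)) * (real N * real N) \<le> discrepancy \<mu> \<theta> \<eta> N x" .
    moreover have "A / (H * (real N * u)) * (real N * real N) = A / H * (real N / u)" using N2 by simp
    \<comment> \<open>Halving the constant yields strict inequality.\<close>
    moreover have "A / (2 * H) * (real N / u) < A / H * (real N / u)"
      using A H N2 u1 by (intro mult_strict_right_mono divide_strict_left_mono) auto
    ultimately have "A / (2 * H) * (real N / u) < discrepancy \<mu> \<theta> \<eta> N x" by linarith
    then show ?thesis using upper by (simp only: Nu)
  qed
  show ?thesis
  proof (intro exI conjI)
    show "0 < A / (2 * H)" using A H by simp
    show "0 < B * b * I + 1" using B b I by (simp add: add_nonneg_pos)
    show "\<forall>\<^sub>F N in sequentially. \<forall>x. admissible \<mu> \<theta> d cminus cplus c' c0 N x \<longrightarrow>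
        A / (2 * H) * real N powr (1 - 1 / real d) < discrepancy \<mu> \<theta> \<eta> N x \<and>
        discrepancy \<mu> \<theta> \<eta> N x < (B * b * I + 1) * real N powr (1 - 1 / real d)"
      using main by (auto simp: eventually_sequentially)
  qed
qed

lemma admissible_in: "admissible \<mu> \<theta> d cminus cplus c' c0 N x \<Longrightarrow> i < N \<Longrightarrow> x i \<in> Q"
  by (auto simp: admissible_def optimal_design_def design_def)

text \<open>The factor \<gamma> lets one statement serve both metrics: with \<gamma> = 1 for the
  symmetric difference metric itself, and with \<gamma> = \<open>chord_factor\<close> and the weight
  sin for the chordal metric.\<close>

theorem distance_sum_bounds:
  assumes \<eta>: "\<eta> \<in> weight_class d d0" and nz: "\<not> (AE r in lebesgue. r \<in> {0..pi} \<longrightarrow> \<eta> r = 0)"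
    and c: "0 < c'" "0 < c0" "0 < cplus"
    and \<gamma>: "0 < \<gamma>" and \<rho>: "\<And>x y. x \<in> Q \<Longrightarrow> y \<in> Q \<Longrightarrow> symdiff_metric \<mu> \<theta> \<eta> x y = \<gamma> * \<rho> x y"
  shows "\<exists>c>0. \<exists>C>0. \<forall>\<^sub>F N in sequentially. \<forall>x. admissible \<mu> \<theta> d cminus cplus c' c0 N x \<longrightarrow>
        average_distance \<mu> \<rho> * real N ^ 2 - c * real N powr (1 - 1 / real d) > sum_of_distances \<rho> N x \<and>
        sum_of_distances \<rho> N x > average_distance \<mu> \<rho> * real N ^ 2 - C * real N powr (1 - 1 / real d)"
proof -
  obtain a A where aA: "0 < a" "0 < A" and ev: "\<forall>\<^sub>F N in sequentially. \<forall>x. admissible \<mu> \<theta> d cminus cplus c' c0 N x \<longrightarrow>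
        a * real N powr (1 - 1 / real d) < discrepancy \<mu> \<theta> \<eta> N x \<and>
        discrepancy \<mu> \<theta> \<eta> N x < A * real N powr (1 - 1 / real d)"
    using discrepancy_bounds[OF \<eta> nz c] by blast
  have avg: "average_distance \<mu> (symdiff_metric \<mu> \<theta> \<eta>) = \<gamma> * average_distance \<mu> \<rho>"
  proof -
    have "(\<integral>y. symdiff_metric \<mu> \<theta> \<eta> x y \<partial>\<mu>) = \<gamma> * (\<integral>y. \<rho> x y \<partial>\<mu>)" if "x \<in> Q" for x
    proof -
      have "(\<integral>y. symdiff_metric \<mu> \<theta> \<eta> x y \<partial>\<mu>) = (\<integral>y. \<gamma> * \<rho> x y \<partial>\<mu>)"
        by (intro Bochner_Integration.integral_cong refl \<rho> that)
      then show ?thesis by simp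
    qed
    then have "average_distance \<mu> (symdiff_metric \<mu> \<theta> \<eta>) = (\<integral>x. \<gamma> * (\<integral>y. \<rho> x y \<partial>\<mu>) \<partial>\<mu>)"
      unfolding average_distance_def by (intro Bochner_Integration.integral_cong refl)
    then show ?thesis by (simp add: average_distance_def)
  qed
  show ?thesis
  proof (intro exI conjI)
    show "0 < a / \<gamma>" "0 < A / \<gamma>" using aA \<gamma> by auto
    show "\<forall>\<^sub>F N in sequentially. \<forall>x. admissible \<mu> \<theta> d cminus cplus c' c0 N x \<longrightarrow>
        average_distance \<mu> \<rho> * real N ^ 2 - a / \<gamma> * real N powr (1 - 1 / real d) > sum_of_distances \<rho> N x \<and>
        sum_of_distances \<rho> N x > average_distance \<mu> \<rho> * real N ^ 2 - A / \<gamma> * real N powr (1 - 1 / real d)"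
      using ev
    proof eventually_elim
      case (elim N)
      show ?case
      proof (intro allI impI)
        fix x assume adm: "admissible \<mu> \<theta> d cminus cplus c' c0 N x"
        define p where "p = real N powr (1 - 1 / real d)"
        have x: "\<And>i. i < N \<Longrightarrow> x i \<in> Q" using admissible_in[OF adm] .
        have "sum_of_distances (symdiff_metric \<mu> \<theta> \<eta>) N x = \<gamma> * sum_of_distances \<rho> N x"
          unfolding sum_of_distances_def sum_distrib_left by (intro sum.cong refl) (simp add: \<rho> x)
        moreover have "sum_of_distances (symdiff_metric \<mu> \<theta> \<eta>) N x =
           average_distance \<mu> (symdiff_metric \<mu> \<theta> \<eta>) * (real N)\<^sup>2 - discrepancy \<mu> \<theta> \<eta> N x"
          by (rule stolarsky(1)[OF \<eta>]) (rule x)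
        ultimately have "discrepancy \<mu> \<theta> \<eta> N x = \<gamma> * (average_distance \<mu> \<rho> * (real N)\<^sup>2 - sum_of_distances \<rho> N x)"
          by (simp add: avg algebra_simps)
        then have "a * p < (average_distance \<mu> \<rho> * (real N)\<^sup>2 - sum_of_distances \<rho> N x) * \<gamma>"
          "(average_distance \<mu> \<rho> * (real N)\<^sup>2 - sum_of_distances \<rho> N x) * \<gamma> < A * p"
          using elim adm by (auto simp: p_def mult.commute)
        then have "a * p / \<gamma> < average_distance \<mu> \<rho> * (real N)\<^sup>2 - sum_of_distances \<rho> N x"
          "average_distance \<mu> \<rho> * (real N)\<^sup>2 - sum_of_distances \<rho> N x < A * p / \<gamma>"
          using \<gamma> by (simp_all add: pos_divide_less_eq pos_less_divide_eq)
        then show "average_distance \<mu> \<rho> * real N ^ 2 - a / \<gamma> * real N powr (1 - 1 / real d) > sum_of_distances \<rho> N x \<and>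
            sum_of_distances \<rho> N x > average_distance \<mu> \<rho> * real N ^ 2 - A / \<gamma> * real N powr (1 - 1 / real d)"
          by (simp add: p_def[symmetric])
      qed
    qed
  qed
qed

end

theorem corollary3p1:
  fixes Q :: "'a::euclidean_space set"
    and \<theta> :: "'a \<Rightarrow> 'a \<Rightarrow> real"
    and \<mu> :: "'a measure"
    and d d0 :: nat
    and \<eta> :: "real \<Rightarrow> real"
    and cplus cminus c' c0 :: real
  assumes "two_point_homogeneous_space Q \<theta> d d0"
    and "invariant_measure Q \<theta> \<mu>"
    and "\<eta> \<in> weight_class d d0"
    and "\<not> (AE r in lebesgue. r \<in> {0..pi} \<longrightarrow> \<eta> r = 0)"
    and "cplus > 0" "cminus > 0" "c' > 0" "c0 > 0"
  shows "(\<exists>c>0. \<exists>C>0. \<forall>\<^sub>F N in sequentially. \<forall>x. admissible \<mu> \<theta> d cminus cplus c' c0 N x \<longrightarrow>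
        average_distance \<mu> (symdiff_metric \<mu> \<theta> \<eta>) * real N ^ 2 - c * real N powr (1 - 1 / real d)
          > sum_of_distances (symdiff_metric \<mu> \<theta> \<eta>) N x \<and>
        sum_of_distances (symdiff_metric \<mu> \<theta> \<eta>) N x
          > average_distance \<mu> (symdiff_metric \<mu> \<theta> \<eta>) * real N ^ 2 - C * real N powr (1 - 1 / real d)) \<and>
     (\<exists>c>0. \<exists>C>0. \<forall>\<^sub>F N in sequentially. \<forall>x. admissible \<mu> \<theta> d cminus cplus c' c0 N x \<longrightarrow>
        c * real N powr (1 - 1 / real d) < discrepancy \<mu> \<theta> \<eta> N x \<and>
        discrepancy \<mu> \<theta> \<eta> N x < C * real N powr (1 - 1 / real d)) \<and>
     (\<exists>c>0. \<exists>C>0. \<forall>\<^sub>F N in sequentially. \<forall>x. admissible \<mu> \<theta> d cminus cplus c' c0 N x \<longrightarrow>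
        average_distance \<mu> (chordal_metric \<theta>) * real N ^ 2 - c * real N powr (1 - 1 / real d)
          > sum_of_distances (chordal_metric \<theta>) N x \<and>
        sum_of_distances (chordal_metric \<theta>) N x
          > average_distance \<mu> (chordal_metric \<theta>) * real N ^ 2 - C * real N powr (1 - 1 / real d))"
proof -
  obtain \<alpha> \<beta> P R S where "zonal_space \<mu> \<theta> d d0 \<alpha> \<beta> P R S"
    using assms(1,2) sphere_zonal_space projective_zonal_space
    unfolding two_point_homogeneous_space_def by meson
  then interpret zonal_space \<mu> \<theta> d d0 \<alpha> \<beta> P R S .
  note c = \<open>c' > 0\<close> \<open>c0 > 0\<close> \<open>cplus > 0\<close>
  show ?thesis
    by (intro conjI discrepancy_bounds[OF assms(3,4) c]
      distance_sum_bounds[OF assms(3,4) c zero_less_one, unfolded mult_1]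
      distance_sum_bounds[OF sin_weight_class sin_nonzero c chord_factor_pos symdiff_sin]) auto
qed

end
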